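(* Let $n>m\geq 2$, let $g\geq 0$, and let $\Sigma$ be either $\Sigma_g$ or $U_{g+1}$. Then there is a surjective homomorphism from $B_n(\Sigma)$ onto the symmetric group $S_m$ if and only if either $m=2$, or $(n,m)=(4,3)$.
   Context: For a compact, connected surface $\Sigma$ and $n\geq 1$, let $\mathbb{F}_n(\Sigma)$ be the configuration space of $n$-tuples $(x_1,\ldots,x_n)\in\Sigma^n$ with $x_i\neq x_j$ for all $i\neq j$. The symmetric group $S_n$ acts freely on $\mathbb{F}_n(\Sigma)$ by permuting coordinates, and the $n$-string braid group of $\Sigma$ is $B_n(\Sigma)=\pi_1(\mathbb{F}_n(\Sigma)/S_n)$. $\Sigma_g$ ($g\geq 0$) denotes the compact, connected, orientable surface of genus $g$ without boundary. $U_g$ ($g\geq 1$) denotes the compact, connected, non-orientable surface of genus $g$ without boundary, i.e. the connected sum of $g$ projective planes. *)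

theory Defs
  imports "HOL-Analysis.Analysis" "HOL-Algebra.Sym_Groups"
begin

section \<open>Quotient spaces\<close>

definition quotient_topology :: "'a topology \<Rightarrow> ('a \<times> 'a) set \<Rightarrow> 'a set topology" where
  "quotient_topology X r =
     topology (\<lambda>U. U \<subseteq> topspace X // r \<and> openin X (\<Union>U))"

lemma openin_quotient_topology:
  assumes "equiv (topspace X) r"
  shows "openin (quotient_topology X r) U \<longleftrightarrow> U \<subseteq> topspace X // r \<and> openin X (\<Union>U)"
proof -
  have "istopology (\<lambda>U. U \<subseteq> topspace X // r \<and> openin X (\<Union>U))"
    unfolding istopology_def
  proof (intro conjI allI impI; (elim conjE)?)
    fix S T
    assume S: "S \<subseteq> topspace X // r" "openin X (\<Union>S)" and T: "T \<subseteq> topspace X // r" "openin X (\<Union>T)"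
    show "S \<inter> T \<subseteq> topspace X // r"
      using S by blast
    have "\<Union>(S \<inter> T) = \<Union>S \<inter> \<Union>T"
    proof
      show "\<Union>S \<inter> \<Union>T \<subseteq> \<Union>(S \<inter> T)"
      proof
        fix x assume "x \<in> \<Union>S \<inter> \<Union>T"
        then obtain A B where "A \<in> S" "B \<in> T" "x \<in> A" "x \<in> B" by blast
        moreover from this have "A = B"
          using quotient_disj[OF assms, of A B] S T by blast
        ultimately show "x \<in> \<Union>(S \<inter> T)" by blast
      qed
    qed blast
    then show "openin X (\<Union>(S \<inter> T))"
      using S T by auto
  next
    fix K assume K: "\<forall>U\<in>K. U \<subseteq> topspace X // r \<and> openin X (\<Union>U)"
    then show "\<Union>K \<subseteq> topspace X // r" by blast
    have "\<Union>(\<Union>K) = \<Union>(Union ` K)" by blast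
    then show "openin X (\<Union>(\<Union>K))"
      using K by auto
  qed
  then show ?thesis
    by (simp add: quotient_topology_def topology_inverse')
qed

lemma topspace_quotient_topology:
  assumes "equiv (topspace X) r"
  shows "topspace (quotient_topology X r) = topspace X // r"
proof
  show "topspace (quotient_topology X r) \<subseteq> topspace X // r"
    using openin_quotient_topology[OF assms] openin_topspace by blast
  have "openin (quotient_topology X r) (topspace X // r)"
    by (simp add: openin_quotient_topology[OF assms] Union_quotient[OF assms])
  then show "topspace X // r \<subseteq> topspace (quotient_topology X r)"
    by (rule openin_subset)
qed

lemma quotient_map_quotient_topology:
  assumes "equiv (topspace X) r"
  shows "quotient_map X (quotient_topology X r) (\<lambda>x. r `` {x})"
  unfolding quotient_map_def topspace_quotient_topology[OF assms]
proof (intro conjI allI impI)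
  show "(\<lambda>x. r `` {x}) ` topspace X = topspace X // r"
    by (auto simp: quotient_def)
  fix U assume U: "U \<subseteq> topspace X // r"
  have "{x \<in> topspace X. r `` {x} \<in> U} = \<Union>U"
  proof (intro Set.set_eqI iffI)
    fix x assume "x \<in> {x \<in> topspace X. r `` {x} \<in> U}"
    then show "x \<in> \<Union>U" using equiv_class_self[OF assms] by blast
  next
    fix x assume "x \<in> \<Union>U"
    then obtain A where A: "A \<in> U" "x \<in> A" by blast
    then obtain y where y: "y \<in> topspace X" "A = r `` {y}"
      using U by (auto simp: quotient_def)
    then have "(y, x) \<in> r" using A by simp
    then have "r `` {y} = r `` {x}" "x \<in> topspace X"
      using equiv_class_eq[OF assms] equiv_class_eq_iff[OF assms] by blast+
    then show "x \<in> {x \<in> topspace X. r `` {x} \<in> U}" using A y by simp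
  qed
  then show "openin X {x \<in> topspace X. r `` {x} \<in> U} \<longleftrightarrow> openin (quotient_topology X r) U"
    using U by (simp add: openin_quotient_topology[OF assms])
qed


section \<open>The closed surfaces\<close>

text \<open>A closed surface is given by a word in letters \<open>x\<close> and \<open>x\<^sup>-\<^sup>1\<close>, encoded as
  \<open>(x, True)\<close> and \<open>(x, False)\<close>, written counterclockwise around the boundary of a polygon.
  The polygon is the closed unit disc, its \<open>i\<close>-th edge being the \<open>i\<close>-th of \<open>length w\<close>
  equal arcs of the unit circle.  Edges with the same letter are glued, preserving the
  parametrisation if the exponents agree and reversing it otherwise.\<close>

definition polygon_edge :: "nat \<Rightarrow> nat \<Rightarrow> real \<Rightarrow> complex" where
  "polygon_edge N i t = cis (2 * pi * (real i + t) / real N)"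

definition edge_pairing :: "(nat \<times> bool) list \<Rightarrow> (complex \<times> complex) set" where
  "edge_pairing w =
     {(polygon_edge (length w) i t,
       polygon_edge (length w) j (if snd (w ! i) = snd (w ! j) then t else 1 - t)) | i j t.
       i < length w \<and> j < length w \<and> t \<in> {0..1} \<and> fst (w ! i) = fst (w ! j)}"

text \<open>The pairing is symmetric, but at the corners it is not transitive; hence the closure.\<close>

definition polygon_gluing :: "(nat \<times> bool) list \<Rightarrow> (complex \<times> complex) set" where
  "polygon_gluing w = Id_on (cball 0 1) \<union> (edge_pairing w)\<^sup>+"

definition polygon_surface :: "(nat \<times> bool) list \<Rightarrow> complex set topology" where
  "polygon_surface w = quotient_topology (top_of_set (cball 0 1)) (polygon_gluing w)"

lemma edge_pairing_subset: "edge_pairing w \<subseteq> cball 0 1 \<times> cball 0 1"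
  by (auto simp: edge_pairing_def polygon_edge_def)

lemma sym_edge_pairing: "sym (edge_pairing w)"
proof (rule symI)
  fix x y assume "(x, y) \<in> edge_pairing w"
  then obtain i j t where *: "i < length w" "j < length w" "t \<in> {0..1}" "fst (w ! i) = fst (w ! j)"
    "x = polygon_edge (length w) i t"
    "y = polygon_edge (length w) j (if snd (w ! i) = snd (w ! j) then t else 1 - t)"
    by (auto simp: edge_pairing_def)
  define s where "s = (if snd (w ! i) = snd (w ! j) then t else 1 - t)"
  have "s \<in> {0..1}" "y = polygon_edge (length w) j s"
    "x = polygon_edge (length w) i (if snd (w ! j) = snd (w ! i) then s else 1 - s)"
    using * by (auto simp: s_def)
  with *(1,2,4) show "(y, x) \<in> edge_pairing w"
    unfolding edge_pairing_def by (intro CollectI exI[of _ j] exI[of _ i] exI[of _ s]) auto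
qed

lemma equiv_polygon_gluing: "equiv (cball 0 1) (polygon_gluing w)"
proof (rule equivI)
  have "(edge_pairing w)\<^sup>+ \<subseteq> cball 0 1 \<times> cball 0 1"
    by (rule trancl_subset_Sigma[OF edge_pairing_subset])
  then show "polygon_gluing w \<subseteq> cball 0 1 \<times> cball 0 1"
    by (auto simp: polygon_gluing_def)
  show "refl_on (cball 0 1) (polygon_gluing w)"
    by (auto simp: refl_on_def polygon_gluing_def)
  show "sym (polygon_gluing w)"
    unfolding polygon_gluing_def
    by (intro sym_Un sym_Id_on sym_trancl sym_edge_pairing)
  show "trans (polygon_gluing w)"
    unfolding polygon_gluing_def
    by (rule transI) (auto intro: trancl_trans)
qed

lemma compact_connected_polygon_surface:
  "compact_space (polygon_surface w)" "connected_space (polygon_surface w)"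
proof -
  have q: "quotient_map (top_of_set (cball 0 1)) (polygon_surface w) (\<lambda>x. polygon_gluing w `` {x})"
    unfolding polygon_surface_def
    by (rule quotient_map_quotient_topology) (simp add: equiv_polygon_gluing)
  have "compact_space (top_of_set (cball (0::complex) 1))"
    by (simp add: compact_space_subtopology)
  then show "compact_space (polygon_surface w)"
    using q by (metis compact_space_def image_compactin quotient_imp_continuous_map
        quotient_imp_surjective_map)
  have "connected_space (top_of_set (cball (0::complex) 1))"
    by (simp add: connected_space_subtopology)
  then show "connected_space (polygon_surface w)"
    using q connected_space_quotient_map_image by blast
qed

text \<open>\<open>\<Sigma>\<^sub>g\<close> is glued from the word \<open>\<Prod>\<^sub>k a\<^sub>k b\<^sub>k a\<^sub>k\<^sup>-\<^sup>1 b\<^sub>k\<^sup>-\<^sup>1\<close>,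
  i.e. it is the connected sum of \<open>g\<close> tori; for \<open>g = 0\<close> the word is \<open>a a\<^sup>-\<^sup>1\<close>,
  which gives the sphere.  \<open>U\<^sub>g\<close>, for \<open>g \<ge> 1\<close>, is glued from
  \<open>\<Prod>\<^sub>k a\<^sub>k a\<^sub>k\<close>, i.e. it is the connected sum of \<open>g\<close> projective planes.\<close>

definition orientable_word :: "nat \<Rightarrow> (nat \<times> bool) list" where
  "orientable_word g =
     (if g = 0 then [(0, True), (0, False)]
      else concat (map (\<lambda>k. [(2*k, True), (2*k+1, True), (2*k, False), (2*k+1, False)]) [0..<g]))"

definition nonorientable_word :: "nat \<Rightarrow> (nat \<times> bool) list" where
  "nonorientable_word g = concat (map (\<lambda>k. [(k, True), (k, True)]) [0..<g])"

definition orientable_surface :: "nat \<Rightarrow> complex set topology" where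
  "orientable_surface g = polygon_surface (orientable_word g)"

definition nonorientable_surface :: "nat \<Rightarrow> complex set topology" where
  "nonorientable_surface g = polygon_surface (nonorientable_word g)"


section \<open>The fundamental group\<close>

text \<open>The path operations of the library require the target to be a type of class
  \<open>topological_space\<close>, so they do not apply to loops in an abstract topology.  Values of a loop outside
  \<open>{0..1}\<close> are unconstrained; homotopy classes do not see them.\<close>

definition loops :: "'a topology \<Rightarrow> 'a \<Rightarrow> (real \<Rightarrow> 'a) set" where
  "loops X b = {p. pathin X p \<and> p 0 = b \<and> p 1 = b}"

definition loop_homotopy :: "'a topology \<Rightarrow> 'a \<Rightarrow> ((real \<Rightarrow> 'a) \<times> (real \<Rightarrow> 'a)) set" where
  "loop_homotopy X b =
     {(p, q). p \<in> loops X b \<and> q \<in> loops X b \<and>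
              homotopic_with (\<lambda>h. h 0 = b \<and> h 1 = b) (top_of_set {0..1}) X p q}"

definition loop_join :: "(real \<Rightarrow> 'a) \<Rightarrow> (real \<Rightarrow> 'a) \<Rightarrow> real \<Rightarrow> 'a" where
  "loop_join p q = (\<lambda>t. if t \<le> 1/2 then p (2 * t) else q (2 * t - 1))"

definition fundamental_group :: "'a topology \<Rightarrow> 'a \<Rightarrow> (real \<Rightarrow> 'a) set monoid" where
  "fundamental_group X b =
     \<lparr>carrier = loops X b // loop_homotopy X b,
      mult = (\<lambda>A B. \<Union>p\<in>A. \<Union>q\<in>B. loop_homotopy X b `` {loop_join p q}),
      one = loop_homotopy X b `` {\<lambda>_. b}\<rparr>"


section \<open>Configuration spaces and braid groups\<close>

definition configuration_space :: "nat \<Rightarrow> 'a topology \<Rightarrow> (nat \<Rightarrow> 'a) topology" where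
  "configuration_space n X =
     subtopology (product_topology (\<lambda>_. X) {..<n}) {x. inj_on x {..<n}}"

definition permutation_orbits :: "nat \<Rightarrow> 'a topology \<Rightarrow> ((nat \<Rightarrow> 'a) \<times> (nat \<Rightarrow> 'a)) set" where
  "permutation_orbits n X =
     {(x, x \<circ> s) | x s. x \<in> topspace (configuration_space n X) \<and> s permutes {..<n}}"

definition unordered_configuration_space :: "nat \<Rightarrow> 'a topology \<Rightarrow> (nat \<Rightarrow> 'a) set topology" where
  "unordered_configuration_space n X =
     quotient_topology (configuration_space n X) (permutation_orbits n X)"

definition braid_group ::
    "nat \<Rightarrow> 'a topology \<Rightarrow> (nat \<Rightarrow> 'a) set \<Rightarrow> (real \<Rightarrow> (nat \<Rightarrow> 'a) set) set monoid" where
  "braid_group n X b = fundamental_group (unordered_configuration_space n X) b"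

lemma topspace_configuration_space:
  "topspace (configuration_space n X) = {x \<in> {..<n} \<rightarrow>\<^sub>E topspace X. inj_on x {..<n}}"
  by (auto simp: configuration_space_def)

lemma equiv_permutation_orbits:
  "equiv (topspace (configuration_space n X)) (permutation_orbits n X)"
proof (rule equivI)
  let ?F = "topspace (configuration_space n X)"
  have perm: "x \<circ> s \<in> ?F" if x: "x \<in> ?F" and s: "s permutes {..<n}" for x s
  proof -
    have "inj_on (x \<circ> s) {..<n}"
      using x s by (intro comp_inj_on) (auto simp: topspace_configuration_space permutes_image permutes_inj_on)
    moreover have "x \<circ> s \<in> {..<n} \<rightarrow>\<^sub>E topspace X"
      using x permutes_in_image[OF s] permutes_not_in[OF s]
      by (auto simp: topspace_configuration_space PiE_iff extensional_def)
    ultimately show ?thesis by (simp add: topspace_configuration_space)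
  qed
  show "permutation_orbits n X \<subseteq> ?F \<times> ?F"
    unfolding permutation_orbits_def using perm by fastforce
  show "refl_on ?F (permutation_orbits n X)"
  proof (rule refl_onI)
    fix x assume "x \<in> ?F"
    then show "(x, x) \<in> permutation_orbits n X"
      unfolding permutation_orbits_def
      by (intro CollectI exI[of _ x] exI[of _ id]) (simp add: permutes_id)
  qed
  show "sym (permutation_orbits n X)"
  proof (rule symI)
    fix x y assume "(x, y) \<in> permutation_orbits n X"
    then obtain s where s: "x \<in> ?F" "s permutes {..<n}" "y = x \<circ> s"
      by (auto simp: permutation_orbits_def)
    then have "x = y \<circ> Hilbert_Choice.inv s" "Hilbert_Choice.inv s permutes {..<n}" "y \<in> ?F"
      using perm by (auto simp: comp_assoc permutes_inv_o permutes_inv)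
    then show "(y, x) \<in> permutation_orbits n X"
      by (auto simp: permutation_orbits_def)
  qed
  show "trans (permutation_orbits n X)"
  proof (rule transI)
    fix x y z assume "(x, y) \<in> permutation_orbits n X" "(y, z) \<in> permutation_orbits n X"
    then obtain s t where "x \<in> ?F" "s permutes {..<n}" "t permutes {..<n}" "z = x \<circ> (s \<circ> t)"
      by (auto simp: permutation_orbits_def comp_assoc)
    then show "(x, z) \<in> permutation_orbits n X"
      using permutes_compose by (fastforce simp: permutation_orbits_def)
  qed
qed

end

theory Submission
  imports Defs
begin

text \<open>A homomorphism from the braid group to a group \<open>G\<close> is a multiplicative, homotopy invariant function of
  the paths of ordered configurations that is unchanged by relabelling the points; changing it by a
  gauge, one may assume that it is trivial on paths in the disc that preserve the order of the real
  parts.  On paths in the open disc its values are then generated by values \<open>s\<^sub>k\<close>, one for each exchange of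
  neighbouring points, which satisfy the braid relations.  The values on all paths are generated
  by these and by the crossings, in which one point passes through the boundary of the polygon.

  Let \<open>G\<close> be the symmetric group of degree \<open>m\<close> with \<open>3 \<le> m < n\<close> and \<open>5 \<le> n\<close>.  By Artin's theorem all \<open>s\<^sub>k\<close>
  are equal.  A crossing commutes with an exchange of two points elsewhere, hence the common value is
  central in the image and so trivial.  Then a crossing depends only on the two edges involved, and
  crossings of two points at different places commute; hence all of them are central, thus trivial.

  For \<open>m = 2\<close> the sign, and for \<open>(n, m) = (4, 3)\<close> the action on the three splittings of four points into
  pairs, is a quotient of the permutation representation, which is onto since the ordered
  configurations are path connected.\<close>

section \<open>Homotopy of paths and representations of the fundamental groupoid\<close>

text \<open>Functions on paths replace a presentation of the surface braid group: a presentation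
  would call for a van Kampen argument on configuration spaces, while here it is enough to know
  which values generate the image. The obstacle is the boundary of the polygon. Where corners are
  glued, a point of the surface has several sectors around it, and a path may touch an edge
  infinitely often. This is met by a local principle: every configuration has a neighbourhood in
  which the value of a path depends only on its ends, and the ends are joined by finitely many disc
  paths and crossings. The same principle, with convex cells as neighbourhoods, reduces disc paths
  to exchanges of neighbours. The bounds on \<open>n\<close> and \<open>m\<close> come from Artin's
  theorem: the \<open>n - 1\<close> exchanges must be at least four and act on at most
  \<open>n - 1\<close> points. For \<open>n = 4\<close> the first and the third exchange have equal
  images in the action on splittings, and the second has a different one. The symmetric group enters
  once more through its trivial centre, where \<open>m \<ge> 3\<close> is used.\<close>

definition path_homotopic :: "'a topology \<Rightarrow> (real \<Rightarrow> 'a) \<Rightarrow> (real \<Rightarrow> 'a) \<Rightarrow> bool" where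
  "path_homotopic Y p q \<longleftrightarrow>
     homotopic_with (\<lambda>h. h 0 = p 0 \<and> h 1 = p 1) (top_of_set {0..1}) Y p q"

lemma continuous_map_compose_on:
  assumes "continuous_map (top_of_set C) Y F" "continuous_on S f" "f \<in> S \<rightarrow> C"
  shows "continuous_map (top_of_set S) Y (\<lambda>x. F (f x))"
proof -
  have "continuous_map (top_of_set S) (top_of_set C) f"
    using assms by auto
  from continuous_map_compose[OF this assms(1)] show ?thesis by (simp add: o_def)
qed

lemma continuous_map_compose_on_subtopology:
  assumes "continuous_map (top_of_set C) Y F" "continuous_on {x \<in> S. P x} f" "f \<in> {x \<in> S. P x} \<rightarrow> C"
  shows "continuous_map (subtopology (top_of_set S) {x \<in> topspace (top_of_set S). P x}) Y (\<lambda>x. F (f x))"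
proof -
  have "S \<inter> {x \<in> S. P x} = {x \<in> S. P x}" by blast
  then show ?thesis
    using continuous_map_compose_on[OF assms] by (simp add: subtopology_subtopology)
qed

lemma path_homotopicI:
  fixes h :: "real \<times> real \<Rightarrow> 'a"
  assumes h: "continuous_map (top_of_set ({0..1} \<times> {0..1})) Y h"
    and "\<And>x. x \<in> {0..1} \<Longrightarrow> h (0, x) = p x" "\<And>x. x \<in> {0..1} \<Longrightarrow> h (1, x) = q x"
    and "\<And>t. t \<in> {0..1} \<Longrightarrow> h (t, 0) = p 0" "\<And>t. t \<in> {0..1} \<Longrightarrow> h (t, 1) = p 1"
  shows "path_homotopic Y p q"
proof -
  \<comment> \<open>\<open>homotopic_with\<close> states the boundary conditions at all real
    parameters, whereas \<open>h\<close> is controlled on the unit square only. Off the square it is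
    overwritten by \<open>p\<close> and \<open>q\<close>; continuity is only asked on the
    square.\<close>
  let ?h = "\<lambda>(t::real, x::real). if x \<in> {0..1} then h (t, x) else if t = 0 then p x else q x"
  have "continuous_map (prod_topology (top_of_set {0..1}) (top_of_set {0..1})) Y ?h"
    by (rule continuous_map_eq[of _ _ h])
       (use h in \<open>auto simp: subtopology_Times[symmetric] euclidean_product_topology\<close>)
  then show ?thesis
    unfolding path_homotopic_def homotopic_with_def
    by (intro exI[of _ ?h]) (use assms(2-) in auto)
qed

lemma path_homotopicE:
  assumes "path_homotopic Y p q"
  obtains h :: "real \<times> real \<Rightarrow> 'a" where "continuous_map (top_of_set ({0..1} \<times> {0..1})) Y h"
    "\<And>x. h (0, x) = p x" "\<And>x. h (1, x) = q x"
    "\<And>t. t \<in> {0..1} \<Longrightarrow> h (t, 0) = p 0" "\<And>t. t \<in> {0..1} \<Longrightarrow> h (t, 1) = p 1"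
proof -
  obtain h :: "real \<times> real \<Rightarrow> 'a"
    where h: "continuous_map (prod_topology (top_of_set {0..1}) (top_of_set {0..1})) Y h"
      "\<forall>x. h (0, x) = p x" "\<forall>x. h (1, x) = q x" "\<forall>t\<in>{0..1}. h (t, 0) = p 0 \<and> h (t, 1) = p 1"
    using assms unfolding path_homotopic_def homotopic_with_def by blast
  show thesis
    by (rule that[of h]) (use h in \<open>simp_all add: subtopology_Times[symmetric] euclidean_product_topology\<close>)
qed

lemma path_homotopic_ends: "path_homotopic Y p q \<Longrightarrow> q 0 = p 0 \<and> q 1 = p 1"
  by (erule path_homotopicE) (metis atLeastAtMost_iff order_refl zero_le_one)

lemma path_homotopic_pathin: "path_homotopic Y p q \<Longrightarrow> pathin Y p \<and> pathin Y q"
  unfolding path_homotopic_def pathin_def by (meson homotopic_with_imp_continuous_maps)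

lemma path_homotopic_sym: "path_homotopic Y p q \<Longrightarrow> path_homotopic Y q p"
  using path_homotopic_ends[of Y p q] homotopic_with_symD unfolding path_homotopic_def by fastforce

lemma path_homotopic_trans [trans]:
  "path_homotopic Y p q \<Longrightarrow> path_homotopic Y q r \<Longrightarrow> path_homotopic Y p r"
  using path_homotopic_ends[of Y p q] homotopic_with_trans unfolding path_homotopic_def by fastforce

text \<open>Straight-line homotopy in the parameter domain \<open>C\<close>, pushed forward by
  \<open>F\<close>. Reparametrisations of a path and the comparison of the two ways round a square
  are instances.\<close>

lemma path_homotopic_convex:
  fixes f g :: "real \<Rightarrow> 'b::real_normed_vector"
  assumes C: "convex C" and F: "continuous_map (top_of_set C) Y F"
    and f: "continuous_on {0..1} f" "f \<in> {0..1} \<rightarrow> C"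
    and g: "continuous_on {0..1} g" "g \<in> {0..1} \<rightarrow> C"
    and "f 0 = g 0" "f 1 = g 1"
  shows "path_homotopic Y (\<lambda>t. F (f t)) (\<lambda>t. F (g t))"
proof (rule path_homotopicI[of _ "\<lambda>z. F ((1 - fst z) *\<^sub>R f (snd z) + fst z *\<^sub>R g (snd z))"])
  let ?S = "{0..1} \<times> {0..1} :: (real \<times> real) set"
  have fg: "continuous_on ?S (\<lambda>z. f (snd z))" "continuous_on ?S (\<lambda>z. g (snd z))"
    by (rule continuous_on_compose2[OF f(1)] continuous_on_compose2[OF g(1)], auto intro!: continuous_intros)+
  have "(1 - fst z) *\<^sub>R f (snd z) + fst z *\<^sub>R g (snd z) \<in> C" if "z \<in> ?S" for z
    using that f(2) g(2) by (intro convexD[OF C]) (auto simp: Pi_iff)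
  then have "continuous_map (top_of_set ?S) (top_of_set C)
          (\<lambda>z. (1 - fst z) *\<^sub>R f (snd z) + fst z *\<^sub>R g (snd z))"
    using fg by (auto intro!: continuous_intros)
  from continuous_map_compose[OF this F]
  show "continuous_map (top_of_set ({0..1} \<times> {0..1})) Y
          (\<lambda>z. F ((1 - fst z) *\<^sub>R f (snd z) + fst z *\<^sub>R g (snd z)))"
    by (simp add: o_def)
qed (use assms(7,8) in \<open>simp_all add: scaleR_left_diff_distrib\<close>)

lemma path_homotopic_reparam:
  assumes "pathin Y p" "continuous_on {0..1} f" "f \<in> {0..1} \<rightarrow> {0..1}"
    "continuous_on {0..1} g" "g \<in> {0..1} \<rightarrow> {0..1}" "f 0 = g 0" "f 1 = (g 1 :: real)"
  shows "path_homotopic Y (\<lambda>t. p (f t)) (\<lambda>t. p (g t))"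
  using assms by (intro path_homotopic_convex[where C = "{0..1}"]) (auto simp: pathin_def)

lemma path_homotopic_eq:
  assumes "pathin Y p" "\<And>t. t \<in> {0..1} \<Longrightarrow> p t = q t"
  shows "path_homotopic Y p q"
proof (rule path_homotopicI[of _ "\<lambda>z. p (snd z)"])
  show "continuous_map (top_of_set ({0..1} \<times> {0..1::real})) Y (\<lambda>z. p (snd z))"
    using assms(1) unfolding pathin_def
    by (rule continuous_map_compose_on) (auto intro!: continuous_intros)
qed (use assms in auto)

lemma path_homotopic_refl: "pathin Y p \<Longrightarrow> path_homotopic Y p p"
  by (rule path_homotopic_eq) auto

lemma loop_join_ends [simp]: "loop_join p q 0 = p 0" "loop_join p q 1 = q 1"
  by (auto simp: loop_join_def)

lemma o_loop_join: "(\<lambda>t. f (loop_join p q t)) = loop_join (\<lambda>t. f (p t)) (\<lambda>t. f (q t))"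
  by (auto simp: loop_join_def)

lemma pathin_loop_join:
  assumes "pathin Y p" "pathin Y q" "p 1 = q 0"
  shows "pathin Y (loop_join p q)"
  unfolding pathin_def loop_join_def
proof (rule continuous_map_cases_le)
  show "continuous_map (subtopology (top_of_set {0..1}) {x \<in> topspace (top_of_set {0..1}). x \<le> 1/2}) Y (\<lambda>t. p (2 * t))"
    using assms(1) unfolding pathin_def
    by (rule continuous_map_compose_on_subtopology) (auto intro!: continuous_intros)
  show "continuous_map (subtopology (top_of_set {0..1}) {x \<in> topspace (top_of_set {0..1}). 1/2 \<le> x}) Y (\<lambda>t. q (2 * t - 1))"
    using assms(2) unfolding pathin_def
    by (rule continuous_map_compose_on_subtopology) (auto intro!: continuous_intros)
  show "p (2 * x) = q (2 * x - 1)" if "x = 1/2" for x :: real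
    unfolding that using assms(3) by simp
qed (auto intro!: continuous_intros)

lemma pathin_reverse:
  assumes "pathin Y p"
  shows "pathin Y (\<lambda>t. p (1 - t))"
  using assms unfolding pathin_def
  by (rule continuous_map_compose_on) (auto intro!: continuous_intros)

lemma path_homotopic_join:
  assumes "path_homotopic Y p p'" "path_homotopic Y q q'" "p 1 = q 0"
  shows "path_homotopic Y (loop_join p q) (loop_join p' q')"
proof -
  obtain h :: "real \<times> real \<Rightarrow> 'a" where h: "continuous_map (top_of_set ({0..1} \<times> {0..1})) Y h"
    "\<And>x. h (0, x) = p x" "\<And>x. h (1, x) = p' x"
    "\<And>t. t \<in> {0..1} \<Longrightarrow> h (t, 0) = p 0" "\<And>t. t \<in> {0..1} \<Longrightarrow> h (t, 1) = p 1"
    using path_homotopicE[OF assms(1)] by metis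
  obtain k :: "real \<times> real \<Rightarrow> 'a" where k: "continuous_map (top_of_set ({0..1} \<times> {0..1})) Y k"
    "\<And>x. k (0, x) = q x" "\<And>x. k (1, x) = q' x"
    "\<And>t. t \<in> {0..1} \<Longrightarrow> k (t, 0) = q 0" "\<And>t. t \<in> {0..1} \<Longrightarrow> k (t, 1) = q 1"
    using path_homotopicE[OF assms(2)] by metis
  let ?S = "{0..1} \<times> {0..1} :: (real \<times> real) set"
  let ?H = "\<lambda>z. if snd z \<le> 1/2 then h (fst z, 2 * snd z) else k (fst z, 2 * snd z - 1)"
  show ?thesis
  proof (rule path_homotopicI[of _ ?H])
    show "continuous_map (top_of_set ?S) Y ?H"
    proof (rule continuous_map_cases_le)
      show "continuous_map (subtopology (top_of_set ?S) {x \<in> topspace (top_of_set ?S). snd x \<le> 1/2}) Y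
              (\<lambda>z. h (fst z, 2 * snd z))"
        using h(1)
        by (rule continuous_map_compose_on_subtopology) (auto intro!: continuous_intros)
      show "continuous_map (subtopology (top_of_set ?S) {x \<in> topspace (top_of_set ?S). 1/2 \<le> snd x}) Y
              (\<lambda>z. k (fst z, 2 * snd z - 1))"
        using k(1)
        by (rule continuous_map_compose_on_subtopology) (auto intro!: continuous_intros)
      show "h (fst x, 2 * snd x) = k (fst x, 2 * snd x - 1)" if "x \<in> topspace (top_of_set ?S)" "snd x = 1/2" for x
      proof -
        have e: "2 * snd x = 1" "fst x \<in> {0..1}" using that by auto
        show ?thesis unfolding e(1) using e(2) h(5)[of "fst x"] k(4)[of "fst x"] assms(3) by simp
      qed
    qed (auto intro!: continuous_intros)
  qed (use h k in \<open>auto simp: loop_join_def\<close>)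
qed

lemma continuous_on_if_le:
  fixes f g :: "real \<Rightarrow> 'a::topological_space"
  assumes "continuous_on {..c} f" "continuous_on {c..} g" "f c = g c"
  shows "continuous_on S (\<lambda>t. if t \<le> c then f t else g t)"
proof -
  have "continuous_on UNIV (\<lambda>t. if t \<le> c then f t else g t)"
    by (rule continuous_on_cases_le[where h = "\<lambda>t. t"])
       (use assms in \<open>auto simp: atMost_def atLeast_def intro: continuous_intros\<close>)
  then show ?thesis by (rule continuous_on_subset) auto
qed

lemma continuous_on_if_half:
  fixes f g :: "real \<Rightarrow> 'a::topological_space"
  assumes "continuous_on {..1/2} f" "continuous_on {1/2..} g" "f (1/2) = g (1/2)"
  shows "continuous_on S (\<lambda>t. if t * 2 \<le> 1 then f t else g t)"
  using continuous_on_if_le[OF assms, of S] by (simp add: field_simps cong: if_cong)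

lemma path_homotopic_assoc:
  assumes "pathin Y p" "pathin Y q" "pathin Y r" "p 1 = q 0" "q 1 = r 0"
  shows "path_homotopic Y (loop_join (loop_join p q) r) (loop_join p (loop_join q r))"
proof -
  let ?F = "loop_join (loop_join p q) r"
  \<comment> \<open>Carries the breakpoints 1/2 and 3/4 of the right-nested join to the breakpoints
    1/4 and 1/2 of the left-nested one.\<close>
  let ?g = "\<lambda>t::real. if t \<le> 1/2 then t/2 else if t \<le> 3/4 then t - 1/4 else 2 * t - 1"
  have "path_homotopic Y (\<lambda>t. ?F t) (\<lambda>t. ?F (?g t))"
  proof (rule path_homotopic_reparam)
    show "pathin Y ?F" using assms by (intro pathin_loop_join) auto
    show "continuous_on {0..1} ?g"
      by (intro continuous_on_if_le continuous_intros) auto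
  qed auto
  moreover have "(\<lambda>t. ?F (?g t)) = loop_join p (loop_join q r)"
    by (auto simp: loop_join_def fun_eq_iff)
  ultimately show ?thesis by simp
qed

lemma path_homotopic_reverse_join:
  assumes "pathin Y p"
  shows "path_homotopic Y (loop_join (\<lambda>t. p (1 - t)) p) (\<lambda>_. p 1)"
proof -
  let ?g = "\<lambda>t::real. if t \<le> 1/2 then 1 - 2 * t else 2 * t - 1"
  have "path_homotopic Y (\<lambda>t. p (?g t)) (\<lambda>t. p 1)"
    by (rule path_homotopic_reparam[OF assms, of ?g "\<lambda>_. 1"])
       (auto intro!: continuous_on_if_le continuous_on_if_half continuous_intros)
  moreover have "(\<lambda>t. p (?g t)) = loop_join (\<lambda>t. p (1 - t)) p"
    by (auto simp: loop_join_def)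
  ultimately show ?thesis by simp
qed

lemma path_homotopic_const_join:
  assumes "pathin Y p"
  shows "path_homotopic Y (loop_join (\<lambda>_. p 0) p) p" "path_homotopic Y (loop_join p (\<lambda>_. p 1)) p"
proof -
  let ?g = "\<lambda>t::real. if t \<le> 1/2 then 0 else 2 * t - 1"
  have "path_homotopic Y (\<lambda>t. p (?g t)) (\<lambda>t. p t)"
    by (rule path_homotopic_reparam[OF assms])
       (auto intro!: continuous_on_if_le continuous_on_if_half continuous_intros)
  moreover have "(\<lambda>t. p (?g t)) = loop_join (\<lambda>_. p 0) p"
    by (auto simp: loop_join_def)
  ultimately show "path_homotopic Y (loop_join (\<lambda>_. p 0) p) p" by simp
  let ?h = "\<lambda>t::real. if t \<le> 1/2 then 2 * t else 1"
  have "path_homotopic Y (\<lambda>t. p (?h t)) (\<lambda>t. p t)"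
    by (rule path_homotopic_reparam[OF assms])
       (auto intro!: continuous_on_if_le continuous_on_if_half continuous_intros)
  moreover have "(\<lambda>t. p (?h t)) = loop_join p (\<lambda>_. p 1)"
    by (auto simp: loop_join_def)
  ultimately show "path_homotopic Y (loop_join p (\<lambda>_. p 1)) p" by simp
qed

section \<open>The fundamental group in terms of loop classes\<close>

lemma loop_homotopy_iff:
  "(p, q) \<in> loop_homotopy Y b \<longleftrightarrow> path_homotopic Y p q \<and> p 0 = b \<and> p 1 = b"
  unfolding loop_homotopy_def path_homotopic_def loops_def
  using path_homotopic_ends[of Y p q, unfolded path_homotopic_def]
    path_homotopic_pathin[of Y p q, unfolded path_homotopic_def] by auto

lemma equiv_loop_homotopy: "equiv (loops Y b) (loop_homotopy Y b)"
proof (rule equivI)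
  show "loop_homotopy Y b \<subseteq> loops Y b \<times> loops Y b"
    by (auto simp: loop_homotopy_def)
  show "refl_on (loops Y b) (loop_homotopy Y b)"
    by (auto simp: refl_on_def loop_homotopy_iff loops_def path_homotopic_refl)
  show "sym (loop_homotopy Y b)"
    by (auto simp: sym_def loop_homotopy_iff path_homotopic_sym dest: path_homotopic_ends)
  show "trans (loop_homotopy Y b)"
    by (auto simp: trans_def loop_homotopy_iff intro: path_homotopic_trans)
qed

definition loop_class :: "'a topology \<Rightarrow> 'a \<Rightarrow> (real \<Rightarrow> 'a) \<Rightarrow> (real \<Rightarrow> 'a) set" where
  "loop_class Y b p = loop_homotopy Y b `` {p}"

lemma loop_class_eq_iff:
  "p \<in> loops Y b \<Longrightarrow> q \<in> loops Y b \<Longrightarrow> loop_class Y b p = loop_class Y b q \<longleftrightarrow> path_homotopic Y p q"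
  unfolding loop_class_def
  by (subst eq_equiv_class_iff[OF equiv_loop_homotopy]) (auto simp: loop_homotopy_iff loops_def)

lemma carrier_fundamental_group: "carrier (fundamental_group Y b) = loop_class Y b ` loops Y b"
  by (auto simp: fundamental_group_def quotient_def loop_class_def)

lemma loop_join_loops: "p \<in> loops Y b \<Longrightarrow> q \<in> loops Y b \<Longrightarrow> loop_join p q \<in> loops Y b"
  by (auto simp: loops_def intro!: pathin_loop_join)

text \<open>The product is defined as a union over all pairs of representatives. Joining respects
  homotopy, so all members of this union are one and the same class.\<close>

lemma mult_fundamental_group:
  assumes "p \<in> loops Y b" "q \<in> loops Y b"
  shows "loop_class Y b p \<otimes>\<^bsub>fundamental_group Y b\<^esub> loop_class Y b q = loop_class Y b (loop_join p q)"
proof -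
  have *: "loop_homotopy Y b `` {loop_join p' q'} = loop_class Y b (loop_join p q)"
    if "p' \<in> loop_class Y b p" "q' \<in> loop_class Y b q" for p' q'
  proof -
    have "path_homotopic Y p p'" "path_homotopic Y q q'"
      using that by (auto simp: loop_class_def loop_homotopy_iff)
    moreover from this have "p' \<in> loops Y b" "q' \<in> loops Y b"
      using assms by (auto simp: loops_def dest: path_homotopic_ends path_homotopic_pathin)
    ultimately have "loop_class Y b (loop_join p q) = loop_class Y b (loop_join p' q')"
      using assms by (subst loop_class_eq_iff) (auto intro!: path_homotopic_join pathin_loop_join simp: loops_def)
    then show ?thesis by (simp add: loop_class_def)
  qed
  have "p \<in> loop_class Y b p" "q \<in> loop_class Y b q"
    using assms by (auto simp: loop_class_def loop_homotopy_iff loops_def path_homotopic_refl)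
  then show ?thesis
    unfolding fundamental_group_def by (simp, use * in blast)
qed

section \<open>Subpaths and values of paths\<close>

definition subpath_on :: "real \<Rightarrow> real \<Rightarrow> (real \<Rightarrow> 'a) \<Rightarrow> real \<Rightarrow> 'a" where
  "subpath_on a b p = (\<lambda>t. p (a + (b - a) * t))"

lemma subpath_on_ends [simp]: "subpath_on a b p 0 = p a" "subpath_on a b p 1 = p b"
  "subpath_on 0 1 p = p"
  by (auto simp: subpath_on_def)

lemma convex_comb_bounds:
  assumes "a \<le> b" "t \<in> {0..1::real}"
  shows "a \<le> a + (b - a) * t" "a + (b - a) * t \<le> b"
proof -
  have "0 \<le> (b - a) * t" "(b - a) * t \<le> (b - a) * 1"
    using assms by (simp, intro mult_left_mono) auto
  then show "a \<le> a + (b - a) * t" "a + (b - a) * t \<le> b" by auto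
qed

lemma convex_comb_unit:
  assumes "0 \<le> a" "a \<le> b" "b \<le> 1" "t \<in> {0..1::real}"
  shows "a + (b - a) * t \<in> {0..1}"
  using convex_comb_bounds[of a b t] assms by auto

lemma subpath_on_mem:
  assumes "a \<le> b" "\<And>t. a \<le> t \<Longrightarrow> t \<le> b \<Longrightarrow> p t \<in> W" "t \<in> {0..1}"
  shows "subpath_on a b p t \<in> W"
  unfolding subpath_on_def using convex_comb_bounds[of a b t] assms by auto

lemma pathin_subpath_on:
  assumes "pathin Y p" "0 \<le> a" "a \<le> b" "b \<le> 1"
  shows "pathin Y (subpath_on a b p)"
proof -
  have "(\<lambda>t. a + (b - a) * t) \<in> {0..1} \<rightarrow> {0..1}"
    using assms by (intro Pi_I convex_comb_unit) auto
  moreover have "continuous_on {0..1} (\<lambda>t. a + (b - a) * t)"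
    by (intro continuous_intros)
  ultimately show ?thesis
    using continuous_map_compose_on[OF assms(1)[unfolded pathin_def]] by (simp add: pathin_def subpath_on_def)
qed

text \<open>A functor from the fundamental groupoid of \<open>Y\<close> to \<open>G\<close>, seen as
  a category with one object, but evaluated on paths instead of classes. Paths with arbitrary ends
  have values, so no base point has to be carried along when a path is cut into pieces.\<close>

locale path_rep = group G for G (structure) +
  fixes Y :: "'a topology" and \<Psi> :: "(real \<Rightarrow> 'a) \<Rightarrow> 'g"
  assumes closed: "pathin Y p \<Longrightarrow> \<Psi> p \<in> carrier G"
    and homotopic: "path_homotopic Y p q \<Longrightarrow> \<Psi> p = \<Psi> q"
    and join: "pathin Y p \<Longrightarrow> pathin Y q \<Longrightarrow> p 1 = q 0 \<Longrightarrow> \<Psi> (loop_join p q) = \<Psi> p \<otimes> \<Psi> q"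
begin

lemma rep_eq: "pathin Y p \<Longrightarrow> (\<And>t. t \<in> {0..1} \<Longrightarrow> p t = q t) \<Longrightarrow> \<Psi> p = \<Psi> q"
  by (intro homotopic path_homotopic_eq)

text \<open>A constant path is its own join with itself, so its value is idempotent.\<close>

lemma rep_const: "y \<in> topspace Y \<Longrightarrow> \<Psi> (\<lambda>_. y) = \<one>"
  using join[of "\<lambda>_. y" "\<lambda>_. y"] closed[of "\<lambda>_. y"]
  by (simp add: loop_join_def pathin_def) 

lemma rep_reverse:
  assumes "pathin Y p"
  shows "\<Psi> (\<lambda>t. p (1 - t)) = inv (\<Psi> p)"
proof -
  have "p 1 \<in> topspace Y"
    using assms by (auto simp: pathin_def continuous_map_def Pi_iff)
  then have "\<Psi> (\<lambda>t. p (1 - t)) \<otimes> \<Psi> p = \<one>"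
    using join[OF pathin_reverse[OF assms] assms] homotopic[OF path_homotopic_reverse_join[OF assms]]
    by (simp add: rep_const)
  then show ?thesis
    using assms closed pathin_reverse by (metis inv_equality)
qed

text \<open>Running through the two pieces one after the other is a reparametrisation of the whole,
  also for degenerate pieces. This multiplicativity is what makes bisection of a path
  possible.\<close>

lemma rep_subpath_on:
  assumes "pathin Y p" "0 \<le> a" "a \<le> b" "b \<le> c" "c \<le> 1"
  shows "\<Psi> (subpath_on a b p) \<otimes> \<Psi> (subpath_on b c p) = \<Psi> (subpath_on a c p)"
proof -
  let ?f = "\<lambda>t. if t \<le> 1/2 then a + (b - a) * (2 * t) else b + (c - b) * (2 * t - 1)"
  have 1: "?f \<in> {0..1} \<rightarrow> {0..1}"
  proof
    fix t :: real assume t: "t \<in> {0..1}"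
    show "?f t \<in> {0..1}"
    proof (cases "t \<le> 1/2")
      case True
      then show ?thesis using convex_comb_unit[of a b "2 * t"] assms t by simp
    next
      case False
      then show ?thesis using convex_comb_unit[of b c "2 * t - 1"] assms t by simp
    qed
  qed
  have 2: "(\<lambda>t. a + (c - a) * t) \<in> {0..1} \<rightarrow> {0..1}"
    using assms by (intro Pi_I convex_comb_unit) auto
  have "path_homotopic Y (\<lambda>t. p (?f t)) (\<lambda>t. p (a + (c - a) * t))"
    by (rule path_homotopic_reparam[OF assms(1) _ 1 _ 2])
       (auto intro!: continuous_on_if_le continuous_on_if_half continuous_intros)
  moreover have "(\<lambda>t. p (?f t)) = loop_join (subpath_on a b p) (subpath_on b c p)"
    by (auto simp: loop_join_def subpath_on_def)
  ultimately have "path_homotopic Y (loop_join (subpath_on a b p) (subpath_on b c p)) (subpath_on a c p)"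
    by (simp only: subpath_on_def[of a c])
  from homotopic[OF this] show ?thesis
    using join[of "subpath_on a b p" "subpath_on b c p"] assms by (simp add: pathin_subpath_on)
qed

text \<open>The parameter square is convex, so its two boundary paths from (0, 0) to (1, 1) are
  homotopic. Every relation that involves a crossing is read off from such a square.\<close>

lemma rep_square:
  assumes F: "continuous_map (top_of_set ({0..1} \<times> {0..1})) Y F"
  shows "\<Psi> (\<lambda>t. F (t, 0)) \<otimes> \<Psi> (\<lambda>t. F (1, t)) = \<Psi> (\<lambda>t. F (0, t)) \<otimes> \<Psi> (\<lambda>t. F (t, 1))"
proof -
  let ?S = "{0..1} \<times> {0..1} :: (real \<times> real) set"
  have path: "pathin Y (\<lambda>t. F (f t))" if "continuous_on {0..1} f" "f \<in> {0..1} \<rightarrow> ?S" for f :: "real \<Rightarrow> real \<times> real"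
  using F that unfolding pathin_def by (rule continuous_map_compose_on)
  have p: "pathin Y (\<lambda>t. F (t, 0))" "pathin Y (\<lambda>t. F (1, t))" "pathin Y (\<lambda>t. F (0, t))" "pathin Y (\<lambda>t. F (t, 1))"
    by (auto intro!: path continuous_intros)
  let ?f = "\<lambda>t::real. (if t \<le> 1/2 then 2 * t else 1, if t \<le> 1/2 then 0 else 2 * t - 1)"
  let ?g = "\<lambda>t::real. (if t \<le> 1/2 then 0 else 2 * t - 1, if t \<le> 1/2 then 2 * t else 1)"
  have "path_homotopic Y (\<lambda>t. F (?f t)) (\<lambda>t. F (?g t))"
    by (rule path_homotopic_convex[OF _ F])
       (auto intro!: continuous_on_if_le continuous_on_if_half continuous_intros convex_Times)
  moreover have "(\<lambda>t. F (?f t)) = loop_join (\<lambda>t. F (t, 0)) (\<lambda>t. F (1, t))"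
    "(\<lambda>t. F (?g t)) = loop_join (\<lambda>t. F (0, t)) (\<lambda>t. F (t, 1))"
    by (auto simp: loop_join_def)
  ultimately show ?thesis
    using homotopic join[OF p(1,2)] join[OF p(3,4)] by auto
qed

text \<open>Used along \<open>orbit_of\<close>, to pass from unordered to ordered configurations,
  and along \<open>J\<close>, to pass from the surface to the open disc.\<close>

lemma pullback:
  assumes J: "continuous_map Z Y J"
  shows "path_rep G Z (\<lambda>p. \<Psi> (\<lambda>t. J (p t)))"
proof -
  have pin: "pathin Y (\<lambda>t. J (p t))" if "pathin Z p" for p
    using continuous_map_compose[OF that[unfolded pathin_def] J] by (simp add: o_def pathin_def)
  show ?thesis
  proof
    show "\<Psi> (\<lambda>t. J (p t)) \<in> carrier G" if "pathin Z p" for p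
      using pin[OF that] by (rule closed)
    show "\<Psi> (\<lambda>t. J (p t)) = \<Psi> (\<lambda>t. J (q t))" if pq: "path_homotopic Z p q" for p q
    proof -
      obtain h :: "real \<times> real \<Rightarrow> 'c" where h: "continuous_map (top_of_set ({0..1} \<times> {0..1})) Z h"
        "\<And>x. h (0, x) = p x" "\<And>x. h (1, x) = q x"
        "\<And>t. t \<in> {0..1} \<Longrightarrow> h (t, 0) = p 0" "\<And>t. t \<in> {0..1} \<Longrightarrow> h (t, 1) = p 1"
        using path_homotopicE[OF pq] by metis
      show ?thesis
        using continuous_map_compose[OF h(1) J] h(2-)
        by (intro homotopic path_homotopicI[of _ "\<lambda>z. J (h z)"]) (auto simp: o_def)
    qed
    show "\<Psi> (\<lambda>t. J (loop_join p q t)) = \<Psi> (\<lambda>t. J (p t)) \<otimes> \<Psi> (\<lambda>t. J (q t))"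
      if "pathin Z p" "pathin Z q" "p 1 = q 0" for p q
      using join[OF pin[OF that(1)] pin[OF that(2)]] that(3) by (simp add: o_loop_join[of J])
  qed
qed

text \<open>A natural isomorphism of functors. Only the values of \<open>g\<close> at the two ends
  of a path enter, so \<open>g\<close> is an arbitrary function on points.\<close>

lemma gauge:
  assumes g: "g \<in> topspace Y \<rightarrow> carrier G"
  shows "path_rep G Y (\<lambda>p. g (p 0) \<otimes> \<Psi> p \<otimes> inv (g (p 1)))"
proof
  have ends: "g (p 0) \<in> carrier G" "g (p 1) \<in> carrier G" if "pathin Y p" for p
    using that g by (auto simp: pathin_def continuous_map_def Pi_iff)
  show "g (p 0) \<otimes> \<Psi> p \<otimes> inv g (p 1) \<in> carrier G" if "pathin Y p" for p
    using ends[OF that] closed[OF that] by auto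
  show "g (p 0) \<otimes> \<Psi> p \<otimes> inv g (p 1) = g (q 0) \<otimes> \<Psi> q \<otimes> inv g (q 1)" if "path_homotopic Y p q" for p q
    using homotopic[OF that] path_homotopic_ends[OF that] by simp
  show "g (loop_join p q 0) \<otimes> \<Psi> (loop_join p q) \<otimes> inv g (loop_join p q 1) =
        g (p 0) \<otimes> \<Psi> p \<otimes> inv g (p 1) \<otimes> (g (q 0) \<otimes> \<Psi> q \<otimes> inv g (q 1))"
    if "pathin Y p" "pathin Y q" "p 1 = q 0" for p q
    using ends[OF that(1)] ends[OF that(2)] closed[OF that(1)] closed[OF that(2)] join[OF that] that(3)
    by (simp add: m_assoc, simp add: m_assoc[symmetric])
qed

end

text \<open>Every point is joined to \<open>b\<close> by a chosen path \<open>\<beta>\<close>, and a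
  path is turned into the loop \<open>L p\<close> by running out and back along the chosen paths of
  its ends.\<close>

lemma path_rep_of_hom:
  fixes Y :: "'a topology"
  assumes G: "group G" and \<phi>: "\<phi> \<in> hom (fundamental_group Y b) G"
    and Y: "path_connected_space Y" "b \<in> topspace Y"
  obtains \<Psi> where "path_rep G Y \<Psi>" "\<And>p. p \<in> loops Y b \<Longrightarrow> \<Psi> p = \<phi> (loop_class Y b p)"
proof -
  have "\<exists>p. pathin Y p \<and> p 0 = b \<and> p 1 = y" if "y \<in> topspace Y" for y
    using Y that by (auto simp: path_connected_space_def)
  then obtain \<beta>0 where \<beta>0: "\<And>y. y \<in> topspace Y \<Longrightarrow> pathin Y (\<beta>0 y) \<and> \<beta>0 y 0 = b \<and> \<beta>0 y 1 = y"
    by metis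
  \<comment> \<open>The path chosen for \<open>b\<close> itself is constant, so that
    \<open>L p\<close> is homotopic to \<open>p\<close> for loops and the representation extends
    \<phi> exactly, not only up to conjugation.\<close>
  define \<beta> where "\<beta> y = (if y = b then (\<lambda>_. b) else \<beta>0 y)" for y
  have \<beta>: "pathin Y (\<beta> y)" "\<beta> y 0 = b" "\<beta> y 1 = y" if "y \<in> topspace Y" for y
    using \<beta>0[OF that] Y by (auto simp: \<beta>_def pathin_def)
  define L where "L p = loop_join (loop_join (\<beta> (p 0)) p) (\<lambda>t. \<beta> (p 1) (1 - t))" for p :: "real \<Rightarrow> 'a"
  have ends: "p 0 \<in> topspace Y" "p 1 \<in> topspace Y" if "pathin Y p" for p
    using that by (auto simp: pathin_def continuous_map_def Pi_iff)
  have L: "L p \<in> loops Y b" if "pathin Y p" for p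
    using \<beta> ends[OF that] that unfolding L_def loops_def
    by (auto intro!: pathin_loop_join pathin_reverse)
  note [trans] = path_homotopic_trans
  have L_loop: "path_homotopic Y (L p) p" if p: "p \<in> loops Y b" for p
  proof -
    have p': "pathin Y p" "p 0 = b" "p 1 = b" using p by (auto simp: loops_def)
    have "L p = loop_join (loop_join (\<lambda>_. b) p) (\<lambda>_. b)" by (simp add: L_def p' \<beta>_def)
    moreover have "path_homotopic Y (loop_join (loop_join (\<lambda>_. b) p) (\<lambda>_. b)) (loop_join p (\<lambda>_. b))"
      using path_homotopic_const_join(1)[OF p'(1)] p' Y
      by (intro path_homotopic_join path_homotopic_refl) (auto simp: pathin_def)
    moreover have "path_homotopic Y (loop_join p (\<lambda>_. b)) p"
      using path_homotopic_const_join(2)[OF p'(1)] p' by simp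
    ultimately show ?thesis by (metis path_homotopic_trans)
  qed
  have L_cong: "path_homotopic Y (L p) (L q)" if pq: "path_homotopic Y p q" for p q
  proof -
    have p: "pathin Y p" using path_homotopic_pathin[OF pq] by auto
    show ?thesis unfolding L_def using path_homotopic_ends[OF pq] \<beta> ends[OF p]
      by (auto intro!: path_homotopic_join path_homotopic_refl pathin_reverse pq)
  qed
  \<comment> \<open>In the middle of the join the return along \<open>\<beta> (p 1)\<close> is
    followed by the departure along the same path, and these two cancel.\<close>
  have L_join: "path_homotopic Y (loop_join (L p) (L q)) (L (loop_join p q))"
    if p: "pathin Y p" and q: "pathin Y q" and pq: "p 1 = q 0" for p q
  proof -
    let ?a = "\<beta> (p 0)" and ?b = "\<beta> (p 1)" and ?b' = "\<lambda>t. \<beta> (p 1) (1 - t)" and ?c = "\<lambda>t. \<beta> (q 1) (1 - t)"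
    have e: "pathin Y ?a" "?a 0 = b" "?a 1 = p 0" "pathin Y ?b" "?b 0 = b" "?b 1 = q 0"
      "pathin Y ?b'" "pathin Y ?c" "pathin Y (\<beta> (q 1))"
      "\<beta> (q 1) 0 = b" "\<beta> (q 1) 1 = q 1" "?b' 0 = p 1" "?b' 1 = b" "?c 0 = q 1" "?c 1 = b"
      using \<beta>[OF ends(1)[OF p]] \<beta>[OF ends(1)[OF q]] \<beta>[OF ends(2)[OF q]] \<beta>[OF ends(2)[OF p]] pq
      by (simp_all add: pathin_reverse)
    note R = path_homotopic_join[OF path_homotopic_refl] and L = path_homotopic_join[OF _ path_homotopic_refl]
    note [simp] = e[unfolded pq] pq p q pathin_loop_join
    have "path_homotopic Y (loop_join (L p) (L q))
        (loop_join (loop_join ?a p) (loop_join ?b' (loop_join (loop_join ?b q) ?c)))"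
      unfolding L_def pq[symmetric] by (rule path_homotopic_assoc) simp_all
    also have "path_homotopic Y \<dots>
        (loop_join (loop_join ?a p) (loop_join ?b' (loop_join ?b (loop_join q ?c))))"
      by (rule R[OF _ R[OF _ path_homotopic_assoc]]) simp_all
    also have "path_homotopic Y \<dots>
        (loop_join (loop_join ?a p) (loop_join (loop_join ?b' ?b) (loop_join q ?c)))"
      by (rule R[OF _ path_homotopic_sym[OF path_homotopic_assoc]]) simp_all
    also have "path_homotopic Y \<dots>
        (loop_join (loop_join ?a p) (loop_join (\<lambda>_. q 0) (loop_join q ?c)))"
      using path_homotopic_reverse_join[of Y ?b] by (intro R[OF _ L]) simp_all
    also have "path_homotopic Y \<dots> (loop_join (loop_join ?a p) (loop_join q ?c))"
      using path_homotopic_const_join(1)[of Y "loop_join q ?c"] by (intro R) simp_all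
    also have "path_homotopic Y \<dots> (loop_join (loop_join (loop_join ?a p) q) ?c)"
      by (rule path_homotopic_sym[OF path_homotopic_assoc]) simp_all
    also have "path_homotopic Y \<dots> (loop_join (loop_join ?a (loop_join p q)) ?c)"
      by (rule L[OF path_homotopic_assoc]) simp_all
    finally show ?thesis unfolding L_def by simp
  qed
  define \<Psi> where "\<Psi> p = \<phi> (loop_class Y b (L p))" for p
  have cls: "loop_class Y b p = loop_class Y b q" if "path_homotopic Y p q" "p \<in> loops Y b" for p q
    using loop_class_eq_iff[OF that(2), of q] that path_homotopic_ends[OF that(1)] path_homotopic_pathin[OF that(1)]
    by (auto simp: loops_def)
  show thesis
  proof (rule that[of \<Psi>])
    show "path_rep G Y \<Psi>"
    proof (intro path_rep.intro path_rep_axioms.intro G)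
      show "\<Psi> p \<in> carrier G" if "pathin Y p" for p
        using \<phi> L[OF that] by (auto simp: \<Psi>_def hom_def carrier_fundamental_group)
      show "\<Psi> p = \<Psi> q" if "path_homotopic Y p q" for p q
        using cls[OF L_cong[OF that]] L path_homotopic_pathin[OF that] by (auto simp: \<Psi>_def)
      show "\<Psi> (loop_join p q) = \<Psi> p \<otimes>\<^bsub>G\<^esub> \<Psi> q" if pq: "pathin Y p" "pathin Y q" "p 1 = q 0" for p q
      proof -
        have "\<Psi> (loop_join p q) = \<phi> (loop_class Y b (loop_join (L p) (L q)))"
          using cls[OF L_join[OF pq]] L pq by (auto simp: \<Psi>_def loop_join_loops)
        also have "\<dots> = \<Psi> p \<otimes>\<^bsub>G\<^esub> \<Psi> q"
          using L pq \<phi> by (subst mult_fundamental_group[symmetric])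
            (auto simp: \<Psi>_def hom_def carrier_fundamental_group)
        finally show ?thesis .
      qed
    qed
    show "\<Psi> p = \<phi> (loop_class Y b p)" if "p \<in> loops Y b" for p
      using cls[OF L_loop[OF that]] L that by (auto simp: \<Psi>_def loops_def)
  qed
qed

section \<open>Configuration spaces and path lifting\<close>

lemma topspace_configuration_spaceI:
  "x \<in> extensional {..<n} \<Longrightarrow> (\<And>i. i < n \<Longrightarrow> x i \<in> topspace X) \<Longrightarrow> inj_on x {..<n} \<Longrightarrow>
     x \<in> topspace (configuration_space n X)"
  by (auto simp: topspace_configuration_space PiE_iff)

lemma continuous_map_configuration_space_coord:
  "i < n \<Longrightarrow> continuous_map (configuration_space n X) X (\<lambda>x. x i)"
  unfolding configuration_space_def
  using continuous_map_product_projection[of i "{..<n}" "\<lambda>_. X"]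
  by (intro continuous_map_from_subtopology) simp

lemma continuous_map_into_configuration_space:
  "continuous_map Z (configuration_space n X) f \<longleftrightarrow>
     (\<forall>i<n. continuous_map Z X (\<lambda>z. f z i)) \<and> f \<in> topspace Z \<rightarrow> topspace (configuration_space n X)"
proof -
  have "f ` topspace Z \<subseteq> extensional {..<n}" if "f \<in> topspace Z \<rightarrow> topspace (configuration_space n X)"
    using that by (auto simp: topspace_configuration_space PiE_iff Pi_iff)
  moreover have "f \<in> topspace Z \<rightarrow> {x. inj_on x {..<n}}"
    if "f \<in> topspace Z \<rightarrow> topspace (configuration_space n X)"
    using that by (auto simp: topspace_configuration_space Pi_iff)
  moreover have "f \<in> topspace Z \<rightarrow> topspace (configuration_space n X)"
    if "f ` topspace Z \<subseteq> extensional {..<n}" "\<forall>i<n. continuous_map Z X (\<lambda>z. f z i)" "f \<in> topspace Z \<rightarrow> {x. inj_on x {..<n}}"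
    using that by (fastforce simp: topspace_configuration_space PiE_iff Pi_iff continuous_map_def)
  ultimately show ?thesis
    unfolding configuration_space_def continuous_map_in_subtopology continuous_map_componentwise
    by (auto simp: configuration_space_def[symmetric])
qed

lemma configuration_permute:
  assumes "x \<in> topspace (configuration_space n X)" "s permutes {..<n}"
  shows "x \<circ> s \<in> topspace (configuration_space n X)"
proof -
  have "(x, x \<circ> s) \<in> permutation_orbits n X"
    using assms by (auto simp: permutation_orbits_def)
  then show ?thesis
    using equiv_permutation_orbits[of n X] by (auto simp: equiv_def)
qed

lemma continuous_map_permute:
  assumes s: "s permutes {..<n}"
  shows "continuous_map (configuration_space n X) (configuration_space n X) (\<lambda>x. x \<circ> s)"
  unfolding continuous_map_into_configuration_space
  using permutes_in_image[OF s] configuration_permute[OF _ s]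
  by (auto intro: continuous_map_configuration_space_coord)

definition orbit_of :: "nat \<Rightarrow> 'a topology \<Rightarrow> (nat \<Rightarrow> 'a) \<Rightarrow> (nat \<Rightarrow> 'a) set" where
  "orbit_of n X x = permutation_orbits n X `` {x}"

lemma quotient_map_orbit_of:
  "quotient_map (configuration_space n X) (unordered_configuration_space n X) (orbit_of n X)"
  unfolding unordered_configuration_space_def orbit_of_def
  by (rule quotient_map_quotient_topology[OF equiv_permutation_orbits])

lemma continuous_map_orbit_of:
  "continuous_map (configuration_space n X) (unordered_configuration_space n X) (orbit_of n X)"
  by (rule quotient_imp_continuous_map[OF quotient_map_orbit_of])

lemma topspace_unordered_configuration_space:
  "topspace (unordered_configuration_space n X) = orbit_of n X ` topspace (configuration_space n X)"
  by (rule quotient_imp_surjective_map[OF quotient_map_orbit_of, symmetric])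

lemma orbit_of_eq_iff:
  assumes "x \<in> topspace (configuration_space n X)" "y \<in> topspace (configuration_space n X)"
  shows "orbit_of n X x = orbit_of n X y \<longleftrightarrow> (\<exists>s. s permutes {..<n} \<and> y = x \<circ> s)"
  unfolding orbit_of_def using eq_equiv_class_iff[OF equiv_permutation_orbits assms] assms
  by (auto simp: permutation_orbits_def)

lemma orbit_of_permute:
  assumes "x \<in> topspace (configuration_space n X)" "s permutes {..<n}"
  shows "orbit_of n X (x \<circ> s) = orbit_of n X x"
  using assms configuration_permute[OF assms] by (subst eq_commute, subst orbit_of_eq_iff) auto

lemma disjoint_neighbourhoods:
  assumes X: "Hausdorff_space X" and x: "x \<in> topspace (configuration_space n X)"
  obtains U where "\<And>i. i < n \<Longrightarrow> openin X (U i) \<and> x i \<in> U i"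
    "\<And>i j. i < n \<Longrightarrow> j < n \<Longrightarrow> i \<noteq> j \<Longrightarrow> U i \<inter> U j = {}"
proof -
  have "\<exists>V W. openin X V \<and> openin X W \<and> x i \<in> V \<and> x j \<in> W \<and> V \<inter> W = {}"
    if "i < n" "j < n" "i \<noteq> j" for i j
  proof -
    have "x i \<in> topspace X" "x j \<in> topspace X" "x i \<noteq> x j"
      using x that by (auto simp: topspace_configuration_space PiE_iff inj_on_eq_iff)
    then show ?thesis using X unfolding Hausdorff_space_def disjnt_def by blast
  qed
  then obtain V W where VW: "\<And>i j. i < n \<Longrightarrow> j < n \<Longrightarrow> i \<noteq> j \<Longrightarrow>
      openin X (V i j) \<and> openin X (W i j) \<and> x i \<in> V i j \<and> x j \<in> W i j \<and> V i j \<inter> W i j = {}"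
    by metis
  \<comment> \<open>For a single point the index set is empty and the intersection is the whole
    type; the factor \<open>topspace X\<close> keeps the set open in \<open>X\<close>.\<close>
  define U where "U i = (\<Inter>j\<in>{..<n} - {i}. V i j \<inter> W j i) \<inter> topspace X" for i
  show thesis
  proof
    fix i assume i: "i < n"
    have "openin X (U i)"
    proof (cases "{..<n} - {i} = {}")
      case True
      then show ?thesis unfolding U_def by (simp only: True) simp
    next
      case False
      then show ?thesis unfolding U_def using VW i by (intro openin_Int openin_INT2) auto
    qed
    then show "openin X (U i) \<and> x i \<in> U i"
      using VW i x by (auto simp: U_def topspace_configuration_space PiE_iff)
  next
    fix i j assume ij: "i < n" "j < n" "i \<noteq> j"
    then have "U i \<subseteq> V i j" "U j \<subseteq> W i j" by (auto simp: U_def)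
    then show "U i \<inter> U j = {}" using VW[OF ij] by blast
  qed
qed

lemma openin_configuration_box:
  assumes "\<And>i. i < n \<Longrightarrow> openin X (U i)"
  shows "openin (configuration_space n X) {u \<in> topspace (configuration_space n X). \<forall>i<n. u i \<in> U i}"
proof -
  have "{u \<in> topspace (configuration_space n X). \<forall>i<n. u i \<in> U i} =
      topspace (configuration_space n X) \<inter>
      (\<Inter>i\<in>{..<n}. {u \<in> topspace (configuration_space n X). u i \<in> U i})" by auto
  also have "openin (configuration_space n X) \<dots>"
  proof (cases "n = 0")
    case False
    then show ?thesis
      using assms by (intro openin_Int openin_INT2 openin_topspace
          openin_continuous_map_preimage[OF continuous_map_configuration_space_coord]) auto
  qed auto
  finally show ?thesis .
qed

text \<open>A box of pairwise disjoint neighbourhoods of the coordinates: a permutation that moves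
  \<open>i\<close> would put one coordinate into two disjoint sets. This freeness makes the orbit
  map a covering.\<close>

lemma free_neighbourhood:
  assumes "Hausdorff_space X" and x: "x \<in> topspace (configuration_space n X)"
  obtains W where "openin (configuration_space n X) W" "x \<in> W"
    "\<And>u s. u \<in> W \<Longrightarrow> u \<circ> s \<in> W \<Longrightarrow> s permutes {..<n} \<Longrightarrow> s = id"
proof -
  obtain U where U: "\<And>i. i < n \<Longrightarrow> openin X (U i) \<and> x i \<in> U i"
    "\<And>i j. i < n \<Longrightarrow> j < n \<Longrightarrow> i \<noteq> j \<Longrightarrow> U i \<inter> U j = {}"
    by (rule disjoint_neighbourhoods[OF assms]) (rule that)
  show thesis
  proof (rule that[of "{u \<in> topspace (configuration_space n X). \<forall>i<n. u i \<in> U i}"])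
    fix u s assume *: "u \<in> {u \<in> topspace (configuration_space n X). \<forall>i<n. u i \<in> U i}"
      "u \<circ> s \<in> {u \<in> topspace (configuration_space n X). \<forall>i<n. u i \<in> U i}" and s: "s permutes {..<n}"
    have "s i = i" if i: "i < n" for i
    proof (rule ccontr)
      assume "s i \<noteq> i"
      moreover have "s i < n" using s i permutes_in_image by fastforce
      ultimately have "U i \<inter> U (s i) = {}" using U(2)[of i "s i"] i by auto
      moreover have "u (s i) \<in> U (s i)" "u (s i) \<in> U i" using * i \<open>s i < n\<close> by auto
      ultimately show False by blast
    qed
    then show "s = id" using s by (metis eq_id_iff lessThan_iff permutes_not_in)
  qed (use U x in \<open>auto intro: openin_configuration_box\<close>)
qed

text \<open>The saturation of an open set is the union of its preimages under all permutations, each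
  of which acts continuously.\<close>

lemma openin_orbit_image:
  assumes W: "openin (configuration_space n X) W"
  shows "openin (unordered_configuration_space n X) (orbit_of n X ` W)"
proof -
  let ?F = "configuration_space n X"
  have sub: "W \<subseteq> topspace ?F" using W by (rule openin_subset)
  have "\<Union>(orbit_of n X ` W) = (\<Union>s\<in>{s. s permutes {..<n}}. {u \<in> topspace ?F. u \<circ> s \<in> W})"
  proof safe
    fix u w assume w: "w \<in> W" and "u \<in> orbit_of n X w"
    then obtain s where s: "s permutes {..<n}" "u = w \<circ> s"
      by (auto simp: orbit_of_def permutation_orbits_def)
    then have "w = u \<circ> inv' s" by (simp add: comp_assoc permutes_inv_o)
    then show "u \<in> (\<Union>s\<in>{s. s permutes {..<n}}. {u \<in> topspace ?F. u \<circ> s \<in> W})"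
      using s w sub permutes_inv[OF s(1)] configuration_permute by fastforce
  next
    fix u s assume s: "s permutes {..<n}" "u \<in> topspace ?F" "u \<circ> s \<in> W"
    then have "(u, u \<circ> s) \<in> permutation_orbits n X"
      by (auto simp: permutation_orbits_def)
    then have "(u \<circ> s, u) \<in> permutation_orbits n X"
      using equiv_permutation_orbits[of n X] by (meson equivE symE)
    then show "u \<in> \<Union>(orbit_of n X ` W)"
      using s by (auto simp: orbit_of_def)
  qed
  also have "openin ?F \<dots>"
    using openin_continuous_map_preimage[OF continuous_map_permute W] by blast
  finally have "openin ?F (\<Union>(orbit_of n X ` W))" .
  moreover have "orbit_of n X ` W \<subseteq> topspace ?F // permutation_orbits n X"
    using sub by (auto simp: orbit_of_def quotient_def)
  ultimately show ?thesis
    unfolding unordered_configuration_space_def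
    by (simp add: openin_quotient_topology[OF equiv_permutation_orbits])
qed

section \<open>Lifting paths and squares along the orbit map\<close>

lemma Hausdorff_configuration_space:
  "Hausdorff_space X \<Longrightarrow> Hausdorff_space (configuration_space n X)"
  unfolding configuration_space_def
  by (intro Hausdorff_space_subtopology) (simp add: Hausdorff_space_product_topology)

text \<open>The set where two lifts agree is closed by the Hausdorff property. It is open because
  the lifts differ at each point by a permutation, which inside a free neighbourhood can only be the
  identity.\<close>

lemma lift_unique:
  assumes X: "Hausdorff_space X" and Z: "connected_space Z"
    and k: "continuous_map Z (configuration_space n X) k" "continuous_map Z (configuration_space n X) l"
    and eq: "\<And>z. z \<in> topspace Z \<Longrightarrow> orbit_of n X (k z) = orbit_of n X (l z)"
    and z0: "z0 \<in> topspace Z" "k z0 = l z0" and z: "z \<in> topspace Z"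
  shows "k z = l z"
proof -
  let ?E = "{z \<in> topspace Z. k z = l z}"
  have "closedin Z ?E"
    by (rule closedin_continuous_maps_eq[OF Hausdorff_configuration_space[OF X] k])
  moreover have "openin Z ?E"
  proof (subst openin_subopen, intro ballI)
    fix z assume z: "z \<in> ?E"
    then have kz: "k z \<in> topspace (configuration_space n X)"
      using k by (auto simp: continuous_map_def Pi_iff)
    obtain W where W: "openin (configuration_space n X) W" "k z \<in> W"
      "\<And>u s. u \<in> W \<Longrightarrow> u \<circ> s \<in> W \<Longrightarrow> s permutes {..<n} \<Longrightarrow> s = id"
      by (rule free_neighbourhood[OF X kz]) (rule that)
    let ?T = "{z \<in> topspace Z. k z \<in> W} \<inter> {z \<in> topspace Z. l z \<in> W}"
    have "openin Z ?T"
      by (intro openin_Int openin_continuous_map_preimage[OF k(1) W(1)]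
          openin_continuous_map_preimage[OF k(2) W(1)])
    moreover have "?T \<subseteq> ?E"
    proof
      fix y assume y: "y \<in> ?T"
      then have "k y \<in> topspace (configuration_space n X)" "l y \<in> topspace (configuration_space n X)"
        using k by (auto simp: continuous_map_def Pi_iff)
      from orbit_of_eq_iff[OF this] obtain s where "s permutes {..<n}" "l y = k y \<circ> s"
        using eq y by auto
      with W(3)[of "k y" s] y show "y \<in> ?E" by auto
    qed
    ultimately show "\<exists>T. openin Z T \<and> z \<in> T \<and> T \<subseteq> ?E"
      using z W(2) by auto
  qed
  ultimately show ?thesis
    using Z z0 z unfolding connected_space_clopen_in by blast
qed

text \<open>No initial value is prescribed: a lift can be moved to any point over the same orbit by
  a permutation, so gluing only needs existence.\<close>

definition liftable :: "nat \<Rightarrow> 'a topology \<Rightarrow> ('b::topological_space \<Rightarrow> (nat \<Rightarrow> 'a) set) \<Rightarrow> 'b set \<Rightarrow> bool" where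
  "liftable n X h A \<longleftrightarrow>
     (\<exists>k. continuous_map (top_of_set A) (configuration_space n X) k \<and> (\<forall>z\<in>A. orbit_of n X (k z) = h z))"

lemma liftable_subset: "liftable n X h A \<Longrightarrow> B \<subseteq> A \<Longrightarrow> liftable n X h B"
  unfolding liftable_def by (metis continuous_map_from_subtopology_mono subsetD)

lemma lift_adjust:
  assumes k: "continuous_map Z (configuration_space n X) k" and z0: "z0 \<in> topspace Z"
    and x: "x \<in> topspace (configuration_space n X)" "orbit_of n X (k z0) = orbit_of n X x"
  obtains k' where "continuous_map Z (configuration_space n X) k'" "k' z0 = x"
    "\<And>z. z \<in> topspace Z \<Longrightarrow> orbit_of n X (k' z) = orbit_of n X (k z)"
proof -
  have kz: "k z \<in> topspace (configuration_space n X)" if "z \<in> topspace Z" for z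
    using k that by (auto simp: continuous_map_def Pi_iff)
  obtain s where s: "s permutes {..<n}" "x = k z0 \<circ> s"
    using orbit_of_eq_iff[OF kz[OF z0] x(1)] x(2) by auto
  show thesis
  proof (rule that[of "\<lambda>z. k z \<circ> s"])
    show "continuous_map Z (configuration_space n X) (\<lambda>z. k z \<circ> s)"
      using continuous_map_compose[OF k continuous_map_permute[OF s(1)]] by (simp add: o_def)
  qed (use s kz in \<open>auto simp: orbit_of_permute\<close>)
qed

text \<open>A permutation makes the two lifts agree at one point of the interface
  \<open>f z = c\<close>; since the interface is connected, they then agree on all of it. An empty
  interface leaves nothing to adjust.\<close>

lemma liftable_glue:
  fixes h :: "'b::topological_space \<Rightarrow> (nat \<Rightarrow> 'a) set" and A :: "'b set"
  assumes X: "Hausdorff_space X" and f: "continuous_on A f"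
    and l1: "liftable n X h {z \<in> A. f z \<le> (c::real)}" and l2: "liftable n X h {z \<in> A. c \<le> f z}"
    and conn: "connected {z \<in> A. f z = c}"
  shows "liftable n X h A"
proof -
  let ?F = "configuration_space n X"
  obtain k where k: "continuous_map (top_of_set {z \<in> A. f z \<le> c}) ?F k"
    "\<And>z. z \<in> A \<Longrightarrow> f z \<le> c \<Longrightarrow> orbit_of n X (k z) = h z"
    using l1 unfolding liftable_def by auto
  obtain l where l: "continuous_map (top_of_set {z \<in> A. c \<le> f z}) ?F l"
    "\<And>z. z \<in> A \<Longrightarrow> c \<le> f z \<Longrightarrow> orbit_of n X (l z) = h z"
    using l2 unfolding liftable_def by auto
  obtain l' where l': "continuous_map (top_of_set {z \<in> A. c \<le> f z}) ?F l'"
    "\<And>z. z \<in> A \<Longrightarrow> c \<le> f z \<Longrightarrow> orbit_of n X (l' z) = h z"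
    "\<And>z. z \<in> A \<Longrightarrow> f z = c \<Longrightarrow> k z = l' z"
  proof (cases "{z \<in> A. f z = c} = {}")
    case True
    then show ?thesis using l by (intro that[of l]) auto
  next
    case False
    then obtain z0 where z0: "z0 \<in> A" "f z0 = c" by auto
    have kz0: "k z0 \<in> topspace ?F" using k(1) z0 by (auto simp: continuous_map_def Pi_iff)
    have z0': "z0 \<in> topspace (top_of_set {z \<in> A. c \<le> f z})" using z0 by simp
    have o: "orbit_of n X (l z0) = orbit_of n X (k z0)" using k(2)[of z0] l(2)[of z0] z0 by simp
    obtain l' where l': "continuous_map (top_of_set {z \<in> A. c \<le> f z}) ?F l'" "l' z0 = k z0"
      "\<And>z. z \<in> topspace (top_of_set {z \<in> A. c \<le> f z}) \<Longrightarrow> orbit_of n X (l' z) = orbit_of n X (l z)"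
      by (rule lift_adjust[OF l(1) z0' kz0 o]) (rule that)
    show ?thesis
    proof (rule that[OF l'(1)])
      show "orbit_of n X (l' z) = h z" if "z \<in> A" "c \<le> f z" for z
        using l'(3)[of z] l(2)[of z] that by simp
      show "k z = l' z" if "z \<in> A" "f z = c" for z
      proof (rule lift_unique[OF X, of "top_of_set {z \<in> A. f z = c}" _ k l' z0])
        show "connected_space (top_of_set {z \<in> A. f z = c})"
          using conn by (simp add: connected_space_subtopology)
        show "continuous_map (top_of_set {z \<in> A. f z = c}) ?F k"
          using k(1) by (rule continuous_map_from_subtopology_mono) auto
        show "continuous_map (top_of_set {z \<in> A. f z = c}) ?F l'"
          using l'(1) by (rule continuous_map_from_subtopology_mono) auto
      qed (use that z0 k(2) l(2) l'(2,3) in auto)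
    qed
  qed
  let ?k = "\<lambda>z. if f z \<le> c then k z else l' z"
  have "continuous_map (top_of_set A) ?F ?k"
  proof (rule continuous_map_cases_le)
    have "A \<inter> {x \<in> A. f x \<le> c} = {x \<in> A. f x \<le> c}" "A \<inter> {x \<in> A. c \<le> f x} = {x \<in> A. c \<le> f x}" by auto
    then show "continuous_map (subtopology (top_of_set A) {x \<in> topspace (top_of_set A). f x \<le> c}) ?F k"
      "continuous_map (subtopology (top_of_set A) {x \<in> topspace (top_of_set A). c \<le> f x}) ?F l'"
      using k(1) l'(1) by (simp_all add: subtopology_subtopology)
  qed (use f l'(3) in auto)
  then show ?thesis
    unfolding liftable_def using k(2) l'(2) by (intro exI[of _ ?k]) auto
qed

text \<open>On a free neighbourhood the orbit map is injective, and it is open; its inverse there is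
  a continuous local section, to be composed with \<open>h\<close>.\<close>

lemma liftable_local:
  assumes X: "Hausdorff_space X"
    and h: "continuous_map (top_of_set S) (unordered_configuration_space n X) h" and z: "z \<in> S"
  obtains T where "openin (top_of_set S) T" "z \<in> T" "liftable n X h T"
proof -
  let ?F = "configuration_space n X"
  have "h z \<in> topspace (unordered_configuration_space n X)"
    using h z by (auto simp: continuous_map_def Pi_iff)
  then obtain x where x: "x \<in> topspace ?F" "h z = orbit_of n X x"
    by (auto simp: topspace_unordered_configuration_space)
  obtain W where W: "openin ?F W" "x \<in> W"
    "\<And>u s. u \<in> W \<Longrightarrow> u \<circ> s \<in> W \<Longrightarrow> s permutes {..<n} \<Longrightarrow> s = id"
    by (rule free_neighbourhood[OF X x(1)]) (rule that)
  have sub: "W \<subseteq> topspace ?F" using W(1) by (rule openin_subset)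
  have inj: "inj_on (orbit_of n X) W"
  proof (rule inj_onI)
    fix u v assume uv: "u \<in> W" "v \<in> W" "orbit_of n X u = orbit_of n X v"
    then obtain s where "s permutes {..<n}" "v = u \<circ> s"
      using orbit_of_eq_iff[of u n X v] sub by auto
    with W(3) uv show "u = v" by fastforce
  qed
  define T where "T = {z \<in> topspace (top_of_set S). h z \<in> orbit_of n X ` W}"
  define k where "k z = the_inv_into W (orbit_of n X) (h z)" for z
  have k: "k z \<in> W" "orbit_of n X (k z) = h z" if "z \<in> T" for z
    using that the_inv_into_into[OF inj] f_the_inv_into_f[OF inj] unfolding k_def T_def by auto
  have "continuous_map (top_of_set T) ?F k"
    unfolding continuous_map_def
  proof (intro conjI allI impI)
    show "k \<in> topspace (top_of_set T) \<rightarrow> topspace ?F" using k sub by auto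
    fix U assume U: "openin ?F U"
    have "{z \<in> topspace (top_of_set T). k z \<in> U} = T \<inter> {z \<in> topspace (top_of_set S). h z \<in> orbit_of n X ` (U \<inter> W)}"
    proof (intro equalityI subsetI)
      fix z assume "z \<in> T \<inter> {z \<in> topspace (top_of_set S). h z \<in> orbit_of n X ` (U \<inter> W)}"
      then obtain w where w: "z \<in> T" "w \<in> U" "w \<in> W" "h z = orbit_of n X w" by auto
      with inj_onD[OF inj, of "k z" w] k[of z] show "z \<in> {z \<in> topspace (top_of_set T). k z \<in> U}" by simp
    next
      fix z assume "z \<in> {z \<in> topspace (top_of_set T). k z \<in> U}"
      then have "z \<in> T" "k z \<in> U \<inter> W" "h z = orbit_of n X (k z)" using k[of z] by simp_all
      then show "z \<in> T \<inter> {z \<in> topspace (top_of_set S). h z \<in> orbit_of n X ` (U \<inter> W)}"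
        by (auto simp: T_def)
    qed
    moreover have "openin (top_of_set S) {z \<in> topspace (top_of_set S). h z \<in> orbit_of n X ` (U \<inter> W)}"
      using U W(1) by (intro openin_continuous_map_preimage[OF h] openin_orbit_image openin_Int)
    then have "openin (top_of_set T) (T \<inter> {z \<in> topspace (top_of_set S). h z \<in> orbit_of n X ` (U \<inter> W)})"
    proof -
      assume "openin (top_of_set S) {z \<in> topspace (top_of_set S). h z \<in> orbit_of n X ` (U \<inter> W)}"
      then obtain V where "open V" "{z \<in> topspace (top_of_set S). h z \<in> orbit_of n X ` (U \<inter> W)} = S \<inter> V"
        by (auto simp: openin_open)
      moreover have "T \<subseteq> S" by (auto simp: T_def)
      ultimately show ?thesis by (auto simp: openin_open)
    qed
    ultimately show "openin (top_of_set T) {z \<in> topspace (top_of_set T). k z \<in> U}" by simp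
  qed
  then have "liftable n X h T" unfolding liftable_def using k(2) by blast
  moreover have "openin (top_of_set S) T"
    unfolding T_def by (intro openin_continuous_map_preimage[OF h] openin_orbit_image W(1))
  moreover have "z \<in> T" using z x W(2) by (auto simp: T_def)
  ultimately show thesis using that by blast
qed

text \<open>Bisection takes the place of a Lebesgue number. For fixed \<open>s\<close> the second
  coordinate is bisected; the width of the strip around \<open>s\<close> shrinks with each gluing
  but stays positive, so a full strip lifts, and then the first coordinate is bisected. All
  interfaces are products of intervals, hence connected.\<close>

lemma liftable_square:
  assumes X: "Hausdorff_space X"
    and h: "continuous_map (top_of_set ({0..1} \<times> {0..1})) (unordered_configuration_space n X) h"
  shows "liftable n X h ({0..1} \<times> {0..1 :: real} :: (real \<times> real) set)"
proof -
  let ?I = "{0..1 :: real}"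
  let ?B = "\<lambda>a b c d. ({a..b} \<inter> ?I) \<times> ({c..d} \<inter> ?I)"
  have glue_snd: "liftable n X h (?B a b c e)"
    if "liftable n X h (?B a b c d)" "liftable n X h (?B a b d e)" for a b c d e
  proof (rule liftable_glue[OF X, of _ snd _ _ d])
    show "liftable n X h {z \<in> ?B a b c e. snd z \<le> d}"
      using that(1) by (rule liftable_subset) auto
    show "liftable n X h {z \<in> ?B a b c e. d \<le> snd z}"
      using that(2) by (rule liftable_subset) auto
    have "{z \<in> ?B a b c e. snd z = d} = ({a..b} \<inter> ?I) \<times> ({c..e} \<inter> ?I \<inter> {d})" by auto
    then show "connected {z \<in> ?B a b c e. snd z = d}"
      by (simp add: convex_connected convex_Times convex_Int)
  qed (auto intro!: continuous_intros)
  have glue_fst: "liftable n X h (?B a e c d)"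
    if "liftable n X h (?B a b c d)" "liftable n X h (?B b e c d)" for a b c d e
  proof (rule liftable_glue[OF X, of _ fst _ _ b])
    show "liftable n X h {z \<in> ?B a e c d. fst z \<le> b}"
      using that(1) by (rule liftable_subset) auto
    show "liftable n X h {z \<in> ?B a e c d. b \<le> fst z}"
      using that(2) by (rule liftable_subset) auto
    have "{z \<in> ?B a e c d. fst z = b} = ({a..e} \<inter> ?I \<inter> {b}) \<times> ({c..d} \<inter> ?I)" by auto
    then show "connected {z \<in> ?B a e c d. fst z = b}"
      by (simp add: convex_connected convex_Times convex_Int)
  qed (auto intro!: continuous_intros)
  have strip: "\<exists>\<delta>>0. liftable n X h (?B (s - \<delta>) (s + \<delta>) 0 1)" if s: "s \<in> ?I" for s
  proof -
    define P where "P a b \<longleftrightarrow> (\<exists>\<delta>>0. liftable n X h (?B (s - \<delta>) (s + \<delta>) a b))" for a b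
    have "P 0 1"
    proof (rule Bolzano)
      fix a b c :: real
      assume "P a b" "P b c"
      then obtain \<delta>1 \<delta>2 where d: "\<delta>1 > 0" "liftable n X h (?B (s - \<delta>1) (s + \<delta>1) a b)"
        "\<delta>2 > 0" "liftable n X h (?B (s - \<delta>2) (s + \<delta>2) b c)" unfolding P_def by blast
      let ?d = "min \<delta>1 \<delta>2"
      have "liftable n X h (?B (s - ?d) (s + ?d) a b)" using d(2) by (rule liftable_subset) auto
      moreover have "liftable n X h (?B (s - ?d) (s + ?d) b c)" using d(4) by (rule liftable_subset) auto
      ultimately have "liftable n X h (?B (s - ?d) (s + ?d) a c)" by (rule glue_snd)
      moreover have "?d > 0" using d by auto
      ultimately show "P a c" unfolding P_def by blast
    next
      fix x :: real assume "0 \<le> x" "x \<le> 1"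
      then have "(s, x) \<in> ?I \<times> ?I" using s by auto
      from liftable_local[OF X h this] obtain T where
        T: "openin (top_of_set (?I \<times> ?I)) T" "(s, x) \<in> T" "liftable n X h T" by blast
      then obtain e where e: "e > 0" "ball (s, x) e \<inter> (?I \<times> ?I) \<subseteq> T"
        unfolding openin_contains_ball by blast
      \<comment> \<open>The distance is at most the sum of the coordinate distances, each of which
        is at most \<open>e/3\<close>.\<close>
      have "?B (s - e/3) (s + e/3) a b \<subseteq> T" if "a \<le> x" "x \<le> b" "b - a < e/3" for a b
      proof
        fix z assume z: "z \<in> ?B (s - e/3) (s + e/3) a b"
        have "dist (s, x) z \<le> dist s (fst z) + dist x (snd z)"
          by (metis dist_Pair_Pair prod.collapse real_sqrt_sum_squares_triangle_ineq
              sqrt_sum_squares_le_sum zero_le_dist)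
        also have "\<dots> < e" using z that e(1) by (auto simp: dist_real_def abs_if)
        finally show "z \<in> T" using z e(2) by auto
      qed
      then show "\<exists>d>0. \<forall>a b. a \<le> x \<and> x \<le> b \<and> b - a < d \<longrightarrow> P a b"
        unfolding P_def using e(1) liftable_subset[OF T(3)]
        by (intro exI[of _ "e/3"] conjI allI impI) auto
    qed simp
    then show ?thesis by (simp add: P_def)
  qed
  define P where "P a b \<longleftrightarrow> liftable n X h (?B a b 0 1)" for a b
  have "P 0 1"
  proof (rule Bolzano)
    fix s :: real assume "0 \<le> s" "s \<le> 1"
    with strip[of s] obtain \<delta> where d: "\<delta> > 0" "liftable n X h (?B (s - \<delta>) (s + \<delta>) 0 1)" by auto
    then show "\<exists>d>0. \<forall>a b. a \<le> s \<and> s \<le> b \<and> b - a < d \<longrightarrow> P a b"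
      unfolding P_def by (intro exI[of _ \<delta>]) (auto intro!: liftable_subset[OF d(2)])
  next
    fix a b c assume "P a b" "P b c"
    then show "P a c" unfolding P_def by (rule glue_fst)
  qed simp
  then show ?thesis by (simp add: P_def)
qed

lemma square_lift:
  assumes X: "Hausdorff_space X"
    and h: "continuous_map (top_of_set ({0..1} \<times> {0..1})) (unordered_configuration_space n X) h"
    and x: "x \<in> topspace (configuration_space n X)" "h (0, 0) = orbit_of n X x"
  obtains k where "continuous_map (top_of_set ({0..1} \<times> {0..1 :: real})) (configuration_space n X) k"
    "k (0 :: real, 0) = x" "\<And>s t. s \<in> {0..1} \<Longrightarrow> t \<in> {0..1} \<Longrightarrow> orbit_of n X (k (s, t)) = h (s, t)"
proof -
  obtain k where k: "continuous_map (top_of_set ({0..1} \<times> {0..1 :: real})) (configuration_space n X) k"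
    "\<And>z. z \<in> {0..1} \<times> {0..1} \<Longrightarrow> orbit_of n X (k z) = h z"
    using liftable_square[OF X h] unfolding liftable_def by auto
  have z: "(0 :: real, 0 :: real) \<in> topspace (top_of_set ({0..1} \<times> {0..1}))" by simp
  obtain k' where "continuous_map (top_of_set ({0..1} \<times> {0..1 :: real})) (configuration_space n X) k'"
    "k' (0, 0) = x" "\<And>z. z \<in> topspace (top_of_set ({0..1} \<times> {0..1})) \<Longrightarrow> orbit_of n X (k' z) = orbit_of n X (k z)"
    by (rule lift_adjust[OF k(1) z x(1)]) (use k(2)[of "(0, 0)"] x(2) in auto)
  with k(2) show thesis by (intro that[of k']) auto
qed

text \<open>The path is regarded as a square that is constant in its first parameter.\<close>

lemma path_lift:
  assumes X: "Hausdorff_space X" and p: "pathin (unordered_configuration_space n X) p"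
    and x: "x \<in> topspace (configuration_space n X)" "p 0 = orbit_of n X x"
  obtains q where "pathin (configuration_space n X) q" "q 0 = x"
    "\<And>t. t \<in> {0..1} \<Longrightarrow> orbit_of n X (q t) = p t"
proof -
  have "continuous_map (top_of_set ({0..1} \<times> {0..1 :: real})) (unordered_configuration_space n X) (\<lambda>z. p (snd z))"
    using p unfolding pathin_def by (rule continuous_map_compose_on) (auto intro!: continuous_intros)
  then obtain k where k: "continuous_map (top_of_set ({0..1} \<times> {0..1 :: real})) (configuration_space n X) k"
    "k (0 :: real, 0) = x" "\<And>s t. s \<in> {0..1} \<Longrightarrow> t \<in> {0..1} \<Longrightarrow> orbit_of n X (k (s, t)) = p t"
    using square_lift[OF X _ x(1), of "\<lambda>z. p (snd z)"] x(2) by auto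
  have "pathin (configuration_space n X) (\<lambda>t. k (0, t))"
    unfolding pathin_def by (rule continuous_map_compose_on[OF k(1)]) (auto intro!: continuous_intros)
  with k show thesis by (intro that[of "\<lambda>t. k (0, t)"]) auto
qed

lemma path_lift_unique:
  assumes X: "Hausdorff_space X"
    and q: "pathin (configuration_space n X) q" "pathin (configuration_space n X) r" "q 0 = r 0"
    and eq: "\<And>t. t \<in> {0..1} \<Longrightarrow> orbit_of n X (q t) = orbit_of n X (r t)" and t: "t \<in> {0..1}"
  shows "q t = r t"
proof (rule lift_unique[OF X, of "top_of_set {0..1}" _ q r 0])
  show "connected_space (top_of_set {0..1::real})" by (simp add: connected_space_subtopology)
qed (use assms in \<open>auto simp: pathin_def\<close>)

text \<open>The homotopy is lifted as a square. On the two sides where it keeps the ends fixed, the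
  lift projects to a constant path and is therefore constant by unique lifting.\<close>

lemma homotopic_lifts_end:
  assumes X: "Hausdorff_space X"
    and q: "pathin (configuration_space n X) q" "pathin (configuration_space n X) r" "q 0 = r 0"
    and hom: "path_homotopic (unordered_configuration_space n X) (\<lambda>t. orbit_of n X (q t)) (\<lambda>t. orbit_of n X (r t))"
  shows "q 1 = r 1"
proof -
  let ?F = "configuration_space n X"
  obtain h :: "real \<times> real \<Rightarrow> (nat \<Rightarrow> 'a) set" where
    h: "continuous_map (top_of_set ({0..1} \<times> {0..1})) (unordered_configuration_space n X) h"
    "\<And>x. h (0, x) = orbit_of n X (q x)" "\<And>x. h (1, x) = orbit_of n X (r x)"
    "\<And>t. t \<in> {0..1} \<Longrightarrow> h (t, 0) = orbit_of n X (q 0)" "\<And>t. t \<in> {0..1} \<Longrightarrow> h (t, 1) = orbit_of n X (q 1)"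
    by (rule path_homotopicE[OF hom]) (rule that)
  have top: "q t \<in> topspace ?F" if "t \<in> {0..1}" for t
    using q(1) that by (auto simp: pathin_def continuous_map_def Pi_iff)
  obtain k where k: "continuous_map (top_of_set ({0..1} \<times> {0..1 :: real})) ?F k"
    "k (0 :: real, 0) = q 0" "\<And>s t. s \<in> {0..1} \<Longrightarrow> t \<in> {0..1} \<Longrightarrow> orbit_of n X (k (s, t)) = h (s, t)"
    using square_lift[OF X h(1) top[of 0]] h(2) by auto
  have paths: "pathin ?F (\<lambda>t. k (a, t))" "pathin ?F (\<lambda>t. k (t, a))" if "a \<in> {0..1}" for a
    unfolding pathin_def by (rule continuous_map_compose_on[OF k(1)], use that in \<open>auto intro!: continuous_intros\<close>)+
  have const: "pathin ?F (\<lambda>_. q t)" if "t \<in> {0..1}" for t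
    using top[OF that] by (simp add: pathin_def)
  have 0: "k (s, 0) = q 0" if "s \<in> {0..1}" for s
    by (rule path_lift_unique[OF X paths(2)[of 0] const[of 0] _ _ that]) (use k h in auto)
  have 1: "k (0, 1) = q 1"
    by (rule path_lift_unique[OF X paths(1)[of 0] q(1)]) (use k h in auto)
  have "k (1, 1) = q 1"
    by (rule path_lift_unique[OF X paths(2)[of 1] const[of 1]]) (use k(3) h(5) 1 in auto)
  moreover have "k (1, 1) = r 1"
    by (rule path_lift_unique[OF X paths(1)[of 1] q(2)]) (use k(3) h(3) 0[of 1] q(3) in auto)
  ultimately show ?thesis by simp
qed

theorem monodromy:
  assumes X: "Hausdorff_space X" and conn: "path_connected_space (configuration_space n X)"
    and b: "b \<in> topspace (unordered_configuration_space n X)"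
  obtains \<mu> where "\<And>A. A \<in> carrier (braid_group n X b) \<Longrightarrow> \<mu> A permutes {..<n}"
    "\<And>A B. A \<in> carrier (braid_group n X b) \<Longrightarrow> B \<in> carrier (braid_group n X b) \<Longrightarrow>
       \<mu> (A \<otimes>\<^bsub>braid_group n X b\<^esub> B) = \<mu> A \<circ> \<mu> B"
    "\<And>s. s permutes {..<n} \<Longrightarrow> \<exists>A\<in>carrier (braid_group n X b). \<mu> A = s"
proof -
  let ?F = "configuration_space n X" and ?U = "unordered_configuration_space n X"
  obtain x where x: "x \<in> topspace ?F" "b = orbit_of n X x"
    using b by (auto simp: topspace_unordered_configuration_space)
  \<comment> \<open>Lifts are made to end at \<open>x\<close>, not to start there. The lift of a
    first loop, relabelled by the permutation of the second one, then continues to the lift of the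
    second, and the permutations compose in the order of the loops: a homomorphism, not an
    antihomomorphism.\<close>
  define R where "R p s \<longleftrightarrow> s permutes {..<n} \<and> (\<exists>q. pathin ?F q \<and> q 0 = x \<circ> s \<and> q 1 = x \<and>
      (\<forall>t\<in>{0..1}. orbit_of n X (q t) = p t))" for p s
  have R_E: "\<exists>q. pathin ?F q \<and> q 0 = x \<circ> s \<and> q 1 = x \<and> (\<forall>t. t \<in> {0..1} \<longrightarrow> orbit_of n X (q t) = p t) \<and>
      s permutes {..<n}" if "R p s" for p s
    using that unfolding R_def by blast
  have R_ex: "\<exists>s. R p s" if p: "p \<in> loops ?U b" for p
  proof -
    have p': "pathin ?U (\<lambda>t. p (1 - t))" using p by (auto simp: loops_def pathin_reverse)
    obtain q where q: "pathin ?F q" "q 0 = x" "\<And>t. t \<in> {0..1} \<Longrightarrow> orbit_of n X (q t) = p (1 - t)"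
      using path_lift[OF X p' x(1)] p x(2) by (auto simp: loops_def)
    have "q 1 \<in> topspace ?F" using q(1) by (auto simp: pathin_def continuous_map_def Pi_iff)
    moreover have "orbit_of n X x = orbit_of n X (q 1)" using q(3)[of 1] p x by (auto simp: loops_def)
    ultimately obtain s where s: "s permutes {..<n}" "q 1 = x \<circ> s"
      using orbit_of_eq_iff[OF x(1)] by auto
    have "pathin ?F (\<lambda>t. q (1 - t))" using q(1) by (rule pathin_reverse)
    then show ?thesis unfolding R_def using q s by (intro exI[of _ s]) (auto intro!: exI[of _ "\<lambda>t. q (1 - t)"])
  qed
  have x_free: "s = s'" if "x \<circ> s = x \<circ> s'" "s permutes {..<n}" "s' permutes {..<n}" for s s'
  proof
    fix i
    show "s i = s' i"
    proof (cases "i < n")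
      case True
      moreover have "inj_on x {..<n}" using x by (simp add: topspace_configuration_space)
      moreover have "s i < n" "s' i < n" using True that permutes_in_image by fastforce+
      ultimately show ?thesis using fun_cong[OF that(1), of i] by (simp add: inj_on_eq_iff)
    next
      case False
      then show ?thesis using that by (simp add: permutes_not_in)
    qed
  qed
  have R_unique: "s = s'" if RR: "R p s" "R p' s'" and hom: "path_homotopic ?U p p'" for p p' s s'
  proof -
    obtain q where q: "pathin ?F q" "q 0 = x \<circ> s" "q 1 = x" "\<And>t. t \<in> {0..1} \<Longrightarrow> orbit_of n X (q t) = p t" "s permutes {..<n}"
      using R_E[OF RR(1)] by metis
    obtain q' where q': "pathin ?F q'" "q' 0 = x \<circ> s'" "q' 1 = x" "\<And>t. t \<in> {0..1} \<Longrightarrow> orbit_of n X (q' t) = p' t" "s' permutes {..<n}"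
      using R_E[OF RR(2)] by metis
    have r: "pathin ?F (\<lambda>t. q (1 - t))" "pathin ?F (\<lambda>t. q' (1 - t))"
      using q(1) q'(1) by (auto intro: pathin_reverse)
    obtain h :: "real \<times> real \<Rightarrow> (nat \<Rightarrow> 'a) set" where
      h: "continuous_map (top_of_set ({0..1} \<times> {0..1})) ?U h"
      "\<And>x. h (0, x) = p x" "\<And>x. h (1, x) = p' x"
      "\<And>t. t \<in> {0..1} \<Longrightarrow> h (t, 0) = p 0" "\<And>t. t \<in> {0..1} \<Longrightarrow> h (t, 1) = p 1"
      by (rule path_homotopicE[OF hom]) (rule that)
    have "path_homotopic ?U (\<lambda>t. orbit_of n X (q (1 - t))) (\<lambda>t. orbit_of n X (q' (1 - t)))"
    proof (rule path_homotopicI[of _ "\<lambda>z. h (fst z, 1 - snd z)"])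
      show "continuous_map (top_of_set ({0..1} \<times> {0..1 :: real})) ?U (\<lambda>z. h (fst z, 1 - snd z))"
        by (rule continuous_map_compose_on[OF h(1)]) (auto intro!: continuous_intros)
    qed (use h(2-) q(4) q'(4) q(4)[of 0] q(4)[of 1] in simp_all)
    from homotopic_lifts_end[OF X r _ this] q q' have "x \<circ> s = x \<circ> s'" by simp
    then show ?thesis using x_free q(5) q'(5) by blast
  qed
  have R_join: "R (loop_join p p') (s \<circ> s')" if RR: "R p s" "R p' s'" for p p' s s'
  proof -
    obtain q where q: "pathin ?F q" "q 0 = x \<circ> s" "q 1 = x" "\<And>t. t \<in> {0..1} \<Longrightarrow> orbit_of n X (q t) = p t" "s permutes {..<n}"
      using R_E[OF RR(1)] by metis
    obtain q' where q': "pathin ?F q'" "q' 0 = x \<circ> s'" "q' 1 = x" "\<And>t. t \<in> {0..1} \<Longrightarrow> orbit_of n X (q' t) = p' t" "s' permutes {..<n}"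
      using R_E[OF RR(2)] by metis
    let ?q = "loop_join (\<lambda>t. q t \<circ> s') q'"
    have qs: "pathin ?F (\<lambda>t. q t \<circ> s')"
      using continuous_map_compose[OF q(1)[unfolded pathin_def] continuous_map_permute[OF q'(5)]]
      by (simp add: pathin_def o_def)
    have top: "q t \<in> topspace ?F" if "t \<in> {0..1}" for t
      using q(1) that by (auto simp: pathin_def continuous_map_def Pi_iff)
    have "orbit_of n X (?q t) = loop_join p p' t" if t: "t \<in> {0..1}" for t
    proof (cases "t \<le> 1/2")
      case True
      then have "2 * t \<in> {0..1}" using t by auto
      from orbit_of_permute[OF top[OF this] q'(5)] q(4)[OF this] True show ?thesis
        by (simp add: loop_join_def)
    next
      case False
      then show ?thesis using q'(4)[of "2 * t - 1"] t by (simp add: loop_join_def)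
    qed
    moreover have "pathin ?F ?q" using qs q'(1) q q' by (intro pathin_loop_join) auto
    moreover have "s \<circ> s' permutes {..<n}" using q(5) q'(5) permutes_compose by blast
    ultimately show ?thesis unfolding R_def using q q' by (auto intro!: exI[of _ ?q] simp: comp_assoc)
  qed
  have R_onto: "\<exists>p\<in>loops ?U b. R p s" if s: "s permutes {..<n}" for s
  proof -
    have xs: "x \<circ> s \<in> topspace ?F" using configuration_permute[OF x(1) s] .
    obtain q where q: "pathin ?F q" "q 0 = x \<circ> s" "q 1 = x"
      using conn x(1) xs unfolding path_connected_space_def by blast
    have "pathin ?U (\<lambda>t. orbit_of n X (q t))"
      using continuous_map_compose[OF q(1)[unfolded pathin_def] continuous_map_orbit_of] by (simp add: pathin_def o_def)
    then have "(\<lambda>t. orbit_of n X (q t)) \<in> loops ?U b"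
      using q x s by (simp add: loops_def orbit_of_permute)
    then show ?thesis using q s by (intro bexI[of _ "\<lambda>t. orbit_of n X (q t)"]) (auto simp: R_def)
  qed
  define \<mu> where "\<mu> A = (THE s. \<forall>p\<in>A. R p s)" for A
  have \<mu>: "\<mu> (loop_class ?U b p) = s" if p: "p \<in> loops ?U b" and s: "R p s" for p s
    unfolding \<mu>_def
  proof (rule the_equality)
    show "\<forall>p'\<in>loop_class ?U b p. R p' s"
    proof
      fix p' assume "p' \<in> loop_class ?U b p"
      then have h: "path_homotopic ?U p p'" by (auto simp: loop_class_def loop_homotopy_iff)
      then have "p' \<in> loops ?U b" using p path_homotopic_ends[OF h] path_homotopic_pathin[OF h] by (simp add: loops_def)
      then obtain s' where "R p' s'" using R_ex by blast
      with R_unique[OF s this h] show "R p' s" by simp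
    qed
    fix s' assume "\<forall>p'\<in>loop_class ?U b p. R p' s'"
    moreover have "p \<in> loop_class ?U b p"
      using p by (auto simp: loop_class_def loop_homotopy_iff loops_def path_homotopic_refl)
    ultimately have "R p s'" by blast
    then show "s' = s" using R_unique[OF _ s] p by (auto simp: loops_def path_homotopic_refl)
  qed
  show thesis
  proof (rule that[of \<mu>])
    show "\<mu> A permutes {..<n}" if "A \<in> carrier (braid_group n X b)" for A
    proof -
      from that obtain p where p: "p \<in> loops ?U b" "A = loop_class ?U b p"
        by (auto simp: braid_group_def carrier_fundamental_group)
      with R_ex obtain s where "R p s" by blast
      with \<mu> p show ?thesis by (simp add: R_def)
    qed
    show "\<mu> (A \<otimes>\<^bsub>braid_group n X b\<^esub> B) = \<mu> A \<circ> \<mu> B"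
      if "A \<in> carrier (braid_group n X b)" "B \<in> carrier (braid_group n X b)" for A B
    proof -
      from that obtain p q where p: "p \<in> loops ?U b" "A = loop_class ?U b p"
        and q: "q \<in> loops ?U b" "B = loop_class ?U b q"
        by (auto simp: braid_group_def carrier_fundamental_group)
      obtain s s' where s: "R p s" "R q s'" using R_ex p q by blast
      then show ?thesis
        unfolding p q braid_group_def mult_fundamental_group[OF p(1) q(1)]
        using \<mu>[OF p(1) s(1)] \<mu>[OF q(1) s(2)] \<mu>[OF loop_join_loops[OF p(1) q(1)] R_join[OF s]] by simp
    qed
    show "\<exists>A\<in>carrier (braid_group n X b). \<mu> A = s" if "s permutes {..<n}" for s
      using R_onto[OF that] \<mu> by (auto simp: braid_group_def carrier_fundamental_group)
  qed
qed

section \<open>Generating the image of a representation by local data\<close>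

lemma pathin_top: "pathin Y p \<Longrightarrow> t \<in> {0..1} \<Longrightarrow> p t \<in> topspace Y"
  by (auto simp: pathin_def continuous_map_def Pi_iff)

lemma loop_join_image:
  "p ` {0..1} \<subseteq> W \<Longrightarrow> q ` {0..1} \<subseteq> W \<Longrightarrow> loop_join p q ` {0..1} \<subseteq> W"
  by (auto simp: loop_join_def)

lemma reverse_image:
  assumes "p ` {0..1} \<subseteq> W"
  shows "(\<lambda>t::real. p (1 - t)) ` {0..1} \<subseteq> W"
  using assms by auto

lemma pathin_continuous_map: "pathin Y p \<Longrightarrow> continuous_map Y Z f \<Longrightarrow> pathin Z (\<lambda>t. f (p t))"
  unfolding pathin_def using continuous_map_compose[of _ Y p Z f] by (simp add: o_def)

context path_rep
begin

text \<open>Short paths are controlled only between good ends, while the pieces of a subdivided path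
  may end anywhere. Each point therefore gets an access path \<alpha> to a good point, with value
  \<open>c\<close>. The value of a piece, corrected by \<open>c\<close> at both ends, lies in
  \<open>H\<close> for short pieces and is multiplicative in the pieces, so bisection applies to
  it.\<close>

lemma rep_generated:
  assumes H: "subgroup H G"
    and W: "\<And>y. y \<in> topspace Y \<Longrightarrow> \<exists>W. openin Y W \<and> y \<in> W \<and>
      (\<forall>p. pathin Y p \<longrightarrow> p ` {0..1} \<subseteq> W \<longrightarrow> p 0 \<in> Good \<longrightarrow> p 1 \<in> Good \<longrightarrow> \<Psi> p \<in> H)"
    and access: "\<And>y V. openin Y V \<Longrightarrow> y \<in> V \<Longrightarrow>
      \<exists>p. pathin Y p \<and> p ` {0..1} \<subseteq> V \<and> p 0 = y \<and> p 1 \<in> Good"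
    and p: "pathin Y p" "p 0 \<in> Good" "p 1 \<in> Good"
  shows "\<Psi> p \<in> H"
proof -
  interpret H: subgroup H G by (rule H)
  have "\<forall>y\<in>topspace Y. \<exists>W. openin Y W \<and> y \<in> W \<and>
      (\<forall>p. pathin Y p \<longrightarrow> p ` {0..1} \<subseteq> W \<longrightarrow> p 0 \<in> Good \<longrightarrow> p 1 \<in> Good \<longrightarrow> \<Psi> p \<in> H)"
    using W by blast
  then obtain W where W: "\<And>y. y \<in> topspace Y \<Longrightarrow> openin Y (W y)" "\<And>y. y \<in> topspace Y \<Longrightarrow> y \<in> W y"
    "\<And>y p. y \<in> topspace Y \<Longrightarrow> pathin Y p \<Longrightarrow> p ` {0..1} \<subseteq> W y \<Longrightarrow> p 0 \<in> Good \<Longrightarrow> p 1 \<in> Good \<Longrightarrow> \<Psi> p \<in> H"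
    unfolding bchoice_iff by blast
  have "\<forall>y\<in>topspace Y. \<exists>p. pathin Y p \<and> p ` {0..1} \<subseteq> W y \<and> p 0 = y \<and> p 1 \<in> Good"
    using access W(1,2) by blast
  then obtain \<alpha> where \<alpha>: "\<And>y. y \<in> topspace Y \<Longrightarrow> pathin Y (\<alpha> y)" "\<And>y. y \<in> topspace Y \<Longrightarrow> \<alpha> y ` {0..1} \<subseteq> W y"
    "\<And>y. y \<in> topspace Y \<Longrightarrow> \<alpha> y 0 = y" "\<And>y. y \<in> topspace Y \<Longrightarrow> \<alpha> y 1 \<in> Good"
    unfolding bchoice_iff by blast
  define c where "c y = \<Psi> (\<alpha> y)" for y
  have c: "c y \<in> carrier G" if "y \<in> topspace Y" for y
    using \<alpha>(1)[OF that] by (simp add: c_def closed)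
  \<comment> \<open>The chosen access path may be replaced by any path \<open>e\<close> from
    \<open>y\<close> to a good point inside \<open>W y\<close>: back along one and out along the
    other is a short path between good ends.\<close>
  have c_rel: "inv (c y) \<otimes> \<Psi> e \<in> H"
    if "y \<in> topspace Y" "pathin Y e" "e ` {0..1} \<subseteq> W y" "e 0 = y" "e 1 \<in> Good" for y e
  proof -
    let ?r = "loop_join (\<lambda>t. \<alpha> y (1 - t)) e"
    have r: "pathin Y (\<lambda>t. \<alpha> y (1 - t))" using \<alpha>(1)[OF that(1)] by (rule pathin_reverse)
    have "\<Psi> ?r = inv (c y) \<otimes> \<Psi> e"
      using join[OF r that(2)] rep_reverse[OF \<alpha>(1)[OF that(1)]] \<alpha>(3)[OF that(1)] that(4) by (simp add: c_def)
    moreover have "\<Psi> ?r \<in> H"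
    proof (rule W(3)[OF that(1)])
      show "pathin Y ?r" using r that(2,4) \<alpha>(3)[OF that(1)] by (intro pathin_loop_join) auto
      show "?r ` {0..1} \<subseteq> W y"
        by (intro loop_join_image reverse_image \<alpha>(2)[OF that(1)] that(3))
    qed (use \<alpha>(4)[OF that(1)] that(5) in auto)
    ultimately show ?thesis by simp
  qed
  define P where "P a b \<longleftrightarrow> (0 \<le> a \<longrightarrow> b \<le> 1 \<longrightarrow> inv (c (p a)) \<otimes> \<Psi> (subpath_on a b p) \<otimes> c (p b) \<in> H)" for a b
  have "P 0 1"
  proof (rule Bolzano)
    fix a b d :: real assume ab: "P a b" "P b d" "a \<le> b" "b \<le> d"
    show "P a d"
      unfolding P_def
    proof (intro impI)
      assume ad: "0 \<le> a" "d \<le> 1"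
      let ?S = "\<Psi> (subpath_on a b p)" and ?T = "\<Psi> (subpath_on b d p)"
      have cl: "?S \<in> carrier G" "?T \<in> carrier G"
        using ab ad by (auto intro!: closed pathin_subpath_on p(1))
      have cc: "c (p a) \<in> carrier G" "c (p b) \<in> carrier G" "c (p d) \<in> carrier G"
        using ab ad by (auto intro!: c pathin_top[OF p(1)])
      have "(inv (c (p a)) \<otimes> ?S \<otimes> c (p b)) \<otimes> (inv (c (p b)) \<otimes> ?T \<otimes> c (p d)) \<in> H"
      proof (rule H.m_closed)
        show "inv (c (p a)) \<otimes> ?S \<otimes> c (p b) \<in> H" using ab ad by (simp add: P_def)
        show "inv (c (p b)) \<otimes> ?T \<otimes> c (p d) \<in> H" using ab ad by (simp add: P_def)
      qed
      moreover have "(inv (c (p a)) \<otimes> ?S \<otimes> c (p b)) \<otimes> (inv (c (p b)) \<otimes> ?T \<otimes> c (p d)) =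
          inv (c (p a)) \<otimes> (?S \<otimes> ?T) \<otimes> c (p d)"
        using cl cc by (simp add: m_assoc, simp add: m_assoc[symmetric])
      moreover have "?S \<otimes> ?T = \<Psi> (subpath_on a d p)"
        using ab ad by (intro rep_subpath_on p(1))
      ultimately show "inv (c (p a)) \<otimes> \<Psi> (subpath_on a d p) \<otimes> c (p d) \<in> H" by simp
    qed
  next
    fix t :: real assume t: "0 \<le> t" "t \<le> 1"
    then have y: "p t \<in> topspace Y" using pathin_top[OF p(1)] by auto
    have "openin (top_of_set {0..1}) {s \<in> topspace (top_of_set {0..1}). p s \<in> W (p t)}"
      using p(1) unfolding pathin_def by (rule openin_continuous_map_preimage) (rule W(1)[OF y])
    moreover have "t \<in> {s \<in> topspace (top_of_set {0..1}). p s \<in> W (p t)}" using t W(2)[OF y] by auto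
    ultimately obtain e where e: "e > 0" "\<And>s. s \<in> {0..1} \<Longrightarrow> \<bar>s - t\<bar> < e \<Longrightarrow> p s \<in> W (p t)"
      unfolding openin_euclidean_subtopology_iff dist_real_def by (auto simp: subset_iff)
    show "\<exists>e>0. \<forall>a b. a \<le> t \<and> t \<le> b \<and> b - a < e \<longrightarrow> P a b"
    proof (intro exI[of _ e] conjI allI impI e(1))
      fix a b assume ab: "a \<le> t \<and> t \<le> b \<and> b - a < e"
      show "P a b"
        unfolding P_def
      proof (intro impI)
        assume 01: "0 \<le> a" "b \<le> 1"
        have sub: "subpath_on a b p ` {0..1} \<subseteq> W (p t)"
          using ab 01 by (auto intro!: subpath_on_mem e(2))
        have pa: "p a \<in> topspace Y" "p b \<in> topspace Y" using ab 01 by (auto intro!: pathin_top[OF p(1)])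
        have pW: "p a \<in> W (p t)" "p b \<in> W (p t)" using ab 01 by (auto intro!: e(2))
        \<comment> \<open>Access paths at the ends of the piece are taken inside two neighbourhoods
          at once: \<open>W (p t)\<close> controls the piece extended by them, while
          \<open>W (p a)\<close> and \<open>W (p b)\<close> allow the comparison with the chosen
          access paths.\<close>
        have "\<exists>e. pathin Y e \<and> e ` {0..1} \<subseteq> W (p t) \<inter> W z \<and> e 0 = z \<and> e 1 \<in> Good"
          if "z \<in> topspace Y" "z \<in> W (p t)" for z
          using that W(1,2) y by (intro access openin_Int) auto
        from this[OF pa(1) pW(1)] this[OF pa(2) pW(2)] obtain e1 e2 where
          e1: "pathin Y e1" "e1 ` {0..1} \<subseteq> W (p t)" "e1 ` {0..1} \<subseteq> W (p a)" "e1 0 = p a" "e1 1 \<in> Good"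
          and e2: "pathin Y e2" "e2 ` {0..1} \<subseteq> W (p t)" "e2 ` {0..1} \<subseteq> W (p b)" "e2 0 = p b" "e2 1 \<in> Good"
          by auto
        have s: "pathin Y (subpath_on a b p)" using ab 01 by (intro pathin_subpath_on p(1)) auto
        have r1: "pathin Y (\<lambda>t. e1 (1 - t))" using e1(1) by (rule pathin_reverse)
        let ?q = "loop_join (\<lambda>t. e1 (1 - t)) (loop_join (subpath_on a b p) e2)"
        have j: "pathin Y (loop_join (subpath_on a b p) e2)"
          using s e2 by (intro pathin_loop_join) auto
        have "\<Psi> ?q \<in> H"
        proof (rule W(3)[OF y])
          show "pathin Y ?q" by (rule pathin_loop_join[OF r1 j]) (use e1 in simp)
          show "?q ` {0..1} \<subseteq> W (p t)" by (intro loop_join_image reverse_image e1 e2 sub)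
        qed (use e1 e2 in auto)
        moreover have "\<Psi> ?q = inv (\<Psi> e1) \<otimes> (\<Psi> (subpath_on a b p) \<otimes> \<Psi> e2)"
          using join[OF r1 j] join[OF s e2(1)] rep_reverse[OF e1(1)] e1(4) e2(4) by simp
        ultimately have 1: "inv (\<Psi> e1) \<otimes> (\<Psi> (subpath_on a b p) \<otimes> \<Psi> e2) \<in> H" by simp
        have 2: "inv (c (p a)) \<otimes> \<Psi> e1 \<in> H" using c_rel[OF pa(1) e1(1,3,4,5)] .
        have 3: "inv (c (p b)) \<otimes> \<Psi> e2 \<in> H" using c_rel[OF pa(2) e2(1,3,4,5)] .
        have cl: "\<Psi> e1 \<in> carrier G" "\<Psi> e2 \<in> carrier G" "\<Psi> (subpath_on a b p) \<in> carrier G"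
          "c (p a) \<in> carrier G" "c (p b) \<in> carrier G"
          using e1(1) e2(1) s pa by (auto intro: closed c)
        have "(inv (c (p a)) \<otimes> \<Psi> e1) \<otimes> (inv (\<Psi> e1) \<otimes> (\<Psi> (subpath_on a b p) \<otimes> \<Psi> e2)) \<otimes>
            inv (inv (c (p b)) \<otimes> \<Psi> e2) \<in> H"
          by (rule H.m_closed[OF H.m_closed[OF 2 1] H.m_inv_closed[OF 3]])
        also have "(inv (c (p a)) \<otimes> \<Psi> e1) \<otimes> (inv (\<Psi> e1) \<otimes> (\<Psi> (subpath_on a b p) \<otimes> \<Psi> e2)) \<otimes>
            inv (inv (c (p b)) \<otimes> \<Psi> e2) = inv (c (p a)) \<otimes> \<Psi> (subpath_on a b p) \<otimes> c (p b)"
          using cl by (simp add: m_assoc inv_mult_group, simp add: m_assoc[symmetric])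
        finally show "inv (c (p a)) \<otimes> \<Psi> (subpath_on a b p) \<otimes> c (p b) \<in> H" .
      qed
    qed
  qed simp
  then have main: "inv (c (p 0)) \<otimes> \<Psi> p \<otimes> c (p 1) \<in> H" by (simp add: P_def)
  have top: "p 0 \<in> topspace Y" "p 1 \<in> topspace Y" using pathin_top[OF p(1)] by auto
  \<comment> \<open>Both ends of \<open>p\<close> are good, so the access paths chosen there are
    themselves short paths between good points.\<close>
  have cH: "c (p 0) \<in> H" "c (p 1) \<in> H"
    using W(3)[OF top(1) \<alpha>(1,2)[OF top(1)]] W(3)[OF top(2) \<alpha>(1,2)[OF top(2)]] p(2,3)
      \<alpha>(3,4)[OF top(1)] \<alpha>(3,4)[OF top(2)] by (simp_all add: c_def)
  have "c (p 0) \<otimes> (inv (c (p 0)) \<otimes> \<Psi> p \<otimes> c (p 1)) \<otimes> inv (c (p 1)) \<in> H"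
    by (rule H.m_closed[OF H.m_closed[OF cH(1) main] H.m_inv_closed[OF cH(2)]])
  also have "c (p 0) \<otimes> (inv (c (p 0)) \<otimes> \<Psi> p \<otimes> c (p 1)) \<otimes> inv (c (p 1)) = \<Psi> p"
    using c[OF top(1)] c[OF top(2)] closed[OF p(1)] by (simp add: m_assoc, simp add: m_assoc[symmetric])
  finally show ?thesis .
qed

end


section \<open>Configurations in the plane\<close>

lemma continuous_map_into_plane_configuration:
  fixes f :: "'b::topological_space \<Rightarrow> nat \<Rightarrow> complex"
  shows "continuous_map (top_of_set A) (configuration_space n (top_of_set S)) f \<longleftrightarrow>
     (\<forall>i<n. continuous_on A (\<lambda>z. f z i)) \<and> (\<forall>z\<in>A. f z \<in> topspace (configuration_space n (top_of_set S)))"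
  unfolding continuous_map_into_configuration_space
  by (auto simp: topspace_configuration_space PiE_iff Pi_iff)

lemma plane_configuration_iff:
  "x \<in> topspace (configuration_space n (top_of_set S)) \<longleftrightarrow>
     x \<in> extensional {..<n} \<and> (\<forall>i<n. x i \<in> S) \<and> inj_on x {..<n}"
  by (auto simp: topspace_configuration_space PiE_iff)

text \<open>One point moves at a time, in the complement of finitely many others, which stays
  connected in an open connected set of the plane. Exchanging coordinates one by one for those of
  the target could cause collisions if the configurations share points; so both are joined to a
  third one that avoids them.\<close>

lemma path_connected_space_plane_configurations:
  fixes S :: "complex set"
  assumes S: "open S" "connected S"
  shows "path_connected_space (configuration_space n (top_of_set S))"
proof -
  let ?F = "configuration_space n (top_of_set S)"
  define J where "J x y \<longleftrightarrow> (\<exists>p. pathin ?F p \<and> p 0 = x \<and> p 1 = y)" for x y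
  have J_trans: "J x z" if J: "J x y" "J y z" for x y z
  proof -
    obtain p q where p: "pathin ?F p" "p 0 = x" "p 1 = y" and q: "pathin ?F q" "q 0 = y" "q 1 = z"
      using J unfolding J_def by blast
    have "pathin ?F (loop_join p q)" using p q by (intro pathin_loop_join) auto
    then show ?thesis unfolding J_def using p q by (intro exI[of _ "loop_join p q"]) simp
  qed
  have J_sym: "J y x" if xy: "J x y" for x y
  proof -
    obtain p where p: "pathin ?F p" "p 0 = x" "p 1 = y" using xy unfolding J_def by blast
    have "pathin ?F (\<lambda>t. p (1 - t))" using p(1) by (rule pathin_reverse)
    then show ?thesis unfolding J_def using p by (intro exI[of _ "\<lambda>t. p (1 - t)"]) simp
  qed
  have J_move: "J x (x(k := w))" if x: "x \<in> topspace ?F" and k: "k < n" and w: "w \<in> S - x ` ({..<n} - {k})" for x k w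
  proof -
    have "connected (S - x ` ({..<n} - {k}))"
      by (rule connected_open_delete_finite[OF S]) auto
    moreover have "open (S - x ` ({..<n} - {k}))"
      using S(1) by (intro open_Diff finite_imp_closed) auto
    ultimately have "path_connected (S - x ` ({..<n} - {k}))"
      by (simp add: connected_open_path_connected)
    moreover have "x k \<in> S - x ` ({..<n} - {k})"
      using x k by (auto simp: plane_configuration_iff inj_on_def)
    ultimately obtain g where g: "path g" "path_image g \<subseteq> S - x ` ({..<n} - {k})" "pathstart g = x k" "pathfinish g = w"
      using w unfolding path_connected_def by blast
    have gt: "g t \<in> S - x ` ({..<n} - {k})" if "t \<in> {0..1}" for t
      using g(2) that unfolding path_image_def by blast
    have gx: "g t \<noteq> x i" "x i \<noteq> g t" if "t \<in> {0..1}" "i < n" "i \<noteq> k" for t i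
      using gt[OF that(1)] that by force+
    have "x(k := g t) \<in> topspace ?F" if "t \<in> {0..1}" for t
      using gt[OF that] gx[OF that] x k by (auto simp: plane_configuration_iff extensional_def inj_on_def)
    moreover have "continuous_on {0..1} (\<lambda>t. (x(k := g t)) i)" for i
      using g(1) by (cases "i = k") (auto simp: path_def)
    ultimately have "pathin ?F (\<lambda>t. x(k := g t))"
      unfolding pathin_def continuous_map_into_plane_configuration by blast
    then show ?thesis
      unfolding J_def using g(3,4) by (intro exI[of _ "\<lambda>t. x(k := g t)"]) (auto simp: pathstart_def pathfinish_def)
  qed
  have J_avoid: "J x w" if x: "x \<in> topspace ?F" and w: "w \<in> topspace ?F" and d: "x ` {..<n} \<inter> w ` {..<n} = {}" for x w
  proof -
    define mix where "mix k = (\<lambda>i. if i < k then w i else x i)" for k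
    have mix: "mix k \<in> topspace ?F" if "k \<le> n" for k
    proof -
      have "mix k i \<noteq> mix k j" if "i < n" "j < n" "i \<noteq> j" for i j
      proof -
        have "x i \<noteq> w j" "w i \<noteq> x j" using that d by blast+
        moreover have "x i \<noteq> x j" "w i \<noteq> w j"
          using that x w by (auto simp: plane_configuration_iff inj_on_eq_iff)
        ultimately show ?thesis by (simp add: mix_def)
      qed
      then have "inj_on (mix k) {..<n}" by (intro inj_onI) blast
      moreover have "mix k \<in> extensional {..<n}" "\<forall>i<n. mix k i \<in> S"
        using that x w by (simp_all add: mix_def plane_configuration_iff extensional_def)
      ultimately show ?thesis by (simp add: plane_configuration_iff)
    qed
    have "k \<le> n \<Longrightarrow> J x (mix k)" for k
    proof (induction k)
      case 0
      have "pathin ?F (\<lambda>_. x)" using x by (simp add: pathin_def)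
      moreover have "mix 0 = x" by (simp add: mix_def)
      ultimately show ?case unfolding J_def by (intro exI[of _ "\<lambda>_. x"]) simp
    next
      case (Suc k)
      then have k: "k < n" by simp
      have "w k \<noteq> mix k i" if "i < n" "i \<noteq> k" for i
      proof -
        have "w k \<noteq> x i" using that k d by blast
        moreover have "w k \<noteq> w i" using that k w by (auto simp: plane_configuration_iff inj_on_eq_iff)
        ultimately show ?thesis by (simp add: mix_def)
      qed
      moreover have "w k \<in> S" using w k unfolding plane_configuration_iff by blast
      ultimately have wk: "w k \<in> S - mix k ` ({..<n} - {k})" by blast
      have "mix k \<in> topspace ?F" using mix k by simp
      from J_move[OF this k wk] have "J (mix k) ((mix k)(k := w k))" .
      moreover have "(mix k)(k := w k) = mix (Suc k)" by (auto simp: mix_def fun_eq_iff less_Suc_eq)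
      moreover have "J x (mix k)" using Suc by simp
      ultimately show ?case using J_trans by metis
    qed
    moreover have "mix n = w" using x w by (simp add: mix_def plane_configuration_iff fun_eq_iff extensional_def)
    ultimately show ?thesis using order_refl[of n] by metis
  qed
  have "J x y" if x: "x \<in> topspace ?F" and y: "y \<in> topspace ?F" for x y
  proof (cases "n = 0")
    case True
    then have "x = y" using x y by (auto simp: plane_configuration_iff)
    moreover have "pathin ?F (\<lambda>_. x)" using x by (simp add: pathin_def)
    ultimately show ?thesis unfolding J_def by (intro exI[of _ "\<lambda>_. x"]) simp
  next
    case False
    then have "S \<noteq> {}" using x by (auto simp: plane_configuration_iff)
    then have "infinite S" using S(1) finite_imp_not_open by blast
    then have "infinite (S - (x ` {..<n} \<union> y ` {..<n}))" by (simp add: Diff_infinite_finite)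
    from infinite_arbitrarily_large[OF this, of n] obtain T where
      T: "T \<subseteq> S - (x ` {..<n} \<union> y ` {..<n})" "finite T" "card T = n" by auto
    obtain f where f: "bij_betw f {..<n} T"
      using ex_bij_betw_nat_finite[OF T(2)] unfolding T(3) lessThan_atLeast0 by blast
    define w where "w = restrict f {..<n}"
    have wT: "w ` {..<n} = T" "inj_on w {..<n}"
      using f by (simp_all add: w_def bij_betw_def inj_on_def)
    then have "w \<in> topspace ?F"
      using T(1) unfolding plane_configuration_iff by (auto simp: w_def)
    moreover have "x ` {..<n} \<inter> w ` {..<n} = {}" "y ` {..<n} \<inter> w ` {..<n} = {}"
      unfolding wT(1) using T(1) by blast+
    ultimately have w: "w \<in> topspace ?F" "x ` {..<n} \<inter> w ` {..<n} = {}" "y ` {..<n} \<inter> w ` {..<n} = {}" .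
    show ?thesis using J_avoid[OF x w(1,2)] J_avoid[OF y w(1,3)] J_sym J_trans by blast
  qed
  then show ?thesis unfolding path_connected_space_def J_def by blast
qed

section \<open>Representations on configurations in the open disc\<close>

text \<open>Cells are convex, so that paths in a cell are determined up to homotopy by their ends once every
  pair of points is constrained.\<close>

definition cell :: "nat \<Rightarrow> (nat \<Rightarrow> nat \<Rightarrow> bool) \<Rightarrow> (nat \<Rightarrow> nat \<Rightarrow> bool) \<Rightarrow> (nat \<Rightarrow> complex) set" where
  "cell n R I = {x \<in> extensional {..<n}. (\<forall>i<n. x i \<in> ball 0 1) \<and>
     (\<forall>i<n. \<forall>j<n. R i j \<longrightarrow> Re (x i) < Re (x j)) \<and> (\<forall>i<n. \<forall>j<n. I i j \<longrightarrow> Im (x i) < Im (x j))}"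

definition covers :: "nat \<Rightarrow> (nat \<Rightarrow> nat \<Rightarrow> bool) \<Rightarrow> (nat \<Rightarrow> nat \<Rightarrow> bool) \<Rightarrow> bool" where
  "covers n R I \<longleftrightarrow> (\<forall>i<n. \<forall>j<n. i \<noteq> j \<longrightarrow> R i j \<or> R j i \<or> I i j \<or> I j i)"

definition seg :: "nat \<Rightarrow> (nat \<Rightarrow> complex) \<Rightarrow> (nat \<Rightarrow> complex) \<Rightarrow> real \<Rightarrow> nat \<Rightarrow> complex" where
  "seg n x y t = (\<lambda>i. if i < n then (1 - t) *\<^sub>R x i + t *\<^sub>R y i else undefined)"

abbreviation disc_configurations :: "nat \<Rightarrow> (nat \<Rightarrow> complex) topology" where
  "disc_configurations n \<equiv> configuration_space n (top_of_set (ball 0 1))"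

lemma cell_D:
  assumes "x \<in> cell n R I" "i < n" "j < n"
  shows "x i \<in> ball 0 1" "R i j \<Longrightarrow> Re (x i) < Re (x j)" "I i j \<Longrightarrow> Im (x i) < Im (x j)"
  using assms by (auto simp: cell_def)

lemma cell_configuration:
  assumes c: "covers n R I" and x: "x \<in> cell n R I"
  shows "x \<in> topspace (disc_configurations n)"
  unfolding plane_configuration_iff
proof (intro conjI)
  show "x \<in> extensional {..<n}" "\<forall>i<n. x i \<in> ball 0 1" using x by (simp_all add: cell_def)
  show "inj_on x {..<n}"
  proof (rule inj_onI, rule ccontr)
    fix i j assume ij: "i \<in> {..<n}" "j \<in> {..<n}" "x i = x j" "i \<noteq> j"
    then have "R i j \<or> R j i \<or> I i j \<or> I j i" using c by (simp add: covers_def)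
    then show False
      using cell_D(2,3)[OF x, of i j] cell_D(2,3)[OF x, of j i] ij by auto
  qed
qed

lemma strict_convex_comb:
  assumes "a < b" "c < d" "t \<in> {0..1::real}"
  shows "(1 - t) * a + t * c < (1 - t) * b + t * d"
proof (cases "t = 1")
  case False
  then have "(1 - t) * a < (1 - t) * b" "t * c \<le> t * d"
    using assms by (simp_all add: mult_left_mono)
  then show ?thesis by simp
qed (use assms in simp)

lemma seg_cell:
  assumes x: "x \<in> cell n R I" "y \<in> cell n R I" and t: "t \<in> {0..1}"
  shows "seg n x y t \<in> cell n R I"
  unfolding cell_def mem_Collect_eq
proof (intro conjI allI impI)
  show "seg n x y t \<in> extensional {..<n}" by (auto simp: seg_def extensional_def)
  fix i assume i: "i < n"
  have "(1 - t) *\<^sub>R x i + t *\<^sub>R y i \<in> ball 0 1"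
    using t cell_D(1)[OF x(1) i i] cell_D(1)[OF x(2) i i] by (intro convexD[OF convex_ball]) auto
  then show "seg n x y t i \<in> ball 0 1" using i by (simp add: seg_def)
  fix j assume j: "j < n"
  show "Re (seg n x y t i) < Re (seg n x y t j)" if "R i j"
    using strict_convex_comb[OF cell_D(2)[OF x(1) i j that] cell_D(2)[OF x(2) i j that] t] i j
    by (simp add: seg_def)
  show "Im (seg n x y t i) < Im (seg n x y t j)" if "I i j"
    using strict_convex_comb[OF cell_D(3)[OF x(1) i j that] cell_D(3)[OF x(2) i j that] t] i j
    by (simp add: seg_def)
qed

lemma seg_ends: "x \<in> extensional {..<n} \<Longrightarrow> seg n x y 0 = x" "y \<in> extensional {..<n} \<Longrightarrow> seg n x y 1 = y"
  by (auto simp: seg_def fun_eq_iff extensional_def)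

lemma cell_extensional: "x \<in> cell n R I \<Longrightarrow> x \<in> extensional {..<n}"
  by (simp add: cell_def)

lemma pathin_seg:
  assumes c: "covers n R I" and x: "x \<in> cell n R I" "y \<in> cell n R I"
  shows "pathin (disc_configurations n) (seg n x y)"
  unfolding pathin_def continuous_map_into_plane_configuration
proof (intro conjI allI impI ballI)
  show "continuous_on {0..1} (\<lambda>t. seg n x y t i)" if "i < n" for i
    using that by (simp add: seg_def, intro continuous_intros)
  show "seg n x y t \<in> topspace (disc_configurations n)" if "t \<in> {0..1}" for t
    using cell_configuration[OF c seg_cell[OF x that]] .
qed

lemma pathin_coord:
  fixes p :: "real \<Rightarrow> nat \<Rightarrow> complex"
  assumes "pathin (configuration_space n (top_of_set S)) p" "i < n"
  shows "continuous_on {0..1} (\<lambda>t. p t i)"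
  using assms unfolding pathin_def continuous_map_into_plane_configuration by blast

lemma path_homotopic_cell:
  assumes c: "covers n R I" and p: "pathin (disc_configurations n) p" "p ` {0..1} \<subseteq> cell n R I"
    and q: "pathin (disc_configurations n) q" "q ` {0..1} \<subseteq> cell n R I"
    and e: "p 0 = q 0" "p 1 = q 1"
  shows "path_homotopic (disc_configurations n) p q"
proof (rule path_homotopicI[of _ "\<lambda>z. seg n (p (snd z)) (q (snd z)) (fst z)"])
  let ?S = "{0..1} \<times> {0..1} :: (real \<times> real) set"
  have pc: "p t \<in> cell n R I" "q t \<in> cell n R I" if "t \<in> {0..1}" for t
    using p(2) q(2) that by blast+
  show "continuous_map (top_of_set ?S) (disc_configurations n) (\<lambda>z. seg n (p (snd z)) (q (snd z)) (fst z))"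
    unfolding continuous_map_into_plane_configuration
  proof (intro conjI allI impI ballI)
    fix i assume i: "i < n"
    have "continuous_on ?S (\<lambda>z. p (snd z) i)" "continuous_on ?S (\<lambda>z. q (snd z) i)"
      by (rule continuous_on_compose2[OF pathin_coord[OF p(1) i]], auto intro!: continuous_intros)
         (rule continuous_on_compose2[OF pathin_coord[OF q(1) i]], auto intro!: continuous_intros)
    then show "continuous_on ?S (\<lambda>z. seg n (p (snd z)) (q (snd z)) (fst z) i)"
      using i by (simp add: seg_def, intro continuous_intros)
  next
    fix z :: "real \<times> real" assume "z \<in> ?S"
    then have "fst z \<in> {0..1}" "snd z \<in> {0..1}" by auto
    then show "seg n (p (snd z)) (q (snd z)) (fst z) \<in> topspace (disc_configurations n)"
      using cell_configuration[OF c seg_cell[OF pc]] by blast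
  qed
  show "seg n (p (snd (0, t))) (q (snd (0, t))) (fst (0, t)) = p t" if "t \<in> {0..1}" for t
    using seg_ends(1)[OF cell_extensional[OF pc(1)[OF that]]] by simp
  show "seg n (p (snd (1, t))) (q (snd (1, t))) (fst (1, t)) = q t" if "t \<in> {0..1}" for t
    using seg_ends(2)[OF cell_extensional[OF pc(2)[OF that]]] by simp
  have "seg n x x t = x" if "x \<in> extensional {..<n}" for x t
    using that by (auto simp: seg_def fun_eq_iff extensional_def algebra_simps scaleR_left_diff_distrib)
  then show "seg n (p (snd (t, 0))) (q (snd (t, 0))) (fst (t, 0)) = p 0"
    "seg n (p (snd (t, 1))) (q (snd (t, 1))) (fst (t, 1)) = p 1" for t
    using cell_extensional[OF pc(1)[of 0]] cell_extensional[OF pc(1)[of 1]] e by simp_all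
qed

lemma seg_permute:
  assumes "s permutes {..<n}"
  shows "seg n (x \<circ> s) (y \<circ> s) t = seg n x y t \<circ> s"
proof
  fix i
  have "s i < n \<longleftrightarrow> i < n" using permutes_in_image[OF assms, of i] by simp
  then show "seg n (x \<circ> s) (y \<circ> s) t i = (seg n x y t \<circ> s) i" by (simp add: seg_def)
qed

lemma sorting_permutation:
  fixes r :: "nat \<Rightarrow> real"
  assumes "inj_on r {..<n}"
  obtains s where "s permutes {..<n}" "\<And>i j. i < j \<Longrightarrow> j < n \<Longrightarrow> r (s i) < r (s j)"
proof -
  define xs where "xs = sort_key r [0..<n]"
  have xs: "set xs = {..<n}" "distinct xs" "length xs = n"
    by (auto simp: xs_def)
  have "sorted (map r xs)" by (simp add: xs_def)
  moreover have "distinct (map r xs)" using xs assms by (simp add: distinct_map)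
  ultimately have st: "sorted_wrt (<) (map r xs)" by (simp add: strict_sorted_iff)
  define s where "s i = (if i < n then xs ! i else i)" for i
  have "bij_betw ((!) xs) {..<n} {..<n}" by (rule bij_betw_nth[OF xs(2)]) (simp_all only: xs)
  then have "bij_betw s {..<n} {..<n}" using bij_betw_cong[of "{..<n}" s "(!) xs" "{..<n}"] by (simp add: s_def)
  then have "s permutes {..<n}" by (rule bij_imp_permutes) (simp add: s_def)
  moreover have "r (s i) < r (s j)" if "i < j" "j < n" for i j
    using sorted_wrt_nth_less[OF st, of i j] that xs by (simp add: s_def)
  ultimately show thesis by (rule that)
qed

definition generic :: "nat \<Rightarrow> (nat \<Rightarrow> complex) \<Rightarrow> bool" where
  "generic n x \<longleftrightarrow> x \<in> topspace (disc_configurations n) \<and> inj_on (\<lambda>i. Re (x i)) {..<n}"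

lemma generic_ne: "generic n x \<Longrightarrow> i < n \<Longrightarrow> j < n \<Longrightarrow> i \<noteq> j \<Longrightarrow> Re (x i) \<noteq> Re (x j)"
  unfolding generic_def inj_on_def by auto

abbreviation chamber :: "nat \<Rightarrow> (nat \<Rightarrow> complex) set" where
  "chamber n \<equiv> cell n (<) (\<lambda>_ _. False)"

text \<open>Increasing values in (0, 1/2), so that a point with two grid coordinates lies in the
  open unit disc.\<close>

definition grid :: "nat \<Rightarrow> nat \<Rightarrow> real" where
  "grid n j = (real j + 1) / (2 * (real n + 1))"

text \<open>A standard configuration for each permutation: the height of point \<open>i\<close> is
  fixed by \<open>i\<close>, its horizontal rank is \<open>\<pi> i\<close>.\<close>

definition grid_configuration :: "nat \<Rightarrow> (nat \<Rightarrow> nat) \<Rightarrow> nat \<Rightarrow> complex" where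
  "grid_configuration n \<pi> = (\<lambda>i. if i < n then Complex (grid n (\<pi> i)) (grid n i) else undefined)"

lemma grid_mono: "i < j \<Longrightarrow> grid n i < grid n j"
  by (simp add: grid_def divide_strict_right_mono)

lemma grid_bounds: "j < n \<Longrightarrow> 0 < grid n j \<and> grid n j < 1/2"
  by (auto simp: grid_def field_simps)

lemma ball_Complex: "\<bar>a\<bar> + \<bar>b\<bar> < 1 \<Longrightarrow> Complex a b \<in> ball 0 1"
  using cmod_le[of "Complex a b"] by simp

lemma grid_configuration_cell:
  assumes \<pi>: "\<pi> permutes {..<n}"
    and R: "\<And>i j. i < n \<Longrightarrow> j < n \<Longrightarrow> R i j \<Longrightarrow> \<pi> i < \<pi> j" and I: "\<And>i j. i < n \<Longrightarrow> j < n \<Longrightarrow> I i j \<Longrightarrow> i < j"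
  shows "grid_configuration n \<pi> \<in> cell n R I"
proof -
  have "\<pi> i < n" if "i < n" for i using permutes_in_image[OF \<pi>, of i] that by simp
  then have "Complex (grid n (\<pi> i)) (grid n i) \<in> ball 0 1" if "i < n" for i
    using grid_bounds[of i n] grid_bounds[of "\<pi> i" n] that by (intro ball_Complex) auto
  then show ?thesis
    unfolding cell_def using R I
    by (auto simp: grid_configuration_def extensional_def intro: grid_mono)
qed

lemma grid_configuration_permute:
  assumes \<rho>: "\<rho> permutes {..<n}" and i: "i < n"
  shows "(grid_configuration n \<pi> \<circ> \<rho>) i = Complex (grid n (\<pi> (\<rho> i))) (grid n (\<rho> i))"
  using permutes_in_image[OF \<rho>, of i] i by (simp add: grid_configuration_def)

text \<open>A convex piece of two adjacent chambers together with the wall between them: the points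
  \<open>k\<close> and \<open>Suc k\<close> may pass each other horizontally, with \<open>k\<close>
  staying below. A half twist becomes a straight motion.\<close>

definition crossing_cell :: "nat \<Rightarrow> nat \<Rightarrow> (nat \<Rightarrow> complex) set" where
  "crossing_cell n k = cell n (\<lambda>i j. i < j \<and> (i, j) \<noteq> (k, Suc k)) (\<lambda>i j. (i, j) = (k, Suc k))"

lemma covers_simps:
  "covers n (<) I" "covers n R (<)" "covers n (\<lambda>i j. i < j \<and> (i, j) \<noteq> (k, Suc k)) (\<lambda>i j. (i, j) = (k, Suc k))"
  by (auto simp: covers_def)

section \<open>Values of segments, chambers and the braid relations\<close>

locale disc_rep = path_rep G "disc_configurations n" \<Psi> for G (structure) and n \<Psi> +
  assumes rep_permute: "s permutes {..<n} \<Longrightarrow> pathin (disc_configurations n) p \<Longrightarrow> \<Psi> (\<lambda>t. p t \<circ> s) = \<Psi> p"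
begin

text \<open>Meaningful when both ends lie in a common cell that covers all pairs; by convexity it is
  then the value of every path in that cell between these ends.\<close>

definition V where "V x y = \<Psi> (seg n x y)"

lemma V_closed: "covers n R I \<Longrightarrow> x \<in> cell n R I \<Longrightarrow> y \<in> cell n R I \<Longrightarrow> V x y \<in> carrier G"
  unfolding V_def by (rule closed[OF pathin_seg])

lemma seg_image: "x \<in> cell n R I \<Longrightarrow> y \<in> cell n R I \<Longrightarrow> seg n x y ` {0..1} \<subseteq> cell n R I"
  using seg_cell by blast

lemma rep_cell:
  assumes c: "covers n R I" and p: "pathin (disc_configurations n) p" "p ` {0..1} \<subseteq> cell n R I"
  shows "\<Psi> p = V (p 0) (p 1)"
proof -
  have e: "p 0 \<in> cell n R I" "p 1 \<in> cell n R I" using p(2) by auto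
  show ?thesis
    unfolding V_def using seg_ends[OF cell_extensional] e
    by (intro homotopic path_homotopic_cell[OF c p pathin_seg[OF c e] seg_image[OF e]]) auto
qed

lemma V_trans:
  assumes c: "covers n R I" and x: "x \<in> cell n R I" "y \<in> cell n R I" "z \<in> cell n R I"
  shows "V x y \<otimes> V y z = V x z"
proof -
  note e = seg_ends[OF cell_extensional]
  have p: "pathin (disc_configurations n) (seg n x y)" "pathin (disc_configurations n) (seg n y z)"
    using pathin_seg[OF c] x by auto
  have j: "seg n x y 1 = seg n y z 0" using e x by simp
  have "\<Psi> (loop_join (seg n x y) (seg n y z)) = V (loop_join (seg n x y) (seg n y z) 0) (loop_join (seg n x y) (seg n y z) 1)"
    by (rule rep_cell[OF c pathin_loop_join[OF p j]]) (intro loop_join_image seg_image x)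
  then show ?thesis using join[OF p j] e x by (simp add: V_def)
qed

lemma V_refl: "covers n R I \<Longrightarrow> x \<in> cell n R I \<Longrightarrow> V x x = \<one>"
  using V_trans[of R I x x x] V_closed[of R I x x] by (simp add: l_cancel_one')

lemma V_inv: "covers n R I \<Longrightarrow> x \<in> cell n R I \<Longrightarrow> y \<in> cell n R I \<Longrightarrow> V y x = inv (V x y)"
  using V_trans[of R I y x y] V_closed[of R I] V_refl[of R I y] by (metis inv_equality)

lemma V_permute:
  assumes "covers n R I" "x \<in> cell n R I" "y \<in> cell n R I" "s permutes {..<n}"
  shows "V (x \<circ> s) (y \<circ> s) = V x y"
  unfolding V_def seg_permute[OF assms(4), abs_def] using rep_permute[OF assms(4) pathin_seg[OF assms(1-3)]]
  by (simp add: seg_permute[OF assms(4)] fun_eq_iff o_def)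

end

lemma permute_chamber:
  assumes x: "x \<in> topspace (disc_configurations n)" and s: "s permutes {..<n}"
    and R: "\<And>i j. i < n \<Longrightarrow> j < n \<Longrightarrow> R i j \<Longrightarrow> Re (x (s i)) < Re (x (s j))"
    and I: "\<And>i j. i < n \<Longrightarrow> j < n \<Longrightarrow> I i j \<Longrightarrow> Im (x (s i)) < Im (x (s j))"
  shows "x \<circ> s \<in> cell n R I"
  using configuration_permute[OF x s] R I by (auto simp: plane_configuration_iff cell_def)

locale gauged_disc_rep = disc_rep +
  assumes chamber_trivial: "x \<in> chamber n \<Longrightarrow> y \<in> chamber n \<Longrightarrow> V x y = \<one>"
begin

text \<open>Sorting the real parts of \<open>x\<close> sorts those of \<open>y\<close> as well, so
  the same relabelling moves both into the chamber.\<close>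

lemma V_same_order:
  assumes x: "generic n x" and y: "y \<in> topspace (disc_configurations n)"
    and o: "\<And>i j. i < n \<Longrightarrow> j < n \<Longrightarrow> Re (x i) < Re (x j) \<Longrightarrow> Re (y i) < Re (y j)"
  shows "V x y = \<one>"
proof -
  let ?R = "\<lambda>i j. Re (x i) < Re (x j)" and ?I = "\<lambda>_ _. False"
  have c: "covers n ?R ?I"
    unfolding covers_def
  proof (intro allI impI)
    fix i j assume "i < n" "j < n" "i \<noteq> j"
    from generic_ne[OF x this] show "?R i j \<or> ?R j i \<or> ?I i j \<or> ?I j i" by linarith
  qed
  have xy: "x \<in> cell n ?R ?I" "y \<in> cell n ?R ?I"
    using x y o by (auto simp: cell_def generic_def plane_configuration_iff)
  obtain s where s: "s permutes {..<n}" "\<And>i j. i < j \<Longrightarrow> j < n \<Longrightarrow> Re (x (s i)) < Re (x (s j))"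
    using sorting_permutation[of "\<lambda>i. Re (x i)" n] x unfolding generic_def by blast
  have sn: "s i < n" if "i < n" for i using permutes_in_image[OF s(1), of i] that by simp
  have "x \<circ> s \<in> chamber n" "y \<circ> s \<in> chamber n"
    using x y s sn o by (auto intro!: permute_chamber simp: generic_def)
  from chamber_trivial[OF this] V_permute[OF c xy s(1)] show ?thesis by simp
qed

definition gen where "gen k = V (grid_configuration n id) (grid_configuration n (Transposition.transpose k (Suc k)))"

lemma transpose_permutes: "Suc k < n \<Longrightarrow> Transposition.transpose k (Suc k) permutes {..<n}"
  by (rule permutes_swap_id) auto

text \<open>The segment is compared with the exchange in the grid. From \<open>x\<close> to
  \<open>?a\<close> all stays in the chamber; from \<open>?b\<close> to \<open>y\<close> it does so
  after relabelling by \<open>?t\<close>. Both legs are trivial by the gauge.\<close>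

lemma V_crossing:
  assumes k: "Suc k < n" and x: "x \<in> crossing_cell n k" "Re (x k) < Re (x (Suc k))"
    and y: "y \<in> crossing_cell n k" "Re (y (Suc k)) < Re (y k)"
  shows "V x y = gen k"
proof -
  let ?t = "Transposition.transpose k (Suc k)"
  let ?a = "grid_configuration n id" and ?b = "grid_configuration n ?t"
  note t = transpose_permutes[OF k]
  note c = covers_simps(3)[of n k]
  have a: "?a \<in> crossing_cell n k" "?b \<in> crossing_cell n k"
    unfolding crossing_cell_def
    by (rule grid_configuration_cell, use permutes_id t in \<open>auto simp: Transposition.transpose_def split: if_splits\<close>)+
  have cell: "z \<in> cell n (\<lambda>i j. i < j \<and> (i, j) \<noteq> (k, Suc k)) (\<lambda>i j. (i, j) = (k, Suc k))"
    if "z \<in> crossing_cell n k" for z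
    using that by (simp add: crossing_cell_def)
  have ch: "z \<in> chamber n" if "z \<in> crossing_cell n k" "Re (z k) < Re (z (Suc k))" for z
    using that unfolding crossing_cell_def cell_def by auto
  have ch': "z \<circ> ?t \<in> chamber n" if z: "z \<in> crossing_cell n k" "Re (z (Suc k)) < Re (z k)" for z
  proof (rule permute_chamber[OF _ t])
    show "z \<in> topspace (disc_configurations n)" using cell_configuration[OF c cell[OF z(1)]] .
    fix i j assume ij: "i < n" "j < n" "i < j"
    show "Re (z (?t i)) < Re (z (?t j))"
    proof (cases "i = k \<and> j = Suc k")
      case True
      then show ?thesis using z(2) by simp
    next
      case False
      have "?t i < n" "?t j < n" using ij permutes_in_image[OF t] by (metis lessThan_iff)+
      moreover have "?t i < ?t j" "(?t i, ?t j) \<noteq> (k, Suc k)"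
        using ij False by (auto simp: Transposition.transpose_def)
      ultimately show ?thesis using cell_D(2)[OF cell[OF z(1)], of "?t i" "?t j"] by simp
    qed
  qed simp
  have gr: "Re (?a k) < Re (?a (Suc k))" "Re (?b (Suc k)) < Re (?b k)"
    using k grid_mono[of k "Suc k" n] by (simp_all add: grid_configuration_def)
  have "V x ?a = \<one>" by (rule chamber_trivial[OF ch[OF x] ch[OF a(1) gr(1)]])
  moreover have "V ?b y = \<one>"
    using chamber_trivial[OF ch'[OF a(2) gr(2)] ch'[OF y]] V_permute[OF c cell[OF a(2)] cell[OF y(1)] t] by simp
  moreover have "V x y = V x ?a \<otimes> V ?a ?b \<otimes> V ?b y"
    using V_trans[OF c cell[OF x(1)] cell[OF a(1)] cell[OF a(2)]]
      V_trans[OF c cell[OF x(1)] cell[OF a(2)] cell[OF y(1)]] by simp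
  moreover have "V ?a ?b \<in> carrier G" by (rule V_closed[OF c cell[OF a(1)] cell[OF a(2)]])
  ultimately show ?thesis by (simp add: gen_def)
qed

text \<open>Sorting the real parts of \<open>x\<close> puts \<open>a\<close> and \<open>b\<close> at
  consecutive positions \<open>k\<close> and \<open>Suc k\<close>, because no point lies between
  them, and the motion takes place in \<open>crossing_cell n k\<close>. The conditions on imaginary
  parts fix the sense of the half twist: \<open>a\<close> passes below \<open>b\<close>.\<close>

lemma V_swap:
  assumes x: "generic n x" and y: "y \<in> topspace (disc_configurations n)"
    and ab: "a < n" "b < n" "Re (x a) < Re (x b)" "Im (x a) < Im (x b)" "Im (y a) < Im (y b)"
    and adj: "\<And>c. c < n \<Longrightarrow> \<not> (Re (x a) < Re (x c) \<and> Re (x c) < Re (x b))"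
    and o: "\<And>i j. i < n \<Longrightarrow> j < n \<Longrightarrow> Re (x (Transposition.transpose a b i)) < Re (x (Transposition.transpose a b j)) \<Longrightarrow> Re (y i) < Re (y j)"
  obtains k where "Suc k < n" "V x y = gen k"
proof -
  have xt: "x \<in> topspace (disc_configurations n)" using x by (simp add: generic_def)
  obtain s where s: "s permutes {..<n}" "\<And>i j. i < j \<Longrightarrow> j < n \<Longrightarrow> Re (x (s i)) < Re (x (s j))"
    using sorting_permutation[of "\<lambda>i. Re (x i)" n] x unfolding generic_def by blast
  have sn: "s i < n" if "i < n" for i using permutes_in_image[OF s(1), of i] that by simp
  obtain k l where kl: "s k = a" "s l = b" using permutes_surj[OF s(1)] by (metis surjD)
  have kln: "k < n" "l < n" using kl ab permutes_in_image[OF s(1)] by (metis lessThan_iff)+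
  have "k < l"
  proof (rule ccontr)
    assume "\<not> k < l"
    then have "l = k \<or> l < k" by auto
    then show False using s(2)[of l k] kl kln ab(3) by auto
  qed
  have l: "l = Suc k"
  proof (rule ccontr)
    assume "l \<noteq> Suc k"
    with \<open>k < l\<close> have "k < Suc k" "Suc k < l" by auto
    then show False using s(2)[of k "Suc k"] s(2)[of "Suc k" l] kl kln adj[OF sn, of "Suc k"] by auto
  qed
  have k: "Suc k < n" using kln l by simp
  let ?t = "Transposition.transpose k (Suc k)"
  have comm: "Transposition.transpose a b (s i) = s (?t i)" for i
    using permutes_inj[OF s(1), THEN inj_eq] kl l by (auto simp: Transposition.transpose_def)
  have 1: "x \<circ> s \<in> crossing_cell n k"
    unfolding crossing_cell_def
    by (rule permute_chamber[OF xt s(1)]) (use s(2) ab(4) kl l in auto)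
  have 2: "y \<circ> s \<in> crossing_cell n k"
    unfolding crossing_cell_def
  proof (rule permute_chamber[OF y s(1)])
    fix i j assume ij: "i < n" "j < n" "i < j \<and> (i, j) \<noteq> (k, Suc k)"
    then have "?t i < ?t j" by (auto simp: Transposition.transpose_def)
    moreover have "?t j < n" using ij permutes_in_image[OF transpose_permutes[OF k]] by (metis lessThan_iff)
    ultimately have "Re (x (s (?t i))) < Re (x (s (?t j)))" by (rule s(2))
    then show "Re (y (s i)) < Re (y (s j))" using o[OF sn[OF ij(1)] sn[OF ij(2)]] comm by simp
  qed (use ab(5) kl l in auto)
  have "Re (y b) < Re (y a)" using o[OF ab(2,1)] ab(3) by simp
  then have "V (x \<circ> s) (y \<circ> s) = gen k"
    using V_crossing[OF k 1 _ 2] kl l ab(3) by simp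
  moreover have "V (x \<circ> s) (y \<circ> s) = V x y"
  proof -
    have "inv' s permutes {..<n}" using s(1) by (rule permutes_inv)
    from V_permute[OF covers_simps(3) 1[unfolded crossing_cell_def] 2[unfolded crossing_cell_def] this]
    show ?thesis by (simp add: comp_assoc permutes_inv_o[OF s(1)])
  qed
  ultimately show thesis using k that by simp
qed

text \<open>Grid configurations all have the same vertical order and so lie in one cell, where
  values compose along any chain. Each braid relation then compares two factorisations of one
  permutation into transpositions of neighbours.\<close>

lemma V_grid:
  assumes \<pi>: "\<pi> permutes {..<n}" "\<rho> permutes {..<n}" "\<tau> permutes {..<n}"
  shows "V (grid_configuration n \<pi>) (grid_configuration n \<rho>) \<otimes> V (grid_configuration n \<rho>) (grid_configuration n \<tau>)
    = V (grid_configuration n \<pi>) (grid_configuration n \<tau>)"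
  by (rule V_trans[OF covers_simps(2)[of n "\<lambda>_ _. False"]]; rule grid_configuration_cell) (use \<pi> in auto)

text \<open>The condition on the inverse says that the point of horizontal rank \<open>k\<close> has
  the smaller index and hence lies lower than the one of rank \<open>Suc k\<close>. It passes below
  its neighbour, in the sense of the generator; in the other case the value would be the
  inverse.\<close>

lemma V_grid_step:
  assumes \<pi>: "\<pi> permutes {..<n}" and k: "Suc k < n" and lt: "inv' \<pi> k < inv' \<pi> (Suc k)"
  shows "V (grid_configuration n \<pi>) (grid_configuration n (Transposition.transpose k (Suc k) \<circ> \<pi>)) = gen k"
proof -
  let ?t = "Transposition.transpose k (Suc k)" and ?i = "inv' \<pi>"
  let ?a = "grid_configuration n \<pi>" and ?b = "grid_configuration n (?t \<circ> \<pi>)"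
  note t = transpose_permutes[OF k]
  have i: "?i permutes {..<n}" using \<pi> by (rule permutes_inv)
  have tp: "?t \<circ> \<pi> permutes {..<n}" using permutes_compose[OF \<pi> t] .
  have ab: "?a \<in> cell n (\<lambda>_ _. False) (<)" "?b \<in> cell n (\<lambda>_ _. False) (<)"
    by (rule grid_configuration_cell, use \<pi> tp in auto)+
  have top: "?a \<in> topspace (disc_configurations n)" "?b \<in> topspace (disc_configurations n)"
    using ab cell_configuration[OF covers_simps(2)] by blast+
  have pi: "\<pi> (?i j) = j" for j using permutes_inverses(1)[OF \<pi>] .
  have co: "?a (?i j) = Complex (grid n j) (grid n (?i j))" "?b (?i j) = Complex (grid n (?t j)) (grid n (?i j))"
    if "j < n" for j
    using grid_configuration_permute[OF i that, of \<pi>] grid_configuration_permute[OF i that, of "?t \<circ> \<pi>"] pi by simp_all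
  have 1: "?a \<circ> ?i \<in> crossing_cell n k" "?b \<circ> ?i \<in> crossing_cell n k"
    unfolding crossing_cell_def
    by (rule permute_chamber[OF _ i], use top lt grid_mono in \<open>auto simp: co Transposition.transpose_def\<close>)+
  have "V (?a \<circ> ?i) (?b \<circ> ?i) = gen k"
    by (rule V_crossing[OF k 1(1) _ 1(2)]) (use k co grid_mono[of k "Suc k" n] in auto)
  then show ?thesis using V_permute[OF covers_simps(2) ab i] by simp
qed

lemma gen_closed: "Suc k < n \<Longrightarrow> gen k \<in> carrier G"
  unfolding gen_def
  by (rule V_closed[OF covers_simps(2)[of n "\<lambda>_ _. False"]]; rule grid_configuration_cell)
     (auto simp: permutes_id transpose_permutes)

lemma V_grid_gen: "Suc k < n \<Longrightarrow> V (grid_configuration n id) (grid_configuration n (Transposition.transpose k (Suc k))) = gen k"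
  by (simp add: gen_def)

lemma gen_far:
  assumes kl: "Suc k < l" "Suc l < n"
  shows "gen k \<otimes> gen l = gen l \<otimes> gen k"
proof -
  let ?s = "Transposition.transpose k (Suc k)" and ?t = "Transposition.transpose l (Suc l)"
  have p: "?s permutes {..<n}" "?t permutes {..<n}" "id permutes {..<n}"
    using transpose_permutes kl by (auto simp: permutes_id)
  have "V (grid_configuration n ?s) (grid_configuration n (?t \<circ> ?s)) = gen l"
    by (rule V_grid_step[OF p(1)]) (use kl in \<open>auto simp: Transposition.transpose_def\<close>)
  moreover have "V (grid_configuration n ?t) (grid_configuration n (?s \<circ> ?t)) = gen k"
    by (rule V_grid_step[OF p(2)]) (use kl in \<open>auto simp: Transposition.transpose_def\<close>)
  moreover have "?t \<circ> ?s = ?s \<circ> ?t" using kl by (auto simp: fun_eq_iff Transposition.transpose_def)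
  ultimately show ?thesis
    using V_grid[OF p(3,1), of "?t \<circ> ?s"] V_grid[OF p(3,2), of "?s \<circ> ?t"] kl
      permutes_compose[OF p(1,2)] V_grid_gen[of k] V_grid_gen[of l] by simp
qed

lemma gen_braid:
  assumes k: "Suc (Suc k) < n"
  shows "gen k \<otimes> gen (Suc k) \<otimes> gen k = gen (Suc k) \<otimes> gen k \<otimes> gen (Suc k)"
proof -
  let ?s = "Transposition.transpose k (Suc k)" and ?t = "Transposition.transpose (Suc k) (Suc (Suc k))"
  let ?c = "grid_configuration n"
  have p: "?s permutes {..<n}" "?t permutes {..<n}" "id permutes {..<n}"
    using transpose_permutes k by (auto simp: permutes_id)
  have q: "?t \<circ> ?s permutes {..<n}" "?s \<circ> ?t permutes {..<n}"
    using p permutes_compose by blast+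
  have r: "?s \<circ> (?t \<circ> ?s) permutes {..<n}" "?t \<circ> (?s \<circ> ?t) permutes {..<n}"
    using p q permutes_compose by blast+
  have inv: "inv' (?t \<circ> ?s) = ?s \<circ> ?t" "inv' (?s \<circ> ?t) = ?t \<circ> ?s"
    by (simp_all add: o_inv_distrib)
  have "V (?c ?s) (?c (?t \<circ> ?s)) = gen (Suc k)"
    by (rule V_grid_step[OF p(1)]) (use k in \<open>auto simp: Transposition.transpose_def\<close>)
  moreover have "V (?c (?t \<circ> ?s)) (?c (?s \<circ> (?t \<circ> ?s))) = gen k"
    by (rule V_grid_step[OF q(1)]) (use k in \<open>auto simp: inv Transposition.transpose_def\<close>)
  moreover have "V (?c ?t) (?c (?s \<circ> ?t)) = gen k"
    by (rule V_grid_step[OF p(2)]) (use k in \<open>auto simp: Transposition.transpose_def\<close>)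
  moreover have "V (?c (?s \<circ> ?t)) (?c (?t \<circ> (?s \<circ> ?t))) = gen (Suc k)"
    by (rule V_grid_step[OF q(2)]) (use k in \<open>auto simp: inv Transposition.transpose_def\<close>)
  moreover have "?s \<circ> (?t \<circ> ?s) = ?t \<circ> (?s \<circ> ?t)" by (auto simp: fun_eq_iff Transposition.transpose_def)
  ultimately show ?thesis
    using V_grid[OF p(3,1) q(1)] V_grid[OF p(3) q(1) r(1)] V_grid[OF p(3,2) q(2)] V_grid[OF p(3) q(2) r(2)]
      V_grid_gen[of k] V_grid_gen[of "Suc k"] k by simp
qed

end

section \<open>Neighbour exchanges generate the values on the disc\<close>

lemma openin_Collect_ball:
  assumes "finite A" "\<And>a. a \<in> A \<Longrightarrow> openin X {x \<in> topspace X. P a x}"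
  shows "openin X {x \<in> topspace X. \<forall>a\<in>A. P a x}"
  using assms
proof (induction A rule: finite_induct)
  case (insert a A)
  have "{x \<in> topspace X. \<forall>a\<in>insert a A. P a x} = {x \<in> topspace X. P a x} \<inter> {x \<in> topspace X. \<forall>a\<in>A. P a x}"
    by auto
  then show ?case using insert by auto
qed simp

lemma openin_coord_less:
  fixes f :: "complex \<Rightarrow> real"
  assumes ij: "i < n" "j < n" and f: "continuous_on UNIV f"
  shows "openin (configuration_space n (top_of_set S)) {x \<in> topspace (configuration_space n (top_of_set S)). f (x i) < f (x j)}"
proof -
  let ?F = "configuration_space n (top_of_set S)"
  have c: "continuous_map ?F euclideanreal (\<lambda>x. f (x k))" if "k < n" for k
  proof -
    have "continuous_map (top_of_set S) euclideanreal f"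
      using continuous_on_subset[OF f] by auto
    from continuous_map_compose[OF continuous_map_configuration_space_coord[OF that] this] show ?thesis
      by (simp add: o_def)
  qed
  have "continuous_map ?F euclideanreal (\<lambda>x. f (x j) - f (x i))"
    by (intro continuous_intros c ij)
  from openin_continuous_map_preimage[OF this, of "{0<..}"] show ?thesis by simp
qed

lemma openin_cell:
  assumes c: "covers n R I"
  shows "openin (disc_configurations n) (cell n R I)"
proof -
  let ?F = "disc_configurations n"
  let ?P = "\<lambda>p x. (R (fst p) (snd p) \<longrightarrow> Re (x (fst p)) < Re (x (snd p))) \<and>
      (I (fst p) (snd p) \<longrightarrow> Im (x (fst p)) < Im (x (snd p)))"
  have "cell n R I = {x \<in> topspace ?F. \<forall>p\<in>{..<n} \<times> {..<n}. ?P p x}"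
  proof (intro equalityI subsetI)
    fix x assume x: "x \<in> cell n R I"
    then show "x \<in> {x \<in> topspace ?F. \<forall>p\<in>{..<n} \<times> {..<n}. ?P p x}"
      using cell_configuration[OF c x] by (simp add: cell_def)
  next
    fix x assume "x \<in> {x \<in> topspace ?F. \<forall>p\<in>{..<n} \<times> {..<n}. ?P p x}"
    then show "x \<in> cell n R I"
      by (simp add: cell_def plane_configuration_iff)
  qed
  also have "openin ?F \<dots>"
  proof (rule openin_Collect_ball)
    fix p assume p: "p \<in> {..<n} \<times> {..<n}"
    have "openin ?F {x \<in> topspace ?F. Re (x (fst p)) < Re (x (snd p))}"
      "openin ?F {x \<in> topspace ?F. Im (x (fst p)) < Im (x (snd p))}"
      using p by (auto intro!: openin_coord_less continuous_intros)
    moreover have "{x \<in> topspace ?F. ?P p x} =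
        (if R (fst p) (snd p) then {x \<in> topspace ?F. Re (x (fst p)) < Re (x (snd p))} else topspace ?F) \<inter>
        (if I (fst p) (snd p) then {x \<in> topspace ?F. Im (x (fst p)) < Im (x (snd p))} else topspace ?F)"
      by auto
    ultimately show "openin ?F {x \<in> topspace ?F. ?P p x}" by (simp add: openin_Int)
  qed simp
  finally show ?thesis .
qed

text \<open>Shearing makes the real parts distinct: two points of the sheared configuration have equal real
  parts for at most one value of the parameter.\<close>

lemma generic_access:
  assumes V: "openin (disc_configurations n) V" and y: "y \<in> V"
  obtains p where "pathin (disc_configurations n) p" "p ` {0..1} \<subseteq> V" "p 0 = y" "generic n (p 1)"
proof -
  let ?F = "disc_configurations n"
  have yt: "y \<in> topspace ?F" using V y openin_subset by blast
  define \<phi> where "\<phi> t = (\<lambda>i. if i < n then (y i + of_real (t * Im (y i))) / of_real (1 + t) else undefined)" for t :: real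
  have \<phi>: "\<phi> t \<in> topspace ?F" if t: "0 \<le> t" for t
    unfolding plane_configuration_iff
  proof (intro conjI allI impI)
    show "\<phi> t \<in> extensional {..<n}" by (auto simp: \<phi>_def extensional_def)
    show "\<phi> t i \<in> ball 0 1" if i: "i < n" for i
    proof -
      have yi: "cmod (y i) < 1" using yt i by (auto simp: plane_configuration_iff)
      have "cmod (y i + of_real (t * Im (y i))) \<le> cmod (y i) + \<bar>t * Im (y i)\<bar>"
        by (rule norm_triangle_le) (simp add: norm_mult abs_mult)
      also have "\<dots> \<le> cmod (y i) + t * cmod (y i)"
        using t abs_Im_le_cmod[of "y i"] by (simp add: abs_mult mult_left_mono)
      also have "\<dots> = (1 + t) * cmod (y i)" by (simp add: algebra_simps)
      also have "\<dots> < (1 + t) * 1" using t yi by (intro mult_strict_left_mono) auto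
      finally have "cmod (y i + of_real (t * Im (y i))) < 1 + t" by simp
      moreover have "cmod (of_real (1 + t)) = 1 + t" using t by (simp only: norm_of_real)
      ultimately show ?thesis using i t by (simp add: \<phi>_def norm_divide del: of_real_add of_real_mult)
    qed
    show "inj_on (\<phi> t) {..<n}"
    proof (rule inj_onI)
      fix i j assume ij: "i \<in> {..<n}" "j \<in> {..<n}" "\<phi> t i = \<phi> t j"
      have "complex_of_real (1 + t) \<noteq> 0" using t by (simp only: of_real_eq_0_iff)
      then have e: "y i + of_real (t * Im (y i)) = y j + of_real (t * Im (y j))"
        using ij by (simp add: \<phi>_def del: of_real_add of_real_mult)
      from arg_cong[OF e, of Im] have "Im (y i) = Im (y j)" by simp
      with e have "y i = y j" by simp
      then show "i = j" using yt ij by (auto simp: plane_configuration_iff inj_on_def)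
    qed
  qed
  have cont: "continuous_map (top_of_set {0..}) ?F \<phi>"
    unfolding continuous_map_into_plane_configuration
  proof (intro conjI allI impI ballI)
    fix i assume i: "i < n"
    have "continuous_on {0..} (\<lambda>t. (y i + of_real (t * Im (y i))) / of_real (1 + t))"
    proof (intro continuous_intros ballI)
      fix t :: real assume "t \<in> {0..}"
      then have "1 + t \<noteq> 0" by auto
      then show "complex_of_real (1 + t) \<noteq> 0" by (simp only: of_real_eq_0_iff not_False_eq_True)
    qed
    then show "continuous_on {0..} (\<lambda>t. \<phi> t i)" using i by (simp add: \<phi>_def)
  qed (use \<phi> in auto)
  have \<phi>0: "\<phi> 0 = y" using yt by (auto simp: \<phi>_def plane_configuration_iff extensional_def fun_eq_iff)
  have "openin (top_of_set {0..}) {t \<in> topspace (top_of_set {0..}). \<phi> t \<in> V}"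
    using cont V by (rule openin_continuous_map_preimage)
  moreover have "0 \<in> {t \<in> topspace (top_of_set {0..}). \<phi> t \<in> V}" using \<phi>0 y by simp
  ultimately obtain e where e: "e > 0" "\<And>t. 0 \<le> t \<Longrightarrow> t < e \<Longrightarrow> \<phi> t \<in> V"
    unfolding openin_euclidean_subtopology_iff dist_real_def by (auto simp: subset_iff)
  define bad where "bad = (\<lambda>(i, j). - (Re (y i) - Re (y j)) / (Im (y i) - Im (y j))) ` ({..<n} \<times> {..<n})"
  have "finite bad" unfolding bad_def by (intro finite_imageI finite_cartesian_product) auto
  moreover have "infinite {0<..<e}" using e(1) by (simp add: infinite_Ioo)
  ultimately have "{0<..<e} - bad \<noteq> {}" by (metis Diff_infinite_finite finite.emptyI)
  then obtain t where "t \<in> {0<..<e} - bad" by blast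
  then have t: "0 < t" "t < e" "t \<notin> bad" by auto
  have gen: "generic n (\<phi> t)"
    unfolding generic_def
  proof (intro conjI \<phi> inj_onI)
    fix i j assume ij: "i \<in> {..<n}" "j \<in> {..<n}" "Re (\<phi> t i) = Re (\<phi> t j)"
    have Re: "Re (\<phi> t k) = (Re (y k) + t * Im (y k)) / (1 + t)" if "k < n" for k
      using that by (simp add: \<phi>_def del: of_real_add of_real_mult)
    have "1 + t \<noteq> 0" using t by simp
    then have eq: "Re (y i) + t * Im (y i) = Re (y j) + t * Im (y j)"
      using ij Re[of i] Re[of j] by simp
    show "i = j"
    proof (cases "Im (y i) = Im (y j)")
      case True
      then have "y i = y j" using eq by (simp add: complex_eq_iff)
      then show ?thesis using yt ij by (auto simp: plane_configuration_iff inj_on_def)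
    next
      case False
      then have "t = - (Re (y i) - Re (y j)) / (Im (y i) - Im (y j))"
        using eq by (simp add: field_simps)
      then have "t \<in> bad" using ij unfolding bad_def by force
      then show ?thesis using t by simp
    qed
  qed (use t in simp)
  have st: "0 \<le> t * s \<and> t * s < e" if "s \<in> {0..1}" for s
  proof -
    have "t * s \<le> t * 1" by (rule mult_left_mono) (use that t in auto)
    then have "t * s \<le> t" by (simp only: mult_1_right)
    moreover have "0 \<le> t * s" using that t by simp
    ultimately show ?thesis using t(2) by linarith
  qed
  have "pathin ?F (\<lambda>s. \<phi> (t * s))"
    unfolding pathin_def by (rule continuous_map_compose_on[OF cont]) (use st in \<open>auto intro!: continuous_intros\<close>)
  moreover have "(\<lambda>s. \<phi> (t * s)) ` {0..1} \<subseteq> V" using st e(2) by blast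
  ultimately show thesis using \<phi>0 gen by (intro that[of "\<lambda>s. \<phi> (t * s)"]) auto
qed

text \<open>The points of \<open>y\<close> with different real parts keep their horizontal order,
  those with equal real parts keep their vertical order and may pass each other horizontally. All
  conditions are strict, so this convex set is an open neighbourhood of \<open>y\<close>.\<close>

definition order_cell :: "nat \<Rightarrow> (nat \<Rightarrow> complex) \<Rightarrow> (nat \<Rightarrow> complex) set" where
  "order_cell n y = cell n (\<lambda>i j. Re (y i) < Re (y j)) (\<lambda>i j. Re (y i) = Re (y j) \<and> Im (y i) < Im (y j))"

lemma order_cell_covers:
  assumes "y \<in> topspace (disc_configurations n)"
  shows "covers n (\<lambda>i j. Re (y i) < Re (y j)) (\<lambda>i j. Re (y i) = Re (y j) \<and> Im (y i) < Im (y j))"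
  unfolding covers_def
proof (intro allI impI)
  fix i j assume "i < n" "j < n" "i \<noteq> j"
  then have "y i \<noteq> y j" using assms by (auto simp: plane_configuration_iff inj_on_def)
  then show "Re (y i) < Re (y j) \<or> Re (y j) < Re (y i) \<or> (Re (y i) = Re (y j) \<and> Im (y i) < Im (y j)) \<or>
      (Re (y j) = Re (y i) \<and> Im (y j) < Im (y i))"
    by (auto simp: complex_eq_iff)
qed

lemma order_cell_self: "y \<in> topspace (disc_configurations n) \<Longrightarrow> y \<in> order_cell n y"
  by (auto simp: order_cell_def cell_def plane_configuration_iff)

context gauged_disc_rep
begin

text \<open>Bubble sort. \<open>L\<close> is the lexicographic order of the points of
  \<open>y\<close>, and an inversion is a pair that \<open>x\<close> shows horizontally in the
  opposite order. In the order cell this only happens for points with equal real part in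
  \<open>y\<close>, whose vertical order is fixed. An inversion of smallest gap is undone by a
  single exchange, and two configurations without inversions have the same horizontal order.\<close>

lemma V_order_cell:
  assumes H: "subgroup H G" and gens: "\<And>k. Suc k < n \<Longrightarrow> gen k \<in> H"
    and y: "y \<in> topspace (disc_configurations n)"
    and x: "x \<in> order_cell n y" "generic n x" and x': "x' \<in> order_cell n y" "generic n x'"
  shows "V x x' \<in> H"
proof -
  interpret H: subgroup H G by (rule H)
  note cov = order_cell_covers[OF y]
  define L where "L i j \<longleftrightarrow> Re (y i) < Re (y j) \<or> (Re (y i) = Re (y j) \<and> Im (y i) < Im (y j))" for i j
  have L_trans: "L i k" if "L i j" "L j k" for i j k using that by (auto simp: L_def)
  have L_total: "L i j \<or> L j i" if "i < n" "j < n" "i \<noteq> j" for i j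
    using cov that unfolding covers_def L_def by metis
  have L_asym: "\<not> L j i" if "L i j" for i j using that by (auto simp: L_def)
  define invs where "invs x = {(i, j). i < n \<and> j < n \<and> L i j \<and> Re (x j) < Re (x i)}" for x :: "nat \<Rightarrow> complex"
  have fin: "finite (invs x)" for x
    by (rule finite_subset[of _ "{..<n} \<times> {..<n}"]) (auto simp: invs_def)
  have cellD: "Re (x i) < Re (x j)" if "x \<in> order_cell n y" "i < n" "j < n" "Re (y i) < Re (y j)" for x i j
    using cell_D(2)[OF that(1)[unfolded order_cell_def] that(2,3)] that(4) by simp
  have cellI: "Im (x i) < Im (x j)" if "x \<in> order_cell n y" "i < n" "j < n" "Re (y i) = Re (y j)" "Im (y i) < Im (y j)" for x i j
    using cell_D(3)[OF that(1)[unfolded order_cell_def] that(2,3)] that(4,5) by simp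
  have V: "V u v \<otimes> V v w = V u w" "V u v \<in> carrier G" "V v u = inv (V u v)"
    if "u \<in> order_cell n y" "v \<in> order_cell n y" "w \<in> order_cell n y" for u v w
    using V_trans[OF cov] V_closed[OF cov] V_inv[OF cov] that unfolding order_cell_def by blast+
  have step: "\<exists>z. z \<in> order_cell n y \<and> generic n z \<and> V x z \<in> H \<and> card (invs z) < card (invs x)"
    if x: "x \<in> order_cell n y" "generic n x" and ne: "invs x \<noteq> {}" for x
  proof -
    \<comment> \<open>An inversion with the smallest horizontal gap concerns neighbours: a point
      strictly between \<open>b\<close> and \<open>a\<close> would form an inversion of smaller gap
      with one of them.\<close>
    define gap where "gap p = Re (x (fst p)) - Re (x (snd p))" for p
    obtain p where p: "p \<in> invs x" "\<And>q. q \<in> invs x \<Longrightarrow> gap p \<le> gap q"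
      using ex_min_if_finite[of "gap ` invs x"] fin[of x] ne
      by (metis (no_types, lifting) arg_min_least arg_min_if_finite(1))
    obtain a b where ab: "p = (a, b)" by (cases p)
    have an: "a < n" "b < n" "L a b" "Re (x b) < Re (x a)" using p(1) by (auto simp: invs_def ab)
    have "a \<noteq> b" using an by auto
    have eqRe: "Re (y a) = Re (y b)" "Im (y a) < Im (y b)"
      using an(3,4) cellD[OF x(1) an(1,2)] by (auto simp: L_def)
    have adj: "\<not> (Re (x b) < Re (x c) \<and> Re (x c) < Re (x a))" if c: "c < n" for c
    proof
      assume bt: "Re (x b) < Re (x c) \<and> Re (x c) < Re (x a)"
      then have "c \<noteq> a" "c \<noteq> b" by auto
      then consider "L a c" | "L c a" using L_total[OF an(1) c] by auto
      then show False
      proof cases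
        case 1
        then have "(a, c) \<in> invs x" using an c bt by (simp add: invs_def)
        from p(2)[OF this] bt show False by (simp add: gap_def ab)
      next
        case 2
        then have "L c b" using L_trans an(3) by blast
        then have "(c, b) \<in> invs x" using an c bt by (simp add: invs_def)
        from p(2)[OF this] bt show False by (simp add: gap_def ab)
      qed
    qed
    let ?t = "Transposition.transpose a b"
    have tn: "?t i < n" if "i < n" for i using an that by (auto simp: Transposition.transpose_def)
    have yt: "Re (y (?t i)) = Re (y i)" for i using eqRe by (auto simp: Transposition.transpose_def)
    have xt: "x \<in> topspace (disc_configurations n)" using x(2) by (simp add: generic_def)
    \<comment> \<open>\<open>z\<close> is \<open>x\<close> with the real parts of \<open>a\<close>
      and \<open>b\<close> exchanged and all coordinates halved. The exchange alone could push a
      point out of the disc; after halving, the absolute values of the two coordinates sum to less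
      than 1.\<close>
    define z where "z = (\<lambda>i. if i < n then Complex (Re (x (?t i)) / 2) (Im (x i) / 2) else undefined)"
    have zRe: "Re (z i) = Re (x (?t i)) / 2" "Im (z i) = Im (x i) / 2" if "i < n" for i
      using that by (simp_all add: z_def)
    have xb: "\<bar>Re (x i)\<bar> < 1" "\<bar>Im (x i)\<bar> < 1" if "i < n" for i
    proof -
      have "cmod (x i) < 1" using xt that by (auto simp: plane_configuration_iff)
      then show "\<bar>Re (x i)\<bar> < 1" "\<bar>Im (x i)\<bar> < 1"
        using abs_Re_le_cmod[of "x i"] abs_Im_le_cmod[of "x i"] by linarith+
    qed
    have zb: "z i \<in> ball 0 1" if "i < n" for i
    proof -
      have "Complex (Re (x (?t i)) / 2) (Im (x i) / 2) \<in> ball 0 1"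
        using xb(1)[OF tn[OF that]] xb(2)[OF that] by (intro ball_Complex) linarith
      then show ?thesis using that by (simp add: z_def)
    qed
    have zc: "z \<in> order_cell n y"
      unfolding order_cell_def cell_def mem_Collect_eq
    proof (intro conjI allI impI)
      show "z \<in> extensional {..<n}" by (auto simp: z_def extensional_def)
      fix i j assume ij: "i < n" "j < n"
      show "Re (z i) < Re (z j)" if "Re (y i) < Re (y j)"
        using cellD[OF x(1) tn[OF ij(1)] tn[OF ij(2)]] that unfolding zRe(1)[OF ij(1)] zRe(1)[OF ij(2)] by (simp add: yt)
      show "Im (z i) < Im (z j)" if "Re (y i) = Re (y j) \<and> Im (y i) < Im (y j)"
        using cellI[OF x(1) ij] that unfolding zRe(2)[OF ij(1)] zRe(2)[OF ij(2)] by simp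
    qed (use zb in blast)
    have zt: "z \<in> topspace (disc_configurations n)"
      using cell_configuration[OF cov] zc unfolding order_cell_def by blast
    have zg: "generic n z"
      unfolding generic_def
    proof (intro conjI zt inj_onI)
      fix i j assume ij: "i \<in> {..<n}" "j \<in> {..<n}" "Re (z i) = Re (z j)"
      then have "Re (x (?t i)) = Re (x (?t j))" using zRe(1)[of i] zRe(1)[of j] by simp
      then have "?t i = ?t j" using generic_ne[OF x(2) tn tn, of i j] ij by auto
      then show "i = j" by (metis Transposition.transpose_involutory)
    qed
    \<comment> \<open>Applied from \<open>z\<close> to \<open>x\<close>, since it is in
      \<open>z\<close> that the lower point \<open>a\<close> is on the left.\<close>
    obtain k where k: "Suc k < n" "V z x = gen k"
    proof (rule V_swap[OF zg xt an(1,2)])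
      show "Re (z a) < Re (z b)" using zRe(1)[OF an(1)] zRe(1)[OF an(2)] an by simp
      show "Im (z a) < Im (z b)" "Im (x a) < Im (x b)"
        using cellI[OF zc an(1,2) eqRe] cellI[OF x(1) an(1,2) eqRe] .
      show "\<not> (Re (z a) < Re (z c) \<and> Re (z c) < Re (z b))" if c: "c < n" for c
      proof (cases "c = a \<or> c = b")
        case True
        then show ?thesis by auto
      next
        case False
        then show ?thesis using adj[OF c] zRe(1)[OF c] zRe(1)[OF an(1)] zRe(1)[OF an(2)] by auto
      qed
      show "Re (x i) < Re (x j)" if "i < n" "j < n" "Re (z (?t i)) < Re (z (?t j))" for i j
        using that zRe(1)[OF tn[OF that(1)]] zRe(1)[OF tn[OF that(2)]] by simp
    qed
    have "V x z = inv (gen k)" using V(3)[OF zc x(1) x(1)] k(2) by simp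
    then have "V x z \<in> H" using gens[OF k(1)] by simp
    \<comment> \<open>Exchanging horizontal neighbours changes the relative order of no other pair,
      and the pair of \<open>a\<close> and \<open>b\<close> ceases to be an inversion.\<close>
    moreover have "invs z \<subset> invs x"
    proof
      show "invs z \<subseteq> invs x"
      proof
        fix q assume q: "q \<in> invs z"
        obtain i j where ij: "q = (i, j)" by (cases q)
        have i: "i < n" "j < n" "L i j" "Re (z j) < Re (z i)"
          using q by (auto simp: invs_def ij)
        then have i: "i < n" "j < n" "L i j" "Re (x (?t j)) < Re (x (?t i))"
          using zRe(1)[of i] zRe(1)[of j] by simp_all
        have nij: "i \<noteq> j" using i by auto
        have ne: "Re (x u) \<noteq> Re (x v)" if "u < n" "v < n" "u \<noteq> v" for u v
          using generic_ne[OF x(2) that] .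
        have "Re (x j) < Re (x i)"
        proof (cases "i = a")
          case ia: True
          show ?thesis
          proof (cases "j = b")
            case True
            then show ?thesis using ia an by simp
          next
            case False
            then have "Re (x j) < Re (x b)" using i(4) ia nij by (simp add: Transposition.transpose_def)
            then show ?thesis using ia an by simp
          qed
        next
          case ia: False
          show ?thesis
          proof (cases "i = b")
            case ib: True
            have "j \<noteq> a" using L_asym[OF an(3)] i(3) ib by auto
            then have "Re (x j) < Re (x a)" using i(4) ib nij \<open>a \<noteq> b\<close> by (simp add: Transposition.transpose_def)
            then show ?thesis using adj[OF i(2)] ne[OF i(2) an(2)] ib nij by auto
          next
            case ib: False
            then have ti: "?t i = i" using ia by simp
            show ?thesis
            proof (cases "j = a")
              case True
              then have "Re (x b) < Re (x i)" using i(4) ti by simp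
              then show ?thesis using adj[OF i(1)] ne[OF i(1) an(1)] ia True by auto
            next
              case False
              show ?thesis
              proof (cases "j = b")
                case True
                then have "Re (x a) < Re (x i)" using i(4) ti by simp
                then show ?thesis using an True by simp
              next
                case jb: False
                then show ?thesis using i(4) ti False by simp
              qed
            qed
          qed
        qed
        then show "q \<in> invs x" using i ij by (simp add: invs_def)
      qed
      have "(a, b) \<in> invs x" using p(1) ab by simp
      moreover have "(a, b) \<notin> invs z" using zRe(1)[OF an(1)] zRe(1)[OF an(2)] an by (simp add: invs_def)
      ultimately show "invs z \<noteq> invs x" by blast
    qed
    then have "card (invs z) < card (invs x)" by (rule psubset_card_mono[OF fin])
    ultimately show ?thesis using zc zg by blast
  qed
  have reach: "\<exists>z. z \<in> order_cell n y \<and> generic n z \<and> V x z \<in> H \<and> invs z = {}"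
    if "x \<in> order_cell n y" "generic n x" for x
    using that
  proof (induction "card (invs x)" arbitrary: x rule: less_induct)
    case less
    show ?case
    proof (cases "invs x = {}")
      case True
      have "V x x = \<one>" using V_refl[OF cov] less.prems(1) unfolding order_cell_def by blast
      then show ?thesis using True less.prems by (intro exI[of _ x]) simp
    next
      case False
      from step[OF less.prems False] obtain z where
        z: "z \<in> order_cell n y" "generic n z" "V x z \<in> H" "card (invs z) < card (invs x)" by blast
      from less.hyps[OF z(4,1,2)] obtain w where
        w: "w \<in> order_cell n y" "generic n w" "V z w \<in> H" "invs w = {}" by blast
      have "V x w \<in> H" using V(1)[OF less.prems(1) z(1) w(1)] H.m_closed[OF z(3) w(3)] by simp
      then show ?thesis using w by blast
    qed
  qed
  from reach[OF x] obtain z where z: "z \<in> order_cell n y" "generic n z" "V x z \<in> H" "invs z = {}" by blast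
  from reach[OF x'] obtain z' where z': "z' \<in> order_cell n y" "generic n z'" "V x' z' \<in> H" "invs z' = {}" by blast
  have "V z z' = \<one>"
  proof (rule V_same_order[OF z(2)])
    show "z' \<in> topspace (disc_configurations n)" using z'(2) by (simp add: generic_def)
    fix i j assume ij: "i < n" "j < n" "Re (z i) < Re (z j)"
    then have "i \<noteq> j" by auto
    have "\<not> L j i" using z(4) ij by (auto simp: invs_def)
    then have "L i j" using L_total ij \<open>i \<noteq> j\<close> by blast
    then have "\<not> Re (z' j) < Re (z' i)" using z'(4) ij by (auto simp: invs_def)
    then show "Re (z' i) < Re (z' j)" using generic_ne[OF z'(2) ij(1,2) \<open>i \<noteq> j\<close>] by linarith
  qed
  then have "V x x' = V x z \<otimes> inv (V x' z')"
    using V(1)[OF x(1) z(1) z'(1)] V(1)[OF x(1) z'(1) x'(1)] V(2)[OF x(1) z(1) z(1)] V(3)[OF x'(1) z'(1) z'(1)]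
    by simp
  then show ?thesis using z(3) z'(3) by simp
qed

text \<open>The local principle with order cells as neighbourhoods and generic configurations as
  good points.\<close>

theorem disc_generated:
  assumes H: "subgroup H G" and gens: "\<And>k. Suc k < n \<Longrightarrow> gen k \<in> H"
    and p: "pathin (disc_configurations n) p" "generic n (p 0)" "generic n (p 1)"
  shows "\<Psi> p \<in> H"
proof (rule rep_generated[OF H _ _ p(1), of "Collect (generic n)"])
  fix y assume y: "y \<in> topspace (disc_configurations n)"
  note cov = order_cell_covers[OF y]
  have "\<Psi> q \<in> H" if q: "pathin (disc_configurations n) q" "q ` {0..1} \<subseteq> order_cell n y"
    "generic n (q 0)" "generic n (q 1)" for q
  proof -
    have "\<Psi> q = V (q 0) (q 1)" using rep_cell[OF cov q(1)] q(2) unfolding order_cell_def by blast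
    moreover have "q 0 \<in> order_cell n y" "q 1 \<in> order_cell n y" using q(2) by auto
    ultimately show ?thesis using V_order_cell[OF H gens y] q(3,4) by simp
  qed
  then show "\<exists>W. openin (disc_configurations n) W \<and> y \<in> W \<and> (\<forall>p. pathin (disc_configurations n) p \<longrightarrow>
      p ` {0..1} \<subseteq> W \<longrightarrow> p 0 \<in> Collect (generic n) \<longrightarrow> p 1 \<in> Collect (generic n) \<longrightarrow> \<Psi> p \<in> H)"
    using openin_cell[OF cov] order_cell_self[OF y]
    by (intro exI[of _ "order_cell n y"]) (simp add: order_cell_def)
next
  fix y V assume "openin (disc_configurations n) V" "y \<in> V"
  from generic_access[OF this] show "\<exists>p. pathin (disc_configurations n) p \<and> p ` {0..1} \<subseteq> V \<and> p 0 = y \<and> p 1 \<in> Collect (generic n)"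
    by (metis mem_Collect_eq)
qed (use p in auto)

end

section \<open>Construction of the gauge on disc configurations\<close>

lemma increasing_permutation_id:
  fixes s :: "nat \<Rightarrow> nat"
  assumes s: "s permutes {..<n}" and mono: "\<And>i j. i < j \<Longrightarrow> j < n \<Longrightarrow> s i < s j"
  shows "s = id"
proof -
  have ge: "i \<le> t i" if "\<And>i j. i < j \<Longrightarrow> j < n \<Longrightarrow> t i < t j" "i < n" for t :: "nat \<Rightarrow> nat" and i :: nat
    using that(2)
  proof (induction i)
    case (Suc i)
    then have "i \<le> t i" "t i < t (Suc i)" using that(1)[of i "Suc i"] by auto
    then show ?case by simp
  qed simp
  have sn: "s i < n \<longleftrightarrow> i < n" for i using permutes_in_image[OF s, of i] by simp
  have im: "inv' s i < inv' s j" if ij: "i < j" "j < n" for i j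
  proof (rule ccontr)
    let ?i = "inv' s i" and ?j = "inv' s j"
    assume "\<not> ?i < ?j"
    moreover have e: "s ?i = i" "s ?j = j" using permutes_inverses(1)[OF s] by auto
    moreover have "?i < n" using sn[of ?i] e ij by simp
    ultimately show False using mono[of ?j ?i] ij by (cases "?i = ?j") auto
  qed
  have inv: "i \<le> inv' s i" if "i < n" for i
    by (rule ge[of "inv' s", OF im that])
  have "s i = i" if i: "i < n" for i
  proof -
    have "i \<le> s i" using ge[OF mono i] .
    moreover have "s i \<le> i" using inv[of "s i"] sn i permutes_inverses(2)[OF s] by simp
    ultimately show ?thesis by simp
  qed
  then show ?thesis using permutes_not_in[OF s] by (auto simp: fun_eq_iff)
qed

text \<open>An orbit meets the chamber at most once, so the representative chosen for the orbit of a
  chamber point is that point itself.\<close>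

lemma chamber_unique:
  assumes x: "x \<in> chamber n" and s: "s permutes {..<n}" "x \<circ> s \<in> chamber n"
  shows "s = id"
proof (rule increasing_permutation_id[OF s(1)])
  fix i j assume ij: "i < j" "j < n"
  have sn: "s i < n" "s j < n" using permutes_in_image[OF s(1)] ij by (metis lessThan_iff less_trans)+
  have lt: "Re (x (s i)) < Re (x (s j))"
    using cell_D(2)[OF s(2), of i j] ij by simp
  show "s i < s j"
  proof (rule ccontr)
    assume "\<not> s i < s j"
    then consider "s i = s j" | "s j < s i" by linarith
    then show False using lt cell_D(2)[OF x sn(2,1)] by cases auto
  qed
qed

text \<open>The gauge at \<open>x\<close> is the value of a path from \<open>x0\<close> to a
  representative of the orbit of \<open>x\<close>. Working with orbits makes it invariant under
  relabelling; a representative in the chamber, reached by a segment, makes segments of the chamber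
  trivial. The last clause admits arbitrary ends: the gauged value of \<open>p\<close> is the value
  of an extension of \<open>p\<close> that runs between relabellings of \<open>x0\<close>, which are
  generic and have gauge one.\<close>

theorem (in disc_rep) gauge_exists:
  obtains g where "g \<in> topspace (disc_configurations n) \<rightarrow> carrier G"
    "\<And>x s. x \<in> topspace (disc_configurations n) \<Longrightarrow> s permutes {..<n} \<Longrightarrow> g (x \<circ> s) = g x"
    "gauged_disc_rep G n (\<lambda>p. g (p 0) \<otimes> \<Psi> p \<otimes> inv (g (p 1)))"
    "\<And>H p. subgroup H G \<Longrightarrow>
       (\<And>k. Suc k < n \<Longrightarrow> gauged_disc_rep.gen n (\<lambda>p. g (p 0) \<otimes> \<Psi> p \<otimes> inv (g (p 1))) k \<in> H) \<Longrightarrow>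
       pathin (disc_configurations n) p \<Longrightarrow> g (p 0) \<otimes> \<Psi> p \<otimes> inv (g (p 1)) \<in> H"
proof -
  let ?F = "disc_configurations n"
  define x0 where "x0 = grid_configuration n id"
  have x0: "x0 \<in> chamber n" unfolding x0_def by (rule grid_configuration_cell) (auto simp: permutes_id)
  have ct: "z \<in> topspace ?F" if "z \<in> chamber n" for z
    using cell_configuration[OF covers_simps(1) that] .
  have "path_connected_space ?F"
    by (rule path_connected_space_plane_configurations) (auto simp: convex_connected)
  then have "\<exists>b. pathin ?F b \<and> b 0 = x0 \<and> b 1 = y" if "y \<in> topspace ?F" for y
    using ct[OF x0] that unfolding path_connected_space_def by blast
  then obtain b0 where b0: "\<And>y. y \<in> topspace ?F \<Longrightarrow> pathin ?F (b0 y) \<and> b0 y 0 = x0 \<and> b0 y 1 = y" by metis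
  define b where "b y = (if y \<in> chamber n then seg n x0 y else b0 y)" for y
  have b: "pathin ?F (b y)" "b y 0 = x0" "b y 1 = y" if "y \<in> topspace ?F" for y
    using b0[OF that] pathin_seg[OF covers_simps(1) x0] seg_ends[OF cell_extensional] x0
    by (auto simp: b_def)
  define orb where "orb x = {x \<circ> s | s. s permutes {..<n}}" for x :: "nat \<Rightarrow> complex"
  \<comment> \<open>A function of the orbit alone, hence unchanged by relabelling; a point of the
    chamber is preferred whenever the orbit has one.\<close>
  define r where "r x = (SOME y. y \<in> orb x \<and> (y \<in> chamber n \<or> orb x \<inter> chamber n = {}))" for x
  have r: "r x \<in> orb x \<and> (r x \<in> chamber n \<or> orb x \<inter> chamber n = {})" for x
  proof -
    have "x \<circ> id \<in> orb x" unfolding orb_def using permutes_id by blast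
    then have "\<exists>y. y \<in> orb x \<and> (y \<in> chamber n \<or> orb x \<inter> chamber n = {})" by blast
    from someI_ex[OF this] show ?thesis unfolding r_def .
  qed
  have orb_permute: "orb (x \<circ> s) = orb x" if s: "s permutes {..<n}" for x s
  proof
    show "orb (x \<circ> s) \<subseteq> orb x"
      unfolding orb_def using s permutes_compose by (fastforce simp: comp_assoc)
    show "orb x \<subseteq> orb (x \<circ> s)"
    proof
      fix z assume "z \<in> orb x"
      then obtain t where t: "t permutes {..<n}" "z = x \<circ> t" by (auto simp: orb_def)
      have "z = (x \<circ> s) \<circ> (inv' s \<circ> t)"
        using t(2) permutes_inv_o(1)[OF s] by (metis comp_assoc id_comp)
      moreover have "inv' s \<circ> t permutes {..<n}" using permutes_compose[OF t(1) permutes_inv[OF s]] .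
      ultimately show "z \<in> orb (x \<circ> s)" unfolding orb_def by blast
    qed
  qed
  have r_permute: "r (x \<circ> s) = r x" if "s permutes {..<n}" for x s
    unfolding r_def orb_permute[OF that] ..
  have r_top: "r x \<in> topspace ?F" if "x \<in> topspace ?F" for x
    using r[of x] configuration_permute[OF that] by (auto simp: orb_def)
  have r_chamber: "r x = x" if "x \<in> chamber n" for x
  proof -
    have "x \<circ> id \<in> orb x" unfolding orb_def using permutes_id by blast
    then have "r x \<in> chamber n" using r[of x] that by auto
    moreover obtain s where s: "s permutes {..<n}" "r x = x \<circ> s" using r[of x] by (auto simp: orb_def)
    ultimately have "s = id" using chamber_unique[OF that s(1)] by simp
    then show ?thesis using s by simp
  qed
  define g where "g x = \<Psi> (b (r x))" for x
  have g: "g x \<in> carrier G" if "x \<in> topspace ?F" for x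
    unfolding g_def using closed[OF b(1)[OF r_top[OF that]]] .
  have g_permute: "g (x \<circ> s) = g x" if "s permutes {..<n}" for x s
    by (simp add: g_def r_permute[OF that])
  have g_chamber: "g x = V x0 x" if "x \<in> chamber n" for x
    using that by (simp add: g_def r_chamber b_def V_def)
  let ?\<Psi> = "\<lambda>p. g (p 0) \<otimes> \<Psi> p \<otimes> inv (g (p 1))"
  interpret g: path_rep G ?F ?\<Psi> using g by (intro gauge) auto
  interpret g: disc_rep G n ?\<Psi>
  proof
    fix s p assume s: "s permutes {..<n}" "pathin ?F p"
    show "g (p 0 \<circ> s) \<otimes> \<Psi> (\<lambda>t. p t \<circ> s) \<otimes> inv (g (p 1 \<circ> s)) = g (p 0) \<otimes> \<Psi> p \<otimes> inv (g (p 1))"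
      by (simp add: g_permute[OF s(1)] rep_permute[OF s])
  qed
  interpret g: gauged_disc_rep G n ?\<Psi>
  proof
    fix x y assume xy: "x \<in> chamber n" "y \<in> chamber n"
    note c = covers_simps(1)[of n "\<lambda>_ _. False"]
    have "g.V x y = V x0 x \<otimes> V x y \<otimes> inv (V x0 y)"
      unfolding g.V_def using seg_ends[OF cell_extensional] xy by (simp add: g_chamber V_def)
    also have "\<dots> = \<one>"
      using V_trans[OF c x0 xy] V_closed[OF c x0 xy(2)] by simp
    finally show "g.V x y = \<one>" .
  qed
  have gx0: "g x0 = \<one>" using g_chamber[OF x0] V_refl[OF covers_simps(1) x0] by simp
  have main: "?\<Psi> p \<in> H" if H: "subgroup H G" and gens: "\<And>k. Suc k < n \<Longrightarrow> g.gen k \<in> H" and p: "pathin ?F p" for H p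
  proof -
    have pt: "p 0 \<in> topspace ?F" "p 1 \<in> topspace ?F" using pathin_top[OF p] by auto
    obtain s where s: "s permutes {..<n}" "r (p 0) = p 0 \<circ> s" using r[of "p 0"] by (auto simp: orb_def)
    obtain s' where s': "s' permutes {..<n}" "r (p 1) = p 1 \<circ> s'" using r[of "p 1"] by (auto simp: orb_def)
    \<comment> \<open>Relabelling \<open>p\<close> by \<open>s\<close> makes it start at
      \<open>r (p 0)\<close>; relabelling the path to \<open>r (p 1)\<close> by \<open>u\<close>
      makes it end at \<open>p 1 \<circ> s\<close>. So the three paths can be joined.\<close>
    define u where "u = inv' s' \<circ> s"
    have u: "u permutes {..<n}" unfolding u_def by (rule permutes_compose[OF s(1) permutes_inv[OF s'(1)]])
    have ru: "r (p 1) \<circ> u = p 1 \<circ> s"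
      unfolding u_def s'(2) using permutes_inv_o(1)[OF s'(1)] by (metis comp_assoc comp_id)
    let ?a = "b (r (p 0))" and ?p = "\<lambda>t. p t \<circ> s" and ?c = "\<lambda>t. b (r (p 1)) t \<circ> u"
    have path: "pathin ?F ?a" "pathin ?F ?p" "pathin ?F ?c"
      using b(1)[OF r_top[OF pt(1)]] pathin_continuous_map[OF p continuous_map_permute[OF s(1)]]
        pathin_continuous_map[OF b(1)[OF r_top[OF pt(2)]] continuous_map_permute[OF u]] by auto
    have ends: "?a 0 = x0" "?a 1 = p 0 \<circ> s" "?c 0 = x0 \<circ> u" "?c 1 = p 1 \<circ> s"
      using b(2,3)[OF r_top[OF pt(1)]] b(2,3)[OF r_top[OF pt(2)]] s(2) ru by simp_all
    have rc: "pathin ?F (\<lambda>t. ?c (1 - t))" using path(3) by (rule pathin_reverse)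
    have j: "pathin ?F (loop_join ?p (\<lambda>t. ?c (1 - t)))"
      by (rule pathin_loop_join[OF path(2) rc]) (use ends in simp)
    let ?P = "loop_join ?a (loop_join ?p (\<lambda>t. ?c (1 - t)))"
    have P: "pathin ?F ?P" by (rule pathin_loop_join[OF path(1) j]) (use ends in simp)
    have pc: "\<Psi> ?p = \<Psi> p" "\<Psi> ?c = \<Psi> (b (r (p 1)))"
      using rep_permute[OF s(1) p] rep_permute[OF u b(1)[OF r_top[OF pt(2)]]] .
    have j1: "\<Psi> ?P = \<Psi> ?a \<otimes> \<Psi> (loop_join ?p (\<lambda>t. ?c (1 - t)))"
      by (rule join[OF path(1) j]) (use ends in simp)
    have j2: "\<Psi> (loop_join ?p (\<lambda>t. ?c (1 - t))) = \<Psi> p \<otimes> inv (\<Psi> (b (r (p 1))))"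
      unfolding pc[symmetric] rep_reverse[OF path(3), symmetric]
      by (rule join[OF path(2) rc]) (use ends in simp)
    have "\<Psi> ?P = ?\<Psi> p"
      unfolding j1 j2 using g[OF pt(1)] g[OF pt(2)] closed[OF p] by (simp add: g_def m_assoc)
    moreover have "?\<Psi> ?P = \<Psi> ?P"
      using ends gx0 g_permute[OF u, of x0] closed[OF P] by simp
    moreover have "generic n x0" 
      using ct[OF x0] unfolding generic_def inj_on_def x0_def grid_configuration_def
      by (auto simp: grid_def)
    then have gP: "generic n (?P 0)" "generic n (?P 1)"
    proof -
      assume gx: "generic n x0"
      then show "generic n (?P 0)" using ends by simp
      have "inj_on (\<lambda>i. Re (x0 (u i))) {..<n}"
        using gx permutes_inj[OF u] permutes_in_image[OF u] unfolding generic_def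
        by (auto simp: inj_on_def inj_def)
      then show "generic n (?P 1)"
        using ends configuration_permute[OF ct[OF x0] u] unfolding generic_def by simp
    qed
    have "?\<Psi> ?P \<in> H" by (rule g.disc_generated[OF H gens P gP])
    ultimately show ?thesis by simp
  qed
  show thesis
    by (rule that[of g]) (use g g_permute g.gauged_disc_rep_axioms main in auto)
qed

section \<open>Local structure of a glued polygon\<close>

lemma dist_cis: "dist (cis x) (cis y) = cmod (cis (x - y) - 1)"
proof -
  have "cis x - cis y = cis y * (cis (x - y) - 1)"
    by (simp add: algebra_simps cis_mult)
  then show ?thesis by (simp add: dist_norm norm_mult)
qed

lemma cmod_cis_minus_one_minus: "cmod (cis (- x) - 1) = cmod (cis x - 1)"
proof -
  have "cis (- x) - 1 = cnj (cis x - 1)" by (simp add: cis_cnj)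
  then show ?thesis by (simp only: complex_mod_cnj)
qed

lemma norm_polygon_edge [simp]: "cmod (polygon_edge N i t) = 1"
  by (simp add: polygon_edge_def)

lemma dist_polygon_edge:
  "dist (polygon_edge N i a) (polygon_edge N i b) = cmod (cis (2 * pi * (a - b) / real N) - 1)"
proof -
  have "2 * pi * (real i + a) / real N - 2 * pi * (real i + b) / real N = 2 * pi * (a - b) / real N"
    by (simp add: diff_divide_distrib[symmetric] algebra_simps)
  then show ?thesis by (simp only: polygon_edge_def dist_cis)
qed

lemma dist_polygon_edge_reverse:
  "dist (polygon_edge N i (1 - a)) (polygon_edge N i (1 - b)) = dist (polygon_edge N j a) (polygon_edge N j b)"
proof -
  have "2 * pi * (1 - a - (1 - b)) / real N = - (2 * pi * (a - b) / real N)"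
    by (simp add: algebra_simps minus_divide_left)
  then show ?thesis unfolding dist_polygon_edge by (simp only: cmod_cis_minus_one_minus)
qed

text \<open>The two angles differ by a multiple of \<open>2 * pi\<close>, so \<open>s - t\<close> is
  an integer. Within the unit interval a nonzero difference occurs only at corners, where one
  parameter is 0 and the other is 1.\<close>

lemma polygon_edge_eq:
  assumes N: "0 < N" and eq: "polygon_edge N i t = polygon_edge N j s" and ts: "t \<in> {0..1}" "s \<in> {0..1}"
  shows "s = t \<or> s = 1 - t"
proof -
  have "cos (2 * pi * (real i + t) / real N) = cos (2 * pi * (real j + s) / real N)"
    "sin (2 * pi * (real i + t) / real N) = sin (2 * pi * (real j + s) / real N)"
    using arg_cong[OF eq, of Re] arg_cong[OF eq, of Im] by (simp_all add: polygon_edge_def)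
  then obtain k :: int where k: "2 * pi * (real i + t) / real N = 2 * pi * (real j + s) / real N + 2 * pi * k"
    using sin_cos_eq_iff by metis
  have "(2 * pi) * ((real i + t) / real N) = (2 * pi) * ((real j + s) / real N + k)"
    using k by (simp add: algebra_simps)
  then have "(real i + t) / real N = (real j + s) / real N + k"
    by (simp only: mult_cancel_left) simp
  then have "real i + t = real j + s + k * real N"
    using N by (simp add: field_simps)
  then have "s - t = of_int (int i - int j - k * int N)" by simp
  moreover have "\<bar>s - t\<bar> \<le> 1" using ts by auto
  ultimately have "\<bar>int i - int j - k * int N\<bar> \<le> 1"
    by (metis of_int_abs of_int_le_1_iff)
  then have "int i - int j - k * int N \<in> {-1, 0, 1}" by auto
  then have "s - t \<in> {-1, 0, 1}" using \<open>s - t = _\<close> by force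
  then show ?thesis using ts by auto
qed

lemma edge_pairing_sphere:
  assumes "(z, z') \<in> (edge_pairing w)\<^sup>+"
  shows "cmod z = 1 \<and> cmod z' = 1"
  using assms by (induction rule: trancl_induct) (auto simp: edge_pairing_def)

lemma polygon_gluing_interior:
  assumes "cmod z < 1" "(z, z') \<in> polygon_gluing w \<or> (z', z) \<in> polygon_gluing w"
  shows "z' = z"
  using assms edge_pairing_sphere[of z z' w] edge_pairing_sphere[of z' z w]
  by (auto simp: polygon_gluing_def)

text \<open>A pairing takes the parameter \<open>t\<close> to \<open>t\<close> or
  \<open>1 - t\<close>, and rereading a corner as an end of another edge does the same. Chains of
  pairings thus stay in the set \<open>T\<close>, with two parameters per edge; this makes gluing
  classes finite.\<close>

lemma polygon_gluing_edge:
  assumes i: "i < length w" and t: "t \<in> {0..1}" and g: "(polygon_edge (length w) i t, z) \<in> polygon_gluing w"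
  obtains j s where "j < length w" "z = polygon_edge (length w) j s" "s \<in> {t, 1 - t}"
proof -
  let ?N = "length w"
  have w: "w \<noteq> []" using i by auto
  define T where "T = {polygon_edge ?N j s | j s. j < ?N \<and> s \<in> {t, 1 - t}}"
  have step: "y' \<in> T" if yy: "(y, y') \<in> edge_pairing w" "y \<in> T" for y y'
  proof -
    from yy(1) obtain j k s where jk: "j < ?N" "k < ?N" "s \<in> {0..1}" "y = polygon_edge ?N j s"
      "y' = polygon_edge ?N k (if snd (w ! j) = snd (w ! k) then s else 1 - s)"
      by (auto simp: edge_pairing_def)
    obtain l r where "y = polygon_edge ?N l r" "r \<in> {t, 1 - t}" using yy(2) by (auto simp: T_def)
    moreover have "r \<in> {0..1}" using calculation t by auto
    ultimately have "s \<in> {t, 1 - t}" using polygon_edge_eq[of ?N l r j s] jk w by auto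
    then have "(if snd (w ! j) = snd (w ! k) then s else 1 - s) \<in> {t, 1 - t}" by auto
    then show ?thesis unfolding T_def jk(5) using jk(2) by blast
  qed
  have self: "polygon_edge ?N i t \<in> T" using i by (auto simp: T_def)
  have "z \<in> T" if "(polygon_edge ?N i t, z) \<in> (edge_pairing w)\<^sup>+"
    using that by (induction rule: trancl_induct) (use step self in blast)+
  then have "z \<in> T" using g self by (auto simp: polygon_gluing_def)
  then show thesis using that by (auto simp: T_def)
qed

lemma finite_gluing_class: "finite {z'. (z, z') \<in> polygon_gluing w}"
proof (cases "\<exists>i t. i < length w \<and> t \<in> {0..1} \<and> z = polygon_edge (length w) i t")
  case True
  then obtain i t where it: "i < length w" "t \<in> {0..1}" "z = polygon_edge (length w) i t" by blast
  have "{z'. (z, z') \<in> polygon_gluing w} \<subseteq> (\<lambda>(j, s). polygon_edge (length w) j s) ` ({..<length w} \<times> {t, 1 - t})"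
  proof
    fix z' assume "z' \<in> {z'. (z, z') \<in> polygon_gluing w}"
    then have g: "(polygon_edge (length w) i t, z') \<in> polygon_gluing w" using it(3) by simp
    obtain j s where "j < length w" "z' = polygon_edge (length w) j s" "s \<in> {t, 1 - t}"
      by (rule polygon_gluing_edge[OF it(1,2) g])
    then show "z' \<in> (\<lambda>(j, s). polygon_edge (length w) j s) ` ({..<length w} \<times> {t, 1 - t})" by force
  qed
  then show ?thesis by (rule finite_subset) simp
next
  case False
  have "(z, y) \<notin> edge_pairing w" for y using False by (auto simp: edge_pairing_def)
  then have "(z, y) \<notin> (edge_pairing w)\<^sup>+" for y by (meson tranclD)
  then have "{z'. (z, z') \<in> polygon_gluing w} \<subseteq> {z}" by (auto simp: polygon_gluing_def)
  then show ?thesis by (rule finite_subset) simp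
qed

text \<open>\<open>X\<close> comes with its own quotient map from the disc, so that any homeomorphic
  copy of the glued polygon is covered. At least two edges keep the angle spanned by an edge at most
  pi.\<close>

locale polygon_space =
  fixes w :: "(nat \<times> bool) list" and X :: "'a topology" and q :: "complex \<Rightarrow> 'a"
  assumes len: "2 \<le> length w"
    and quot: "quotient_map (top_of_set (cball 0 1)) X q"
    and q_eq: "\<And>z z'. z \<in> cball 0 1 \<Longrightarrow> z' \<in> cball 0 1 \<Longrightarrow> q z = q z' \<longleftrightarrow> (z, z') \<in> polygon_gluing w"
begin

abbreviation edge :: "nat \<Rightarrow> real \<Rightarrow> complex" where
  "edge \<equiv> polygon_edge (length w)"

definition partner :: "nat \<Rightarrow> nat \<Rightarrow> real \<Rightarrow> real" where
  "partner i j t = (if snd (w ! i) = snd (w ! j) then t else 1 - t)"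

definition paired :: "nat \<Rightarrow> nat \<Rightarrow> bool" where
  "paired i j \<longleftrightarrow> i < length w \<and> j < length w \<and> fst (w ! i) = fst (w ! j)"

definition fib :: "'a \<Rightarrow> complex set" where
  "fib v = {c \<in> cball 0 1. q c = v}"

definition near :: "'a \<Rightarrow> real \<Rightarrow> complex set" where
  "near v \<epsilon> = {z \<in> cball 0 1. \<exists>c\<in>fib v. dist z c < \<epsilon>}"

definition nb :: "'a \<Rightarrow> real \<Rightarrow> 'a set" where
  "nb v \<epsilon> = q ` near v \<epsilon>"

text \<open>The bound 1/2 keeps \<open>z / c\<close> in the right half plane for \<open>z\<close>
  near a boundary point \<open>c\<close>. The separation by twice the radius makes the fibre point
  near a given \<open>z\<close> unique. Finally, either the disc around the single interior point
  stays inside the polygon, or the disc around each boundary point meets only those edges on which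
  that point lies.\<close>

definition good_radius :: "'a \<Rightarrow> real \<Rightarrow> bool" where
  "good_radius v \<delta> \<longleftrightarrow> 0 < \<delta> \<and> \<delta> \<le> 1/2 \<and> (\<forall>c\<in>fib v. \<forall>c'\<in>fib v. c \<noteq> c' \<longrightarrow> 2 * \<delta> \<le> dist c c') \<and>
     ((\<exists>c. fib v = {c} \<and> cmod c + \<delta> \<le> 1) \<or>
      (\<forall>c\<in>fib v. cmod c = 1 \<and>
         (\<forall>i<length w. \<forall>t\<in>{0..1}. dist c (edge i t) < \<delta> \<longrightarrow> (\<exists>s\<in>{0..1}. c = edge i s))))"

lemma topspace_X: "topspace X = q ` cball 0 1"
  using quotient_imp_surjective_map[OF quot] by simp

lemma edge_cball: "edge i t \<in> cball 0 1"
  by simp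

lemma edge_pairing_iff:
  "(z, z') \<in> edge_pairing w \<longleftrightarrow> (\<exists>i j t. paired i j \<and> t \<in> {0..1} \<and> z = edge i t \<and> z' = edge j (partner i j t))"
  unfolding edge_pairing_def paired_def partner_def by blast

lemma partner_unit: "t \<in> {0..1} \<Longrightarrow> partner i j t \<in> {0..1}"
  by (auto simp: partner_def)

lemma q_edge: "paired i j \<Longrightarrow> t \<in> {0..1} \<Longrightarrow> q (edge j (partner i j t)) = q (edge i t)"
proof -
  assume "paired i j" "t \<in> {0..1}"
  then have "(edge i t, edge j (partner i j t)) \<in> edge_pairing w" using edge_pairing_iff by blast
  then have "(edge i t, edge j (partner i j t)) \<in> polygon_gluing w" by (auto simp: polygon_gluing_def)
  then show ?thesis 
    using q_eq[OF edge_cball[of i t] edge_cball[of j "partner i j t"]] by simp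
qed

lemma q_interior:
  assumes "cmod z < 1" "z' \<in> cball 0 1" "q z = q z'"
  shows "z' = z"
proof -
  have "(z, z') \<in> polygon_gluing w" using q_eq[of z z'] assms by simp
  then show ?thesis using polygon_gluing_interior[OF assms(1)] by blast
qed

lemma finite_fib: "finite (fib v)"
proof (cases "fib v = {}")
  case False
  then obtain c where c: "c \<in> cball 0 1" "q c = v" by (auto simp: fib_def)
  have "(c, x) \<in> polygon_gluing w" if "x \<in> fib v" for x
    using q_eq[OF c(1), of x] that c(2) by (simp add: fib_def)
  then have "fib v \<subseteq> {z'. (c, z') \<in> polygon_gluing w}" by blast
  then show ?thesis using finite_gluing_class finite_subset by blast
qed simp

lemma fib_nonempty: "v \<in> topspace X \<Longrightarrow> fib v \<noteq> {}"
  by (auto simp: topspace_X fib_def)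

section \<open>Saturated neighbourhoods and the Hausdorff property\<close>

lemma good_radius_mono: "good_radius v \<delta> \<Longrightarrow> 0 < \<epsilon> \<Longrightarrow> \<epsilon> \<le> \<delta> \<Longrightarrow> good_radius v \<epsilon>"
proof -
  assume g: "good_radius v \<delta>" and \<epsilon>: "0 < \<epsilon>" "\<epsilon> \<le> \<delta>"
  have "\<delta> \<le> 1/2" using g by (simp add: good_radius_def)
  then have 1: "\<epsilon> \<le> 1/2" using \<epsilon> by simp
  have 2: "2 * \<epsilon> \<le> dist c c'" if "c \<in> fib v" "c' \<in> fib v" "c \<noteq> c'" for c c'
  proof -
    have "2 * \<delta> \<le> dist c c'" using g that unfolding good_radius_def by blast
    then show ?thesis using \<epsilon> by simp
  qed
  have "(\<exists>c. fib v = {c} \<and> cmod c + \<delta> \<le> 1) \<or> (\<forall>c\<in>fib v. cmod c = 1 \<and>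
         (\<forall>i<length w. \<forall>t\<in>{0..1}. dist c (edge i t) < \<delta> \<longrightarrow> (\<exists>s\<in>{0..1}. c = edge i s)))"
    using g by (simp add: good_radius_def)
  then have "(\<exists>c. fib v = {c} \<and> cmod c + \<epsilon> \<le> 1) \<or> (\<forall>c\<in>fib v. cmod c = 1 \<and>
         (\<forall>i<length w. \<forall>t\<in>{0..1}. dist c (edge i t) < \<epsilon> \<longrightarrow> (\<exists>s\<in>{0..1}. c = edge i s)))"
  proof
    assume "\<exists>c. fib v = {c} \<and> cmod c + \<delta> \<le> 1"
    then obtain c where "fib v = {c}" "cmod c + \<delta> \<le> 1" by blast
    then have "fib v = {c} \<and> cmod c + \<epsilon> \<le> 1" using \<epsilon> by simp
    then show ?thesis by blast
  next
    assume *: "\<forall>c\<in>fib v. cmod c = 1 \<and>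
         (\<forall>i<length w. \<forall>t\<in>{0..1}. dist c (edge i t) < \<delta> \<longrightarrow> (\<exists>s\<in>{0..1}. c = edge i s))"
    show ?thesis
    proof (intro disjI2 ballI conjI allI impI)
      fix c i t assume "c \<in> fib v" "i < length w" "t \<in> {0..1}" "dist c (edge i t) < \<epsilon>"
      moreover from this have "dist c (edge i t) < \<delta>" using \<epsilon> by simp
      ultimately show "\<exists>s\<in>{0..1}. c = edge i s" using * by blast
    qed (use * in blast)
  qed
  then show "good_radius v \<epsilon>" using \<epsilon>(1) 1 2 unfolding good_radius_def by blast
qed

lemma finite_lower_bound:
  assumes "finite S" "\<And>x. x \<in> S \<Longrightarrow> 0 < (f x :: real)"
  obtains \<delta> where "0 < \<delta>" "\<And>x. x \<in> S \<Longrightarrow> \<delta> \<le> f x"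
proof
  show "0 < Min (insert 1 (f ` S))" using assms by (subst Min_gr_iff) auto
  show "Min (insert 1 (f ` S)) \<le> f x" if "x \<in> S" for x using assms(1) that by simp
qed

text \<open>Finitely many positive bounds: the distances between points of the finite fibre, and the
  distances of its points from the compact edges that do not contain them.\<close>

lemma good_radius_exists:
  assumes v: "v \<in> topspace X"
  obtains \<delta> where "good_radius v \<delta>"
proof -
  obtain d1 where d1: "0 < d1" "\<And>p. p \<in> {p \<in> fib v \<times> fib v. fst p \<noteq> snd p} \<Longrightarrow> d1 \<le> dist (fst p) (snd p)"
  proof (rule finite_lower_bound[of "{p \<in> fib v \<times> fib v. fst p \<noteq> snd p}" "\<lambda>p. dist (fst p) (snd p)"])
    show "finite {p \<in> fib v \<times> fib v. fst p \<noteq> snd p}" using finite_fib[of v] by simp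
  qed auto
  have d1': "d1 \<le> dist c c'" if "c \<in> fib v" "c' \<in> fib v" "c \<noteq> c'" for c c'
    using d1(2)[of "(c, c')"] that by simp
  show thesis
  proof (cases "\<exists>c\<in>fib v. cmod c < 1")
    case True
    then obtain c where c: "c \<in> fib v" "cmod c < 1" by blast
    have "fib v = {c}" using c q_interior[OF c(2)] by (auto simp: fib_def)
    moreover define \<delta> where "\<delta> = min (1/2) (1 - cmod c)"
    ultimately have "good_radius v \<delta>" using c unfolding good_radius_def by (auto simp: min_def)
    then show thesis by (rule that)
  next
    case False
    then have c1: "cmod c = 1" if "c \<in> fib v" for c using that by (force simp: fib_def)
    define arc where "arc i = edge i ` {0..1}" for i
    have arc: "compact (arc i)" "arc i \<noteq> {}" for i
    proof -
      have "continuous_on {0..1} (edge i)" unfolding polygon_edge_def by (intro continuous_intros) (use len in auto)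
      then show "compact (arc i)" unfolding arc_def by (rule compact_continuous_image) simp
      show "arc i \<noteq> {}" by (simp add: arc_def)
    qed
    obtain d2 where d2: "0 < d2" "\<And>p. p \<in> {p \<in> fib v \<times> {..<length w}. fst p \<notin> arc (snd p)} \<Longrightarrow> d2 \<le> infdist (fst p) (arc (snd p))"
    proof (rule finite_lower_bound[of "{p \<in> fib v \<times> {..<length w}. fst p \<notin> arc (snd p)}" "\<lambda>p. infdist (fst p) (arc (snd p))"])
      show "finite {p \<in> fib v \<times> {..<length w}. fst p \<notin> arc (snd p)}" using finite_fib[of v] by simp
      show "0 < infdist (fst p) (arc (snd p))" if "p \<in> {p \<in> fib v \<times> {..<length w}. fst p \<notin> arc (snd p)}" for p
        using that arc by (intro infdist_pos_not_in_closed compact_imp_closed) auto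
    qed auto
    have d2': "\<exists>s\<in>{0..1}. c = edge i s" if "c \<in> fib v" "i < length w" "t \<in> {0..1}" "dist c (edge i t) < d2" for c i t
    proof (rule ccontr)
      assume "\<not> (\<exists>s\<in>{0..1}. c = edge i s)"
      then have "c \<notin> arc i" by (auto simp: arc_def)
      then have "d2 \<le> infdist c (arc i)" using d2(2)[of "(c, i)"] that by simp
      also have "\<dots> \<le> dist c (edge i t)" using that by (intro infdist_le) (auto simp: arc_def)
      finally show False using that by simp
    qed
    define \<delta> where "\<delta> = min (1/2) (min (d1/2) d2)"
    have \<delta>: "0 < \<delta>" "\<delta> \<le> 1/2" "2 * \<delta> \<le> d1" "\<delta> \<le> d2" using d1(1) d2(1) by (auto simp: \<delta>_def)
    have "good_radius v \<delta>"
      unfolding good_radius_def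
    proof (intro conjI \<delta>(1,2) ballI impI disjI2 allI)
      show "2 * \<delta> \<le> dist c c'" if "c \<in> fib v" "c' \<in> fib v" "c \<noteq> c'" for c c'
        using d1'[OF that] \<delta>(3) by simp
      show "\<exists>s\<in>{0..1}. c = edge i s" if "c \<in> fib v" "i < length w" "t \<in> {0..1}" "dist c (edge i t) < \<delta>" for c i t
        using d2'[OF that(1,2,3)] that(4) \<delta>(4) by simp
    qed (use c1 in auto)
    then show thesis by (rule that)
  qed
qed

text \<open>Within a good radius of \<open>c\<close>, a boundary point \<open>z\<close> lies on an
  edge through \<open>c\<close>, and gluing is isometric along edges. So the partner of
  \<open>z\<close> is as far from the corresponding partner of \<open>c\<close> as \<open>z\<close>
  is from \<open>c\<close>.\<close>

lemma near_pairing: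
  assumes g: "good_radius v \<epsilon>" and c: "c \<in> fib v" and z: "dist z c < \<epsilon>" "(z, z') \<in> edge_pairing w"
  obtains i j t s where "paired i j" "t \<in> {0..1}" "s \<in> {0..1}" "z = edge i t" "z' = edge j (partner i j t)"
    "c = edge i s" "edge j (partner i j s) \<in> fib v" "dist z' (edge j (partner i j s)) < \<epsilon>"
proof -
  obtain i j t where ij: "paired i j" "t \<in> {0..1}" "z = edge i t" "z' = edge j (partner i j t)"
    using z(2) edge_pairing_iff by blast
  have "\<not> (\<exists>c. fib v = {c} \<and> cmod c + \<epsilon> \<le> 1)"
  proof
    assume "\<exists>c. fib v = {c} \<and> cmod c + \<epsilon> \<le> 1"
    then have "cmod c + \<epsilon> \<le> 1" using c by auto
    moreover have "cmod z = 1" using ij by simp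
    moreover have "cmod z \<le> cmod c + dist z c" by (metis dist_norm norm_triangle_sub)
    ultimately show False using z(1) by simp
  qed
  moreover have "dist c (edge i t) < \<epsilon>" "i < length w" using z(1) ij by (auto simp: dist_commute paired_def)
  ultimately obtain s where s: "s \<in> {0..1}" "c = edge i s"
    using g c ij(2) unfolding good_radius_def by blast
  have "edge j (partner i j s) \<in> fib v"
    using q_edge[OF ij(1) s(1)] s(2) c edge_cball by (auto simp: fib_def)
  moreover have "dist z' (edge j (partner i j s)) = dist z c"
    unfolding ij s partner_def
    using dist_polygon_edge_reverse[of "length w" j t s i] dist_polygon_edge[of "length w" j t s] dist_polygon_edge[of "length w" i t s]
    by simp
  ultimately show thesis using that ij s z(1) by simp
qed

lemma near_pairing_closed:
  assumes g: "good_radius v \<epsilon>" and z: "z \<in> near v \<epsilon>" and zz: "(z, z') \<in> edge_pairing w"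
  shows "z' \<in> near v \<epsilon>"
proof -
  obtain c where c: "c \<in> fib v" "dist z c < \<epsilon>" using z by (auto simp: near_def)
  from near_pairing[OF g c zz] obtain c' where "c' \<in> fib v" "dist z' c' < \<epsilon>" by metis
  moreover have "z' \<in> cball 0 1" using edge_pairing_subset zz by blast
  ultimately show ?thesis by (auto simp: near_def)
qed

lemma near_saturated:
  assumes g: "good_radius v \<epsilon>" and z: "z \<in> near v \<epsilon>" and zz: "z' \<in> cball 0 1" "q z = q z'"
  shows "z' \<in> near v \<epsilon>"
proof -
  have "(z, z') \<in> polygon_gluing w" using q_eq z zz by (auto simp: near_def)
  then consider "z' = z" | "(z, z') \<in> (edge_pairing w)\<^sup>+" by (auto simp: polygon_gluing_def)
  then show ?thesis
  proof cases
    case 2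
    then show ?thesis
      by (induction rule: trancl_induct) (use z near_pairing_closed[OF g] in blast)+
  qed (use z in simp)
qed

lemma near_preimage: "good_radius v \<epsilon> \<Longrightarrow> {z \<in> topspace (top_of_set (cball 0 1)). q z \<in> nb v \<epsilon>} = near v \<epsilon>"
proof (intro equalityI subsetI)
  fix z assume g: "good_radius v \<epsilon>" and "z \<in> {z \<in> topspace (top_of_set (cball 0 1)). q z \<in> nb v \<epsilon>}"
  then obtain z' where "z \<in> cball 0 1" "z' \<in> near v \<epsilon>" "q z' = q z" by (auto simp: nb_def)
  then show "z \<in> near v \<epsilon>" using near_saturated[OF g] by blast
qed (auto simp: nb_def near_def)

lemma openin_near: "openin (top_of_set (cball 0 1)) (near v \<epsilon>)"
proof -
  have "near v \<epsilon> = cball 0 1 \<inter> (\<Union>c\<in>fib v. ball c \<epsilon>)" by (auto simp: near_def dist_commute)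
  moreover have "open (\<Union>c\<in>fib v. ball c \<epsilon>)" by auto
  ultimately show ?thesis by (simp add: openin_open_Int)
qed

lemma openin_nb:
  assumes "good_radius v \<epsilon>"
  shows "openin X (nb v \<epsilon>)"
proof -
  have "nb v \<epsilon> \<subseteq> topspace X" by (auto simp: nb_def near_def topspace_X)
  then have "openin (top_of_set (cball 0 1)) {z \<in> topspace (top_of_set (cball 0 1)). q z \<in> nb v \<epsilon>} \<longleftrightarrow> openin X (nb v \<epsilon>)"
    using quot unfolding quotient_map_def by blast
  then show ?thesis unfolding near_preimage[OF assms] using openin_near by simp
qed

lemma nb_self: "v \<in> topspace X \<Longrightarrow> 0 < \<epsilon> \<Longrightarrow> v \<in> nb v \<epsilon>"
proof -
  assume v: "v \<in> topspace X" "0 < \<epsilon>"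
  then obtain c where c: "c \<in> fib v" using fib_nonempty by blast
  then have "c \<in> near v \<epsilon>" "q c = v" using v(2) by (auto simp: near_def fib_def)
  then show "v \<in> nb v \<epsilon>" unfolding nb_def by blast
qed

lemma nb_mono: "\<epsilon> \<le> \<epsilon>' \<Longrightarrow> nb v \<epsilon> \<subseteq> nb v \<epsilon>'"
  unfolding nb_def near_def by (auto intro!: imageI) (meson less_le_trans)

text \<open>The radius is at most half the distance between the two finite fibres. A common point
  would, by saturation, have a preimage closer than that to both.\<close>

lemma nb_disjoint:
  assumes v: "v \<in> topspace X" "v' \<in> topspace X" "v \<noteq> v'"
  obtains \<delta> where "0 < \<delta>" "good_radius v \<delta>" "good_radius v' \<delta>" "nb v \<delta> \<inter> nb v' \<delta> = {}"
proof -
  obtain d1 where d1: "good_radius v d1" using good_radius_exists[OF v(1)] .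
  obtain d2 where d2: "good_radius v' d2" using good_radius_exists[OF v(2)] .
  have ne: "c \<noteq> c'" if "c \<in> fib v" "c' \<in> fib v'" for c c' using that v(3) by (auto simp: fib_def)
  obtain d3 where d3: "0 < d3" "\<And>p. p \<in> fib v \<times> fib v' \<Longrightarrow> d3 \<le> dist (fst p) (snd p)"
    by (rule finite_lower_bound[of "fib v \<times> fib v'" "\<lambda>p. dist (fst p) (snd p)"]) (use finite_fib ne in auto)
  define \<delta> where "\<delta> = min d1 (min d2 (d3/2))"
  have \<delta>: "0 < \<delta>" "\<delta> \<le> d1" "\<delta> \<le> d2" "2 * \<delta> \<le> d3"
    using d1 d2 d3(1) by (auto simp: \<delta>_def good_radius_def)
  have g: "good_radius v \<delta>" "good_radius v' \<delta>" using d1 d2 \<delta> good_radius_mono by blast+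
  have "nb v \<delta> \<inter> nb v' \<delta> = {}"
  proof (rule ccontr)
    assume "nb v \<delta> \<inter> nb v' \<delta> \<noteq> {}"
    then obtain z z' where z: "z \<in> near v \<delta>" "z' \<in> near v' \<delta>" "q z = q z'" by (auto simp: nb_def)
    then have "z \<in> near v' \<delta>" using near_saturated[OF g(2) z(2), of z] by (auto simp: near_def)
    then obtain c c' where c: "c \<in> fib v" "c' \<in> fib v'" "dist z c < \<delta>" "dist z c' < \<delta>"
      using z(1) by (auto simp: near_def)
    have "dist c c' \<le> dist z c + dist z c'" by (metis dist_commute dist_triangle)
    then show False using c d3(2)[of "(c, c')"] \<delta>(4) by simp
  qed
  then show thesis using that \<delta>(1) g by blast
qed

lemma Hausdorff_X: "Hausdorff_space X"
  unfolding Hausdorff_space_def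
proof (intro allI impI)
  fix x y assume "x \<in> topspace X \<and> y \<in> topspace X \<and> x \<noteq> y"
  then have xy: "x \<in> topspace X" "y \<in> topspace X" "x \<noteq> y" by auto
  from nb_disjoint[OF this] obtain \<delta> where \<delta>: "0 < \<delta>" "good_radius x \<delta>" "good_radius y \<delta>" "nb x \<delta> \<inter> nb y \<delta> = {}" .
  then show "\<exists>U V. openin X U \<and> openin X V \<and> x \<in> U \<and> y \<in> V \<and> disjnt U V"
    using openin_nb nb_self xy by (intro exI[of _ "nb x \<delta>"] exI[of _ "nb y \<delta>"]) (auto simp: disjnt_def)
qed

text \<open>The product of a quotient map with the identity of the compact unit interval is again a
  quotient map. So a homotopy of the saturated set \<open>near v \<epsilon>\<close> that respects
  the fibres of \<open>q\<close> at every time descends.\<close>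

lemma contraction_descends:
  fixes K :: "complex \<times> real \<Rightarrow> complex"
  assumes g: "good_radius v \<epsilon>"
    and K: "continuous_on (near v \<epsilon> \<times> {0..1}) K"
      "\<And>z \<tau>. z \<in> near v \<epsilon> \<Longrightarrow> \<tau> \<in> {0..1} \<Longrightarrow> K (z, \<tau>) \<in> near v \<epsilon>'"
      "\<And>z. z \<in> near v \<epsilon> \<Longrightarrow> K (z, 0) = z" "\<And>z. z \<in> near v \<epsilon> \<Longrightarrow> q (K (z, 1)) = v"
    and compat: "\<And>z z' \<tau>. z \<in> near v \<epsilon> \<Longrightarrow> z' \<in> near v \<epsilon> \<Longrightarrow> \<tau> \<in> {0..1} \<Longrightarrow> q z = q z' \<Longrightarrow>
      q (K (z, \<tau>)) = q (K (z', \<tau>))"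
  obtains h where "continuous_map (prod_topology (subtopology X (nb v \<epsilon>)) (top_of_set {0..1 :: real})) X h"
    "\<And>x. x \<in> nb v \<epsilon> \<Longrightarrow> h (x, 0) = x" "\<And>x. x \<in> nb v \<epsilon> \<Longrightarrow> h (x, 1) = v"
    "\<And>x \<tau>. x \<in> nb v \<epsilon> \<Longrightarrow> \<tau> \<in> {0..1} \<Longrightarrow> h (x, \<tau>) \<in> nb v \<epsilon>'"
proof -
  let ?I = "top_of_set {0..1 :: real}"
  have sub: "near v \<epsilon> \<subseteq> cball 0 1" by (auto simp: near_def)
  have "quotient_map (subtopology (top_of_set (cball 0 1)) (near v \<epsilon>)) (subtopology X (nb v \<epsilon>)) q"
    by (rule quotient_map_restriction[OF quot near_preimage[OF g]]) (use openin_nb[OF g] in blast)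
  then have "quotient_map (top_of_set (near v \<epsilon>)) (subtopology X (nb v \<epsilon>)) q"
    using sub by (simp add: subtopology_subtopology Int_absorb1)
  moreover have "locally_compact_space ?I"
    by (intro compact_imp_locally_compact_space) (simp add: compact_space_subtopology)
  moreover have "Hausdorff_space ?I" by (simp add: Hausdorff_space_subtopology)
  ultimately have Q: "quotient_map (prod_topology (top_of_set (near v \<epsilon>)) ?I) (prod_topology (subtopology X (nb v \<epsilon>)) ?I)
      (\<lambda>(z, \<tau>). (q z, \<tau>))"
    by (intro quotient_map_prod_left) auto
  have K_cball: "K (z, \<tau>) \<in> cball 0 1" if "z \<in> near v \<epsilon>" "\<tau> \<in> {0..1}" for z \<tau>
    using K(2)[OF that] by (simp add: near_def)
  have "continuous_map (top_of_set (near v \<epsilon> \<times> {0..1})) (top_of_set (cball 0 1)) K"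
    using K(1) K_cball by auto
  from continuous_map_compose[OF this quotient_imp_continuous_map[OF quot]]
  have KQ: "continuous_map (prod_topology (top_of_set (near v \<epsilon>)) ?I) X (\<lambda>z. q (K z))"
    by (simp add: o_def subtopology_Times[symmetric] euclidean_product_topology)
  have resp: "q (K x) = q (K y)"
    if "x \<in> topspace (prod_topology (top_of_set (near v \<epsilon>)) ?I)" "y \<in> topspace (prod_topology (top_of_set (near v \<epsilon>)) ?I)"
      "(\<lambda>(z, \<tau>). (q z, \<tau>)) x = (\<lambda>(z, \<tau>). (q z, \<tau>)) y" for x y
  proof -
    obtain z \<tau> z' \<tau>' where "x = (z, \<tau>)" "y = (z', \<tau>')" by (metis prod.exhaust)
    then show ?thesis using that compat[of z z' \<tau>] by auto
  qed
  obtain h where h: "continuous_map (prod_topology (subtopology X (nb v \<epsilon>)) ?I) X h"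
    "\<And>x. x \<in> topspace (prod_topology (top_of_set (near v \<epsilon>)) ?I) \<Longrightarrow> h ((\<lambda>(z, \<tau>). (q z, \<tau>)) x) = q (K x)"
    by (rule quotient_map_lift_exists[OF Q KQ]) (use resp in blast)+
  have hq: "h (q z, \<tau>) = q (K (z, \<tau>))" if "z \<in> near v \<epsilon>" "\<tau> \<in> {0..1}" for z \<tau>
    using h(2)[of "(z, \<tau>)"] that by simp
  show thesis
  proof (rule that[OF h(1)])
    show "h (x, 0) = x" if "x \<in> nb v \<epsilon>" for x using that hq K(3) by (auto simp: nb_def)
    show "h (x, 1) = v" if "x \<in> nb v \<epsilon>" for x using that hq K(4) by (auto simp: nb_def)
    show "h (x, \<tau>) \<in> nb v \<epsilon>'" if "x \<in> nb v \<epsilon>" "\<tau> \<in> {0..1}" for x \<tau>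
      using that hq K(2) by (auto simp: nb_def)
  qed
qed

text \<open>Near a boundary point \<open>c\<close> the neighbourhood is contracted linearly in the coordinate
  \<open>Ln (z / c)\<close>.  This maps the circle to itself, linearly in the parameter of the edges, and hence
  is compatible with the gluing.\<close>

lemma contraction:
  assumes v: "v \<in> topspace X" and \<epsilon>': "0 < \<epsilon>'"
  obtains \<epsilon> h where "0 < \<epsilon>" "\<epsilon> \<le> \<epsilon>'" "good_radius v \<epsilon>"
    "continuous_map (prod_topology (subtopology X (nb v \<epsilon>)) (top_of_set {0..1 :: real})) X h"
    "\<And>x. x \<in> nb v \<epsilon> \<Longrightarrow> h (x, 0) = x" "\<And>x. x \<in> nb v \<epsilon> \<Longrightarrow> h (x, 1) = v"
    "\<And>x \<tau>. x \<in> nb v \<epsilon> \<Longrightarrow> \<tau> \<in> {0..1} \<Longrightarrow> h (x, \<tau>) \<in> nb v \<epsilon>'"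
proof -
  obtain \<delta> where \<delta>: "good_radius v \<delta>" using good_radius_exists[OF v] .
  show thesis
  proof (cases "\<exists>c. fib v = {c} \<and> cmod c + \<delta> \<le> 1")
    case True
    then obtain c where c: "fib v = {c}" "cmod c + \<delta> \<le> 1" by blast
    define \<epsilon> where "\<epsilon> = min \<delta> \<epsilon>'"
    have \<epsilon>: "0 < \<epsilon>" "\<epsilon> \<le> \<delta>" "\<epsilon> \<le> \<epsilon>'" using \<delta> \<epsilon>' by (auto simp: \<epsilon>_def good_radius_def)
    have g: "good_radius v \<epsilon>" using good_radius_mono[OF \<delta> \<epsilon>(1,2)] .
    have qc: "q c = v" using c(1) by (auto simp: fib_def)
    have near: "near v r = cball 0 1 \<inter> ball c r" for r using c(1) by (auto simp: near_def dist_commute)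
    define K where "K p = (1 - snd p) *\<^sub>R fst p + snd p *\<^sub>R c" for p :: "complex \<times> real"
    obtain h where "continuous_map (prod_topology (subtopology X (nb v \<epsilon>)) (top_of_set {0..1 :: real})) X h"
      "\<And>x. x \<in> nb v \<epsilon> \<Longrightarrow> h (x, 0) = x" "\<And>x. x \<in> nb v \<epsilon> \<Longrightarrow> h (x, 1) = v"
      "\<And>x \<tau>. x \<in> nb v \<epsilon> \<Longrightarrow> \<tau> \<in> {0..1} \<Longrightarrow> h (x, \<tau>) \<in> nb v \<epsilon>'"
    proof (rule contraction_descends[OF g, of K \<epsilon>'])
      show "continuous_on (near v \<epsilon> \<times> {0..1}) K" unfolding K_def by (intro continuous_intros)
      show "K (z, \<tau>) \<in> near v \<epsilon>'" if z: "z \<in> near v \<epsilon>" "\<tau> \<in> {0..1}" for z \<tau>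
      proof -
        have "c \<in> near v \<epsilon>" using c(2) \<epsilon>(1) \<delta> by (auto simp: near good_radius_def)
        then have "K (z, \<tau>) \<in> near v \<epsilon>"
          using z convexD[OF convex_Int[OF convex_cball convex_ball], of z 0 1 c \<epsilon> c "1 - \<tau>" \<tau>]
          by (simp add: near K_def)
        then show ?thesis using \<epsilon>(3) by (auto simp: near)
      qed
      show "q (K (z, 1)) = v" for z by (simp add: K_def qc)
      show "q (K (z, \<tau>)) = q (K (z', \<tau>))" if z: "z \<in> near v \<epsilon>" "z' \<in> near v \<epsilon>" "q z = q z'" for z z' \<tau>
      proof -
        have "cmod z < 1"
        proof -
          have "cmod z \<le> cmod c + dist z c" by (metis dist_norm norm_triangle_sub)
          then show ?thesis using z(1) c(2) \<epsilon>(2) by (auto simp: near dist_commute)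
        qed
        then have "z' = z" using q_interior z by (auto simp: near)
        then show ?thesis by simp
      qed
    qed (use that in \<open>auto simp: K_def\<close>)
    then show thesis using that[OF \<epsilon>(1,3) g] by blast
  next
    case False
    then have bd: "cmod c = 1" if "c \<in> fib v" for c using \<delta> that unfolding good_radius_def by blast
    \<comment> \<open>Choice of radii: \<open>\<eta>\<close> keeps exponentials of short numbers
      within \<epsilon>' of 1, and \<open>r\<close> makes the logarithm of \<open>z / c\<close>
      shorter than \<eta>. Scaling the logarithm by \<open>1 - \<tau>\<close> preserves the bound,
      so the contraction stays within \<epsilon>'.\<close>
    have "isCont exp (0::complex)" by simp
    then obtain \<eta> where \<eta>: "0 < \<eta>" "\<And>x::complex. dist x 0 < \<eta> \<Longrightarrow> dist (exp x) (exp 0) < \<epsilon>'"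
      using \<epsilon>' unfolding continuous_at_eps_delta by blast
    have "isCont Ln 1" by (rule continuous_at_Ln) simp
    then obtain r where r: "0 < r" "\<And>u. dist u 1 < r \<Longrightarrow> dist (Ln u) (Ln 1) < \<eta>"
      using \<eta>(1) unfolding continuous_at_eps_delta by blast
    define \<epsilon> where "\<epsilon> = min \<delta> (min \<epsilon>' r)"
    have \<epsilon>: "0 < \<epsilon>" "\<epsilon> \<le> \<delta>" "\<epsilon> \<le> \<epsilon>'" "\<epsilon> \<le> r" "\<epsilon> \<le> 1/2"
      using \<delta> \<epsilon>' r(1) by (auto simp: \<epsilon>_def good_radius_def)
    have g: "good_radius v \<epsilon>" using good_radius_mono[OF \<delta> \<epsilon>(1,2)] .
    \<comment> \<open>The fibre point near \<open>z\<close>; two candidates would be closer to each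
      other than \<open>2 * \<epsilon>\<close>.\<close>
    define ctr where "ctr z = (THE c. c \<in> fib v \<and> dist z c < \<epsilon>)" for z
    have ctr: "ctr z = c" if "c \<in> fib v" "dist z c < \<epsilon>" for z c
      unfolding ctr_def
    proof (rule the_equality)
      fix c' assume c': "c' \<in> fib v \<and> dist z c' < \<epsilon>"
      have "dist c' c \<le> dist z c' + dist z c" by (metis dist_commute dist_triangle)
      then have "\<not> 2 * \<epsilon> \<le> dist c' c" using c' that by simp
      then show "c' = c" using g c' that(1) unfolding good_radius_def by blast
    qed (use that in simp)
    define K where "K p = ctr (fst p) * exp ((1 - snd p) *\<^sub>R Ln (fst p / ctr (fst p)))" for p :: "complex \<times> real"
    have Kc: "K (z, \<tau>) = c * exp ((1 - \<tau>) *\<^sub>R Ln (z / c))" if "c \<in> fib v" "dist z c < \<epsilon>" for z c \<tau>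
      using ctr[OF that] by (simp add: K_def)
    have quotient_near: "dist (z / c) 1 < \<epsilon>" "0 < Re (z / c)" if "c \<in> fib v" "dist z c < \<epsilon>" for z c
    proof -
      have c1: "cmod c = 1" "c \<noteq> 0" using bd[OF that(1)] by auto
      have "z / c - 1 = (z - c) / c" using c1(2) by (simp add: field_simps)
      then show d: "dist (z / c) 1 < \<epsilon>" using that(2) c1 by (simp add: dist_norm norm_divide)
      have "\<bar>Re (z / c) - 1\<bar> \<le> dist (z / c) 1" using abs_Re_le_cmod[of "z / c - 1"] by (simp add: dist_norm)
      then show "0 < Re (z / c)" using d \<epsilon>(5) by linarith
    qed
    have single: "q (K (z', \<tau>)) = q (K (z, \<tau>))"
      if z: "z \<in> near v \<epsilon>" and p: "(z, z') \<in> edge_pairing w" and \<tau>: "\<tau> \<in> {0..1}" for z z' \<tau>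
    proof -
      obtain c where c: "c \<in> fib v" "dist z c < \<epsilon>" using z by (auto simp: near_def)
      obtain i j t s where ij: "paired i j" "t \<in> {0..1}" "s \<in> {0..1}" "z = edge i t" "z' = edge j (partner i j t)"
        "c = edge i s" "edge j (partner i j s) \<in> fib v" "dist z' (edge j (partner i j s)) < \<epsilon>"
        using near_pairing[OF g c p] .
      have lin: "K (edge k a, \<tau>) = edge k (b + (1 - \<tau>) * (a - b))"
        if "edge k b \<in> fib v" "dist (edge k a) (edge k b) < \<epsilon>" "a \<in> {0..1}" "b \<in> {0..1}" for k a b
      proof -
        let ?x = "2 * pi * (a - b) / real (length w)"
        have quot: "edge k a / edge k b = cis ?x"
          unfolding polygon_edge_def cis_divide by (simp add: diff_divide_distrib[symmetric] algebra_simps)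
        \<comment> \<open>An edge spans at most the angle pi, as there are at least two edges. The
          value -pi is excluded afterwards by the positive real part of the quotient, so the
          principal logarithm of \<open>cis ?x\<close> is given by the angle itself, also for words
          with two letters.\<close>
        have "\<bar>?x\<bar> \<le> pi"
        proof -
          have "\<bar>a - b\<bar> \<le> 1" "2 \<le> real (length w)" using that(3,4) len by auto
          then have "\<bar>a - b\<bar> * 2 \<le> 2" by simp
          then have "\<bar>a - b\<bar> * 2 \<le> real (length w)" using \<open>2 \<le> real (length w)\<close> by (rule order_trans)
          then have "pi * (\<bar>a - b\<bar> * 2) \<le> pi * real (length w)" by (intro mult_left_mono) auto
          moreover have "0 < real (length w)" using len by linarith
          ultimately have "pi * (\<bar>a - b\<bar> * 2) / real (length w) \<le> pi" by (simp only: pos_divide_le_eq)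
          moreover have "\<bar>?x\<bar> = pi * (\<bar>a - b\<bar> * 2) / real (length w)" unfolding abs_divide abs_mult by simp
          ultimately show ?thesis by (simp only:)
        qed
        moreover have "0 < cos ?x" using quotient_near(2)[OF that(1,2)] unfolding quot by simp
        then have "?x \<noteq> - pi" using cos_pi cos_minus[of pi] by (metis less_numeral_extra(1) neg_0_less_iff_less not_less_iff_gr_or_eq)
        ultimately have "- pi < ?x" "?x \<le> pi"
          using abs_le_D1[of ?x pi] abs_le_D2[of ?x pi] by linarith+
        then have "- pi < Im (\<i> * of_real ?x)" "Im (\<i> * of_real ?x) \<le> pi"
          by (simp_all only: Im_i_times Re_complex_of_real)
        then have "Ln (cis ?x) = \<i> * of_real ?x" unfolding cis_conv_exp by (rule Ln_exp)
        then have "K (edge k a, \<tau>) = edge k b * exp ((1 - \<tau>) *\<^sub>R (\<i> * of_real ?x))"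
          using Kc[OF that(1,2)] quot by simp
        also have "(1 - \<tau>) *\<^sub>R (\<i> * of_real ?x) = \<i> * of_real ((1 - \<tau>) * ?x)"
          by (simp add: scaleR_conv_of_real)
        also have "edge k b * exp \<dots> = cis (2 * pi * (real k + b) / real (length w) + (1 - \<tau>) * ?x)"
          unfolding polygon_edge_def by (simp only: cis_conv_exp[symmetric] cis_mult)
        also have "2 * pi * (real k + b) / real (length w) + (1 - \<tau>) * ?x =
            2 * pi * (real k + (b + (1 - \<tau>) * (a - b))) / real (length w)"
          by (simp add: add_divide_distrib[symmetric] algebra_simps)
        finally show ?thesis by (simp only: polygon_edge_def)
      qed
      let ?u = "s + (1 - \<tau>) * (t - s)"
      have u: "?u \<in> {0..1}"
      proof -
        have "?u = \<tau> *\<^sub>R s + (1 - \<tau>) *\<^sub>R t" by (simp add: algebra_simps)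
        also have "\<dots> \<in> {0..1}" by (rule convexD) (use ij \<tau> in auto)
        finally show ?thesis .
      qed
      have "K (z, \<tau>) = edge i ?u"
        unfolding ij(4) by (rule lin) (use ij c in auto)
      moreover have "K (z', \<tau>) = edge j (partner i j s + (1 - \<tau>) * (partner i j t - partner i j s))"
        unfolding ij(5) by (rule lin) (use ij partner_unit in auto)
      moreover have "partner i j s + (1 - \<tau>) * (partner i j t - partner i j s) = partner i j ?u"
        by (simp add: partner_def algebra_simps)
      ultimately show ?thesis using q_edge[OF ij(1) u] by simp
    qed
    obtain h where "continuous_map (prod_topology (subtopology X (nb v \<epsilon>)) (top_of_set {0..1 :: real})) X h"
      "\<And>x. x \<in> nb v \<epsilon> \<Longrightarrow> h (x, 0) = x" "\<And>x. x \<in> nb v \<epsilon> \<Longrightarrow> h (x, 1) = v"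
      "\<And>x \<tau>. x \<in> nb v \<epsilon> \<Longrightarrow> \<tau> \<in> {0..1} \<Longrightarrow> h (x, \<tau>) \<in> nb v \<epsilon>'"
    proof (rule contraction_descends[OF g, of K \<epsilon>'])
      \<comment> \<open>On the ball around each fibre point \<open>ctr\<close> is constant, and
        \<open>K\<close> is given there by the explicit formula.\<close>
      have "continuous_on (\<Union>c\<in>fib v. ball c \<epsilon> \<times> UNIV) K"
      proof (rule continuous_on_open_UN)
        fix c assume c: "c \<in> fib v"
        have c0: "c \<noteq> 0" using bd[OF c] by auto
        have pos: "fst p / c \<notin> \<real>\<^sub>\<le>\<^sub>0" if "p \<in> ball c \<epsilon> \<times> (UNIV :: real set)" for p
        proof -
          have "0 < Re (fst p / c)" using that quotient_near(2)[OF c] by (auto simp: dist_commute)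
          then show ?thesis by (auto simp: complex_nonpos_Reals_iff)
        qed
        have "continuous_on (ball c \<epsilon> \<times> UNIV) (\<lambda>p. c * exp ((1 - snd p) *\<^sub>R Ln (fst p / c)))"
          by (intro continuous_intros ballI) (use c0 pos in auto)
        then show "continuous_on (ball c \<epsilon> \<times> UNIV) K"
        proof (rule continuous_on_eq)
          fix p assume "p \<in> ball c \<epsilon> \<times> (UNIV :: real set)"
          then show "c * exp ((1 - snd p) *\<^sub>R Ln (fst p / c)) = K p"
            using Kc[OF c, of "fst p" "snd p"] by (auto simp: dist_commute)
        qed
      qed (simp add: open_Times)
      then show "continuous_on (near v \<epsilon> \<times> {0..1}) K"
        by (rule continuous_on_subset) (auto simp: near_def dist_commute)
    next
      fix z and \<tau> :: real assume z: "z \<in> near v \<epsilon>" and \<tau>: "\<tau> \<in> {0..1}"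
      obtain c where c: "c \<in> fib v" "dist z c < \<epsilon>" using z by (auto simp: near_def)
      have zc: "z \<noteq> 0" "cmod (z / c) \<le> 1" "z / c \<noteq> 0"
        using quotient_near(2)[OF c] z bd[OF c(1)] by (auto simp: near_def norm_divide)
      let ?l = "Ln (z / c)"
      \<comment> \<open>In the closed disc the logarithm of \<open>z / c\<close> has real part at
        most 0. Scaling by \<open>1 - \<tau>\<close> preserves this, so the contraction never leaves
        the disc.\<close>
      have "Re ?l \<le> 0" using zc(2,3) by (simp add: Re_Ln del: norm_divide)
      then have "exp ((1 - \<tau>) * Re ?l) \<le> 1" using \<tau> by (simp add: mult_nonneg_nonpos)
      then have "cmod (K (z, \<tau>)) \<le> 1" using Kc[OF c] bd[OF c(1)] by (simp add: norm_mult)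
      moreover have "dist (K (z, \<tau>)) c < \<epsilon>'"
      proof -
        have "dist ?l (Ln 1) < \<eta>" by (rule r(2)) (use quotient_near(1)[OF c] \<epsilon>(4) in simp)
        then have "cmod ?l < \<eta>" by simp
        moreover have "cmod ((1 - \<tau>) *\<^sub>R ?l) \<le> 1 * cmod ?l"
          unfolding norm_scaleR using \<tau> by (intro mult_right_mono) auto
        ultimately have "dist ((1 - \<tau>) *\<^sub>R ?l) 0 < \<eta>" by simp
        then have "dist (exp ((1 - \<tau>) *\<^sub>R ?l)) (exp 0) < \<epsilon>'" by (rule \<eta>(2))
        moreover have "K (z, \<tau>) - c = c * (exp ((1 - \<tau>) *\<^sub>R ?l) - 1)" using Kc[OF c] by (simp add: algebra_simps)
        ultimately show ?thesis using bd[OF c(1)] by (simp add: dist_norm norm_mult)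
      qed
      ultimately show "K (z, \<tau>) \<in> near v \<epsilon>'" using c(1) by (auto simp: near_def)
    next
      fix z assume "z \<in> near v \<epsilon>"
      then obtain c where c: "c \<in> fib v" "dist z c < \<epsilon>" by (auto simp: near_def)
      have "z / c \<noteq> 0" "c \<noteq> 0" using quotient_near(2)[OF c] by auto
      then show "K (z, 0) = z" using Kc[OF c, of 0] by simp
      show "q (K (z, 1)) = v" using Kc[OF c, of 1] c(1) by (simp add: fib_def)
    next
      fix z z' and \<tau> :: real
      assume z: "z \<in> near v \<epsilon>" "z' \<in> near v \<epsilon>" and \<tau>: "\<tau> \<in> {0..1}" and qz: "q z = q z'"
      have "(z, z') \<in> polygon_gluing w" using q_eq z qz by (auto simp: near_def)
      then consider "z' = z" | "(z, z') \<in> (edge_pairing w)\<^sup>+" by (auto simp: polygon_gluing_def)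
      then show "q (K (z, \<tau>)) = q (K (z', \<tau>))"
      proof cases
        case 2
        then have "z' \<in> near v \<epsilon> \<and> q (K (z', \<tau>)) = q (K (z, \<tau>))"
        proof (induction rule: trancl_induct)
          case (base y)
          then show ?case using near_pairing_closed[OF g z(1)] single[OF z(1) _ \<tau>] by blast
        next
          case (step y x)
          then show ?case using near_pairing_closed[OF g, of y x] single[of y x, OF _ _ \<tau>] by metis
        qed
        then show ?thesis by simp
      qed simp
    qed (rule that)
    then show thesis using that[OF \<epsilon>(1,3) g] by blast
  qed
qed

end

section \<open>Edge crossings\<close>

context polygon_space
begin

lemma continuous_map_q_comp:
  assumes "continuous_on A f" "f \<in> A \<rightarrow> cball 0 1"
  shows "continuous_map (top_of_set A) X (\<lambda>z. q (f z))"
  by (rule continuous_map_compose_on[OF quotient_imp_continuous_map[OF quot] assms])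

definition J :: "nat \<Rightarrow> (nat \<Rightarrow> complex) \<Rightarrow> nat \<Rightarrow> 'a" where
  "J n x = (\<lambda>i. if i < n then q (x i) else undefined)"

lemma J_configuration:
  assumes "\<And>i. i < n \<Longrightarrow> x i \<in> ball 0 1" "inj_on x {..<n}"
  shows "J n x \<in> topspace (configuration_space n X)"
proof (rule topspace_configuration_spaceI)
  show "J n x \<in> extensional {..<n}" by (auto simp: J_def extensional_def)
  show "J n x i \<in> topspace X" if "i < n" for i
    using assms(1)[OF that] that by (auto simp: J_def topspace_X)
  show "inj_on (J n x) {..<n}"
  proof (rule inj_onI)
    fix i j assume ij: "i \<in> {..<n}" "j \<in> {..<n}" "J n x i = J n x j"
    then have "x j = x i" using q_interior[of "x i" "x j"] assms(1)[of i] assms(1)[of j] by (simp add: J_def)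
    then show "i = j" using inj_onD[OF assms(2), of j i] ij by simp
  qed
qed

lemma J_configuration': "x \<in> topspace (disc_configurations n) \<Longrightarrow> J n x \<in> topspace (configuration_space n X)"
  by (rule J_configuration) (auto simp: plane_configuration_iff)

lemma continuous_map_J: "continuous_map (disc_configurations n) (configuration_space n X) (J n)"
  unfolding continuous_map_into_configuration_space
proof (intro conjI allI impI)
  fix i assume i: "i < n"
  have "continuous_map (top_of_set (ball 0 1)) X (\<lambda>z. q z)"
    by (rule continuous_map_q_comp) (auto intro!: continuous_intros)
  from continuous_map_compose[OF continuous_map_configuration_space_coord[OF i] this]
  show "continuous_map (disc_configurations n) X (\<lambda>x. J n x i)" using i by (simp add: J_def o_def)
qed (use J_configuration' in blast)

lemma J_inj: "inj_on (J n) (topspace (disc_configurations n))"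
proof (rule inj_onI, rule ext)
  fix x y i assume x: "x \<in> topspace (disc_configurations n)" and y: "y \<in> topspace (disc_configurations n)" and eq: "J n x = J n y"
  show "x i = y i"
  proof (cases "i < n")
    case True
    then have "q (y i) = q (x i)" using fun_cong[OF eq, of i] by (simp add: J_def)
    then show ?thesis using q_interior[of "y i" "x i"] x y True by (auto simp: plane_configuration_iff)
  next
    case False
    then show ?thesis using x y by (auto simp: plane_configuration_iff extensional_def)
  qed
qed

lemma J_permute: "s permutes {..<n} \<Longrightarrow> J n (x \<circ> s) = J n x \<circ> s"
proof
  fix i assume s: "s permutes {..<n}"
  have "s i < n \<longleftrightarrow> i < n" using permutes_in_image[OF s, of i] by simp
  then show "J n (x \<circ> s) i = (J n x \<circ> s) i" by (simp add: J_def)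
qed

definition arm :: "nat \<Rightarrow> real \<Rightarrow> real \<Rightarrow> real \<Rightarrow> complex" where
  "arm i t \<delta> u = of_real (1 - \<delta> * u) * edge i t"

text \<open>Outward along one arm, then inward along the glued one; at \<open>u = 1/2\<close> the
  two halves meet in boundary points that \<open>q\<close> identifies.\<close>

definition cross :: "nat \<Rightarrow> nat \<Rightarrow> real \<Rightarrow> real \<Rightarrow> real \<Rightarrow> 'a" where
  "cross i j t \<delta> u = (if u \<le> 1/2 then q (arm i t \<delta> (1 - 2 * u)) else q (arm j (partner i j t) \<delta> (2 * u - 1)))"

lemma norm_arm: "0 \<le> \<delta> \<Longrightarrow> \<delta> \<le> 1 \<Longrightarrow> u \<in> {0..1} \<Longrightarrow> cmod (arm i t \<delta> u) = 1 - \<delta> * u"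
proof -
  assume a: "0 \<le> \<delta>" "\<delta> \<le> 1" "u \<in> {0..1}"
  then have "\<delta> * u \<le> 1 * 1" by (intro mult_mono) auto
  then show ?thesis unfolding arm_def norm_mult norm_of_real norm_polygon_edge by simp
qed

lemma arm_cball: "0 \<le> \<delta> \<Longrightarrow> \<delta> \<le> 1 \<Longrightarrow> u \<in> {0..1} \<Longrightarrow> arm i t \<delta> u \<in> cball 0 1"
  using norm_arm[of \<delta> u i t] by simp

lemma arm_0: "arm i t \<delta> 0 = edge i t" by (simp add: arm_def)

lemma continuous_on_arm:
  assumes "continuous_on A t" "continuous_on A u"
  shows "continuous_on A (\<lambda>z. arm i (t z) \<delta> (u z))"
  unfolding arm_def polygon_edge_def using assms by (intro continuous_intros) (use len in auto)

lemma continuous_map_cross: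
  fixes t u :: "'b::topological_space \<Rightarrow> real"
  assumes ij: "paired i j" and \<delta>: "0 \<le> \<delta>" "\<delta> \<le> 1" and t: "continuous_on A t" "t \<in> A \<rightarrow> {0..1}"
    and u: "continuous_on A u" "u \<in> A \<rightarrow> {0..1}"
  shows "continuous_map (top_of_set A) X (\<lambda>z. cross i j (t z) \<delta> (u z))"
  unfolding cross_def
proof (rule continuous_map_cases_le)
  have t': "continuous_on A (\<lambda>z. partner i j (t z))"
    using t(1) by (cases "snd (w ! i) = snd (w ! j)") (auto simp: partner_def intro!: continuous_intros)
  have s: "A \<inter> {z \<in> A. u z \<le> 1/2} = {z \<in> A. u z \<le> 1/2}" "A \<inter> {z \<in> A. 1/2 \<le> u z} = {z \<in> A. 1/2 \<le> u z}" by auto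
  have "continuous_map (top_of_set {z \<in> A. u z \<le> 1/2}) X (\<lambda>z. q (arm i (t z) \<delta> (1 - 2 * u z)))"
  proof (rule continuous_map_q_comp)
    show "continuous_on {z \<in> A. u z \<le> 1/2} (\<lambda>z. arm i (t z) \<delta> (1 - 2 * u z))"
      by (intro continuous_on_arm continuous_intros continuous_on_subset[OF t(1)] continuous_on_subset[OF u(1)]) auto
    show "(\<lambda>z. arm i (t z) \<delta> (1 - 2 * u z)) \<in> {z \<in> A. u z \<le> 1/2} \<rightarrow> cball 0 1"
      using u(2) \<delta> by (intro Pi_I arm_cball) auto
  qed
  then show "continuous_map (subtopology (top_of_set A) {z \<in> topspace (top_of_set A). u z \<le> 1/2}) X
      (\<lambda>z. q (arm i (t z) \<delta> (1 - 2 * u z)))"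
    by (simp only: subtopology_subtopology topspace_euclidean_subtopology s)
  have "continuous_map (top_of_set {z \<in> A. 1/2 \<le> u z}) X (\<lambda>z. q (arm j (partner i j (t z)) \<delta> (2 * u z - 1)))"
  proof (rule continuous_map_q_comp)
    show "continuous_on {z \<in> A. 1/2 \<le> u z} (\<lambda>z. arm j (partner i j (t z)) \<delta> (2 * u z - 1))"
      by (intro continuous_on_arm continuous_intros continuous_on_subset[OF t'] continuous_on_subset[OF u(1)]) auto
    show "(\<lambda>z. arm j (partner i j (t z)) \<delta> (2 * u z - 1)) \<in> {z \<in> A. 1/2 \<le> u z} \<rightarrow> cball 0 1"
      using u(2) \<delta> by (intro Pi_I arm_cball) auto
  qed
  then show "continuous_map (subtopology (top_of_set A) {z \<in> topspace (top_of_set A). 1/2 \<le> u z}) X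
      (\<lambda>z. q (arm j (partner i j (t z)) \<delta> (2 * u z - 1)))"
    by (simp only: subtopology_subtopology topspace_euclidean_subtopology s)
  show "q (arm i (t z) \<delta> (1 - 2 * u z)) = q (arm j (partner i j (t z)) \<delta> (2 * u z - 1))"
    if "z \<in> topspace (top_of_set A)" "u z = 1/2" for z
  proof -
    have "1 - 2 * u z = 0" "2 * u z - 1 = 0" using that(2) by simp_all
    then show ?thesis using that(1) t(2) q_edge[OF ij, of "t z"] by (simp add: arm_0 Pi_iff)
  qed
qed (use u(1) in auto)

definition crossing_path :: "nat \<Rightarrow> nat \<Rightarrow> nat \<Rightarrow> real \<Rightarrow> real \<Rightarrow> nat \<Rightarrow> (nat \<Rightarrow> complex) \<Rightarrow> real \<Rightarrow> nat \<Rightarrow> 'a" where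
  "crossing_path n i j t \<delta> p x u = (J n x)(p := cross i j t \<delta> u)"

text \<open>The entry \<open>x p\<close> is irrelevant: \<open>p\<close> is the point that crosses.\<close>

definition admissible :: "nat \<Rightarrow> nat \<Rightarrow> nat \<Rightarrow> real \<Rightarrow> real \<Rightarrow> nat \<Rightarrow> (nat \<Rightarrow> complex) \<Rightarrow> bool" where
  "admissible n i j t \<delta> p x \<longleftrightarrow> paired i j \<and> t \<in> {0..1} \<and> 0 < \<delta> \<and> \<delta> < 1 \<and> p < n \<and>
     inj_on x ({..<n} - {p}) \<and>
     (\<forall>k<n. k \<noteq> p \<longrightarrow> cmod (x k) < 1 \<and> (\<forall>u\<in>{0..1}. x k \<noteq> arm i t \<delta> u \<and> x k \<noteq> arm j (partner i j t) \<delta> u))"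

text \<open>Stronger than \<open>admissible\<close>: the other points stay within radius
  \<open>1 - \<delta>\<close>, clear of the collar that contains all arms. They and the place of the
  crossing can then be moved independently.\<close>

definition deep :: "nat \<Rightarrow> nat \<Rightarrow> nat \<Rightarrow> real \<Rightarrow> real \<Rightarrow> nat \<Rightarrow> (nat \<Rightarrow> complex) \<Rightarrow> bool" where
  "deep n i j t \<delta> p x \<longleftrightarrow> paired i j \<and> t \<in> {0..1} \<and> 0 < \<delta> \<and> \<delta> < 1 \<and> p < n \<and>
     inj_on x ({..<n} - {p}) \<and> (\<forall>k<n. k \<noteq> p \<longrightarrow> cmod (x k) < 1 - \<delta>)"

lemma deep_admissible:
  assumes d: "deep n i j t \<delta> p x"
  shows "admissible n i j t \<delta> p x"
proof -
  have \<delta>: "0 < \<delta>" "\<delta> < 1" using d by (auto simp: deep_def)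
  have "x k \<noteq> arm l s \<delta> u" if "k < n" "k \<noteq> p" "u \<in> {0..1}" for k l s u
  proof
    assume e: "x k = arm l s \<delta> u"
    have "\<delta> * u \<le> \<delta> * 1" using \<delta> that by (intro mult_left_mono) auto
    moreover have "cmod (x k) < 1 - \<delta>" using d that by (auto simp: deep_def)
    moreover have "cmod (x k) = 1 - \<delta> * u" unfolding e using \<delta> that by (intro norm_arm) auto
    ultimately show False by linarith
  qed
  moreover have "cmod (x k) < 1" if "k < n" "k \<noteq> p" for k
  proof -
    have "cmod (x k) < 1 - \<delta>" using d that by (auto simp: deep_def)
    then show ?thesis using \<delta> by linarith
  qed
  ultimately show ?thesis using d unfolding admissible_def deep_def by blast
qed

lemma cross_in_X: "0 \<le> \<delta> \<Longrightarrow> \<delta> \<le> 1 \<Longrightarrow> u \<in> {0..1} \<Longrightarrow> cross i j t \<delta> u \<in> topspace X"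
  unfolding cross_def topspace_X using arm_cball[of \<delta> "1 - 2 * u" i t] arm_cball[of \<delta> "2 * u - 1" j "partner i j t"]
  by auto

lemma crossing_configuration:
  assumes a: "admissible n i j t \<delta> p x" and u: "u \<in> {0..1}"
  shows "crossing_path n i j t \<delta> p x u \<in> topspace (configuration_space n X)"
proof -
  have \<delta>: "0 \<le> \<delta>" "\<delta> \<le> 1" and p: "p < n" using a by (auto simp: admissible_def)
  have xb: "cmod (x k) < 1" if "k < n" "k \<noteq> p" for k using a that by (auto simp: admissible_def)
  have ne: "q (x k) \<noteq> cross i j t \<delta> u" if k: "k < n" "k \<noteq> p" for k
  proof
    assume e: "q (x k) = cross i j t \<delta> u"
    show False
    proof (cases "u \<le> 1/2")
      case True
      then have "1 - 2 * u \<in> {0..1}" using u by auto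
      moreover from this have "arm i t \<delta> (1 - 2 * u) = x k"
        using q_interior[OF xb[OF k] arm_cball[OF \<delta>]] e True by (simp add: cross_def)
      ultimately show False using a k unfolding admissible_def by metis
    next
      case False
      then have "2 * u - 1 \<in> {0..1}" using u by auto
      moreover from this have "arm j (partner i j t) \<delta> (2 * u - 1) = x k"
        using q_interior[OF xb[OF k] arm_cball[OF \<delta>]] e False by (simp add: cross_def)
      ultimately show False using a k unfolding admissible_def by metis
    qed
  qed
  have inj: "q (x k) \<noteq> q (x l)" if "k < n" "l < n" "k \<noteq> p" "l \<noteq> p" "k \<noteq> l" for k l
  proof
    assume "q (x k) = q (x l)"
    then have "x l = x k" using q_interior[OF xb[OF that(1,3)]] xb[OF that(2,4)] by simp
    moreover have "inj_on x ({..<n} - {p})" using a by (simp add: admissible_def)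
    ultimately show False using that by (auto simp: inj_on_def)
  qed
  let ?y = "crossing_path n i j t \<delta> p x u"
  have y: "?y k = q (x k)" if "k < n" "k \<noteq> p" for k using that by (simp add: crossing_path_def J_def)
  have yp: "?y p = cross i j t \<delta> u" by (simp add: crossing_path_def)
  show ?thesis
  proof (rule topspace_configuration_spaceI)
    show "?y \<in> extensional {..<n}" using p by (auto simp: crossing_path_def J_def extensional_def)
    show "?y k \<in> topspace X" if "k < n" for k
    proof (cases "k = p")
      case True
      then show ?thesis using yp cross_in_X[OF \<delta> u] by simp
    next
      case False
      then show ?thesis using y[OF that] xb[OF that] by (auto simp: topspace_X)
    qed
    show "inj_on ?y {..<n}"
    proof (rule inj_onI, rule ccontr)
      fix k l assume kl: "k \<in> {..<n}" "l \<in> {..<n}" "?y k = ?y l" "k \<noteq> l"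
      consider "k = p" | "l = p" | "k \<noteq> p" "l \<noteq> p" by blast
      then show False
      proof cases
        case 1
        then show False using kl y[of l] yp ne[of l] by auto
      next
        case 2
        then show False using kl y[of k] yp ne[of k] by auto
      next
        case 3
        then show False using kl y[of k] y[of l] inj[of k l] by auto
      qed
    qed
  qed
qed

lemma pathin_crossing:
  assumes a: "admissible n i j t \<delta> p x"
  shows "pathin (configuration_space n X) (crossing_path n i j t \<delta> p x)"
  unfolding pathin_def continuous_map_into_configuration_space
proof (intro conjI allI impI)
  fix k assume k: "k < n"
  show "continuous_map (top_of_set {0..1}) X (\<lambda>u. crossing_path n i j t \<delta> p x u k)"
  proof (cases "k = p")
    case True
    have "continuous_map (top_of_set {0..1}) X (\<lambda>u. cross i j t \<delta> u)"
      by (rule continuous_map_cross) (use a in \<open>auto simp: admissible_def intro: continuous_intros\<close>)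
    then show ?thesis using True by (simp add: crossing_path_def)
  next
    case False
    then have "q (x k) \<in> topspace X" using a k by (auto simp: admissible_def topspace_X)
    then show ?thesis using False k by (simp add: crossing_path_def J_def)
  qed
qed (use crossing_configuration[OF a] in auto)

end

section \<open>Crossings under motion and change of depth\<close>

locale surface_rep = polygon_space w X q + path_rep G "configuration_space n X" \<Psi>
  for w :: "(nat \<times> bool) list" and X :: "'a topology" and q and G (structure) and n \<Psi> +
  assumes rep_permute: "s permutes {..<n} \<Longrightarrow> pathin (configuration_space n X) p \<Longrightarrow> \<Psi> (\<lambda>t. p t \<circ> s) = \<Psi> p"
begin

definition \<Psi>D :: "(real \<Rightarrow> nat \<Rightarrow> complex) \<Rightarrow> _" where
  "\<Psi>D p = \<Psi> (\<lambda>t. J n (p t))"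

lemma pathin_J: "pathin (disc_configurations n) p \<Longrightarrow> pathin (configuration_space n X) (\<lambda>t. J n (p t))"
  by (rule pathin_continuous_map[OF _ continuous_map_J])

lemma disc_rep_\<Psi>D: "disc_rep G n \<Psi>D"
proof -
  interpret D: path_rep G "disc_configurations n" \<Psi>D
    using pullback[OF continuous_map_J] by (simp add: \<Psi>D_def[abs_def])
  show ?thesis
  proof
    fix s p assume s: "s permutes {..<n}" "pathin (disc_configurations n) p"
    show "\<Psi>D (\<lambda>t. p t \<circ> s) = \<Psi>D p"
      unfolding \<Psi>D_def J_permute[OF s(1)] by (rule rep_permute[OF s(1) pathin_J[OF s(2)]])
  qed
qed

text \<open>In the square with the crossing in one direction and the motion of \<open>t\<close> and
  the other points in the other, two opposite sides are crossings and the other two are disc paths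
  that keep point \<open>p\<close> at depth \<delta>.\<close>

lemma crossing_move:
  assumes \<xi>: "\<And>k. k < n \<Longrightarrow> k \<noteq> p \<Longrightarrow> continuous_on {0..1} (\<lambda>v. \<xi> v k)"
    and t: "continuous_on {0..1} t"
    and d: "\<And>v. v \<in> {0..1} \<Longrightarrow> deep n i j (t v) \<delta> p (\<xi> v)"
    and ext: "\<And>v. v \<in> {0..1} \<Longrightarrow> \<xi> v \<in> extensional {..<n}"
  shows "pathin (disc_configurations n) (\<lambda>v. (\<xi> v)(p := arm i (t v) \<delta> 1))"
    "pathin (disc_configurations n) (\<lambda>v. (\<xi> v)(p := arm j (partner i j (t v)) \<delta> 1))"
    "\<Psi> (crossing_path n i j (t 0) \<delta> p (\<xi> 0)) \<otimes> \<Psi>D (\<lambda>v. (\<xi> v)(p := arm j (partner i j (t v)) \<delta> 1)) =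
     \<Psi>D (\<lambda>v. (\<xi> v)(p := arm i (t v) \<delta> 1)) \<otimes> \<Psi> (crossing_path n i j (t 1) \<delta> p (\<xi> 1))"
proof -
  let ?S = "{0..1} \<times> {0..1} :: (real \<times> real) set"
  have d0: "deep n i j (t 0) \<delta> p (\<xi> 0)" using d[of 0] by simp
  have \<delta>: "0 < \<delta>" "\<delta> < 1" and p: "p < n" and ij: "paired i j" using d0 by (auto simp: deep_def)
  have tu: "t v \<in> {0..1}" if "v \<in> {0..1}" for v using d[OF that] by (simp add: deep_def)
  have small: "cmod (\<xi> v k) < 1 - \<delta>" if "v \<in> {0..1}" "k < n" "k \<noteq> p" for v k
    using d[OF that(1)] that by (auto simp: deep_def)
  have arm1: "cmod (arm l s \<delta> 1) = 1 - \<delta>" for l s using \<delta> norm_arm[of \<delta> 1 l s] by simp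
  have side: "pathin (disc_configurations n) (\<lambda>v. (\<xi> v)(p := arm l (s v) \<delta> 1))"
    if s: "continuous_on {0..1} s" for l s
    unfolding pathin_def continuous_map_into_plane_configuration
  proof (intro conjI allI impI ballI)
    show "continuous_on {0..1} (\<lambda>v. ((\<xi> v)(p := arm l (s v) \<delta> 1)) k)" if "k < n" for k
      using \<xi>[OF that] continuous_on_arm[OF s continuous_on_const, of l \<delta> 1] by (cases "k = p") auto
    fix v :: real assume v: "v \<in> {0..1}"
    have ne: "\<xi> v k \<noteq> arm l (s v) \<delta> 1" if "k < n" "k \<noteq> p" for k
      using small[OF v that] arm1[of l "s v"] by auto
    have "inj_on (\<xi> v) ({..<n} - {p})" using d[OF v] by (simp add: deep_def)
    then have "inj_on ((\<xi> v)(p := arm l (s v) \<delta> 1)) {..<n}"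
      using ne unfolding inj_on_def by (auto, metis+)
    moreover have "((\<xi> v)(p := arm l (s v) \<delta> 1)) k \<in> ball 0 1" if "k < n" for k
      using small[OF v that] arm1[of l "s v"] \<delta> by (cases "k = p") auto
    moreover have "(\<xi> v)(p := arm l (s v) \<delta> 1) \<in> extensional {..<n}"
      using ext[OF v] p by (auto simp: extensional_def)
    ultimately show "(\<xi> v)(p := arm l (s v) \<delta> 1) \<in> topspace (disc_configurations n)"
      by (simp add: plane_configuration_iff)
  qed
  have pt: "continuous_on {0..1} (\<lambda>v. partner i j (t v))"
    using t by (cases "snd (w ! i) = snd (w ! j)") (auto simp: partner_def intro!: continuous_intros)
  show s1: "pathin (disc_configurations n) (\<lambda>v. (\<xi> v)(p := arm i (t v) \<delta> 1))" by (rule side[OF t])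
  show s2: "pathin (disc_configurations n) (\<lambda>v. (\<xi> v)(p := arm j (partner i j (t v)) \<delta> 1))"
    by (rule side[OF pt])
  define F where "F z = crossing_path n i j (t (snd z)) \<delta> p (\<xi> (snd z)) (fst z)" for z :: "real \<times> real"
  have F: "continuous_map (top_of_set ?S) (configuration_space n X) F"
    unfolding continuous_map_into_configuration_space
  proof (intro conjI allI impI)
    fix k assume k: "k < n"
    show "continuous_map (top_of_set ?S) X (\<lambda>z. F z k)"
    proof (cases "k = p")
      case True
      have "continuous_map (top_of_set ?S) X (\<lambda>z. cross i j (t (snd z)) \<delta> (fst z))"
      proof (rule continuous_map_cross[OF ij])
        show "continuous_on ?S (\<lambda>z. t (snd z))"
          by (rule continuous_on_compose2[OF t]) (auto intro!: continuous_intros)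
        show "(\<lambda>z. t (snd z)) \<in> ?S \<rightarrow> {0..1}" 
        proof
          fix z assume "z \<in> ?S"
          then have "snd z \<in> {0..1}" unfolding mem_Times_iff by (rule conjunct2)
          then show "t (snd z) \<in> {0..1}" by (rule tu)
        qed
        show "fst \<in> ?S \<rightarrow> {0..1}" by (rule Pi_I) (simp only: mem_Times_iff)
        show "continuous_on ?S fst" by (intro continuous_on_fst continuous_on_id)
      qed (use \<delta> in auto)
      then show ?thesis using True by (simp add: F_def crossing_path_def)
    next
      case False
      have "continuous_map (top_of_set ?S) X (\<lambda>z. q (\<xi> (snd z) k))"
      proof (rule continuous_map_q_comp)
        show "continuous_on ?S (\<lambda>z. \<xi> (snd z) k)"
          by (rule continuous_on_compose2[OF \<xi>[OF k False]]) (auto intro!: continuous_intros)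
        show "(\<lambda>z. \<xi> (snd z) k) \<in> ?S \<rightarrow> cball 0 1"
        proof
          fix z assume "z \<in> ?S"
          then have "cmod (\<xi> (snd z) k) < 1 - \<delta>" using small[OF _ k False] by auto
          then show "\<xi> (snd z) k \<in> cball 0 1" using \<delta> by simp
        qed
      qed
      then show ?thesis using False k by (simp add: F_def crossing_path_def J_def)
    qed
  next
    show "F \<in> topspace (top_of_set ?S) \<rightarrow> topspace (configuration_space n X)"
      using crossing_configuration[OF deep_admissible[OF d]] by (auto simp: F_def)
  qed
  have J_upd: "J n (y(p := z)) = (J n y)(p := q z)" for y z using p by (auto simp: J_def fun_eq_iff)
  have b: "F (0, v) = J n ((\<xi> v)(p := arm i (t v) \<delta> 1))" "F (1, v) = J n ((\<xi> v)(p := arm j (partner i j (t v)) \<delta> 1))" for v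
    by (simp_all add: F_def crossing_path_def cross_def J_upd)
  show "\<Psi> (crossing_path n i j (t 0) \<delta> p (\<xi> 0)) \<otimes> \<Psi>D (\<lambda>v. (\<xi> v)(p := arm j (partner i j (t v)) \<delta> 1)) =
     \<Psi>D (\<lambda>v. (\<xi> v)(p := arm i (t v) \<delta> 1)) \<otimes> \<Psi> (crossing_path n i j (t 1) \<delta> p (\<xi> 1))"
    using rep_square[OF F] unfolding b \<Psi>D_def[symmetric] by (simp add: F_def)
qed

text \<open>The part of a crossing within depth \<delta>' is itself a crossing; what remains before
  and after it runs in the open disc.\<close>

lemma crossing_shrink:
  assumes a: "admissible n i j t \<delta> p x" and \<delta>': "0 < \<delta>'" "\<delta>' \<le> \<delta>" and ext: "x \<in> extensional {..<n}"
  obtains r r' where "pathin (disc_configurations n) r" "pathin (disc_configurations n) r'"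
    "\<Psi> (crossing_path n i j t \<delta> p x) = \<Psi>D r \<otimes> \<Psi> (crossing_path n i j t \<delta>' p x) \<otimes> \<Psi>D r'"
proof -
  let ?K = "crossing_path n i j t \<delta> p x"
  have \<delta>: "0 < \<delta>" "\<delta> < 1" and p: "p < n" using a by (auto simp: admissible_def)
  \<comment> \<open>The time at which the crossing point has come up to depth \<delta>' on its way
    out.\<close>
  define s where "s = (1 - \<delta>' / \<delta>) / 2"
  have s: "0 \<le> s" "s < 1/2" "\<delta> * (1 - 2 * s) = \<delta>'" using \<delta> \<delta>' by (auto simp: s_def field_simps)
  have K: "pathin (configuration_space n X) ?K" by (rule pathin_crossing[OF a])
  have mid: "subpath_on s (1 - s) ?K = crossing_path n i j t \<delta>' p x"
  proof
    fix u
    let ?u = "s + (1 - s - s) * u"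
    have 1: "?u \<le> 1/2 \<longleftrightarrow> u \<le> 1/2"
    proof -
      have "?u - 1/2 = (1 - 2 * s) * (u - 1/2)" by (simp add: algebra_simps)
      moreover have "0 < 1 - 2 * s" using s(2) by simp
      ultimately show ?thesis by (smt (verit) mult_le_0_iff mult_pos_pos)
    qed
    have 2: "\<delta> * (1 - 2 * ?u) = \<delta>' * (1 - 2 * u)" "\<delta> * (2 * ?u - 1) = \<delta>' * (2 * u - 1)"
      unfolding s(3)[symmetric] by (simp_all add: algebra_simps)
    show "subpath_on s (1 - s) ?K u = crossing_path n i j t \<delta>' p x u"
      unfolding subpath_on_def crossing_path_def cross_def arm_def 1 2 ..
  qed
  have J_upd: "J n (y(p := z)) = (J n y)(p := q z)" for y z using p by (auto simp: J_def fun_eq_iff)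
  have side: "pathin (disc_configurations n) (\<lambda>v. x(p := arm l t' \<delta> (f v)))"
    if f: "continuous_on {0..1} f" "\<And>v. v \<in> {0..1} \<Longrightarrow> 0 < f v \<and> f v \<le> 1"
      and l: "(l, t') = (i, t) \<or> (l, t') = (j, partner i j t)" for f l t'
    unfolding pathin_def continuous_map_into_plane_configuration
  proof (intro conjI allI impI ballI)
    show "continuous_on {0..1} (\<lambda>v. (x(p := arm l t' \<delta> (f v))) k)" if "k < n" for k
      using continuous_on_arm[OF continuous_on_const f(1), of l t' \<delta>] by (cases "k = p") auto
    fix v :: real assume v: "v \<in> {0..1}"
    have fv: "f v \<in> {0..1}" "0 < f v" using f(2)[OF v] by auto
    have ne: "x k \<noteq> arm l t' \<delta> (f v)" if "k < n" "k \<noteq> p" for k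
      using a l that fv(1) unfolding admissible_def by blast
    have "inj_on x ({..<n} - {p})" using a by (simp add: admissible_def)
    then have "inj_on (x(p := arm l t' \<delta> (f v))) {..<n}"
      using ne unfolding inj_on_def by (auto, metis+)
    moreover have "(x(p := arm l t' \<delta> (f v))) k \<in> ball 0 1" if "k < n" for k
    proof (cases "k = p")
      case True
      have "cmod (arm l t' \<delta> (f v)) = 1 - \<delta> * f v" using \<delta> fv by (intro norm_arm) auto
      moreover have "0 < \<delta> * f v" using \<delta> fv by simp
      ultimately show ?thesis using True by simp
    next
      case False
      then show ?thesis using a that by (auto simp: admissible_def)
    qed
    moreover have "x(p := arm l t' \<delta> (f v)) \<in> extensional {..<n}"
      using ext p by (auto simp: extensional_def)
    ultimately show "x(p := arm l t' \<delta> (f v)) \<in> topspace (disc_configurations n)"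
      by (simp add: plane_configuration_iff)
  qed
  define r r' where "r v = x(p := arm i t \<delta> (1 - 2 * (s * v)))" and
    "r' v = x(p := arm j (partner i j t) \<delta> (2 * (1 - s + s * v) - 1))" for v
  have sv: "0 \<le> s * v \<and> s * v \<le> s" if "v \<in> {0..1}" for v
    using that s(1) mult_left_mono[of v 1 s] by auto
  have r: "pathin (disc_configurations n) r" "pathin (disc_configurations n) r'"
    unfolding r_def r'_def
    by (rule side, use sv s(2) in \<open>fastforce intro!: continuous_intros\<close>, use sv s in fastforce, simp)+
  have e1: "subpath_on 0 s ?K v = J n (r v)" if "v \<in> {0..1}" for v
    using sv[OF that] s(2) by (simp add: subpath_on_def r_def J_upd crossing_path_def cross_def)
  have e2: "subpath_on (1 - s) 1 ?K v = J n (r' v)" if "v \<in> {0..1}" for v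
    using sv[OF that] s(2) by (simp add: subpath_on_def r'_def J_upd crossing_path_def cross_def)
  have "\<Psi> (subpath_on 0 s ?K) = \<Psi>D r" "\<Psi> (subpath_on (1 - s) 1 ?K) = \<Psi>D r'"
    unfolding \<Psi>D_def by (rule rep_eq[OF pathin_subpath_on[OF K]], use s e1 e2 in auto)+
  moreover have "\<Psi> ?K = \<Psi> (subpath_on 0 s ?K) \<otimes> \<Psi> (subpath_on s (1 - s) ?K) \<otimes> \<Psi> (subpath_on (1 - s) 1 ?K)"
    using rep_subpath_on[OF K, of 0 s "1 - s"] rep_subpath_on[OF K, of 0 "1 - s" 1] s by simp
  ultimately show thesis using that[OF r] mid by simp
qed

end

section \<open>Crossings and disc paths generate\<close>

context polygon_space
begin

lemma admissible_permute:
  assumes a: "admissible n i j t \<delta> p x" and s: "s permutes {..<n}" "s p' = p" and p': "p' < n"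
  shows "admissible n i j t \<delta> p' (x \<circ> s)"
proof -
  have "s ` ({..<n} - {p'}) = {..<n} - {p}"
    unfolding image_set_diff[OF permutes_inj[OF s(1)]] permutes_image[OF s(1)] using s(2) by simp
  moreover from this have "inj_on (x \<circ> s) ({..<n} - {p'})"
    using a permutes_inj_on[OF s(1)] by (intro comp_inj_on) (auto simp: admissible_def)
  moreover have "s k < n" "s k \<noteq> p" if "k < n" "k \<noteq> p'" for k
    using permutes_in_image[OF s(1), of k] permutes_inj[OF s(1)] s(2) that by (auto simp: inj_def)
  ultimately show ?thesis using a p' unfolding admissible_def o_def by blast
qed

lemma crossing_path_permute:
  assumes s: "s permutes {..<n}" "s p' = p"
  shows "crossing_path n i j t \<delta> p x u \<circ> s = crossing_path n i j t \<delta> p' (x \<circ> s) u"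
proof
  fix k
  have "s k = p \<longleftrightarrow> k = p'" using permutes_inj[OF s(1)] s(2) by (metis injD)
  moreover have "J n (x \<circ> s) k = J n x (s k)" using J_permute[OF s(1), of x] by (simp add: fun_eq_iff)
  ultimately show "(crossing_path n i j t \<delta> p x u \<circ> s) k = crossing_path n i j t \<delta> p' (x \<circ> s) u k"
    by (simp add: crossing_path_def)
qed

lemma J_upd: "p < n \<Longrightarrow> J n (y(p := z)) = (J n y)(p := q z)"
  by (auto simp: J_def fun_eq_iff)

lemma crossing_path_ends:
  assumes "p < n"
  shows "crossing_path n i j t \<delta> p x 0 = J n (x(p := arm i t \<delta> 1))"
    "crossing_path n i j t \<delta> p x 1 = J n (x(p := arm j (partner i j t) \<delta> 1))"
  using J_upd[OF assms] by (simp_all add: crossing_path_def cross_def)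

lemma crossing_path_upd: "crossing_path n i j t \<delta> p (x(p := z)) = crossing_path n i j t \<delta> p x"
  by (auto simp: crossing_path_def J_def fun_eq_iff)

text \<open>The entry of the crossing point is filled by a fresh point, so that the others can be
  moved by a path in the connected space of \<open>n\<close>-point configurations of a smaller
  disc.\<close>

lemma extend_plane_configuration:
  assumes "inj_on x ({..<n} - {p})" "\<And>k. k < n \<Longrightarrow> k \<noteq> p \<Longrightarrow> cmod (x k) < r" "x \<in> extensional {..<n}" "0 < r" "p < n"
  obtains z where "x(p := z) \<in> topspace (configuration_space n (top_of_set (ball 0 r)))"
proof -
  have "infinite (ball (0 :: complex) r)" using assms(4) uncountable_ball[of r] countable_finite by blast
  then obtain z where z: "z \<in> ball 0 r" "z \<notin> x ` ({..<n} - {p})"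
    by (meson finite_Diff finite_imageI finite_lessThan finite_subset subsetI)
  have "inj_on (x(p := z)) {..<n}"
  proof (rule inj_onI)
    fix k l assume kl: "k \<in> {..<n}" "l \<in> {..<n}" "(x(p := z)) k = (x(p := z)) l"
    consider "k = p" "l = p" | "k = p" "l \<noteq> p" | "k \<noteq> p" "l = p" | "k \<noteq> p" "l \<noteq> p" by blast
    then show "k = l"
    proof cases
      case 4
      then show ?thesis using kl inj_onD[OF assms(1), of k l] by simp
    qed (use kl z(2) in auto)
  qed
  moreover have "(x(p := z)) k \<in> ball 0 r" if "k < n" for k using z(1) assms(2)[OF that] by (cases "k = p") auto
  moreover have "x(p := z) \<in> extensional {..<n}" using assms(3,5) by (auto simp: extensional_def)
  ultimately show thesis using that[of z] by (simp add: plane_configuration_iff)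
qed

text \<open>The other points are finitely many and lie in the open disc, hence at a positive
  distance from the circle.\<close>

lemma deep_of_admissible:
  assumes a: "admissible n i j t \<delta> p x"
  obtains \<delta>0 where "0 < \<delta>0" "\<delta>0 \<le> \<delta>" "\<And>\<delta>'. 0 < \<delta>' \<Longrightarrow> \<delta>' \<le> \<delta>0 \<Longrightarrow> deep n i j t \<delta>' p x"
proof -
  obtain e where e: "0 < e" "\<And>k. k \<in> {..<n} - {p} \<Longrightarrow> e \<le> 1 - cmod (x k)"
    by (rule finite_lower_bound[of "{..<n} - {p}" "\<lambda>k. 1 - cmod (x k)"]) (use a in \<open>auto simp: admissible_def\<close>)
  have \<delta>: "0 < \<delta>" "\<delta> < 1" using a by (auto simp: admissible_def)
  show thesis
  proof (rule that[of "min \<delta> (e / 2)"])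
    fix \<delta>' assume \<delta>': "0 < \<delta>'" "\<delta>' \<le> min \<delta> (e / 2)"
    have "cmod (x k) < 1 - \<delta>'" if "k < n" "k \<noteq> p" for k
      using e(1) e(2)[of k] that \<delta>' by auto
    moreover have "\<delta>' < 1" using \<delta> \<delta>' by linarith
    ultimately show "deep n i j t \<delta>' p x" using a \<delta>' unfolding admissible_def deep_def by blast
  qed (use \<delta> e in auto)
qed

end

context surface_rep
begin

lemma crossing_closed: "admissible n i j t \<delta> p x \<Longrightarrow> \<Psi> (crossing_path n i j t \<delta> p x) \<in> carrier G"
  by (rule closed[OF pathin_crossing])

lemma crossing_permute:
  assumes a: "admissible n i j t \<delta> p x" and s: "s permutes {..<n}" "s p' = p"
  shows "\<Psi> (crossing_path n i j t \<delta> p' (x \<circ> s)) = \<Psi> (crossing_path n i j t \<delta> p x)"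
  using rep_permute[OF s(1) pathin_crossing[OF a]] unfolding crossing_path_permute[OF s] .

text \<open>The other points move within radius \<open>1 - \<delta>\<close>, where they meet no arm,
  while \<open>t\<close> moves linearly to \<open>t'\<close>. The relation of
  \<open>crossing_move\<close> then puts the two crossings into one double coset of
  \<open>S\<close>.\<close>

lemma crossing_coset_deep:
  assumes S: "subgroup S G" and disc: "\<And>p. pathin (disc_configurations n) p \<Longrightarrow> \<Psi>D p \<in> S"
    and x: "deep n i j t \<delta> p x" "x \<in> extensional {..<n}"
    and x': "deep n i j t' \<delta> p x'" "x' \<in> extensional {..<n}"
  obtains a b where "a \<in> S" "b \<in> S"
    "\<Psi> (crossing_path n i j t \<delta> p x) = a \<otimes> \<Psi> (crossing_path n i j t' \<delta> p x') \<otimes> b"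
proof -
  have p: "p < n" and ij: "paired i j" and \<delta>: "0 < \<delta>" "\<delta> < 1" and tt: "t \<in> {0..1}" "t' \<in> {0..1}"
    using x(1) x'(1) by (auto simp: deep_def)
  let ?B = "configuration_space n (top_of_set (ball (0::complex) (1 - \<delta>)))"
  obtain z where z: "x(p := z) \<in> topspace ?B"
    by (rule extend_plane_configuration[of x n p "1 - \<delta>"]) (use x in \<open>auto simp: deep_def\<close>)
  obtain z' where z': "x'(p := z') \<in> topspace ?B"
    by (rule extend_plane_configuration[of x' n p "1 - \<delta>"]) (use x' in \<open>auto simp: deep_def\<close>)
  have "path_connected_space ?B" by (rule path_connected_space_plane_configurations) auto
  then obtain P where P: "pathin ?B P" "P 0 = x(p := z)" "P 1 = x'(p := z')"
    using z z' unfolding path_connected_space_def by blast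
  define \<tau> where "\<tau> v = (1 - v) *\<^sub>R t + v *\<^sub>R t'" for v
  have \<tau>: "\<tau> v \<in> {0..1}" if "v \<in> {0..1}" for v
    unfolding \<tau>_def by (rule convexD) (use that tt in auto)
  have PB: "P v \<in> topspace ?B" if "v \<in> {0..1}" for v using pathin_top[OF P(1) that] .
  have dp: "deep n i j (\<tau> v) \<delta> p (P v)" if "v \<in> {0..1}" for v
    using PB[OF that] \<tau>[OF that] ij \<delta> p unfolding deep_def plane_configuration_iff by (auto intro: inj_on_subset)
  have c\<tau>: "continuous_on {0..1} \<tau>" unfolding \<tau>_def by (intro continuous_intros)
  note cm = crossing_move[of p P \<tau> i j \<delta>, OF pathin_coord[OF P(1)] c\<tau> dp]
  have ext: "P v \<in> extensional {..<n}" if "v \<in> {0..1}" for v using PB[OF that] by (simp add: plane_configuration_iff)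
  have e: "\<tau> 0 = t" "\<tau> 1 = t'" by (simp_all add: \<tau>_def)
  let ?a = "\<Psi>D (\<lambda>v. (P v)(p := arm i (\<tau> v) \<delta> 1))" and ?b = "\<Psi>D (\<lambda>v. (P v)(p := arm j (partner i j (\<tau> v)) \<delta> 1))"
  let ?K = "\<Psi> (crossing_path n i j t \<delta> p x)" and ?K' = "\<Psi> (crossing_path n i j t' \<delta> p x')"
  have ab: "?a \<in> S" "?b \<in> S" using cm(1,2) ext disc by simp_all
  have c: "?a \<in> carrier G" "?b \<in> carrier G" by (rule subgroup.mem_carrier[OF S ab(1)] subgroup.mem_carrier[OF S ab(2)])+
  have K: "?K \<in> carrier G" "?K' \<in> carrier G"
    by (rule crossing_closed[OF deep_admissible[OF x(1)]] crossing_closed[OF deep_admissible[OF x'(1)]])+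
  have "?K \<otimes> ?b = ?a \<otimes> ?K'" using cm(3) ext unfolding e P(2,3) crossing_path_upd by simp
  then have "?K = ?a \<otimes> ?K' \<otimes> inv ?b" using inv_solve_right[of ?K "?a \<otimes> ?K'" ?b] c K by simp
  then show thesis using that[OF ab(1) subgroup.m_inv_closed[OF S ab(2)]] by blast
qed

text \<open>A relabelling makes both crossings concern the same point, without changing values, and
  shrinking brings them to a common depth at the cost of disc values, which lie in
  \<open>S\<close>.\<close>

lemma crossing_coset:
  assumes S: "subgroup S G" and disc: "\<And>p. pathin (disc_configurations n) p \<Longrightarrow> \<Psi>D p \<in> S"
    and x: "admissible n i j t \<delta> p x" "x \<in> extensional {..<n}"
    and x': "admissible n i j t' \<delta>' p' x'" "x' \<in> extensional {..<n}"
  obtains a b where "a \<in> S" "b \<in> S"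
    "\<Psi> (crossing_path n i j t \<delta> p x) = a \<otimes> \<Psi> (crossing_path n i j t' \<delta>' p' x') \<otimes> b"
proof -
  have p: "p < n" "p' < n" using x x' by (auto simp: admissible_def)
  define s where "s = Transposition.transpose p p'"
  have s: "s permutes {..<n}" "s p = p'" using p by (auto simp: s_def permutes_swap_id)
  define y where "y = x' \<circ> s"
  have y: "admissible n i j t' \<delta>' p y" "y \<in> extensional {..<n}"
    unfolding y_def using admissible_permute[OF x'(1) s p(1)] x'(2) permutes_not_in[OF s(1)]
    by (auto simp: extensional_def)
  have Ky: "\<Psi> (crossing_path n i j t' \<delta>' p y) = \<Psi> (crossing_path n i j t' \<delta>' p' x')"
    unfolding y_def by (rule crossing_permute[OF x'(1) s])
  obtain d where d: "0 < d" "d \<le> \<delta>" "\<And>e. 0 < e \<Longrightarrow> e \<le> d \<Longrightarrow> deep n i j t e p x"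
    by (rule deep_of_admissible[OF x(1)]) (rule that)
  obtain d' where d': "0 < d'" "d' \<le> \<delta>'" "\<And>e. 0 < e \<Longrightarrow> e \<le> d' \<Longrightarrow> deep n i j t' e p y"
    by (rule deep_of_admissible[OF y(1)]) (rule that)
  define e where "e = min d d'"
  have e: "0 < e" "e \<le> \<delta>" "e \<le> \<delta>'" and dp: "deep n i j t e p x" "deep n i j t' e p y"
    using d d' by (auto simp: e_def)
  let ?K = "\<Psi> (crossing_path n i j t e p x)" and ?K' = "\<Psi> (crossing_path n i j t' e p y)"
  obtain r1 r2 where r: "pathin (disc_configurations n) r1" "pathin (disc_configurations n) r2"
    "\<Psi> (crossing_path n i j t \<delta> p x) = \<Psi>D r1 \<otimes> ?K \<otimes> \<Psi>D r2"
    using crossing_shrink[OF x(1) e(1,2) x(2)] .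
  obtain u1 u2 where u: "pathin (disc_configurations n) u1" "pathin (disc_configurations n) u2"
    "\<Psi> (crossing_path n i j t' \<delta>' p y) = \<Psi>D u1 \<otimes> ?K' \<otimes> \<Psi>D u2"
    using crossing_shrink[OF y(1) e(1,3) y(2)] .
  obtain a b where ab: "a \<in> S" "b \<in> S" "?K = a \<otimes> ?K' \<otimes> b"
    using crossing_coset_deep[OF S disc dp(1) x(2) dp(2) y(2)] .
  let ?r1 = "\<Psi>D r1" and ?r2 = "\<Psi>D r2" and ?u1 = "\<Psi>D u1" and ?u2 = "\<Psi>D u2"
  have inS: "?r1 \<in> S" "?r2 \<in> S" "?u1 \<in> S" "?u2 \<in> S" using r u disc by blast+
  have c: "?r1 \<in> carrier G" "?r2 \<in> carrier G" "?u1 \<in> carrier G" "?u2 \<in> carrier G" "a \<in> carrier G" "b \<in> carrier G"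
    "?K' \<in> carrier G"
    using inS ab subgroup.mem_carrier[OF S] crossing_closed[OF deep_admissible[OF dp(2)]] by blast+
  let ?L = "\<Psi> (crossing_path n i j t' \<delta>' p y)"
  have L: "?L \<in> carrier G" using crossing_closed[OF y(1)] .
  have "?K' = inv ?u1 \<otimes> ?L \<otimes> inv ?u2" unfolding u(3) using c by (simp add: m_assoc) (simp add: m_assoc[symmetric])
  then have "\<Psi> (crossing_path n i j t \<delta> p x) = (?r1 \<otimes> a \<otimes> inv ?u1) \<otimes> ?L \<otimes> (inv ?u2 \<otimes> b \<otimes> ?r2)"
    unfolding r(3) ab(3) using c L by (simp add: m_assoc)
  moreover have "?r1 \<otimes> a \<otimes> inv ?u1 \<in> S" "inv ?u2 \<otimes> b \<otimes> ?r2 \<in> S"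
    using inS ab by (simp_all add: S subgroup.m_closed subgroup.m_inv_closed)
  ultimately show thesis using that Ky by metis
qed

end

section \<open>Joining configurations inside small neighbourhoods\<close>

context polygon_space
begin

text \<open>The points are moved one at a time; a point reaches another sector of its neighbourhood by
  crossing the boundary of the polygon at the centre of the sector.\<close>

lemma local_connection:
  assumes y: "\<And>i. i < n \<Longrightarrow> y i \<in> topspace X" and \<epsilon>: "\<And>i. i < n \<Longrightarrow> good_radius (y i) (\<epsilon> i)"
    and disj: "\<And>i j. i < n \<Longrightarrow> j < n \<Longrightarrow> i \<noteq> j \<Longrightarrow> nb (y i) (\<epsilon> i) \<inter> nb (y j) (\<epsilon> j) = {}"
    and trans: "\<And>a b c. R a b \<Longrightarrow> R b c \<Longrightarrow> R a c"
    and refl: "\<And>x. x \<in> topspace (disc_configurations n) \<Longrightarrow> \<forall>k<n. q (x k) \<in> nb (y k) (\<epsilon> k) \<Longrightarrow> R (J n x) (J n x)"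
    and disc: "\<And>p. pathin (disc_configurations n) p \<Longrightarrow> (\<And>v k. v \<in> {0..1} \<Longrightarrow> k < n \<Longrightarrow> q (p v k) \<in> nb (y k) (\<epsilon> k)) \<Longrightarrow>
       R (J n (p 0)) (J n (p 1))"
    and crossing: "\<And>i j t \<delta> p x. admissible n i j t \<delta> p x \<Longrightarrow> x \<in> extensional {..<n} \<Longrightarrow>
       (\<And>v k. v \<in> {0..1} \<Longrightarrow> k < n \<Longrightarrow> crossing_path n i j t \<delta> p x v k \<in> nb (y k) (\<epsilon> k)) \<Longrightarrow>
       R (crossing_path n i j t \<delta> p x 0) (crossing_path n i j t \<delta> p x 1)"
    and x: "x \<in> topspace (disc_configurations n)" "\<And>k. k < n \<Longrightarrow> q (x k) \<in> nb (y k) (\<epsilon> k)"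
    and x': "x' \<in> topspace (disc_configurations n)" "\<And>k. k < n \<Longrightarrow> q (x' k) \<in> nb (y k) (\<epsilon> k)"
  shows "R (J n x) (J n x')"
proof -
  define good where "good x \<longleftrightarrow> x \<in> topspace (disc_configurations n) \<and> (\<forall>k<n. q (x k) \<in> nb (y k) (\<epsilon> k))" for x
  have goodI: "good x" if "x \<in> extensional {..<n}" "\<And>k. k < n \<Longrightarrow> x k \<in> ball 0 1" "\<And>k. k < n \<Longrightarrow> q (x k) \<in> nb (y k) (\<epsilon> k)" for x
  proof -
    have "inj_on x {..<n}"
    proof (rule inj_onI, rule ccontr)
      fix k l assume kl: "k \<in> {..<n}" "l \<in> {..<n}" "x k = x l" "k \<noteq> l"
      then have "q (x k) \<in> nb (y k) (\<epsilon> k) \<inter> nb (y l) (\<epsilon> l)" using that(3)[of k] that(3)[of l] by simp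
      moreover have "nb (y k) (\<epsilon> k) \<inter> nb (y l) (\<epsilon> l) = {}" by (rule disj) (use kl in auto)
      ultimately show False by blast
    qed
    then show ?thesis using that by (simp add: good_def plane_configuration_iff)
  qed
  have goodD: "x \<in> extensional {..<n}" "\<And>k. k < n \<Longrightarrow> cmod (x k) < 1" "\<And>k. k < n \<Longrightarrow> q (x k) \<in> nb (y k) (\<epsilon> k)"
    if "good x" for x using that by (auto simp: good_def plane_configuration_iff)
  have good_upd: "good (x(p := z))" if "good x" "p < n" "cmod z < 1" "q z \<in> nb (y p) (\<epsilon> p)" for x p z
    using that goodD[OF that(1)] by (intro goodI) (auto simp: extensional_def)
  have sector: "R (J n (x(p := z))) (J n (x(p := z')))"
    if gx: "good x" and p: "p < n" and c: "c \<in> fib (y p)" and z: "z \<in> ball c (\<epsilon> p) \<inter> ball 0 1" "z' \<in> ball c (\<epsilon> p) \<inter> ball 0 1"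
    for x p c z z'
  proof -
    define P where "P v = x(p := (1 - v) *\<^sub>R z + v *\<^sub>R z')" for v :: real
    have "good (P v)" if v: "v \<in> {0..1}" for v
    proof -
      have "(1 - v) *\<^sub>R z + v *\<^sub>R z' \<in> ball c (\<epsilon> p) \<inter> ball 0 1"
        by (rule convexD[OF convex_Int[OF convex_ball convex_ball] z]) (use v in auto)
      then have "cmod ((1 - v) *\<^sub>R z + v *\<^sub>R z') < 1" "(1 - v) *\<^sub>R z + v *\<^sub>R z' \<in> near (y p) (\<epsilon> p)"
        using c by (auto simp: near_def dist_commute)
      then show ?thesis unfolding P_def by (intro good_upd[OF gx p]) (auto simp: nb_def)
    qed
    moreover from this have "pathin (disc_configurations n) P"
      unfolding pathin_def continuous_map_into_plane_configuration
    proof (intro conjI allI impI)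
      show "continuous_on {0..1} (\<lambda>v. P v k)" for k
        by (cases "k = p") (auto simp: P_def intro!: continuous_intros)
    qed (simp add: good_def)
    ultimately have "R (J n (P 0)) (J n (P 1))" by (intro disc) (auto simp: good_def)
    then show ?thesis by (simp add: P_def)
  qed
  have center: "R (J n (x(p := (1 - \<delta>) *\<^sub>R c))) (J n (x(p := (1 - \<delta>) *\<^sub>R c')))"
    if gx: "good x" and p: "p < n" and c: "c \<in> fib (y p)" "c' \<in> fib (y p)" and e: "(c, c') \<in> edge_pairing w"
      and \<delta>: "0 < \<delta>" "\<delta> < \<epsilon> p" "\<delta> < 1" for x p c c' \<delta>
  proof -
    obtain i j t where ij: "paired i j" "t \<in> {0..1}" "c = edge i t" "c' = edge j (partner i j t)"
      using e unfolding edge_pairing_iff by blast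
    have armnear: "q (arm l s \<delta> u) \<in> nb (y p) (\<epsilon> p)" if "edge l s \<in> fib (y p)" "u \<in> {0..1}" for l s u
    proof -
      have "arm l s \<delta> u - edge l s = - of_real (\<delta> * u) * edge l s" by (simp add: arm_def algebra_simps)
      then have "dist (arm l s \<delta> u) (edge l s) = \<delta> * u" using \<delta> that(2) by (simp add: dist_norm norm_mult del: of_real_mult)
      also have "\<dots> \<le> \<delta> * 1" using \<delta> that(2) by (intro mult_left_mono) auto
      finally have "dist (arm l s \<delta> u) (edge l s) < \<epsilon> p" using \<delta> by simp
      moreover have "arm l s \<delta> u \<in> cball 0 1" by (rule arm_cball) (use \<delta> that in auto)
      ultimately show ?thesis using that(1) unfolding nb_def near_def by blast
    qed
    have cs: "edge i t \<in> fib (y p)" "edge j (partner i j t) \<in> fib (y p)" using c ij by auto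
    have ne: "x k \<noteq> arm l s \<delta> u" if "k < n" "k \<noteq> p" "u \<in> {0..1}" "edge l s \<in> fib (y p)" for k l s u
    proof
      assume "x k = arm l s \<delta> u"
      then have "q (x k) \<in> nb (y k) (\<epsilon> k) \<inter> nb (y p) (\<epsilon> p)" using goodD(3)[OF gx that(1)] armnear[OF that(4,3)] by simp
      then show False using disj[OF that(1) p that(2)] by simp
    qed
    have "inj_on x {..<n}" using gx by (simp add: good_def plane_configuration_iff)
    then have "inj_on x ({..<n} - {p})" by (rule inj_on_subset) auto
    then have a: "admissible n i j t \<delta> p x"
      unfolding admissible_def using ij p \<delta> goodD(2)[OF gx] ne cs by blast
    have "R (crossing_path n i j t \<delta> p x 0) (crossing_path n i j t \<delta> p x 1)"
    proof (rule crossing[OF a goodD(1)[OF gx]])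
      fix v :: real and k assume v: "v \<in> {0..1}" and k: "k < n"
      have "cross i j t \<delta> v \<in> nb (y p) (\<epsilon> p)"
        unfolding cross_def using armnear[OF cs(1), of "1 - 2 * v"] armnear[OF cs(2), of "2 * v - 1"] v by auto
      then show "crossing_path n i j t \<delta> p x v k \<in> nb (y k) (\<epsilon> k)"
        using goodD(3)[OF gx k] k by (simp add: crossing_path_def J_def)
    qed
    moreover have "arm i t \<delta> 1 = (1 - \<delta>) *\<^sub>R c" "arm j (partner i j t) \<delta> 1 = (1 - \<delta>) *\<^sub>R c'"
      by (simp_all add: arm_def ij scaleR_conv_of_real)
    ultimately show ?thesis unfolding crossing_path_ends[OF p] by simp
  qed
  have move: "R (J n (x(p := z))) (J n (x(p := z')))"
    if gx: "good x" and p: "p < n" and z: "cmod z < 1" "q z \<in> nb (y p) (\<epsilon> p)" and z': "cmod z' < 1" "q z' \<in> nb (y p) (\<epsilon> p)"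
    for x p z z'
  proof -
    have g: "good_radius (y p) (\<epsilon> p)" "0 < \<epsilon> p" using \<epsilon>[OF p] by (auto simp: good_radius_def)
    have "z \<in> near (y p) (\<epsilon> p)" "z' \<in> near (y p) (\<epsilon> p)"
      unfolding near_preimage[OF g(1), symmetric] using z z' by simp_all
    then obtain c c' where c: "c \<in> fib (y p)" "dist z c < \<epsilon> p" and c': "c' \<in> fib (y p)" "dist z' c' < \<epsilon> p"
      by (auto simp: near_def)
    \<comment> \<open>Smaller than the radius \<open>\<epsilon> p\<close>, so that arms of this
      depth at the fibre points stay in the neighbourhood.\<close>
    define \<delta> where "\<delta> = min (\<epsilon> p / 2) (1 / 2)"
    have \<delta>: "0 < \<delta>" "\<delta> < \<epsilon> p" "\<delta> < 1" using g(2) by (auto simp: \<delta>_def)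
    have inward: "(1 - \<delta>) *\<^sub>R d \<in> ball d (\<epsilon> p) \<inter> ball 0 1" if "cmod d = 1" for d
    proof -
      have "d - (1 - \<delta>) *\<^sub>R d = \<delta> *\<^sub>R d" by (simp add: algebra_simps)
      then show ?thesis using that \<delta> by (simp add: dist_norm)
    qed
    have zc: "z \<in> ball c (\<epsilon> p) \<inter> ball 0 1" using z(1) c(2) by (simp add: dist_commute)
    have "(c, c') \<in> polygon_gluing w" using c(1) c'(1) q_eq[of c c'] by (simp add: fib_def)
    then consider "c' = c" | "(c, c') \<in> (edge_pairing w)\<^sup>+" by (auto simp: polygon_gluing_def)
    then show ?thesis
    proof cases
      case 1
      then show ?thesis using sector[OF gx p c(1)] z z' c(2) c'(2) by (simp add: dist_commute)
    next
      case 2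
      have "cmod c = 1" using edge_pairing_sphere[OF 2] by simp
      \<comment> \<open>Around a glued corner the passage from the sector at \<open>c\<close> to the
        sector at \<open>c'\<close> may take several crossings, one for each link of the chain of
        pairings.\<close>
      from 2 have "c' \<in> fib (y p) \<and> R (J n (x(p := z))) (J n (x(p := (1 - \<delta>) *\<^sub>R c')))"
      proof (induction rule: trancl_induct)
        case (base d)
        have "d \<in> fib (y p)"
        proof -
          have d: "d \<in> cball 0 1" using base edge_pairing_subset by blast
          have "(c, d) \<in> polygon_gluing w" using base by (auto simp: polygon_gluing_def)
          then have "q c = q d" using q_eq[of c d] c(1) d by (simp add: fib_def)
          then show ?thesis using c(1) d by (simp add: fib_def)
        qed
        moreover have "R (J n (x(p := z))) (J n (x(p := (1 - \<delta>) *\<^sub>R c)))"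
          by (rule sector[OF gx p c(1) zc inward]) fact
        ultimately show ?case using trans center[OF gx p c(1) _ base \<delta>] by blast
      next
        case (step d d')
        have "d' \<in> fib (y p)"
        proof -
          have d: "d' \<in> cball 0 1" using step(2) edge_pairing_subset by blast
          have "(d, d') \<in> polygon_gluing w" using step(2) by (auto simp: polygon_gluing_def)
          then have "q d = q d'" using q_eq[of d d'] step(3) d by (simp add: fib_def)
          then show ?thesis using step(3) d by (simp add: fib_def)
        qed
        then show ?case using trans center[OF gx p _ _ step(2) \<delta>] step(3) by blast
      qed
      moreover have "cmod c' = 1" using edge_pairing_sphere[OF 2] by simp
      then have "R (J n (x(p := (1 - \<delta>) *\<^sub>R c'))) (J n (x(p := z')))"
        using sector[OF gx p c'(1) inward, of z'] z'(1) c'(2) by (simp add: dist_commute)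
      ultimately show ?thesis using trans by blast
    qed
  qed
  define mix where "mix m = (\<lambda>k. if k < m then x' k else x k)" for m
  have gx: "good x" "good x'" using x x' by (auto simp: good_def)
  have gm: "good (mix m)" for m
    using goodD[OF gx(1)] goodD[OF gx(2)] by (intro goodI) (auto simp: mix_def extensional_def)
  have "R (J n x) (J n (mix m))" if "m \<le> n" for m
    using that
  proof (induction m)
    case 0
    have "mix 0 = x" by (simp add: mix_def)
    then show ?case using refl x by simp
  next
    case (Suc m)
    have m: "m < n" using Suc.prems by simp
    have "R (J n ((mix m)(m := x m))) (J n ((mix m)(m := x' m)))"
      by (rule move[OF gm m goodD(2)[OF gx(1) m] goodD(3)[OF gx(1) m] goodD(2)[OF gx(2) m] goodD(3)[OF gx(2) m]])
    moreover have "(mix m)(m := x m) = mix m" "(mix m)(m := x' m) = mix (Suc m)"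
      by (auto simp: mix_def fun_eq_iff less_Suc_eq)
    ultimately show ?case using Suc trans by simp
  qed
  moreover have "J n (mix n) = J n x'" by (auto simp: mix_def J_def)
  ultimately show ?thesis by (metis order_refl)
qed

text \<open>A representative of each point in the closed disc is scaled by \<open>1 - v / 2\<close>.
  For \<open>v > 0\<close> the result lies in the open disc and remains injective, as the
  representatives are distinct; at \<open>v = 0\<close> it is the given configuration.\<close>

lemma disc_access:
  assumes V: "openin (configuration_space n X) V" "y \<in> V"
  obtains p where "pathin (configuration_space n X) p" "p ` {0..1} \<subseteq> V" "p 0 = y"
    "p 1 \<in> J n ` topspace (disc_configurations n)"
proof -
  have y: "y \<in> topspace (configuration_space n X)" using V openin_subset by blast
  then have yX: "y i \<in> topspace X" if "i < n" for i using that by (auto simp: topspace_configuration_space PiE_iff)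
  define c where "c i = (SOME c. c \<in> fib (y i))" for i
  have c: "c i \<in> fib (y i)" if "i < n" for i
    unfolding c_def using fib_nonempty[OF yX[OF that]] some_in_eq by blast
  have c1: "cmod (c i) \<le> 1" "q (c i) = y i" if "i < n" for i using c[OF that] by (auto simp: fib_def)
  define C where "C v = (\<lambda>i. if i < n then (1 - v / 2) *\<^sub>R c i else undefined)" for v :: real
  define P where "P v = J n (C v)" for v
  have P0: "P 0 = y"
    using y c1(2) by (auto simp: P_def J_def C_def topspace_configuration_space fun_eq_iff PiE_iff extensional_def)
  have Cdisc: "C v \<in> topspace (disc_configurations n)" if v: "0 < v" "v \<le> 1" for v
    unfolding plane_configuration_iff
  proof (intro conjI allI impI)
    show "C v \<in> extensional {..<n}" by (auto simp: C_def extensional_def)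
    show "C v i \<in> ball 0 1" if "i < n" for i
    proof -
      have "cmod (C v i) = (1 - v / 2) * cmod (c i)" using v that by (simp add: C_def)
      also have "\<dots> \<le> (1 - v / 2) * 1" using c1(1)[OF that] v by (intro mult_left_mono) auto
      finally show ?thesis using v by simp
    qed
    show "inj_on (C v) {..<n}"
    proof (rule inj_onI)
      fix i j assume ij: "i \<in> {..<n}" "j \<in> {..<n}" "C v i = C v j"
      then have "c i = c j" using v by (simp add: C_def)
      then have "y i = y j" using c1(2) ij by (metis lessThan_iff)
      then show "i = j" using y ij by (auto simp: topspace_configuration_space inj_on_def)
    qed
  qed
  have cP: "continuous_map (top_of_set {0..1}) (configuration_space n X) P"
    unfolding continuous_map_into_configuration_space
  proof (intro conjI allI impI)
    fix i assume i: "i < n"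
    have "continuous_map (top_of_set {0..1}) X (\<lambda>v. q ((1 - v / 2) *\<^sub>R c i))"
    proof (rule continuous_map_q_comp)
      show "(\<lambda>v. (1 - v / 2) *\<^sub>R c i) \<in> {0..1} \<rightarrow> cball 0 1"
      proof
        fix v :: real assume v: "v \<in> {0..1}"
        have "(1 - v / 2) * cmod (c i) \<le> 1 * 1" using c1(1)[OF i] v by (intro mult_mono) auto
        then show "(1 - v / 2) *\<^sub>R c i \<in> cball 0 1" using v by simp
      qed
    qed (intro continuous_intros, simp)
    then show "continuous_map (top_of_set {0..1}) X (\<lambda>v. P v i)" using i by (simp add: P_def J_def C_def)
  next
    show "P \<in> topspace (top_of_set {0..1}) \<rightarrow> topspace (configuration_space n X)"
    proof
      fix v :: real assume v: "v \<in> topspace (top_of_set {0..1})"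
      show "P v \<in> topspace (configuration_space n X)"
      proof (cases "v = 0")
        case False
        then show ?thesis unfolding P_def using v by (intro J_configuration' Cdisc) auto
      qed (simp add: P0 y)
    qed
  qed
  have "openin (top_of_set {0..1}) {v \<in> topspace (top_of_set {0..1}). P v \<in> V}"
    by (rule openin_continuous_map_preimage[OF cP V(1)])
  moreover have "0 \<in> {v \<in> topspace (top_of_set {0..1}). P v \<in> V}" using V(2) P0 by simp
  ultimately have "\<exists>e>0. \<forall>v\<in>{0..1}. dist v 0 < e \<longrightarrow> v \<in> {v \<in> topspace (top_of_set {0..1}). P v \<in> V}"
    unfolding openin_euclidean_subtopology_iff by (rule bspec[OF conjunct2])
  then obtain e where e: "0 < e" "\<And>v. v \<in> {0..1} \<Longrightarrow> dist v 0 < e \<Longrightarrow> P v \<in> V" by blast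
  define \<eta> where "\<eta> = min (e / 2) 1"
  have \<eta>: "0 < \<eta>" "\<eta> \<le> 1" "\<eta> < e" using e(1) by (auto simp: \<eta>_def)
  have r: "v * \<eta> \<in> {0..1} \<and> v * \<eta> < e" if "v \<in> {0..1}" for v
  proof -
    have "v * \<eta> \<le> 1 * \<eta>" by (rule mult_right_mono) (use that \<eta> in auto)
    then have "v * \<eta> \<le> \<eta>" by simp
    moreover have "0 \<le> v * \<eta>" using that \<eta> by simp
    ultimately show ?thesis using \<eta> by (unfold atLeastAtMost_iff, intro conjI; linarith)
  qed
  show thesis
  proof (rule that[of "\<lambda>v. P (v * \<eta>)"])
    show "pathin (configuration_space n X) (\<lambda>v. P (v * \<eta>))"
      unfolding pathin_def by (rule continuous_map_compose_on[OF cP]) (use r in \<open>auto intro!: continuous_intros\<close>)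
    show "(\<lambda>v. P (v * \<eta>)) ` {0..1} \<subseteq> V"
    proof (rule image_subsetI)
      fix v :: real assume "v \<in> {0..1}"
      then show "P (v * \<eta>) \<in> V" using e(2)[of "v * \<eta>"] r[of v] by simp
    qed
    show "P (0 * \<eta>) = y" using P0 by simp
    show "P (1 * \<eta>) \<in> J n ` topspace (disc_configurations n)" using Cdisc[of \<eta>] \<eta> by (auto simp: P_def)
  qed
qed

lemma path_connected_space_configurations: "path_connected_space (configuration_space n X)"
proof -
  let ?F = "configuration_space n X"
  have "\<exists>p. pathin ?F p \<and> p 0 = a \<and> p 1 = b" if ab: "a \<in> topspace ?F" "b \<in> topspace ?F" for a b
  proof -
    obtain p where p: "pathin ?F p" "p 0 = a" "p 1 \<in> J n ` topspace (disc_configurations n)"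
      using disc_access[OF openin_topspace ab(1)] .
    obtain r where r: "pathin ?F r" "r 0 = b" "r 1 \<in> J n ` topspace (disc_configurations n)"
      using disc_access[OF openin_topspace ab(2)] .
    obtain x y where xy: "x \<in> topspace (disc_configurations n)" "y \<in> topspace (disc_configurations n)" "p 1 = J n x" "r 1 = J n y"
      using p r by blast
    have "path_connected_space (disc_configurations n)" by (rule path_connected_space_plane_configurations) auto
    then obtain s where s: "pathin (disc_configurations n) s" "s 0 = x" "s 1 = y"
      using xy unfolding path_connected_space_def by blast
    have 1: "pathin ?F (loop_join p (\<lambda>t. J n (s t)))"
      by (rule pathin_loop_join[OF p(1) pathin_continuous_map[OF s(1) continuous_map_J]]) (simp add: xy s)
    have "pathin ?F (loop_join (loop_join p (\<lambda>t. J n (s t))) (\<lambda>t. r (1 - t)))"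
      by (rule pathin_loop_join[OF 1 pathin_reverse[OF r(1)]]) (simp add: xy s)
    moreover have "loop_join (loop_join p (\<lambda>t. J n (s t))) (\<lambda>t. r (1 - t)) 0 = a"
      "loop_join (loop_join p (\<lambda>t. J n (s t))) (\<lambda>t. r (1 - t)) 1 = b" using p r by simp_all
    ultimately show ?thesis by blast
  qed
  then show ?thesis unfolding path_connected_space_def by blast
qed

end

section \<open>Generation of the values on the whole surface\<close>

context surface_rep
begin

text \<open>The neighbourhood of \<open>y\<close> is a box of contractible neighbourhoods.
  Contracting a path inside it shows that its value is \<open>c (p 0)\<close> times the inverse of
  \<open>c (p 1)\<close>, where \<open>c u\<close> is the value of the contraction of
  \<open>u\<close> to \<open>y\<close>. So only the ends count, and ends in the disc are joined
  within the box by disc paths and crossings.\<close>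

theorem surface_generated:
  assumes H: "subgroup H G" and disc: "\<And>p. pathin (disc_configurations n) p \<Longrightarrow> \<Psi>D p \<in> H"
    and crossing: "\<And>i j t \<delta> p x. admissible n i j t \<delta> p x \<Longrightarrow> x \<in> extensional {..<n} \<Longrightarrow>
       \<Psi> (crossing_path n i j t \<delta> p x) \<in> H"
    and p: "pathin (configuration_space n X) p" "p 0 \<in> J n ` topspace (disc_configurations n)"
      "p 1 \<in> J n ` topspace (disc_configurations n)"
  shows "\<Psi> p \<in> H"
proof (rule rep_generated[OF H _ _ p])
  let ?F = "configuration_space n X" and ?E = "topspace (disc_configurations n)"
  let ?S = "{0..1} \<times> {0..1} :: (real \<times> real) set"
  fix y assume y: "y \<in> topspace ?F"
  have yX: "y i \<in> topspace X" if "i < n" for i using that y by (auto simp: topspace_configuration_space PiE_iff)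
  define A where "A = {(i, j). i < n \<and> j < n \<and> i \<noteq> j}"
  have "A \<subseteq> {..<n} \<times> {..<n}" by (auto simp: A_def)
  then have fA: "finite A" by (rule finite_subset) simp
  have "\<forall>a\<in>A. \<exists>d>0. nb (y (fst a)) d \<inter> nb (y (snd a)) d = {}"
  proof
    fix a assume a: "a \<in> A"
    then have "y (fst a) \<noteq> y (snd a)" using y by (auto simp: A_def topspace_configuration_space inj_on_def)
    then show "\<exists>d>0. nb (y (fst a)) d \<inter> nb (y (snd a)) d = {}"
    proof (rule nb_disjoint[rotated 2])
      show "y (fst a) \<in> topspace X" "y (snd a) \<in> topspace X" using a yX by (auto simp: A_def)
    qed blast
  qed
  then obtain D where D: "\<forall>a\<in>A. 0 < D a \<and> nb (y (fst a)) (D a) \<inter> nb (y (snd a)) (D a) = {}" by (rule bchoice[THEN exE])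
  \<comment> \<open>The contractions start in \<open>nb (y i) (\<epsilon> i)\<close> but are only
    known to stay in \<open>nb (y i) \<epsilon>0\<close>. These larger sets have to be disjoint for
    the contracted points to remain a configuration.\<close>
  obtain \<epsilon>0 where \<epsilon>0: "0 < \<epsilon>0" "\<And>a. a \<in> A \<Longrightarrow> \<epsilon>0 \<le> D a"
    by (rule finite_lower_bound[OF fA, of D]) (use D in auto)
  have disj0: "nb (y i) \<epsilon>0 \<inter> nb (y j) \<epsilon>0 = {}" if "i < n" "j < n" "i \<noteq> j" for i j
  proof -
    have "(i, j) \<in> A" using that by (simp add: A_def)
    then show ?thesis using D \<epsilon>0(2)[of "(i, j)"] nb_mono[of \<epsilon>0 "D (i, j)"] by fastforce
  qed
  define Q where "Q i e h \<longleftrightarrow> e \<le> \<epsilon>0 \<and> good_radius (y i) e \<and>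
      continuous_map (prod_topology (subtopology X (nb (y i) e)) (top_of_set {0..1 :: real})) X h \<and>
      (\<forall>x\<in>nb (y i) e. h (x, 0) = x \<and> h (x, 1) = y i \<and> (\<forall>\<tau>\<in>{0..1}. h (x, \<tau>) \<in> nb (y i) \<epsilon>0))" for i e h
  have "\<forall>i\<in>{..<n}. \<exists>eh. Q i (fst eh) (snd eh)"
  proof
    fix i assume "i \<in> {..<n}"
    then obtain e h where "0 < e" "e \<le> \<epsilon>0" "good_radius (y i) e"
      "continuous_map (prod_topology (subtopology X (nb (y i) e)) (top_of_set {0..1 :: real})) X h"
      "\<And>x. x \<in> nb (y i) e \<Longrightarrow> h (x, 0) = x" "\<And>x. x \<in> nb (y i) e \<Longrightarrow> h (x, 1) = y i"
      "\<And>x \<tau>. x \<in> nb (y i) e \<Longrightarrow> \<tau> \<in> {0..1} \<Longrightarrow> h (x, \<tau>) \<in> nb (y i) \<epsilon>0"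
      using contraction[OF yX \<epsilon>0(1), of i] by blast
    then have "Q i (fst (e, h)) (snd (e, h))" unfolding Q_def by simp
    then show "\<exists>eh. Q i (fst eh) (snd eh)" ..
  qed
  then obtain eh where eh: "\<forall>i\<in>{..<n}. Q i (fst (eh i)) (snd (eh i))" by (rule bchoice[THEN exE])
  define \<epsilon> where "\<epsilon> i = fst (eh i)" for i
  define h where "h i = snd (eh i)" for i
  have Q: "Q i (\<epsilon> i) (h i)" if "i < n" for i using eh that by (simp add: \<epsilon>_def h_def)
  have good: "good_radius (y i) (\<epsilon> i)" "\<epsilon> i \<le> \<epsilon>0"
    and hc: "continuous_map (prod_topology (subtopology X (nb (y i) (\<epsilon> i))) (top_of_set {0..1 :: real})) X (h i)"
    and h0: "\<And>x. x \<in> nb (y i) (\<epsilon> i) \<Longrightarrow> h i (x, 0) = x" and h1: "\<And>x. x \<in> nb (y i) (\<epsilon> i) \<Longrightarrow> h i (x, 1) = y i"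
    and hnb: "\<And>x \<tau>. x \<in> nb (y i) (\<epsilon> i) \<Longrightarrow> \<tau> \<in> {0..1} \<Longrightarrow> h i (x, \<tau>) \<in> nb (y i) \<epsilon>0" if "i < n" for i
    using Q[OF that] unfolding Q_def by blast+
  have disj: "nb (y i) (\<epsilon> i) \<inter> nb (y j) (\<epsilon> j) = {}" if "i < n" "j < n" "i \<noteq> j" for i j
    using disj0[OF that] nb_mono[OF good(2)[OF that(1)], of "y i"] nb_mono[OF good(2)[OF that(2)], of "y j"] by blast
  define W where "W = {u \<in> topspace ?F. \<forall>i<n. u i \<in> nb (y i) (\<epsilon> i)}"
  define c where "c u = \<Psi> (\<lambda>s i. if i < n then h i (u i, s) else undefined)" for u
  have contr: "c (p 0) \<in> carrier G \<and> c (p 1) \<in> carrier G \<and> c (p 0) = \<Psi> p \<otimes> c (p 1)"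
    if p: "pathin ?F p" "\<And>v. v \<in> {0..1} \<Longrightarrow> p v \<in> W" for p
  proof -
    define F where "F z = (\<lambda>i. if i < n then h i (p (snd z) i, fst z) else undefined)" for z :: "real \<times> real"
    have pnb: "p v i \<in> nb (y i) (\<epsilon> i)" if "v \<in> {0..1}" "i < n" for v i using p(2)[OF that(1)] that(2) by (simp add: W_def)
    have F: "continuous_map (top_of_set ?S) ?F F"
      unfolding continuous_map_into_configuration_space
    proof (intro conjI allI impI)
      fix i assume i: "i < n"
      have "continuous_map (top_of_set {0..1}) X (\<lambda>v. p v i)"
        using pathin_continuous_map[OF p(1) continuous_map_configuration_space_coord[OF i]] by (simp add: pathin_def)
      then have "continuous_map (top_of_set ?S) X (\<lambda>z. p (snd z) i)"
        by (rule continuous_map_compose_on) (auto intro!: continuous_intros)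
      then have 1: "continuous_map (top_of_set ?S) (subtopology X (nb (y i) (\<epsilon> i))) (\<lambda>z. p (snd z) i)"
        using pnb[OF _ i] by (auto simp: continuous_map_in_subtopology)
      have "continuous_map (top_of_set ?S) (prod_topology (subtopology X (nb (y i) (\<epsilon> i))) (top_of_set {0..1})) (\<lambda>z. (p (snd z) i, fst z))"
        unfolding continuous_map_pairwise
        using 1 by (auto simp: o_def continuous_map_in_subtopology intro!: continuous_intros)
      from continuous_map_compose[OF this hc[OF i]]
      show "continuous_map (top_of_set ?S) X (\<lambda>z. F z i)" using i by (simp add: F_def o_def)
    next
      show "F \<in> topspace (top_of_set ?S) \<rightarrow> topspace ?F"
      proof
        fix z assume "z \<in> topspace (top_of_set ?S)"
        then have z: "fst z \<in> {0..1}" "snd z \<in> {0..1}" by auto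
        have Fnb: "F z i \<in> nb (y i) \<epsilon>0" if "i < n" for i
          using hnb[OF that pnb[OF z(2) that] z(1)] that by (simp add: F_def)
        show "F z \<in> topspace ?F"
        proof (rule topspace_configuration_spaceI)
          show "F z \<in> extensional {..<n}" by (auto simp: F_def extensional_def)
          show "F z i \<in> topspace X" if "i < n" for i
            using Fnb[OF that] by (auto simp: nb_def near_def topspace_X)
          show "inj_on (F z) {..<n}"
          proof (rule inj_onI, rule ccontr)
            fix i j assume ij: "i \<in> {..<n}" "j \<in> {..<n}" "F z i = F z j" "i \<noteq> j"
            then show False using Fnb[of i] Fnb[of j] disj0[of i j] by auto
          qed
        qed
      qed
    qed
    have F0: "\<Psi> (\<lambda>t. F (0, t)) = \<Psi> p"
    proof (rule rep_eq[symmetric, OF p(1)])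
      fix t :: real assume t: "t \<in> {0..1}"
      have "p t \<in> extensional {..<n}" using pathin_top[OF p(1) t] by (auto simp: topspace_configuration_space PiE_iff)
      then show "p t = F (0, t)" using h0[OF _ pnb[OF t]] by (auto simp: F_def fun_eq_iff extensional_def)
    qed
    have "pathin ?F (\<lambda>t. F (1, t))" unfolding pathin_def
      by (rule continuous_map_compose_on[OF F]) (auto intro!: continuous_intros)
    then have "\<Psi> (\<lambda>t. F (1, t)) = \<Psi> (\<lambda>_. y)"
    proof (rule rep_eq)
      fix t :: real assume t: "t \<in> {0..1}"
      have "y \<in> extensional {..<n}" using y by (auto simp: topspace_configuration_space PiE_iff)
      then show "F (1, t) = y" using h1[OF _ pnb[OF t]] by (auto simp: F_def fun_eq_iff extensional_def)
    qed
    then have F1: "\<Psi> (\<lambda>t. F (1, t)) = \<one>" using rep_const[OF y] by simp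
    have cc: "\<Psi> (\<lambda>t. F (t, s)) \<in> carrier G" if "s \<in> {0..1}" for s
    proof (rule closed, unfold pathin_def, rule continuous_map_compose_on[OF F])
      show "(\<lambda>t. (t, s)) \<in> {0..1} \<rightarrow> ?S" using that by auto
    qed (intro continuous_intros)
    have "c (p 0) = \<Psi> (\<lambda>t. F (t, 0))" "c (p 1) = \<Psi> (\<lambda>t. F (t, 1))"
      unfolding c_def F_def fst_conv snd_conv by (rule refl)+
    then show ?thesis using rep_square[OF F] cc[of 0] cc[of 1] unfolding F0 F1 by simp
  qed
  \<comment> \<open>Says that paths in \<open>W\<close> from \<open>a\<close> to \<open>b\<close>
    have values in \<open>H\<close>, but stated through \<open>c\<close>, which makes it transitive.
    Membership in the carrier is carried along because \<open>c\<close> is a group element only for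
    actual points of \<open>W\<close>.\<close>
  define R where "R a b \<longleftrightarrow> c a \<in> carrier G \<and> c b \<in> carrier G \<and> c a \<otimes> inv (c b) \<in> H" for a b
  have R: "R (p 0) (p 1)" if "pathin ?F p" "\<And>v. v \<in> {0..1} \<Longrightarrow> p v \<in> W" "\<Psi> p \<in> H" for p
    using contr[OF that(1,2)] that(3) closed[OF that(1)] unfolding R_def by (simp add: m_assoc)
  have W_I: "u \<in> W" if "u \<in> topspace ?F" "\<And>i. i < n \<Longrightarrow> u i \<in> nb (y i) (\<epsilon> i)" for u using that by (simp add: W_def)
  have conn: "R (J n x) (J n x')" if x: "x \<in> ?E" "J n x \<in> W" "x' \<in> ?E" "J n x' \<in> W" for x x'
  proof (rule local_connection[where R = R and y = y and \<epsilon> = \<epsilon>, OF yX good(1) disj])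
    fix a b d assume ab: "R a b" "R b d"
    then have "c a \<otimes> inv (c d) = (c a \<otimes> inv (c b)) \<otimes> (c b \<otimes> inv (c d))"
      unfolding R_def by (metis inv_closed inv_solve_left l_inv m_assoc m_closed r_one l_one)
    then show "R a d" using ab subgroup.m_closed[OF H] unfolding R_def by simp
  next
    fix x assume x: "x \<in> ?E" "\<forall>k<n. q (x k) \<in> nb (y k) (\<epsilon> k)"
    have "R ((\<lambda>_. J n x) 0) ((\<lambda>_. J n x) (1::real))"
    proof (rule R)
      show "J n x \<in> W" by (rule W_I[OF J_configuration'[OF x(1)]]) (use x(2) in \<open>simp add: J_def\<close>)
      show "pathin ?F (\<lambda>_. J n x)" using J_configuration'[OF x(1)] by simp
      show "\<Psi> (\<lambda>_. J n x) \<in> H" using rep_const[OF J_configuration'[OF x(1)]] subgroup.one_closed[OF H] by simp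
    qed
    then show "R (J n x) (J n x)" by simp
  next
    fix p assume p: "pathin (disc_configurations n) p" "\<And>v k. v \<in> {0..1} \<Longrightarrow> k < n \<Longrightarrow> q (p v k) \<in> nb (y k) (\<epsilon> k)"
    show "R (J n (p 0)) (J n (p 1))"
    proof (rule R[of "\<lambda>v. J n (p v)"])
      show "pathin ?F (\<lambda>v. J n (p v))" by (rule pathin_J[OF p(1)])
      show "J n (p v) \<in> W" if "v \<in> {0..1}" for v
        by (rule W_I[OF pathin_top[OF pathin_J[OF p(1)] that]]) (use p(2)[OF that] in \<open>simp add: J_def\<close>)
      show "\<Psi> (\<lambda>v. J n (p v)) \<in> H" using disc[OF p(1)] by (simp add: \<Psi>D_def)
    qed
  next
    fix i j t \<delta> p x
    assume a: "admissible n i j t \<delta> p x" "x \<in> extensional {..<n}"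
      and nb: "\<And>v k. v \<in> {0..1} \<Longrightarrow> k < n \<Longrightarrow> crossing_path n i j t \<delta> p x v k \<in> nb (y k) (\<epsilon> k)"
    show "R (crossing_path n i j t \<delta> p x 0) (crossing_path n i j t \<delta> p x 1)"
      by (rule R[OF pathin_crossing[OF a(1)] W_I[OF crossing_configuration[OF a(1)] nb] crossing[OF a]])
  qed (use x in \<open>auto simp: W_def J_def\<close>)
  show "\<exists>W. openin ?F W \<and> y \<in> W \<and> (\<forall>p. pathin ?F p \<longrightarrow> p ` {0..1} \<subseteq> W \<longrightarrow> p 0 \<in> J n ` ?E \<longrightarrow> p 1 \<in> J n ` ?E \<longrightarrow> \<Psi> p \<in> H)"
  proof (intro exI[of _ W] conjI allI impI)
    show "openin ?F W" unfolding W_def by (rule openin_configuration_box[OF openin_nb[OF good(1)]])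
    show "y \<in> W" using y nb_self[OF yX] good(1) by (auto simp: W_def good_radius_def)
    fix p assume p: "pathin ?F p" "p ` {0..1} \<subseteq> W" "p 0 \<in> J n ` ?E" "p 1 \<in> J n ` ?E"
    obtain x x' where x: "x \<in> ?E" "p 0 = J n x" "x' \<in> ?E" "p 1 = J n x'" using p(3,4) by blast
    have pW: "p v \<in> W" if "v \<in> {0..1}" for v using p(2) that by blast
    have "R (p 0) (p 1)" unfolding x(2,4) by (rule conn) (use x pW[of 0] pW[of 1] in auto)
    then show "\<Psi> p \<in> H" using contr[OF p(1) pW] closed[OF p(1)] unfolding R_def by (auto simp: m_assoc)
  qed
next
  fix y V assume "openin (configuration_space n X) V" "y \<in> V"
  from disc_access[OF this]
  show "\<exists>p. pathin (configuration_space n X) p \<and> p ` {0..1} \<subseteq> V \<and> p 0 = y \<and> p 1 \<in> J n ` topspace (disc_configurations n)"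
    by metis
qed

end

text \<open>The second assumption is generation by the exchanges for disc paths with arbitrary ends,
  generic or not.\<close>

locale gauged_surface_rep = surface_rep +
  assumes gauged: "gauged_disc_rep G n \<Psi>D"
    and disc_values: "subgroup H G \<Longrightarrow> (\<And>k. Suc k < n \<Longrightarrow> gauged_disc_rep.gen n \<Psi>D k \<in> H) \<Longrightarrow>
      pathin (disc_configurations n) p \<Longrightarrow> \<Psi>D p \<in> H"

text \<open>\<open>J n\<close> is injective and compatible with relabelling, so the gauge on the
  disc transports to its image. Elsewhere it is set to one; invariance persists since the image is
  closed under relabelling.\<close>

theorem (in surface_rep) surface_gauge:
  obtains \<gamma> where "\<gamma> \<in> topspace (configuration_space n X) \<rightarrow> carrier G"
    "\<And>y s. y \<in> topspace (configuration_space n X) \<Longrightarrow> s permutes {..<n} \<Longrightarrow> \<gamma> (y \<circ> s) = \<gamma> y"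
    "gauged_surface_rep w X q G n (\<lambda>p. \<gamma> (p 0) \<otimes> \<Psi> p \<otimes> inv (\<gamma> (p 1)))"
proof -
  let ?F = "configuration_space n X" and ?E = "disc_configurations n"
  interpret D: disc_rep G n \<Psi>D by (rule disc_rep_\<Psi>D)
  let ?g = "\<lambda>g p. g (p 0) \<otimes> \<Psi>D p \<otimes> inv (g (p 1))"
  obtain g where g: "g \<in> topspace ?E \<rightarrow> carrier G"
    "\<And>x s. x \<in> topspace ?E \<Longrightarrow> s permutes {..<n} \<Longrightarrow> g (x \<circ> s) = g x"
    "gauged_disc_rep G n (?g g)"
    and gH: "\<forall>H p. subgroup H G \<longrightarrow> (\<forall>k. Suc k < n \<longrightarrow> gauged_disc_rep.gen n (?g g) k \<in> H) \<longrightarrow>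
       pathin ?E p \<longrightarrow> ?g g p \<in> H"
  proof (rule D.gauge_exists)
    fix g assume a: "g \<in> topspace ?E \<rightarrow> carrier G"
      "\<And>x s. x \<in> topspace ?E \<Longrightarrow> s permutes {..<n} \<Longrightarrow> g (x \<circ> s) = g x"
      "gauged_disc_rep G n (?g g)"
      and b: "\<And>H p. subgroup H G \<Longrightarrow> (\<And>k. Suc k < n \<Longrightarrow> gauged_disc_rep.gen n (?g g) k \<in> H) \<Longrightarrow>
       pathin ?E p \<Longrightarrow> ?g g p \<in> H"
    show thesis
    proof (rule that[OF a(1) _ a(3)])
      show "g (x \<circ> s) = g x" if "x \<in> topspace ?E" "s permutes {..<n}" for x s by (rule a(2)[OF that])
    qed (intro allI impI, rule b; simp)
  qed
  define \<gamma> where "\<gamma> y = (if y \<in> J n ` topspace ?E then g (inv_into (topspace ?E) (J n) y) else \<one>)" for y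
  have \<gamma>J: "\<gamma> (J n x) = g x" if "x \<in> topspace ?E" for x
    using that inv_into_f_f[OF J_inj that] by (simp add: \<gamma>_def)
  have \<gamma>: "\<gamma> \<in> topspace ?F \<rightarrow> carrier G"
    using g(1) inv_into_into[of _ "J n" "topspace ?E"] by (auto simp: \<gamma>_def Pi_iff)
  have perm: "\<gamma> (y \<circ> s) = \<gamma> y" if y: "y \<in> topspace ?F" and s: "s permutes {..<n}" for y s
  proof (cases "y \<in> J n ` topspace ?E")
    case True
    then obtain x where x: "x \<in> topspace ?E" "y = J n x" by blast
    then show ?thesis
      using \<gamma>J[OF configuration_permute[OF x(1) s]] \<gamma>J[OF x(1)] g(2)[OF x(1) s] J_permute[OF s] by metis
  next
    case False
    have "y \<circ> s \<notin> J n ` topspace ?E"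
    proof
      assume "y \<circ> s \<in> J n ` topspace ?E"
      then obtain x where x: "x \<in> topspace ?E" "y \<circ> s = J n x" by blast
      have "y = J n x \<circ> inv' s" unfolding x(2)[symmetric] by (simp add: comp_assoc permutes_inv_o(1)[OF s])
      also have "\<dots> = J n (x \<circ> inv' s)" using J_permute[OF permutes_inv[OF s]] by simp
      finally show False using False configuration_permute[OF x(1) permutes_inv[OF s]] by blast
    qed
    then show ?thesis using False by (simp add: \<gamma>_def)
  qed
  let ?\<Psi>' = "\<lambda>p. \<gamma> (p 0) \<otimes> \<Psi> p \<otimes> inv (\<gamma> (p 1))"
  interpret S: path_rep G ?F ?\<Psi>' by (rule gauge[OF \<gamma>])
  interpret S: surface_rep w X q G n ?\<Psi>'
  proof
    fix s p assume s: "s permutes {..<n}" and p: "pathin ?F p"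
    show "\<gamma> (p 0 \<circ> s) \<otimes> \<Psi> (\<lambda>t. p t \<circ> s) \<otimes> inv (\<gamma> (p 1 \<circ> s)) = ?\<Psi>' p"
      using perm[OF pathin_top[OF p] s] rep_permute[OF s p] by simp
  qed
  interpret S: disc_rep G n S.\<Psi>D by (rule S.disc_rep_\<Psi>D)
  interpret g: gauged_disc_rep G n "?g g" by (rule g(3))
  have eq: "S.\<Psi>D p = ?g g p" if "pathin ?E p" for p
    using \<gamma>J[OF pathin_top[OF that]] by (simp add: S.\<Psi>D_def \<Psi>D_def)
  have V: "S.V x y = g.V x y" if "covers n R I" "x \<in> cell n R I" "y \<in> cell n R I" for x y R I
    unfolding S.V_def g.V_def by (rule eq[OF pathin_seg[OF that]])
  interpret S: gauged_disc_rep G n S.\<Psi>D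
    by unfold_locales (use V[OF covers_simps(1)] g.chamber_trivial in simp)
  have gen: "S.gen k = g.gen k" if "Suc k < n" for k
    unfolding S.gen_def g.gen_def
    by (rule V[OF covers_simps(2), of _ "\<lambda>_ _. False"];
        rule grid_configuration_cell; use that g.transpose_permutes in \<open>auto simp: permutes_id\<close>)
  have "gauged_surface_rep w X q G n ?\<Psi>'"
  proof (intro gauged_surface_rep.intro gauged_surface_rep_axioms.intro)
    show "surface_rep w X q G n ?\<Psi>'" "gauged_disc_rep G n S.\<Psi>D" by unfold_locales
    fix H p assume H: "subgroup H G" and k: "\<And>k. Suc k < n \<Longrightarrow> S.gen k \<in> H" and p: "pathin ?E p"
    show "S.\<Psi>D p \<in> H" unfolding eq[OF p] 
    proof (rule gH[rule_format, OF H _ p])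
      show "g.gen l \<in> H" if "Suc l < n" for l using k[OF that] unfolding gen[OF that] .
    qed
  qed
  then show thesis using that \<gamma> perm by blast
qed

section \<open>Equal generators force a trivial image\<close>

lemma (in group) centralizer_subgroup:
  assumes "c \<in> carrier G"
  shows "subgroup {h \<in> carrier G. h \<otimes> c = c \<otimes> h} G"
proof
  fix x y assume "x \<in> {h \<in> carrier G. h \<otimes> c = c \<otimes> h}" "y \<in> {h \<in> carrier G. h \<otimes> c = c \<otimes> h}"
  then show "x \<otimes> y \<in> {h \<in> carrier G. h \<otimes> c = c \<otimes> h}"
    using assms by simp (metis m_assoc)
next
  fix x assume "x \<in> {h \<in> carrier G. h \<otimes> c = c \<otimes> h}"
  then have x: "x \<in> carrier G" "x \<otimes> c = c \<otimes> x" by auto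
  have "c = inv x \<otimes> (c \<otimes> x)" unfolding x(2)[symmetric] using x(1) assms by (simp add: m_assoc[symmetric])
  then have "c \<otimes> inv x = inv x \<otimes> c \<otimes> x \<otimes> inv x" using x(1) assms by (simp add: m_assoc)
  also have "\<dots> = inv x \<otimes> c" using x(1) assms by (simp add: m_assoc)
  finally show "inv x \<in> {h \<in> carrier G. h \<otimes> c = c \<otimes> h}" using x(1) by simp
qed (use assms in auto)

text \<open>Real and imaginary parts are prescribed separately: permuting only one of the two
  coordinates is a straight motion without collisions as long as the other is injective.\<close>

definition cluster :: "nat \<Rightarrow> (nat \<Rightarrow> real) \<Rightarrow> (nat \<Rightarrow> real) \<Rightarrow> nat \<Rightarrow> complex" where
  "cluster n r s = (\<lambda>k. if k < n then Complex (r k) (s k) else undefined)"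

lemma cluster_small:
  assumes "r k \<in> {0<..<1/4}" "s k \<in> {0<..<1/4}" "k < n"
  shows "cmod (cluster n r s k) < 1/2"
proof -
  have "cmod (Complex (r k) (s k)) \<le> \<bar>r k\<bar> + \<bar>s k\<bar>" using cmod_le[of "Complex (r k) (s k)"] by simp
  then show ?thesis using assms by (auto simp: cluster_def)
qed

lemma cluster_seg:
  assumes "0 < n"
  shows "(cluster n (\<lambda>k. (1 - v) * r k + v * r' k) (\<lambda>k. (1 - v) * s k + v * s' k))(0 := Z) =
     seg n ((cluster n r s)(0 := Z)) ((cluster n r' s')(0 := Z)) v"
proof
  fix k
  show "((cluster n (\<lambda>k. (1 - v) * r k + v * r' k) (\<lambda>k. (1 - v) * s k + v * s' k))(0 := Z)) k =
     seg n ((cluster n r s)(0 := Z)) ((cluster n r' s')(0 := Z)) v k"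
    using assms by (auto simp: cluster_def seg_def complex_eq_iff left_diff_distrib)
qed

text \<open>Three disjoint candidates against two numbers. The numbers will be the real parts of the
  inner ends of the two arms of a crossing.\<close>

lemma avoiding_interval:
  fixes a b :: real
  obtains lo hi where "0 < lo" "lo < hi" "hi < 1/4" "a \<notin> {lo..hi}" "b \<notin> {lo..hi}"
proof -
  have "(a \<notin> {1/20..2/20} \<and> b \<notin> {1/20..2/20}) \<or> (a \<notin> {5/40..6/40} \<and> b \<notin> {5/40..6/40}) \<or>
    (a \<notin> {7/40..8/40} \<and> b \<notin> {7/40..8/40})"
    by auto
  then show thesis using that[of "1/20" "2/20"] that[of "5/40" "6/40"] that[of "7/40" "8/40"] by auto
qed

context polygon_space
begin

lemma deep_cluster:
  assumes ij: "paired i j" "t \<in> {0..1}" and n: "0 < n"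
    and rs: "\<And>k. k < n \<Longrightarrow> r k \<in> {0<..<1/4}" "\<And>k. k < n \<Longrightarrow> s k \<in> {0<..<1/4}"
    and inj: "inj_on r {..<n} \<or> inj_on s {..<n}"
  shows "deep n i j t (1/4) 0 (cluster n r s)"
proof -
  have "inj_on (cluster n r s) {..<n}"
  proof (rule inj_onI)
    fix k l assume "k \<in> {..<n}" "l \<in> {..<n}" "cluster n r s k = cluster n r s l"
    then show "k = l" using inj by (auto simp: cluster_def inj_on_def)
  qed
  then have "inj_on (cluster n r s) ({..<n} - {0})" by (rule inj_on_subset) auto
  moreover have "cmod (cluster n r s k) < 1 - 1/4" if "k < n" for k
    using cluster_small[of r k s n] rs[OF that] that by simp
  ultimately show ?thesis using ij n unfolding deep_def by simp
qed

lemma arm_eq: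
  assumes "arm i t \<delta> u = arm j s \<delta> u'" "0 < \<delta>" "\<delta> < 1" "u \<in> {0..1}" "u' \<in> {0..1}" "t \<in> {0..1}" "s \<in> {0..1}"
  shows "s = t \<or> s = 1 - t"
proof -
  have "1 - \<delta> * u = 1 - \<delta> * u'" using norm_arm[of \<delta> u i t] norm_arm[of \<delta> u' j s] assms by simp
  then have u: "u' = u" using assms(2) by simp
  have "\<delta> * u \<le> \<delta> * 1" using assms by (intro mult_left_mono) auto
  then have nz: "of_real (1 - \<delta> * u) \<noteq> (0 :: complex)" using assms(3) unfolding of_real_eq_0_iff by linarith
  have "edge i t = edge j s" using assms(1) unfolding u arm_def mult_left_cancel[OF nz] .
  moreover have "0 < length w" using len by linarith
  ultimately show ?thesis using polygon_edge_eq assms(6,7) by blast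
qed

text \<open>Off the boundary a point is alone in its class, so the arms themselves meet and their
  moduli give the same depth. On the boundary the gluing class restricts the edge
  parameters.\<close>

lemma q_arm_eq:
  assumes eq: "q (arm i t \<delta> u) = q (arm j s \<delta> u')" and ij: "i < length w" and \<delta>: "0 < \<delta>" "\<delta> < 1"
    and u: "u \<in> {0..1}" "u' \<in> {0..1}" and ts: "t \<in> {0..1}" "s \<in> {0..1}"
  shows "s = t \<or> s = 1 - t"
proof -
  have c: "arm i t \<delta> u \<in> cball 0 1" "arm j s \<delta> u' \<in> cball 0 1" by (rule arm_cball; use \<delta> u in auto)+
  consider "0 < u" | "0 < u'" | "u = 0" "u' = 0" using u by fastforce
  then show ?thesis
  proof cases
    case 1
    then have "cmod (arm i t \<delta> u) < 1" using norm_arm[of \<delta> u i t] \<delta> u by simp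
    then have "arm i t \<delta> u = arm j s \<delta> u'" using q_interior[OF _ c(2) eq] by simp
    then show ?thesis by (rule arm_eq) fact+
  next
    case 2
    then have "cmod (arm j s \<delta> u') < 1" using norm_arm[of \<delta> u' j s] \<delta> u by simp
    then have "arm i t \<delta> u = arm j s \<delta> u'" using q_interior[OF _ c(1) eq[symmetric]] by simp
    then show ?thesis by (rule arm_eq) fact+
  next
    case 3
    then have "(edge i t, edge j s) \<in> polygon_gluing w"
      using eq q_eq[OF edge_cball edge_cball] by (simp add: arm_0)
    then obtain l r where l: "edge j s = edge l r" "r \<in> {t, 1 - t}"
      using polygon_gluing_edge[OF ij ts(1)] by metis
    moreover have "0 < length w" "r \<in> {0..1}" using len l(2) ts(1) by auto
    ultimately have "s = r \<or> s = 1 - r" using polygon_edge_eq[of "length w" l r j s] ts by simp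
    then show ?thesis using l(2) by auto
  qed
qed

lemma partner_cases: "partner i j t = t \<or> partner i j t = 1 - t"
  by (simp add: partner_def)

text \<open>Parameters that differ also after reversal belong to different arms and different gluing
  classes, whatever edges are involved; so two such crossings can take place at the same
  time.\<close>

lemma cross_ne:
  assumes ij: "paired i j" "paired i' j'" and \<delta>: "0 < \<delta>" "\<delta> < 1" and uv: "u \<in> {0..1}" "v \<in> {0..1}"
    and t: "t \<in> {0..1}" "t' \<in> {0..1}" "t' \<noteq> t" "t' \<noteq> 1 - t"
  shows "cross i j t \<delta> u \<noteq> cross i' j' t' \<delta> v"
proof
  assume eq: "cross i j t \<delta> u = cross i' j' t' \<delta> v"
  obtain l s a where 1: "cross i j t \<delta> u = q (arm l s \<delta> a)" "l < length w" "s = t \<or> s = 1 - t" "a \<in> {0..1}"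
  proof (cases "u \<le> 1/2")
    case True
    then show thesis using that[of i t "1 - 2 * u"] ij uv by (auto simp: cross_def paired_def)
  next
    case False
    then show thesis using that[of j "partner i j t" "2 * u - 1"] ij uv partner_cases by (auto simp: cross_def paired_def)
  qed
  obtain l' s' a' where 2: "cross i' j' t' \<delta> v = q (arm l' s' \<delta> a')" "s' = t' \<or> s' = 1 - t'" "a' \<in> {0..1}"
  proof (cases "v \<le> 1/2")
    case True
    then show thesis using that[of i' t' "1 - 2 * v"] uv by (auto simp: cross_def)
  next
    case False
    then show thesis using that[of j' "partner i' j' t'" "2 * v - 1"] uv partner_cases by (auto simp: cross_def)
  qed
  have "s \<in> {0..1}" "s' \<in> {0..1}" using 1(3) 2(2) t(1,2) by auto
  then have "s' = s \<or> s' = 1 - s" using q_arm_eq[OF _ 1(2) \<delta> 1(4) 2(3)] eq 1(1) 2(1) by simp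
  then show False using 1(3) 2(2) t(3,4) by auto
qed

end

context gauged_surface_rep
begin

sublocale D: gauged_disc_rep G n \<Psi>D by (rule gauged)

text \<open>The arms of depth 1/4 do not reach the cluster, which has radius below 1/2. One
  coordinate stays fixed and injective, which keeps the moving points distinct.\<close>

lemma cluster_move:
  assumes ij: "paired i j" "t \<in> {0..1}" and n: "0 < n"
    and rs: "\<And>k. k < n \<Longrightarrow> r k \<in> {0<..<1/4}" "\<And>k. k < n \<Longrightarrow> s k \<in> {0<..<1/4}"
      "\<And>k. k < n \<Longrightarrow> r' k \<in> {0<..<1/4}" "\<And>k. k < n \<Longrightarrow> s' k \<in> {0<..<1/4}"
    and inj: "inj_on r {..<n} \<and> r' = r \<or> inj_on s {..<n} \<and> s' = s"
    and AB: "A = arm i t (1/4) 1" "B = arm j (partner i j t) (1/4) 1"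
  shows "\<Psi> (crossing_path n i j t (1/4) 0 (cluster n r s)) \<otimes> D.V ((cluster n r s)(0 := B)) ((cluster n r' s')(0 := B)) =
    D.V ((cluster n r s)(0 := A)) ((cluster n r' s')(0 := A)) \<otimes> \<Psi> (crossing_path n i j t (1/4) 0 (cluster n r' s'))"
    "(cluster n r s)(0 := A) \<in> topspace (disc_configurations n)"
    "(cluster n r s)(0 := B) \<in> topspace (disc_configurations n)"
proof -
  define \<xi> where "\<xi> v = cluster n (\<lambda>k. (1 - v) * r k + v * r' k) (\<lambda>k. (1 - v) * s k + v * s' k)" for v
  have \<xi>01: "\<xi> 0 = cluster n r s" "\<xi> 1 = cluster n r' s'" by (simp_all add: \<xi>_def)
  have comb: "(1 - v) * a + v * b \<in> {0<..<1/4}" if "v \<in> {0..1}" "a \<in> {0<..<1/4}" "b \<in> {0<..<1/4}" for a b v :: real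
    using convexD[OF convex_real_interval(8) that(2,3), of "1 - v" v] that(1) by simp
  have dp: "deep n i j t (1/4) 0 (\<xi> v)" if v: "v \<in> {0..1}" for v
    unfolding \<xi>_def
  proof (rule deep_cluster[OF ij n comb[OF v] comb[OF v]])
    show "inj_on (\<lambda>k. (1 - v) * r k + v * r' k) {..<n} \<or> inj_on (\<lambda>k. (1 - v) * s k + v * s' k) {..<n}"
      using inj by (auto simp: distrib_right[symmetric])
  qed (use rs in auto)
  have c\<xi>: "continuous_on {0..1} (\<lambda>v. \<xi> v k)" for k
    by (cases "k < n") (auto simp: \<xi>_def cluster_def Complex_eq intro!: continuous_intros)
  have ext: "\<xi> v \<in> extensional {..<n}" for v by (auto simp: \<xi>_def cluster_def extensional_def)
  have seg: "(\<lambda>v. (\<xi> v)(0 := Z)) = seg n ((cluster n r s)(0 := Z)) ((cluster n r' s')(0 := Z))" for Z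
    unfolding \<xi>_def using cluster_seg[OF n] by blast
  note cm = crossing_move[of 0 \<xi> "\<lambda>_. t" i j "1/4", OF c\<xi> continuous_on_const dp ext]
  show "\<Psi> (crossing_path n i j t (1/4) 0 (cluster n r s)) \<otimes> D.V ((cluster n r s)(0 := B)) ((cluster n r' s')(0 := B)) =
    D.V ((cluster n r s)(0 := A)) ((cluster n r' s')(0 := A)) \<otimes> \<Psi> (crossing_path n i j t (1/4) 0 (cluster n r' s'))"
    using cm(3) unfolding seg \<xi>01 D.V_def AB .
  show "(cluster n r s)(0 := A) \<in> topspace (disc_configurations n)"
    using pathin_top[OF cm(1), of 0] unfolding \<xi>01 AB by simp
  show "(cluster n r s)(0 := B) \<in> topspace (disc_configurations n)"
    using pathin_top[OF cm(2), of 0] unfolding \<xi>01 AB by simp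
qed

text \<open>Two neighbouring points that stay away from the arms can be interchanged before or after the crossing.\<close>

lemma crossing_commutes_generator:
  assumes n: "3 \<le> n" and ij: "paired i j" and gens: "\<And>k. Suc k < n \<Longrightarrow> D.gen k = \<sigma>"
  obtains x where "deep n i j (1/2) (1/4) 0 x" "x \<in> extensional {..<n}"
    "\<Psi> (crossing_path n i j (1/2) (1/4) 0 x) \<otimes> \<sigma> = \<sigma> \<otimes> \<Psi> (crossing_path n i j (1/2) (1/4) 0 x)"
proof -
  define A where "A = arm i (1/2) (1/4) 1"
  define B where "B = arm j (partner i j (1/2)) (1/4) 1"
  \<comment> \<open>The strip avoids the real parts of both inner ends of the crossing, so that
    points 1 and 2 are horizontal neighbours before and after point 0 has crossed.\<close>
  obtain lo hi where lh: "0 < lo" "lo < hi" "hi < 1/4" "Re A \<notin> {lo..hi}" "Re B \<notin> {lo..hi}"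
    by (rule avoiding_interval)
  define r where "r k = lo + (hi - lo) * grid n k" for k
  define s where "s k = grid n k / 2" for k
  define \<tau> where "\<tau> = Transposition.transpose 1 (2::nat)"
  have \<tau>: "\<tau> permutes {..<n}" unfolding \<tau>_def using n by (intro permutes_swap_id) auto
  have \<tau>n: "\<tau> k < n \<longleftrightarrow> k < n" for k using permutes_in_image[OF \<tau>, of k] by simp
  have \<tau>\<tau>: "\<tau> (\<tau> k) = k" for k by (simp add: \<tau>_def)
  have \<tau>v: "\<tau> 0 = 0" "\<tau> 1 = 2" "\<tau> 2 = 1" by (simp_all add: \<tau>_def)
  have r_mono: "r k < r l" if "k < l" for k l
    unfolding r_def using grid_mono[OF that, of n] lh(2) by simp
  have s_mono: "s k < s l" if "k < l" for k l unfolding s_def using grid_mono[OF that, of n] by simp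
  have r_iff: "r k < r l \<longleftrightarrow> k < l" for k l using r_mono[of k l] r_mono[of l k] by (cases k l rule: linorder_cases) auto
  have r_b: "lo < r k" "r k < hi" if "k < n" for k
  proof -
    have g: "0 < grid n k" "grid n k < 1" using grid_bounds[OF that] by auto
    have "(hi - lo) * grid n k < (hi - lo) * 1" by (rule mult_strict_left_mono) (use g lh in auto)
    then show "r k < hi" by (simp add: r_def)
    show "lo < r k" using g lh by (simp add: r_def)
  qed
  have rI: "r k \<in> {0<..<1/4}" if "k < n" for k using r_b[OF that] lh by auto
  have sI: "s k \<in> {0<..<1/4}" if "k < n" for k using grid_bounds[OF that] by (auto simp: s_def)
  have inj: "inj_on r {..<n}" "inj_on s {..<n}"
    using r_mono s_mono by (auto intro!: strict_mono_on_imp_inj_on simp: strict_mono_on_def)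
  have rI': "(r \<circ> \<tau>) k \<in> {0<..<1/4}" if "k < n" for k using rI[of "\<tau> k"] that by (simp add: \<tau>n)
  have sI': "(s \<circ> \<tau>) k \<in> {0<..<1/4}" if "k < n" for k using sI[of "\<tau> k"] that by (simp add: \<tau>n)
  have half: "1/2 \<in> {0..1::real}" and n0: "0 < n" using n by auto
  \<comment> \<open>\<open>?y\<close> exchanges the real parts of points 1 and 2, a half twist.
    \<open>?z\<close> is \<open>?y\<close> relabelled by \<tau> and differs from \<open>?x\<close>
    in the heights only. So moving from \<open>?x\<close> to \<open>?y\<close> costs \<sigma> on
    both sides of the crossing, and moving back from \<open>?z\<close> costs nothing.\<close>
  let ?x = "cluster n r s" and ?y = "cluster n (r \<circ> \<tau>) s" and ?z = "cluster n r (s \<circ> \<tau>)"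
  let ?K = "\<lambda>x. \<Psi> (crossing_path n i j (1/2) (1/4) 0 x)"
  have yz: "?y \<circ> \<tau> = ?z" by (auto simp: cluster_def \<tau>n \<tau>\<tau> fun_eq_iff)
  note m1 = cluster_move[of i j "1/2" r s "r \<circ> \<tau>" s, OF ij half n0 rI sI rI' sI _ A_def B_def]
  note m2 = cluster_move[of i j "1/2" r "s \<circ> \<tau>" r s, OF ij half n0 rI sI' rI sI _ A_def B_def]
  note m3 = cluster_move[of i j "1/2" "r \<circ> \<tau>" s "r \<circ> \<tau>" s, OF ij half n0 rI' sI rI' sI _ A_def B_def]
  have swap: "D.V (?x(0 := Z)) (?y(0 := Z)) = \<sigma>"
    if Z: "Re Z \<notin> {lo..hi}" and top: "?x(0 := Z) \<in> topspace (disc_configurations n)" "?y(0 := Z) \<in> topspace (disc_configurations n)" for Z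
  proof -
    have ReZ: "Re Z \<noteq> r k" if "k < n" for k using r_b[OF that] Z by auto
    have gen: "generic n (?x(0 := Z))"
      unfolding generic_def
    proof (intro conjI inj_onI top(1))
      fix k l assume kl: "k \<in> {..<n}" "l \<in> {..<n}" "Re ((?x(0 := Z)) k) = Re ((?x(0 := Z)) l)"
      then show "k = l" using ReZ[of k] ReZ[of l] inj_onD[OF inj(1), of k l]
        by (cases "k = 0"; cases "l = 0") (auto simp: cluster_def)
    qed
    obtain k where "Suc k < n" "D.V (?x(0 := Z)) (?y(0 := Z)) = D.gen k"
    proof (rule D.V_swap[OF gen top(2), of 1 2])
      show "1 < n" "2 < n" using n by auto
      show "Re ((?x(0 := Z)) 1) < Re ((?x(0 := Z)) 2)" "Im ((?x(0 := Z)) 1) < Im ((?x(0 := Z)) 2)"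
        "Im ((?y(0 := Z)) 1) < Im ((?y(0 := Z)) 2)"
        using n r_mono[of 1 2] s_mono[of 1 2] by (auto simp: cluster_def)
      fix c assume c: "c < n"
      show "\<not> (Re ((?x(0 := Z)) 1) < Re ((?x(0 := Z)) c) \<and> Re ((?x(0 := Z)) c) < Re ((?x(0 := Z)) 2))"
      proof (cases "c = 0")
        case True
        then show ?thesis using Z r_b[of 1] r_b[of 2] n by (auto simp: cluster_def)
      next
        case False
        then show ?thesis using c n r_iff[of 1 c] r_iff[of c 2] by (simp add: cluster_def)
      qed
    next
      fix k l assume kl: "k < n" "l < n"
        "Re ((?x(0 := Z)) (Transposition.transpose 1 2 k)) < Re ((?x(0 := Z)) (Transposition.transpose 1 2 l))"
      have "Re ((?y(0 := Z)) k) = Re ((?x(0 := Z)) (\<tau> k))" if "k < n" for k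
      proof -
        have "\<tau> k = 0 \<longleftrightarrow> k = 0" using \<tau>\<tau> \<tau>v(1) by metis
        then show ?thesis using that \<tau>n by (simp add: cluster_def)
      qed
      then show "Re ((?y(0 := Z)) k) < Re ((?y(0 := Z)) l)" using kl by (simp add: \<tau>_def)
    qed (rule that)
    then show ?thesis using gens by simp
  qed
  have same: "D.V (?z(0 := Z)) (?x(0 := Z)) = \<one>"
    if Z: "Re Z \<notin> {lo..hi}" and top: "?z(0 := Z) \<in> topspace (disc_configurations n)" "?x(0 := Z) \<in> topspace (disc_configurations n)" for Z
  proof (rule D.V_same_order)
    have ReZ: "Re Z \<noteq> r k" if "k < n" for k using r_b[OF that] Z by auto
    show "generic n (?z(0 := Z))"
      unfolding generic_def
    proof (intro conjI inj_onI top(1))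
      fix k l assume kl: "k \<in> {..<n}" "l \<in> {..<n}" "Re ((?z(0 := Z)) k) = Re ((?z(0 := Z)) l)"
      then show "k = l" using ReZ[of k] ReZ[of l] inj_onD[OF inj(1), of k l]
        by (cases "k = 0"; cases "l = 0") (auto simp: cluster_def)
    qed
    show "Re ((?x(0 := Z)) k) < Re ((?x(0 := Z)) l)"
      if "k < n" "l < n" "Re ((?z(0 := Z)) k) < Re ((?z(0 := Z)) l)" for k l
      using that by (auto simp: cluster_def split: if_splits)
  qed (rule top(2))
  have dp: "deep n i j (1/2) (1/4) 0 ?x" "deep n i j (1/2) (1/4) 0 ?y"
    by (rule deep_cluster[OF ij half n0]; use rI sI rI' inj in blast)+
  have K: "?K ?x \<in> carrier G" "?K ?y \<in> carrier G"
    by (rule crossing_closed[OF deep_admissible[OF dp(1)]] crossing_closed[OF deep_admissible[OF dp(2)]])+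
  have xA: "?x(0 := A) \<in> topspace (disc_configurations n)" and xB: "?x(0 := B) \<in> topspace (disc_configurations n)"
    by (rule m1; simp add: inj)+
  have zA: "?z(0 := A) \<in> topspace (disc_configurations n)" and zB: "?z(0 := B) \<in> topspace (disc_configurations n)"
    by (rule m2; simp add: inj)+
  have yA: "?y(0 := A) \<in> topspace (disc_configurations n)" and yB: "?y(0 := B) \<in> topspace (disc_configurations n)"
    by (rule m3; simp add: inj)+
  have "?K ?x \<otimes> D.V (?x(0 := B)) (?y(0 := B)) = D.V (?x(0 := A)) (?y(0 := A)) \<otimes> ?K ?y"
    by (rule m1; simp add: inj)
  then have 1: "?K ?x \<otimes> \<sigma> = \<sigma> \<otimes> ?K ?y"
    unfolding swap[OF lh(4) xA yA] swap[OF lh(5) xB yB] .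
  have "?K ?z \<otimes> D.V (?z(0 := B)) (?x(0 := B)) = D.V (?z(0 := A)) (?x(0 := A)) \<otimes> ?K ?x"
    by (rule m2; simp add: inj)
  then have "?K ?z \<otimes> \<one> = \<one> \<otimes> ?K ?x"
    unfolding same[OF lh(4) zA xA] same[OF lh(5) zB xB] .
  moreover have "?K ?z = ?K ?y"
    unfolding yz[symmetric] by (rule crossing_permute[OF deep_admissible[OF dp(2)] \<tau> \<tau>v(1)])
  ultimately have "?K ?x \<otimes> \<sigma> = \<sigma> \<otimes> ?K ?x" using 1 K by simp
  then show thesis using that[OF dp(1)] by (simp add: cluster_def extensional_def)
qed

text \<open>The centraliser of \<sigma> contains the disc values and one crossing for each pair of
  glued edges; by the double coset relation it contains every crossing.\<close>

theorem generator_central: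
  assumes n: "3 \<le> n" and gens: "\<And>k. Suc k < n \<Longrightarrow> D.gen k = \<sigma>"
    and p: "pathin (configuration_space n X) p" "p 0 \<in> J n ` topspace (disc_configurations n)"
      "p 1 \<in> J n ` topspace (disc_configurations n)"
  shows "\<Psi> p \<otimes> \<sigma> = \<sigma> \<otimes> \<Psi> p"
proof -
  have \<sigma>: "\<sigma> \<in> carrier G" using D.gen_closed[of 0] gens[of 0] n by simp
  define H where "H = {h \<in> carrier G. h \<otimes> \<sigma> = \<sigma> \<otimes> h}"
  have H: "subgroup H G" unfolding H_def by (rule centralizer_subgroup[OF \<sigma>])
  have "D.gen k \<in> H" if "Suc k < n" for k unfolding gens[OF that] H_def using \<sigma> by simp
  then have disc: "\<Psi>D p \<in> H" if "pathin (disc_configurations n) p" for p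
    by (rule disc_values[OF H _ that])
  have "\<Psi> p \<in> H"
  proof (rule surface_generated[OF H disc _ p])
    fix i j t \<delta> p x assume x: "admissible n i j t \<delta> p x" "x \<in> extensional {..<n}"
    then have ij: "paired i j" by (simp add: admissible_def)
    obtain y where y: "deep n i j (1/2) (1/4) 0 y" "y \<in> extensional {..<n}"
      "\<Psi> (crossing_path n i j (1/2) (1/4) 0 y) \<otimes> \<sigma> = \<sigma> \<otimes> \<Psi> (crossing_path n i j (1/2) (1/4) 0 y)"
      by (rule crossing_commutes_generator[OF n ij gens])
    have yH: "\<Psi> (crossing_path n i j (1/2) (1/4) 0 y) \<in> H"
      using y(3) crossing_closed[OF deep_admissible[OF y(1)]] by (simp add: H_def)
    obtain a b where "a \<in> H" "b \<in> H"
      "\<Psi> (crossing_path n i j t \<delta> p x) = a \<otimes> \<Psi> (crossing_path n i j (1/2) (1/4) 0 y) \<otimes> b"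
      by (rule crossing_coset[OF H disc x deep_admissible[OF y(1)] y(2)])
    then show "\<Psi> (crossing_path n i j t \<delta> p x) \<in> H" using yH subgroup.m_closed[OF H] by simp
  qed
  then show ?thesis by (simp add: H_def)
qed

text \<open>With trivial disc values the double coset of a crossing consists of a single
  element.\<close>

lemma crossing_type:
  assumes disc: "\<And>p. pathin (disc_configurations n) p \<Longrightarrow> \<Psi>D p = \<one>"
    and x: "admissible n i j t \<delta> p x" "x \<in> extensional {..<n}"
    and x': "admissible n i j t' \<delta>' p' x'" "x' \<in> extensional {..<n}"
  shows "\<Psi> (crossing_path n i j t \<delta> p x) = \<Psi> (crossing_path n i j t' \<delta>' p' x')"
proof -
  obtain a b where "a \<in> {\<one>}" "b \<in> {\<one>}"
    "\<Psi> (crossing_path n i j t \<delta> p x) = a \<otimes> \<Psi> (crossing_path n i j t' \<delta>' p' x') \<otimes> b"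
    by (rule crossing_coset[OF triv_subgroup _ x x']) (simp add: disc)
  then show ?thesis using crossing_closed[OF x'(1)] by simp
qed

text \<open>Two points cross the boundary at different places, one after the other in either order.\<close>

lemma crossings_commute:
  assumes n: "2 \<le> n" and disc: "\<And>p. pathin (disc_configurations n) p \<Longrightarrow> \<Psi>D p = \<one>"
    and K: "admissible n i j t \<delta> p y" "y \<in> extensional {..<n}"
    and K': "admissible n i' j' t' \<delta>' p' y'" "y' \<in> extensional {..<n}"
  shows "\<Psi> (crossing_path n i j t \<delta> p y) \<otimes> \<Psi> (crossing_path n i' j' t' \<delta>' p' y') =
    \<Psi> (crossing_path n i' j' t' \<delta>' p' y') \<otimes> \<Psi> (crossing_path n i j t \<delta> p y)"
proof -
  let ?F = "configuration_space n X" and ?S = "{0..1} \<times> {0..1} :: (real \<times> real) set"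
  have ij: "paired i j" "paired i' j'" using K K' by (auto simp: admissible_def)
  define x where "x = (\<lambda>k. if k < n then of_real (grid n k) else undefined :: complex)"
  have xn: "cmod (x k) < 1/2" if "k < n" for k using grid_bounds[OF that] that by (simp add: x_def)
  have ext: "x(k := z) \<in> extensional {..<n}" if "k < n" for k z using that by (auto simp: x_def extensional_def)
  have x_inj: "k = l" if "k < n" "l < n" "x k = x l" for k l
    using that grid_mono[of k l n] grid_mono[of l k n] by (cases k l rule: linorder_cases) (auto simp: x_def)
  have arm_ge: "1/2 \<le> cmod (arm l s (1/2) u)" if "u \<in> {0..1}" for l s u using norm_arm[of "1/2" u l s] that by simp
  have adm: "admissible n a b s (1/2) p (x(p' := arm l s' (1/2) 1))"
    if "paired a b" "p < n" "p' < n" "p \<noteq> p'" and s: "s \<in> {0..1}" "s' \<in> {0..1}" "s' \<noteq> s" "s' \<noteq> 1 - s"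
    for a b s p p' l s'
  proof -
    let ?x = "x(p' := arm l s' (1/2) 1)"
    have n1: "cmod (arm l s' (1/2) 1) = 1/2" using norm_arm[of "1/2" 1 l s'] by simp
    have "inj_on ?x ({..<n} - {p})"
    proof (rule inj_onI)
      fix k m assume km: "k \<in> {..<n} - {p}" "m \<in> {..<n} - {p}" "?x k = ?x m"
      show "k = m" using km xn[of k] xn[of m] n1 x_inj[of k m] by (cases "k = p'"; cases "m = p'") auto
    qed
    moreover have "cmod (?x k) < 1" if "k < n" for k using xn[OF that] n1 by (cases "k = p'") auto
    moreover have "?x k \<noteq> arm c s'' (1/2) u" if k: "k < n" and u: "u \<in> {0..1}" and s'': "s'' \<in> {0..1}" "s'' = s \<or> s'' = 1 - s" for k c s'' u
    proof
      assume e: "?x k = arm c s'' (1/2) u"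
      show False
      proof (cases "k = p'")
        case True
        then have "arm l s' (1/2) 1 = arm c s'' (1/2) u" using e by simp
        then have "s'' = s' \<or> s'' = 1 - s'" by (rule arm_eq) (use u s s'' in auto)
        then show False using s s''(2) by auto
      next
        case False
        then show False using e arm_ge[OF u, of c s''] xn[OF k] by simp
      qed
    qed
    ultimately show ?thesis unfolding admissible_def using that partner_unit[OF s(1), of a b] partner_cases[of a b s]
      by auto
  qed
  have h: "1/2 \<in> {0..1::real}" "1/4 \<in> {0..1::real}" by auto
  have n01: "0 < n" "1 < n" using n by auto
  \<comment> \<open>The first point crosses at parameter 1/2, which is its own partner, the second
    at 1/4, whose partner is 1/4 or 3/4. Neither of these is 1/2, so the arms are disjoint.\<close>
  have ad0: "admissible n i j (1/2) (1/2) 0 (x(1 := arm l s (1/2) 1))" if "s \<in> {1/4, 3/4}" for l s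
    by (rule adm[OF ij(1) n01]) (use that in auto)
  have ad1: "admissible n i' j' (1/4) (1/2) 1 (x(0 := arm l (1/2) (1/2) 1))" for l
    by (rule adm[OF ij(2) n01(2,1)]) auto
  have half: "partner i j (1/2) = 1/2" by (simp add: partner_def)
  have quarter: "partner i' j' (1/4) \<in> {1/4, 3/4}" by (auto simp: partner_def)
  \<comment> \<open>Points 0 and 1 cross independently, each in its own parameter. The remaining
    points lie on the real axis within radius 1/2, which arms of depth 1/2 do not enter.\<close>
  define F where "F z = (J n x)(0 := cross i j (1/2) (1/2) (fst z), 1 := cross i' j' (1/4) (1/2) (snd z))" for z :: "real \<times> real"
  have side0: "F (u, v) = crossing_path n i j (1/2) (1/2) 0 (x(1 := b)) u" if "cross i' j' (1/4) (1/2) v = q b" for u v b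
    using that n by (auto simp: F_def crossing_path_def J_def fun_eq_iff)
  have side1: "F (u, v) = crossing_path n i' j' (1/4) (1/2) 1 (x(0 := b)) v" if "cross i j (1/2) (1/2) u = q b" for u v b
    using that n by (auto simp: F_def crossing_path_def J_def fun_eq_iff)
  have c0: "cross a b s \<delta> 0 = q (arm a s \<delta> 1)" "cross a b s \<delta> 1 = q (arm b (partner a b s) \<delta> 1)" for a b s \<delta>
    by (simp_all add: cross_def)
  have F: "continuous_map (top_of_set ?S) ?F F"
    unfolding continuous_map_into_configuration_space
  proof (intro conjI allI impI)
    fix k assume k: "k < n"
    have fs: "fst \<in> ?S \<rightarrow> {0..1}" "snd \<in> ?S \<rightarrow> {0..1}" by (rule Pi_I, simp only: mem_Times_iff)+
    have 0: "continuous_map (top_of_set ?S) X (\<lambda>z. cross i j (1/2) (1/2) (fst z))"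
      by (rule continuous_map_cross[OF ij(1) _ _ continuous_on_const _ continuous_on_fst[OF continuous_on_id] fs(1)]) auto
    have 1: "continuous_map (top_of_set ?S) X (\<lambda>z. cross i' j' (1/4) (1/2) (snd z))"
      by (rule continuous_map_cross[OF ij(2) _ _ continuous_on_const _ continuous_on_snd[OF continuous_on_id] fs(2)]) auto
    consider "k = 0" | "k = 1" | "k \<noteq> 0" "k \<noteq> 1" by blast
    then show "continuous_map (top_of_set ?S) X (\<lambda>z. F z k)"
    proof cases
      case 3
      have "q (x k) \<in> topspace X" using xn[OF k] by (auto simp: topspace_X)
      then show ?thesis using 3 k by (simp add: F_def J_def)
    qed (use 0 1 in \<open>simp_all add: F_def\<close>)
  next
    show "F \<in> topspace (top_of_set ?S) \<rightarrow> topspace ?F"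
    proof
      fix z assume "z \<in> topspace (top_of_set ?S)"
      then obtain u v where z: "z = (u, v)" "u \<in> {0..1}" "v \<in> {0..1}" by auto
      let ?a = "crossing_path n i j (1/2) (1/2) 0 (x(1 := arm i' (1/4) (1/2) 1)) u"
      let ?b = "crossing_path n i' j' (1/4) (1/2) 1 (x(0 := arm i (1/2) (1/2) 1)) v"
      have a: "?a \<in> topspace ?F" by (rule crossing_configuration[OF ad0 z(2)]) simp
      have b: "?b \<in> topspace ?F" by (rule crossing_configuration[OF ad1 z(3)])
      have Fa: "F z k = ?a k" if "k \<noteq> 1" for k using that by (simp add: F_def z(1) crossing_path_def J_def)
      have Fb: "F z k = ?b k" if "k \<noteq> 0" for k using that by (simp add: F_def z(1) crossing_path_def J_def)
      have ne: "F z 0 \<noteq> F z 1"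
        unfolding F_def z(1) using cross_ne[OF ij _ _ z(2,3) h] by simp
      show "F z \<in> topspace ?F"
      proof (rule topspace_configuration_spaceI)
        show "F z \<in> extensional {..<n}" using n by (auto simp: F_def J_def extensional_def)
        show "F z k \<in> topspace X" if "k < n" for k
          using a b that Fa[of k] Fb[of k] by (cases "k = 1") (auto simp: topspace_configuration_space PiE_iff)
        show "inj_on (F z) {..<n}"
        proof (rule inj_onI)
          fix k l assume kl: "k \<in> {..<n}" "l \<in> {..<n}" "F z k = F z l"
          have ia: "inj_on ?a {..<n}" and ib: "inj_on ?b {..<n}" using a b by (auto simp: topspace_configuration_space)
          consider "k \<noteq> 1" "l \<noteq> 1" | "k \<noteq> 0" "l \<noteq> 0" | "k = 0" "l = 1" | "k = 1" "l = 0" by fastforce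
          then show "k = l"
          proof cases
            case 1
            then show ?thesis using inj_onD[OF ia _ kl(1,2)] kl(3) Fa by simp
          next
            case 2
            then show ?thesis using inj_onD[OF ib _ kl(1,2)] kl(3) Fb by simp
          qed (use ne kl(3) in auto)
        qed
      qed
    qed
  qed
  have "\<Psi> (\<lambda>u. F (u, 0)) = \<Psi> (crossing_path n i j t \<delta> p y)" "\<Psi> (\<lambda>u. F (u, 1)) = \<Psi> (crossing_path n i j t \<delta> p y)"
    unfolding side0[OF c0(1)] side0[OF c0(2)]
    by (rule crossing_type[OF disc ad0 ext[OF n01(2)] K]; use quarter in simp)+
  moreover have "\<Psi> (\<lambda>v. F (0, v)) = \<Psi> (crossing_path n i' j' t' \<delta>' p' y')" "\<Psi> (\<lambda>v. F (1, v)) = \<Psi> (crossing_path n i' j' t' \<delta>' p' y')"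
    unfolding side1[OF c0(1)] side1[OF c0(2)] half
    by (rule crossing_type[OF disc ad1 ext[OF n01(1)] K']; simp)+
  ultimately show ?thesis using rep_square[OF F] by simp
qed

theorem equal_generators_trivial:
  assumes n: "3 \<le> n" and gens: "\<And>k. Suc k < n \<Longrightarrow> D.gen k = \<sigma>"
    and full: "\<And>h. h \<in> carrier G \<Longrightarrow> \<exists>p. pathin (configuration_space n X) p \<and> p 0 \<in> J n ` topspace (disc_configurations n) \<and>
      p 1 \<in> J n ` topspace (disc_configurations n) \<and> \<Psi> p = h"
    and center: "\<And>c. c \<in> carrier G \<Longrightarrow> (\<And>h. h \<in> carrier G \<Longrightarrow> h \<otimes> c = c \<otimes> h) \<Longrightarrow> c = \<one>"
  shows "carrier G = {\<one>}"
proof -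
  have \<sigma>: "\<sigma> \<in> carrier G" using D.gen_closed[of 0] gens[of 0] n by simp
  have "h \<otimes> \<sigma> = \<sigma> \<otimes> h" if "h \<in> carrier G" for h
    using full[OF that] generator_central[OF n gens] by metis
  then have "\<sigma> = \<one>" by (rule center[OF \<sigma>])
  then have "D.gen k \<in> {\<one>}" if "Suc k < n" for k using gens[OF that] by simp
  then have disc: "\<Psi>D p = \<one>" if "pathin (disc_configurations n) p" for p
    using disc_values[OF triv_subgroup _ that] by simp
  have generated: "carrier G \<subseteq> H" if H: "subgroup H G"
    and K: "\<And>i j t \<delta> p x. admissible n i j t \<delta> p x \<Longrightarrow> x \<in> extensional {..<n} \<Longrightarrow> \<Psi> (crossing_path n i j t \<delta> p x) \<in> H" for H
  proof
    fix h assume "h \<in> carrier G"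
    then obtain p where p: "pathin (configuration_space n X) p" "p 0 \<in> J n ` topspace (disc_configurations n)"
      "p 1 \<in> J n ` topspace (disc_configurations n)" "\<Psi> p = h" using full by blast
    show "h \<in> H" unfolding p(4)[symmetric]
      by (rule surface_generated[OF H _ K p(1-3)]) (use disc subgroup.one_closed[OF H] in simp)
  qed
  have "\<Psi> (crossing_path n i j t \<delta> p x) = \<one>" if x: "admissible n i j t \<delta> p x" "x \<in> extensional {..<n}" for i j t \<delta> p x
  proof (rule center[OF crossing_closed[OF x(1)]])
    let ?K = "\<Psi> (crossing_path n i j t \<delta> p x)"
    have "carrier G \<subseteq> {h \<in> carrier G. h \<otimes> ?K = ?K \<otimes> h}"
    proof (rule generated[OF centralizer_subgroup[OF crossing_closed[OF x(1)]]])
      fix i' j' t' \<delta>' p' x' assume x': "admissible n i' j' t' \<delta>' p' x'" "x' \<in> extensional {..<n}"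
      show "\<Psi> (crossing_path n i' j' t' \<delta>' p' x') \<in> {h \<in> carrier G. h \<otimes> ?K = ?K \<otimes> h}"
        using crossings_commute[OF _ disc x' x] crossing_closed[OF x'(1)] n by simp
    qed
    then show "h \<otimes> ?K = ?K \<otimes> h" if "h \<in> carrier G" for h using that by blast
  qed
  then have "carrier G \<subseteq> {\<one>}" by (intro generated[OF triv_subgroup]) simp
  then show ?thesis by auto
qed

end

section \<open>Artin's theorem on permutation representations of braid groups\<close>

text \<open>Images of the \<open>k\<close> standard generators of the braid group on
  \<open>k + 1\<close> strands, numbered from 0.\<close>

definition braid_permutations :: "nat \<Rightarrow> 'a set \<Rightarrow> (nat \<Rightarrow> 'a \<Rightarrow> 'a) \<Rightarrow> bool" where
  "braid_permutations k A s \<longleftrightarrow> (\<forall>i<k. s i permutes A) \<and>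
     (\<forall>i. Suc i < k \<longrightarrow> s i \<circ> s (Suc i) \<circ> s i = s (Suc i) \<circ> s i \<circ> s (Suc i)) \<and>
     (\<forall>i j. Suc i < j \<longrightarrow> j < k \<longrightarrow> s i \<circ> s j = s j \<circ> s i)"

section \<open>Braid relations between permutations of few points\<close>

lemma permutes_eqI:
  assumes "f permutes F" "h permutes F" "\<And>x. x \<in> F \<Longrightarrow> f x = h x"
  shows "f = h"
proof
  show "f x = h x" for x
    using assms permutes_not_in[OF assms(1), of x] permutes_not_in[OF assms(2), of x] by (cases "x \<in> F") auto
qed

text \<open>Commuting turns the braid relation into \<open>f f g = f g g\<close>, and cancelling
  leaves \<open>f = g\<close>.\<close>

lemma braid_commute_eq:
  assumes f: "f permutes A" and g: "g permutes A" and c: "f \<circ> g = g \<circ> f" and b: "f \<circ> g \<circ> f = g \<circ> f \<circ> g"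
  shows "f = g"
proof
  fix x
  obtain y where y: "x = f (g y)"
    using permutes_surj[OF f] permutes_surj[OF g] by (metis surjD)
  have "g (f (g y)) = f (g (f y))" using fun_cong[OF b, of y] by simp
  also have "\<dots> = f (f (g y))" using fun_cong[OF c, of y] by simp
  finally show "f x = g x" using y by simp
qed

text \<open>One coincidence spreads: \<open>s (Suc i)\<close> equals \<open>s i\<close>, which
  commutes with \<open>s (Suc (Suc i))\<close>, so these two commute and the braid relation makes
  them equal. The same argument runs downwards.\<close>

lemma braid_permutations_all_equal:
  assumes b: "braid_permutations k A s" and i: "Suc i < k" "s i = s (Suc i)" and j: "j < k"
  shows "s j = s 0"
proof -
  have perm: "s i permutes A" if "i < k" for i using b that by (auto simp: braid_permutations_def)
  have br: "s i \<circ> s (Suc i) \<circ> s i = s (Suc i) \<circ> s i \<circ> s (Suc i)" if "Suc i < k" for i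
    using b that by (auto simp: braid_permutations_def)
  have far: "s i \<circ> s j = s j \<circ> s i" if "Suc i < j" "j < k" for i j
    using b that by (auto simp: braid_permutations_def)
  have up: "s (Suc i) = s (Suc (Suc i))" if "Suc (Suc i) < k" "s i = s (Suc i)" for i
  proof (rule braid_commute_eq[OF perm perm])
    show "s (Suc i) \<circ> s (Suc (Suc i)) = s (Suc (Suc i)) \<circ> s (Suc i)"
      using far[of i "Suc (Suc i)"] that by simp
  qed (use that br[of "Suc i"] in auto)
  have down: "s i = s (Suc i)" if "Suc (Suc i) < k" "s (Suc i) = s (Suc (Suc i))" for i
  proof (rule braid_commute_eq[OF perm perm])
    show "s i \<circ> s (Suc i) = s (Suc i) \<circ> s i"
      using far[of i "Suc (Suc i)"] that by simp
  qed (use that br[of i] in auto)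
  have base: "Suc i < k \<Longrightarrow> s i = s (Suc i) \<Longrightarrow> s 0 = s (Suc 0)" for i
    by (induction i) (use down in auto)
  have "Suc j < k \<Longrightarrow> s j = s (Suc j)" for j
    by (induction j) (use base[OF i] up in auto)
  then show ?thesis using j by (induction j) (simp, metis Suc_lessD)
qed

text \<open>Two 2-cycles of \<sigma>, interchanged by \<open>f\<close>. Counting interchanges in the
  braid relation forces \<open>g\<close> to interchange them as well, so on each cycle
  \<open>g\<close> is \<open>f\<close> or \<open>f\<close> followed by \<sigma>. The second option
  on either cycle would leave an odd number of factors \<sigma> on one side of the relation and an
  even number on the other.\<close>

lemma small_orbits_swap:
  fixes f g \<sigma> :: "'a \<Rightarrow> 'a"
  assumes "distinct [a, b, c, d]" and \<sigma>: "\<sigma> a = b" "\<sigma> b = a" "\<sigma> c = d" "\<sigma> d = c"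
    and comm: "\<And>x. f (\<sigma> x) = \<sigma> (f x)" "\<And>x. g (\<sigma> x) = \<sigma> (g x)"
    and f: "f a \<in> {c, d}" "f c \<in> {a, b}" and g: "g a \<in> {a, b, c, d}" "g c \<in> {a, b, c, d}"
    and br: "\<And>x. f (g (f x)) = g (f (g x))"
  shows "f a = g a \<and> f b = g b \<and> f c = g c \<and> f d = g d"
proof -
  have e: "f b = \<sigma> (f a)" "f d = \<sigma> (f c)" "g b = \<sigma> (g a)" "g d = \<sigma> (g c)"
    using comm(1)[of a] comm(1)[of c] comm(2)[of a] comm(2)[of c] \<sigma> by auto
  have ne: "a \<noteq> b" "a \<noteq> c" "a \<noteq> d" "b \<noteq> c" "b \<noteq> d" "c \<noteq> d" "b \<noteq> a" "c \<noteq> a" "d \<noteq> a" "c \<noteq> b" "d \<noteq> b" "d \<noteq> c"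
    using assms(1) by auto
  have fQ: "f x \<in> {c, d}" if "x \<in> {a, b}" for x using that f e \<sigma> by auto
  have fP: "f x \<in> {a, b}" if "x \<in> {c, d}" for x using that f e \<sigma> by auto
  have disj: "{a, b} \<inter> {c, d} = {}" using ne by auto
  have gP: "g x \<in> {a, b}" if "x \<in> {a, b}" "g a \<in> {a, b}" for x using that e \<sigma> by auto
  have gQ: "g x \<in> {c, d}" if "x \<in> {c, d}" "g c \<in> {c, d}" for x using that e \<sigma> by auto
  have gP': "g x \<in> {a, b}" if "x \<in> {c, d}" "g c \<in> {a, b}" for x using that e \<sigma> by auto
  have gQ': "g x \<in> {c, d}" if "x \<in> {a, b}" "g a \<in> {c, d}" for x using that e \<sigma> by auto
  have ga: "g a \<in> {c, d}"
  proof (rule ccontr)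
    assume "g a \<notin> {c, d}"
    with g have 1: "g a \<in> {a, b}" by blast
    then have 2: "f (g a) \<in> {c, d}" by (rule fQ)
    have fa: "f a \<in> {c, d}" by (rule fQ) simp
    show False
    proof (cases "g c \<in> {a, b}")
      case True
      have "f (g (f a)) \<in> {c, d}" "g (f (g a)) \<in> {a, b}"
        by (rule fQ gP' fa 2 True)+
      then show False using br[of a] disj by auto
    next
      case False
      with g have 3: "g c \<in> {c, d}" by blast
      have "f (g (f a)) \<in> {a, b}" "g (f (g a)) \<in> {c, d}"
        by (rule fP gQ fa 2 3)+
      then show False using br[of a] disj by auto
    qed
  qed
  have gc: "g c \<in> {a, b}"
  proof (rule ccontr)
    assume "g c \<notin> {a, b}"
    with g have 3: "g c \<in> {c, d}" by blast
    have fa: "f a \<in> {c, d}" by (rule fQ) simp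
    have "f (g (f a)) \<in> {a, b}" by (rule fP gQ fa 3)+
    moreover have "g (f (g a)) \<in> {c, d}" by (rule gQ' fP ga)+
    ultimately show False using br[of a] disj by auto
  qed
  have gP2: "(\<forall>x\<in>{a, b}. g x = f x) \<or> (\<forall>x\<in>{a, b}. g x = \<sigma> (f x))"
    using ga f(1) e \<sigma> by auto
  have gQ2: "(\<forall>x\<in>{c, d}. g x = f x) \<or> (\<forall>x\<in>{c, d}. g x = \<sigma> (f x))"
    using gc f(2) e \<sigma> by auto
  have half: "\<not> (\<forall>x\<in>Q. g x = \<sigma> (f x))"
    if inv: "\<forall>x\<in>P \<union> Q. \<sigma> (\<sigma> x) = x \<and> \<sigma> x \<noteq> x"
      and fPQ: "\<And>x. x \<in> P \<Longrightarrow> f x \<in> Q" "\<And>x. x \<in> Q \<Longrightarrow> f x \<in> P"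
      and gP: "(\<forall>x\<in>P. g x = f x) \<or> (\<forall>x\<in>P. g x = \<sigma> (f x))" and x: "x \<in> P" for P Q :: "'a set" and x
  proof
    assume Q: "\<forall>x\<in>Q. g x = \<sigma> (f x)"
    have in': "f x \<in> Q" "f (f x) \<in> P" "f (f (f x)) \<in> Q" using fPQ x by auto
    have "f (g (f x)) = \<sigma> (f (f (f x)))" using Q in' comm by simp
    moreover have "g (f (g x)) = f (f (f x))"
      using gP
    proof
      assume "\<forall>x\<in>P. g x = f x"
      then show ?thesis using x in' by simp
    next
      assume "\<forall>x\<in>P. g x = \<sigma> (f x)"
      then show ?thesis using x in' inv comm by simp
    qed
    moreover have "\<sigma> (f (f (f x))) \<noteq> f (f (f x))" using inv in' by blast
    ultimately show False using br[of x] by metis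
  qed
  have inv: "\<forall>x\<in>{a, b, c, d}. \<sigma> (\<sigma> x) = x \<and> \<sigma> x \<noteq> x" using \<sigma> ne by auto
  have "\<not> (\<forall>x\<in>{c, d}. g x = \<sigma> (f x))" by (rule half[OF _ fQ fP gP2]) (use inv in auto)
  moreover have "\<not> (\<forall>x\<in>{a, b}. g x = \<sigma> (f x))" by (rule half[OF _ fP fQ gQ2]) (use inv in auto)
  ultimately show ?thesis using gP2 gQ2 by auto
qed

text \<open>Settled by running through all permutations of at most three points. The middle element
  may differ from the outer two, as two distinct transpositions of three points show; hence only
  \<open>f\<close> and \<open>h\<close> are compared.\<close>

lemma braid_three_points:
  assumes F: "finite F" "card F \<le> 3" and f: "f permutes F" and g: "g permutes F" and h: "h permutes F"
    and br: "f \<circ> g \<circ> f = g \<circ> f \<circ> g" "g \<circ> h \<circ> g = h \<circ> g \<circ> h" and c: "f \<circ> h = h \<circ> f"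
  shows "f = h"
proof -
  have pts: "f (g (f x)) = g (f (g x))" "g (h (g x)) = h (g (h x))" "f (h x) = h (f x)" for x
    using fun_cong[OF br(1), of x] fun_cong[OF br(2), of x] fun_cong[OF c, of x] by simp_all
  have "card F = 0 \<or> card F = 1 \<or> card F = 2 \<or> card F = 3" using F(2) by linarith
  moreover have ?thesis if "card F = 0"
    using that f h F(1) by (simp add: permutes_empty)
  moreover have ?thesis if "card F = 1"
    using that f h by (metis card_1_singletonE permutes_sing)
  moreover have ?thesis if c2: "card F = 2"
  proof -
    obtain a b where ab: "F = {a, b}" "a \<noteq> b" using c2 unfolding card_2_iff by blast
    have opt: "(p a = a \<and> p b = b) \<or> (p a = b \<and> p b = a)" if "p permutes F" for p
    proof -
      have "p a \<in> {a, b}" "p b \<in> {a, b}" using permutes_in_image[OF that] ab(1) by auto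
      moreover have "p a \<noteq> p b" using permutes_inj[OF that] ab by (auto dest: injD)
      ultimately show ?thesis by auto
    qed
    have "f (g (f a)) = g (f (g a)) \<longrightarrow> g (h (g a)) = h (g (h a)) \<longrightarrow> f a = h a \<and> f b = h b"
      using opt[OF f] opt[OF g] opt[OF h] by (elim disjE conjE; simp add: ab(2) ab(2)[symmetric])
    with pts have "f a = h a \<and> f b = h b" by blast
    then show ?thesis
      using ab(1) by (intro permutes_eqI[OF f h]) auto
  qed
  moreover have ?thesis if c3: "card F = 3"
  proof -
    obtain a b d where ab: "F = {a, b, d}" "a \<noteq> b" "b \<noteq> d" "a \<noteq> d" using c3 unfolding card_3_iff by blast
    have opt: "(p a = a \<and> p b = b \<and> p d = d) \<or> (p a = b \<and> p b = a \<and> p d = d) \<or> (p a = d \<and> p b = b \<and> p d = a) \<or>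
        (p a = a \<and> p b = d \<and> p d = b) \<or> (p a = b \<and> p b = d \<and> p d = a) \<or> (p a = d \<and> p b = a \<and> p d = b)"
      if p: "p permutes F" for p
    proof -
      have "p a \<in> {a, b, d}" "p b \<in> {a, b, d}" "p d \<in> {a, b, d}"
        using permutes_in_image[OF p] ab(1) by auto
      moreover have "p a \<noteq> p b" "p b \<noteq> p d" "p a \<noteq> p d"
        using permutes_inj[OF p, THEN inj_eq] ab by auto
      ultimately show ?thesis
        unfolding insert_iff empty_iff by (elim disjE) (simp_all only: simp_thms)
    qed
    note ne = ab(2-4) ab(2-4)[symmetric]
    have "f (g (f a)) = g (f (g a)) \<and> f (g (f b)) = g (f (g b)) \<and>
        g (h (g a)) = h (g (h a)) \<and> g (h (g b)) = h (g (h b)) \<and>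
        f (h a) = h (f a) \<and> f (h b) = h (f b) \<longrightarrow> f a = h a \<and> f b = h b \<and> f d = h d"
      using opt[OF f] opt[OF g] opt[OF h] by (elim disjE conjE; simp add: ne)
    with pts have "f a = h a \<and> f b = h b \<and> f d = h d" by blast
    then show ?thesis
      using ab(1) by (intro permutes_eqI[OF f h]) auto
  qed
  ultimately show ?thesis by blast
qed

text \<open>\<sigma> will be the first generator. Those from the third on commute with it, so they
  preserve its moved points \<open>U\<close> and its fixed points \<open>F\<close> and permute its
  cycles; this breaks the representation into smaller ones.\<close>

locale commuting_permutation =
  fixes A :: "nat set" and \<sigma> :: "nat \<Rightarrow> nat"
  assumes fin: "finite A" and \<sigma>: "\<sigma> permutes A"
begin

definition U where "U = {a \<in> A. \<sigma> a \<noteq> a}"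
definition F where "F = {a \<in> A. \<sigma> a = a}"
definition comm where "comm t \<longleftrightarrow> (\<forall>x. t (\<sigma> x) = \<sigma> (t x))"
text \<open>The least element stands for the cycle of \<open>a\<close>. Points are natural numbers,
  so the cycles of \<sigma> are again encoded by a set of natural numbers, to which an induction
  hypothesis can be applied.\<close>

definition rep where "rep a = (LEAST x. \<exists>j. x = (\<sigma> ^^ j) a)"

lemma U_F: "U \<union> F = A" "U \<inter> F = {}" "finite U" "finite F" "card U + card F = card A"
proof -
  show 1: "U \<union> F = A" "U \<inter> F = {}" by (auto simp: U_def F_def)
  show 2: "finite U" "finite F" using fin by (auto simp: U_def F_def)
  show "card U + card F = card A" using card_Un_disjoint[OF 2 1(2)] 1(1) by simp
qed

lemma rep_reach: "\<exists>j. rep a = (\<sigma> ^^ j) a"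
  unfolding rep_def by (rule LeastI_ex) blast

lemma reach_sym: "b = (\<sigma> ^^ j) a \<Longrightarrow> \<exists>i. a = (\<sigma> ^^ i) b"
proof -
  have "permutation \<sigma>" using \<sigma> fin permutation_permutes by blast
  then obtain N where N: "N > 0" "\<sigma> ^^ N = id" using permutation_is_nilpotent by blast
  assume b: "b = (\<sigma> ^^ j) a"
  have "(\<sigma> ^^ (N * j)) = id" by (induction j) (auto simp: funpow_add N(2))
  then have "a = (\<sigma> ^^ (N * j - j + j)) a" using N(1) by (simp add: le_add_diff_inverse2)
  also have "\<dots> = (\<sigma> ^^ (N * j - j)) b" using b by (simp add: funpow_add)
  finally show ?thesis by blast
qed

lemma rep_eq_iff: "rep a = rep b \<longleftrightarrow> (\<exists>j. b = (\<sigma> ^^ j) a)"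
proof
  assume "rep a = rep b"
  then obtain i j where "(\<sigma> ^^ i) a = (\<sigma> ^^ j) b" using rep_reach[of a] rep_reach[of b] by metis
  then obtain k where "b = (\<sigma> ^^ k) ((\<sigma> ^^ i) a)" using reach_sym[of "(\<sigma> ^^ i) a" j b] by auto
  then show "\<exists>j. b = (\<sigma> ^^ j) a" by (metis comp_apply funpow_add)
next
  assume "\<exists>j. b = (\<sigma> ^^ j) a"
  then obtain j where j: "b = (\<sigma> ^^ j) a" by blast
  then obtain i where i: "a = (\<sigma> ^^ i) b" using reach_sym by blast
  have "(\<exists>k. x = (\<sigma> ^^ k) a) \<longleftrightarrow> (\<exists>k. x = (\<sigma> ^^ k) b)" for x
    using i j by (metis comp_apply funpow_add)
  then show "rep a = rep b" by (simp add: rep_def)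
qed

lemma rep_\<sigma> [simp]: "rep (\<sigma> a) = rep a"
  using rep_eq_iff[of a "\<sigma> a"] by (metis (no_types) funpow_0 funpow.simps(2) comp_apply id_apply)

lemma rep_rep [simp]: "rep (rep a) = rep a"
  using rep_eq_iff[of a "rep a"] rep_reach[of a] by simp

lemma commute_pow: "comm t \<Longrightarrow> t ((\<sigma> ^^ j) x) = (\<sigma> ^^ j) (t x)"
  by (induction j) (auto simp: comm_def)

lemma comm_comp: "comm t \<Longrightarrow> comm u \<Longrightarrow> comm (t \<circ> u)"
  by (simp add: comm_def)

lemma rep_cong: "comm t \<Longrightarrow> rep a = rep b \<Longrightarrow> rep (t a) = rep (t b)"
  using rep_eq_iff commute_pow by metis

text \<open>Each of the two maps agrees at \<open>a\<close> with a power of \<sigma>, and the other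
  one commutes with that power.\<close>

lemma commute_on_orbit:
  assumes "comm u" "comm v" "rep (u a) = rep a" "rep (v a) = rep a"
  shows "u (v a) = v (u a)"
proof -
  obtain i j where "u a = (\<sigma> ^^ i) a" "v a = (\<sigma> ^^ j) a"
    using rep_eq_iff assms(3,4) by metis
  then show ?thesis
    using commute_pow[OF assms(1)] commute_pow[OF assms(2)] by (metis add.commute comp_apply funpow_add)
qed

lemma \<sigma>_U: "a \<in> U \<Longrightarrow> \<sigma> a \<in> U"
  using \<sigma> permutes_in_image[OF \<sigma>] by (auto simp: U_def permutes_inj[THEN inj_eq])

lemma rep_U: "a \<in> U \<Longrightarrow> rep a \<in> U"
proof -
  assume a: "a \<in> U"
  have "(\<sigma> ^^ j) a \<in> U" for j by (induction j) (use a \<sigma>_U in auto)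
  then show ?thesis using rep_reach[of a] by auto
qed

text \<open>A moved point differs from its image under \<sigma>, so every cycle in \<open>U\<close>
  contributes its representative and a second point.\<close>

lemma card_rep: "2 * card (rep ` U) \<le> card U"
proof -
  let ?O = "rep ` U"
  have sub: "?O \<subseteq> U" "\<sigma> ` ?O \<subseteq> U" using rep_U \<sigma>_U by auto
  have "?O \<inter> \<sigma> ` ?O = {}"
  proof (rule ccontr)
    assume "?O \<inter> \<sigma> ` ?O \<noteq> {}"
    then obtain a b where ab: "a \<in> U" "b \<in> U" "rep a = \<sigma> (rep b)" by auto
    have "rep (rep a) = rep (\<sigma> (rep b))" using ab(3) by (rule arg_cong)
    then have "rep a = rep b" by simp
    then have "\<sigma> (rep b) = rep b" using ab by simp
    then show False using rep_U[OF ab(2)] by (simp add: U_def)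
  qed
  then have "card (?O \<union> \<sigma> ` ?O) = card ?O + card (\<sigma> ` ?O)"
    using U_F(3) by (intro card_Un_disjoint) auto
  moreover have "card (\<sigma> ` ?O) = card ?O"
    using \<sigma> by (intro card_image) (meson inj_on_subset permutes_inj subset_UNIV)
  moreover have "card (?O \<union> \<sigma> ` ?O) \<le> card U"
    using sub U_F(3) by (intro card_mono) auto
  ultimately show ?thesis by simp
qed

definition res where "res B t = (\<lambda>a. if a \<in> B then t a else a)"

lemma res_permutes:
  assumes t: "t permutes A" and B: "\<And>a. a \<in> B \<Longrightarrow> t a \<in> B" "finite B"
  shows "res B t permutes B"
proof (rule bij_imp_permutes)
  have "inj_on t B" using t by (meson inj_on_subset permutes_inj subset_UNIV)
  then have "bij_betw t B B"
    using B endo_inj_surj[of B t] by (auto simp: bij_betw_def)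
  then show "bij_betw (res B t) B B"
    by (subst bij_betw_cong[of B _ t]) (auto simp: res_def)
qed (auto simp: res_def)

lemma res_comp: "(\<And>a. a \<in> B \<Longrightarrow> t' a \<in> B) \<Longrightarrow> res B t \<circ> res B t' = res B (t \<circ> t')"
  by (auto simp: res_def fun_eq_iff)

definition act where "act t = (\<lambda>r. if r \<in> rep ` U then rep (t r) else r)"

lemma commuting_U_F:
  assumes t: "t permutes A" "comm t"
  shows "a \<in> U \<Longrightarrow> t a \<in> U" "a \<in> F \<Longrightarrow> t a \<in> F"
  using t(2) permutes_in_image[OF t(1)] permutes_inj[OF t(1), THEN inj_eq]
  unfolding comm_def U_def F_def by (auto, metis+)

lemma act_permutes:
  assumes t: "t permutes A" "comm t"
  shows "act t permutes rep ` U"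
proof (rule bij_imp_permutes)
  have into: "act t r \<in> rep ` U" if "r \<in> rep ` U" for r
    using that rep_U commuting_U_F(1)[OF t] by (auto simp: act_def)
  have "inj_on (act t) (rep ` U)"
  proof (rule inj_onI)
    fix r r' assume r: "r \<in> rep ` U" "r' \<in> rep ` U" "act t r = act t r'"
    then have "rep (t r) = rep (t r')" by (simp add: act_def)
    then obtain j where "t r' = (\<sigma> ^^ j) (t r)" using rep_eq_iff by blast
    then have "t r' = t ((\<sigma> ^^ j) r)" using commute_pow[OF t(2)] by simp
    then have "r' = (\<sigma> ^^ j) r" using permutes_inj[OF t(1), THEN inj_eq] by simp
    then have "rep r = rep r'" using rep_eq_iff by blast
    then show "r = r'" using r by auto
  qed
  then show "bij_betw (act t) (rep ` U) (rep ` U)"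
    using into U_F(3) endo_inj_surj[of "rep ` U" "act t"] by (auto simp: bij_betw_def)
qed (auto simp: act_def)

lemma act_comp:
  assumes t: "comm t" and t': "t' permutes A" "comm t'"
  shows "act t \<circ> act t' = act (t \<circ> t')"
proof
  fix r show "(act t \<circ> act t') r = act (t \<circ> t') r"
  proof (cases "r \<in> rep ` U")
    case True
    then have "t' r \<in> U" using commuting_U_F(1)[OF t'] rep_U by auto
    moreover have "rep (t (rep (t' r))) = rep (t (t' r))" by (rule rep_cong[OF t]) simp
    ultimately show ?thesis using True by (simp add: act_def)
  qed (simp add: act_def)
qed

lemma act_eqD:
  assumes t: "comm t" and t': "comm t'"
    and eq: "act t = act t'" and a: "a \<in> U"
  shows "rep (t a) = rep (t' a)"
proof -
  have "rep (t a) = rep (t (rep a))" by (rule rep_cong[OF t]) simp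
  also have "\<dots> = rep (t' (rep a))" using fun_cong[OF eq, of "rep a"] a by (simp add: act_def)
  also have "\<dots> = rep (t' a)" by (rule rep_cong[OF t']) simp
  finally show ?thesis .
qed

section \<open>Braid relations on fixed points and on cycles\<close>

lemma braid_res:
  assumes t: "braid_permutations k A t" "\<And>i. i < k \<Longrightarrow> comm (t i)"
    and B: "B = U \<or> B = F"
  shows "braid_permutations k B (\<lambda>i. res B (t i))"
proof -
  have perm: "t i permutes A" if "i < k" for i using t(1) that by (auto simp: braid_permutations_def)
  have into: "t i a \<in> B" if "i < k" "a \<in> B" for i a
    using commuting_U_F[OF perm[OF that(1)] t(2)[OF that(1)]] that B by auto
  show ?thesis
    unfolding braid_permutations_def
  proof (intro conjI allI impI)
    show "res B (t i) permutes B" if "i < k" for i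
      using res_permutes[OF perm[OF that]] into[OF that] B U_F by blast
    show "res B (t i) \<circ> res B (t (Suc i)) \<circ> res B (t i) =
        res B (t (Suc i)) \<circ> res B (t i) \<circ> res B (t (Suc i))" if "Suc i < k" for i
    proof -
      have "t i \<circ> t (Suc i) \<circ> t i = t (Suc i) \<circ> t i \<circ> t (Suc i)"
        using t(1) that by (auto simp: braid_permutations_def)
      moreover have "\<And>a. a \<in> B \<Longrightarrow> t i a \<in> B" "\<And>a. a \<in> B \<Longrightarrow> t (Suc i) a \<in> B" using into that by auto
      ultimately show ?thesis by (simp add: res_comp)
    qed
    show "res B (t i) \<circ> res B (t j) = res B (t j) \<circ> res B (t i)" if "Suc i < j" "j < k" for i j
    proof -
      have "t i \<circ> t j = t j \<circ> t i" using t(1) that by (auto simp: braid_permutations_def)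
      moreover have "\<And>a. a \<in> B \<Longrightarrow> t i a \<in> B" "\<And>a. a \<in> B \<Longrightarrow> t j a \<in> B" using into that by auto
      ultimately show ?thesis by (simp add: res_comp)
    qed
  qed
qed

lemma braid_act:
  assumes t: "braid_permutations k A t" "\<And>i. i < k \<Longrightarrow> comm (t i)"
  shows "braid_permutations k (rep ` U) (\<lambda>i. act (t i))"
proof -
  have perm: "t i permutes A" if "i < k" for i using t(1) that by (auto simp: braid_permutations_def)
  show ?thesis
    unfolding braid_permutations_def
  proof (intro conjI allI impI)
    show "act (t i) permutes rep ` U" if "i < k" for i
      using act_permutes[OF perm[OF that]] t(2)[OF that] by blast
    show "act (t i) \<circ> act (t (Suc i)) \<circ> act (t i) = act (t (Suc i)) \<circ> act (t i) \<circ> act (t (Suc i))"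
      if i: "Suc i < k" for i
    proof -
      have "t i \<circ> t (Suc i) \<circ> t i = t (Suc i) \<circ> t i \<circ> t (Suc i)"
        using t(1) i by (auto simp: braid_permutations_def)
      moreover have "comm (t i)" "comm (t (Suc i))" "t i permutes A" "t (Suc i) permutes A" using i t(2) perm by auto
      ultimately show ?thesis by (simp add: act_comp comm_comp)
    qed
    show "act (t i) \<circ> act (t j) = act (t j) \<circ> act (t i)" if "Suc i < j" "j < k" for i j
    proof -
      have "t i \<circ> t j = t j \<circ> t i" using t(1) that by (auto simp: braid_permutations_def)
      moreover have "comm (t i)" "comm (t j)" "t i permutes A" "t j permutes A" using that t(2) perm by auto
      ultimately show ?thesis by (simp add: act_comp)
    qed
  qed
qed

text \<open>Both maps preserve every cycle in \<open>U\<close>, hence commute there, and the braid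
  relation cancels as for commuting permutations, pointwise on \<open>U\<close> only.\<close>

lemma braid_eq_on_orbits:
  assumes f: "f permutes A" "comm f" and g: "g permutes A" "comm g"
    and br: "\<And>x. f (g (f x)) = g (f (g x))"
    and orb: "\<And>x. x \<in> U \<Longrightarrow> rep (f x) = rep x" "\<And>x. x \<in> U \<Longrightarrow> rep (g x) = rep x" and x: "x \<in> U"
  shows "f x = g x"
proof -
  have rg: "res U g permutes U" using res_permutes[OF g(1)] commuting_U_F(1)[OF g] U_F(3) by blast
  then obtain y where y: "y \<in> U" "x = g y"
    using x unfolding permutes_def by (metis res_def rg permutes_in_image)
  have "f (f (g y)) = f (g (f y))"
    using commute_on_orbit[OF f(2) g(2) orb(1)[OF y(1)] orb(2)[OF y(1)]] by simp
  also have "\<dots> = g (f (g y))" by (rule br)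
  also have "\<dots> = f (g (g y))"
    using commute_on_orbit[OF f(2) g(2), of "g y"] orb commuting_U_F(1)[OF g y(1)] by simp
  finally show ?thesis using y permutes_inj[OF f(1), THEN inj_eq] by simp
qed

text \<open>If \<open>f\<close> takes a cycle to another one, both have the same length, and five
  moved points leave room for two 2-cycles and nothing else; this is the case of
  \<open>small_orbits_swap\<close>. If instead \<open>g\<close> does so, the roles are exchanged,
  and if neither does, \<open>braid_eq_on_orbits\<close> applies.\<close>

lemma braid_eq_small:
  assumes f: "f permutes A" "comm f" and g: "g permutes A" "comm g"
    and br: "\<And>x. f (g (f x)) = g (f (g x))" and U: "card U \<le> 5" and x: "x \<in> U"
  shows "f x = g x"
proof -
  have swap: "f x = g x"
    if f: "f permutes A" "comm f" and g: "g permutes A" "comm g"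
      and br: "\<And>x. f (g (f x)) = g (f (g x))" and a: "a \<in> U" "rep (f a) \<noteq> rep a" and x: "x \<in> U" for f g a x
  proof -
    define b c d where "b = \<sigma> a" and "c = f a" and "d = f b"
    have \<sigma>c: "\<sigma> c = d" using f(2) by (simp add: b_def c_def d_def comm_def)
    have inU: "a \<in> U" "b \<in> U" "c \<in> U" "d \<in> U"
      using a \<sigma>_U commuting_U_F(1)[OF f] by (auto simp: b_def c_def d_def)
    have reps: "rep b = rep a" "rep d = rep c" "rep c \<noteq> rep a"
      using a f(2) by (simp_all add: b_def c_def d_def comm_def)
    have "a \<noteq> b" "c \<noteq> d" using inU \<sigma>c by (auto simp: U_def b_def)
    with reps have dist: "distinct [a, b, c, d]" by auto
    have \<sigma>b: "\<sigma> b = a"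
    proof (rule ccontr)
      assume ne: "\<sigma> b \<noteq> a"
      define e where "e = \<sigma> b"
      have eU: "e \<in> U" "f e \<in> U" using inU \<sigma>_U commuting_U_F(1)[OF f] by (auto simp: e_def)
      have re: "rep e = rep a" "rep (f e) = rep c"
        using reps f(2) by (simp_all add: e_def comm_def d_def[symmetric])
      have eb: "e \<noteq> b" "e \<noteq> a" using inU(2) ne by (simp_all add: U_def e_def)
      then have fe: "f e \<noteq> c" "f e \<noteq> d"
        using permutes_inj[OF f(1), THEN inj_eq] by (simp_all add: c_def d_def)
      have diff: "x \<noteq> y" if "rep x = rep a" "rep y = rep c" for x y using reps that by auto
      have "a \<noteq> f e" "b \<noteq> f e" "e \<noteq> c" "e \<noteq> d" "e \<noteq> f e"
        using diff[of a "f e"] diff[of b "f e"] diff[of e c] diff[of e d] diff[of e "f e"] reps(1,2) re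
        by simp_all
      with eb fe dist have "distinct [a, b, c, d, e, f e]" by simp
      moreover have "set [a, b, c, d, e, f e] \<subseteq> U" using inU eU by simp
      ultimately have "6 \<le> card U"
        using card_mono[OF U_F(3), of "set [a, b, c, d, e, f e]"] distinct_card[of "[a, b, c, d, e, f e]"] by simp
      then show False using U by simp
    qed
    then have \<sigma>d: "\<sigma> d = c" using f(2) by (metis c_def d_def comm_def)
    have Ueq: "U = {a, b, c, d}"
    proof (rule ccontr)
      assume "U \<noteq> {a, b, c, d}"
      then obtain e where e: "e \<in> U" "e \<notin> {a, b, c, d}" using inU by auto
      have "\<sigma> e \<noteq> e" using e by (auto simp: U_def)
      have "\<sigma> e \<notin> {a, b, c, d}"
      proof
        assume "\<sigma> e \<in> {a, b, c, d}"
        then have "\<sigma> e \<in> \<sigma> ` {a, b, c, d}" using \<sigma>b \<sigma>c \<sigma>d b_def by auto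
        then show False using e(2) permutes_inj[OF \<sigma>] by (simp only: inj_image_mem_iff)
      qed
      then have "distinct [a, b, c, d, e, \<sigma> e]" using dist e(2) \<open>\<sigma> e \<noteq> e\<close> by auto
      moreover have "set [a, b, c, d, e, \<sigma> e] \<subseteq> U" using inU e \<sigma>_U by simp
      ultimately have "6 \<le> card U"
        using card_mono[OF U_F(3), of "set [a, b, c, d, e, \<sigma> e]"] distinct_card[of "[a, b, c, d, e, \<sigma> e]"] by simp
      then show False using U by simp
    qed
    have fc: "f c \<in> {a, b}"
    proof -
      have "f c \<in> {a, b, c, d}" using commuting_U_F(1)[OF f inU(3)] Ueq by simp
      moreover have "f c \<noteq> c" "f c \<noteq> d"
        using dist permutes_inj[OF f(1), THEN inj_eq] by (auto simp: c_def d_def)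
      ultimately show ?thesis by auto
    qed
    have g4: "g a \<in> {a, b, c, d}" "g c \<in> {a, b, c, d}"
      using commuting_U_F(1)[OF g] inU Ueq by blast+
    have "f a = g a \<and> f b = g b \<and> f c = g c \<and> f d = g d"
      by (rule small_orbits_swap[OF dist _ \<sigma>b \<sigma>c \<sigma>d _ _ _ fc g4 br])
         (use f(2) g(2) in \<open>simp_all add: comm_def b_def c_def\<close>)
    moreover have "x \<in> {a, b, c, d}" using x Ueq by blast
    ultimately show ?thesis by blast
  qed
  show ?thesis
  proof (cases "\<exists>a\<in>U. rep (f a) \<noteq> rep a")
    case True
    then show ?thesis using swap[OF f g br _ _ x] by blast
  next
    case False
    show ?thesis
    proof (cases "\<exists>a\<in>U. rep (g a) \<noteq> rep a")
      case True
      then show ?thesis using swap[OF g f br[symmetric] _ _ x] by metis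
    next
      case no: False
      show ?thesis
        by (rule braid_eq_on_orbits[OF f g br _ _ x]) (use False no in auto)
    qed
  qed
qed

end

text \<open>Induction in steps of two. The generators from the third on commute with
  \<open>s 0\<close>, hence act on its fixed points and on its nontrivial cycles, at most
  \<open>k - 2\<close> of either, where the induction hypothesis makes them agree. A single
  coincidence of neighbouring generators then spreads to all. Four and five generators are treated
  directly, as the hypothesis does not reach the two or three that remain.\<close>

theorem artin_permutations:
  fixes A :: "nat set"
  assumes "finite A" "card A \<le> k" "4 \<le> k" "braid_permutations k A s" "j < k"
  shows "s j = s 0"
  using assms
proof (induction k arbitrary: A s j rule: less_induct)
  case (less k)
  note fin = less.prems(1) and cardA = less.prems(2) and k = less.prems(3) and b = less.prems(4)
  have perm: "s i permutes A" if "i < k" for i using b that by (auto simp: braid_permutations_def)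
  have br: "s i (s (Suc i) (s i x)) = s (Suc i) (s i (s (Suc i) x))" if "Suc i < k" for i x
  proof -
    have "s i \<circ> s (Suc i) \<circ> s i = s (Suc i) \<circ> s i \<circ> s (Suc i)"
      using b that by (auto simp: braid_permutations_def)
    from fun_cong[OF this, of x] show ?thesis by simp
  qed
  have far: "s i (s j x) = s j (s i x)" if "Suc i < j" "j < k" for i j x
  proof -
    have "s i \<circ> s j = s j \<circ> s i" using b that by (auto simp: braid_permutations_def)
    from fun_cong[OF this, of x] show ?thesis by simp
  qed
  have adj: ?case if "Suc i < k" "s i = s (Suc i)" for i
    by (rule braid_permutations_all_equal[OF b that less.prems(5)])
  show ?case
  proof (cases "s 0 = id")
    case True
    \<comment> \<open>With \<open>s 0\<close> trivial the braid relation says that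
      \<open>s 1\<close> is idempotent, so it is trivial too.\<close>
    have "s 0 = s (Suc 0)"
      using br[of 0] True k permutes_inj[OF perm[of "Suc 0"], THEN inj_eq] by (auto simp: fun_eq_iff)
    then show ?thesis using adj[of 0] k by simp
  next
    case False
    interpret commuting_permutation A "s 0" by unfold_locales (use fin perm k in auto)
    define t where "t i = s (Suc (Suc i))" for i
    have tb: "braid_permutations (k - 2) A t"
      unfolding braid_permutations_def t_def
    proof (intro conjI allI impI)
      show "s (Suc (Suc i)) \<circ> s (Suc (Suc j)) = s (Suc (Suc j)) \<circ> s (Suc (Suc i))" if "Suc i < j" "j < k - 2" for i j
        using far[of "Suc (Suc i)" "Suc (Suc j)"] that by (auto simp: fun_eq_iff)
    qed (use perm br in \<open>auto simp: fun_eq_iff\<close>)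
    have tp: "t i permutes A" if "i < k - 2" for i using tb that by (auto simp: braid_permutations_def)
    have tc: "comm (t i)" if "i < k - 2" for i
      using far[of 0 "Suc (Suc i)"] that by (auto simp: t_def comm_def)
    obtain x where x: "x \<in> U"
      using False permutes_not_in[OF perm[of 0]] k by (auto simp: fun_eq_iff U_def)
    then have "{x, s 0 x} \<subseteq> U" "x \<noteq> s 0 x" using \<sigma>_U by (auto simp: U_def)
    then have "2 \<le> card U" using card_mono[OF U_F(3), of "{x, s 0 x}"] by simp
    then have cF: "card F \<le> k - 2" using U_F(5) cardA by linarith
    \<comment> \<open>There are at most half as many cycles as points, and half of \<open>k\<close>
      is at most \<open>k - 2\<close> because \<open>k \<ge> 4\<close>.\<close>
    have cO: "card (rep ` U) \<le> k - 2" using card_rep U_F(5) cardA k by linarith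
    have rF: "braid_permutations (k - 2) F (\<lambda>i. res F (t i))" using braid_res[OF tb tc] by auto
    have rO: "braid_permutations (k - 2) (rep ` U) (\<lambda>i. act (t i))" using braid_act[OF tb tc] .
    have split: "p = q" if "p permutes A" "q permutes A" "\<And>x. x \<in> U \<Longrightarrow> p x = q x" "\<And>x. x \<in> F \<Longrightarrow> p x = q x" for p q
      using permutes_eqI[OF that(1,2)] that(3,4) U_F(1) by blast
    have resD: "p x = q x" if "res F p = res F q" "x \<in> F" for p q x
      using fun_cong[OF that(1), of x] that(2) by (simp add: res_def)
    have tbr: "t i (t (Suc i) (t i x)) = t (Suc i) (t i (t (Suc i) x))" if "Suc i < k - 2" for i x
      using br[of "Suc (Suc i)" x] that by (simp add: t_def)
    consider "k = 4" | "k = 5" | "6 \<le> k" using k by linarith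
    then show ?thesis
    proof cases
      case 1
      \<comment> \<open>At most two fixed points are left; their permutations commute, and commuting
        elements with the braid relation coincide.\<close>
      have e: "res F (t 0) = res F (t 1)"
      proof -
        have rp: "res F (t 0) permutes F" "res F (t 1) permutes F"
          and rb: "res F (t 0) \<circ> res F (t 1) \<circ> res F (t 0) = res F (t 1) \<circ> res F (t 0) \<circ> res F (t 1)"
          using rF 1 by (auto simp: braid_permutations_def)
        have "res F (t 0) = res F (t 1)" if "res F (t 0) \<circ> res F (t 1) = res F (t 1) \<circ> res F (t 0)"
          using braid_commute_eq[OF rp that rb] .
        moreover have "p \<circ> q = q \<circ> p" if pq: "p permutes F" "q permutes F" for p q
        proof -
          have "card F = 0 \<or> card F = 1 \<or> card F = 2" using cF 1 by linarith
          moreover have ?thesis if "card F = 0" using that pq U_F(4) by (simp add: permutes_empty)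
          moreover have ?thesis if "card F = 1" using that pq by (metis card_1_singletonE permutes_sing)
          moreover have ?thesis if c2: "card F = 2"
          proof -
            obtain a d where ad: "F = {a, d}" "a \<noteq> d" using c2 unfolding card_2_iff by blast
            have opt: "r = id \<or> (r a = d \<and> r d = a)" if r: "r permutes F" for r
            proof -
              have "r a \<in> {a, d}" "r d \<in> {a, d}" using permutes_in_image[OF r] ad(1) by auto
              moreover have "r a \<noteq> r d" using permutes_inj[OF r] ad(2) by (auto dest: injD)
              moreover have "r x = x" if "x \<noteq> a" "x \<noteq> d" for x using r that ad(1) by (simp add: permutes_not_in)
              ultimately have "(r a = a \<and> r d = d) \<or> (r a = d \<and> r d = a)" "\<And>x. x \<noteq> a \<Longrightarrow> x \<noteq> d \<Longrightarrow> r x = x"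
                by auto
              then show ?thesis unfolding fun_eq_iff id_apply by metis
            qed
            have "p (q x) = q (p x)" for x
            proof (cases "x \<in> F")
              case True
              then show ?thesis using opt[OF pq(1)] opt[OF pq(2)] ad by auto
            next
              case False
              then show ?thesis using pq by (simp add: permutes_not_in)
            qed
            then show ?thesis by (simp add: fun_eq_iff)
          qed
          ultimately show ?thesis by blast
        qed
        ultimately show ?thesis using rp by blast
      qed
      have eU: "t 0 x = t 1 x" if "x \<in> U" for x
        by (rule braid_eq_small[OF _ _ _ _ _ _ that])
           (use tp tc tbr[of 0] 1 U_F(5) cardA in auto)
      have "t 0 = t 1"
        by (rule split) (use 1 tp eU resD[OF e] in simp_all)
      then show ?thesis using adj[of 2] 1 by (simp add: t_def numeral_2_eq_2)
    next
      case 2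
      \<comment> \<open>On up to three fixed points only the outer two of the three generators are
        seen to agree. Together with the moved points this gives \<open>s 2 = s 4\<close>, and
        \<open>s 1\<close>, which commutes with \<open>s 4\<close>, then commutes with
        \<open>s 2\<close> and equals it.\<close>
      have e: "res F (t 0) = res F (t 2)"
      proof (rule braid_three_points[of F _ "res F (t 1)"])
        show "res F (t 0) \<circ> res F (t 1) \<circ> res F (t 0) = res F (t 1) \<circ> res F (t 0) \<circ> res F (t 1)"
          "res F (t 1) \<circ> res F (t 2) \<circ> res F (t 1) = res F (t 2) \<circ> res F (t 1) \<circ> res F (t 2)"
          using rF 2 unfolding braid_permutations_def by (auto simp: numeral_2_eq_2)
        have "Suc 0 < 2" "(2 :: nat) < k - 2" using 2 by auto
        then show "res F (t 0) \<circ> res F (t 2) = res F (t 2) \<circ> res F (t 0)"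
          using rF unfolding braid_permutations_def by blast
      qed (use rF 2 U_F cF in \<open>auto simp: braid_permutations_def\<close>)
      have eU: "t 0 x = t 1 x" "t 1 x = t 2 x" if "x \<in> U" for x
        by (rule braid_eq_small[OF _ _ _ _ _ _ that],
            use tp tc tbr[of 0] tbr[of 1] 2 U_F(5) cardA in \<open>auto simp: numeral_2_eq_2\<close>)+
      have "t 0 = t 2"
        by (rule split) (use 2 tp eU resD[OF e] in simp_all)
      then have e: "s 2 = s 4" by (simp add: t_def numeral_eq_Suc)
      have "s 1 = s 2"
        by (rule braid_commute_eq[OF perm perm])
           (use 2 far[of 1 4] br[of 1] e in \<open>auto simp: fun_eq_iff numeral_2_eq_2\<close>)
      then show ?thesis using adj[of 1] 2 by (simp add: numeral_2_eq_2)
    next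
      case 3
      have IH: "r i = r 0" if "finite B" "card B \<le> k - 2" "braid_permutations (k - 2) B r" "i < k - 2" for B :: "nat set" and r i
        using less.IH[of "k - 2" B r i] that 3 by auto
      have eF: "t i x = t 0 x" if "i < k - 2" "x \<in> F" for i x
        using IH[OF U_F(4) cF rF that(1)] resD that(2) by blast
      have eU: "rep (t i x) = rep (t 0 x)" if "i < k - 2" "x \<in> U" for i x
        using act_eqD[OF tc tc IH[OF _ cO rO that(1)] that(2)] U_F(3) that 3 by auto
      have i: "0 < k - 2" "1 < k - 2" "3 < k - 2" using 3 by auto
      \<comment> \<open>All \<open>t i\<close> act alike on cycles, so \<open>t 1\<close> and
        \<open>t 3\<close> composed with \<open>T\<close> preserve every cycle and commute there; on
        fixed points both composites are trivial. As \<open>t 3\<close> commutes with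
        \<open>t 0\<close> and \<open>t 1\<close>, it can be cancelled from this commutation, which
        leaves that \<open>T\<close> commutes with \<open>t 1\<close>.\<close>
      define T where "T = inv' (t 0)"
      have T: "T permutes A" "\<And>x. T (t 0 x) = x" "\<And>x. t 0 (T x) = x"
        using tp[OF i(1)] by (auto simp: T_def permutes_inv permutes_inverses)
      have Tc: "comm T"
        using tc[OF i(1)] T unfolding comm_def by metis
      have u: "comm (\<lambda>x. t a (T x))" if "a < k - 2" for a
        using tc[OF that] Tc by (simp add: comm_def)
      have comm: "t 1 (T (t 3 (T x))) = t 3 (T (t 1 (T x)))" for x
      proof (cases "x \<in> U")
        case True
        then have Tx: "T x \<in> U" using commuting_U_F(1)[OF T(1) Tc] by blast
        have "rep (t a (T x)) = rep x" if "a < k - 2" for a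
          using eU[OF that Tx] T(3) by simp
        then show ?thesis
          using commute_on_orbit[OF u[OF i(2)] u[OF i(3)], of x] i by simp
      next
        case False
        then have "t a (T x) = x" if "a < k - 2" for a
        proof (cases "x \<in> A")
          case True
          with False have "x \<in> F" using U_F(1) by blast
          then have "T x \<in> F" using commuting_U_F(2)[OF T(1) Tc] by blast
          then show ?thesis using eF[OF that] T(3) by simp
        next
          case out: False
          then show ?thesis using tp[OF that] T(1) by (simp add: permutes_not_in)
        qed
        then show ?thesis using i by simp
      qed
      have c31: "t 3 (t 1 x) = t 1 (t 3 x)" and c30: "t 3 (t 0 x) = t 0 (t 3 x)" for x
        using far[of 3 5 x] far[of 2 5 x] 3 by (simp_all add: t_def numeral_eq_Suc)
      have c3T: "t 3 (T x) = T (t 3 x)" for x using c30[of "T x"] T by metis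
      have T1: "T (t 1 z) = t 1 (T z)" for z
      proof -
        have "t 3 (T (t 1 (T y))) = t 3 (t 1 (T (T y)))" for y
          using comm c3T c31 by simp
        then have "T (t 1 (T y)) = t 1 (T (T y))" for y
          using permutes_inj[OF tp[OF i(3)], THEN inj_eq] by blast
        from this[of "t 0 z"] show ?thesis by (simp add: T(2))
      qed
      have "t 0 (t 1 x) = t 1 (t 0 x)" for x
        using arg_cong[OF T1[of "t 0 x"], of "t 0"] T(2,3) by simp
      then have "t 0 = t 1"
        using tbr[of 0] i by (intro braid_commute_eq[OF tp tp]) (auto simp: fun_eq_iff)
      then show ?thesis using adj[of 2] 3 by (simp add: t_def numeral_2_eq_2)
    qed
  qed
qed

section \<open>Homomorphisms to symmetric groups\<close>

text \<open>If \<open>c\<close> moves \<open>a\<close>, the transposition of \<open>c a\<close> with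
  a third point fixes \<open>a\<close> but moves \<open>c a\<close>, and so does not commute with
  \<open>c\<close>.\<close>

lemma sym_group_center:
  assumes m: "3 \<le> m" and c: "c \<in> carrier (sym_group m)"
    and comm: "\<And>h. h \<in> carrier (sym_group m) \<Longrightarrow> h \<otimes>\<^bsub>sym_group m\<^esub> c = c \<otimes>\<^bsub>sym_group m\<^esub> h"
  shows "c = \<one>\<^bsub>sym_group m\<^esub>"
proof (rule ccontr)
  have c: "c permutes {1..m}" using c by (simp add: sym_group_carrier)
  assume "c \<noteq> \<one>\<^bsub>sym_group m\<^esub>"
  then obtain a where a: "c a \<noteq> a" by (auto simp: sym_group_one fun_eq_iff)
  have am: "a \<in> {1..m}" "c a \<in> {1..m}" using a permutes_not_in[OF c] permutes_in_image[OF c] by metis+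
  have "card {1..m} > card {a, c a}" using m a by simp
  then obtain d where d: "d \<in> {1..m}" "d \<notin> {a, c a}"
    by (metis card_mono finite.emptyI finite.insertI not_le subsetI)
  let ?h = "Transposition.transpose (c a) d"
  have "?h permutes {1..m}" using am d by (intro permutes_swap_id) auto
  then have "?h \<circ> c = c \<circ> ?h" using comm[of ?h] by (simp add: sym_group_carrier sym_group_mult)
  then have "(?h \<circ> c) a = (c \<circ> ?h) a" by (rule fun_cong)
  then have "?h (c a) = c (?h a)" by (simp only: comp_apply)
  then show False using a d by (simp add: Transposition.transpose_def split: if_splits)
qed

context polygon_space
begin

text \<open>Surjectivity has to survive lifting, the move into the disc and the gauge. The lift of a
  loop ends at a relabelling of its start; values and gauge are invariant under relabelling, so the
  factors at the two ends are inverse to each other and all changes amount to conjugations.\<close>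

lemma gauged_rep_of_epi:
  assumes G: "group G" and \<phi>: "\<phi> \<in> epi (braid_group n X b) G" and b: "b \<in> topspace (unordered_configuration_space n X)"
  obtains \<Psi> where "gauged_surface_rep w X q G n \<Psi>"
    "\<And>h. h \<in> carrier G \<Longrightarrow> \<exists>p. pathin (configuration_space n X) p \<and> p 0 \<in> J n ` topspace (disc_configurations n) \<and>
      p 1 \<in> J n ` topspace (disc_configurations n) \<and> \<Psi> p = h"
proof -
  let ?F = "configuration_space n X" and ?U = "unordered_configuration_space n X" and ?E = "disc_configurations n"
  interpret group G by (rule G)
  have hom: "\<phi> \<in> hom (fundamental_group ?U b) G" and onto: "\<phi> ` carrier (fundamental_group ?U b) = carrier G"
    using \<phi> by (auto simp: epi_def braid_group_def)
  have "\<exists>p. pathin ?U p \<and> p 0 = y \<and> p 1 = z" if yz: "y \<in> topspace ?U" "z \<in> topspace ?U" for y z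
  proof -
    obtain x x' where x: "x \<in> topspace ?F" "y = orbit_of n X x" "x' \<in> topspace ?F" "z = orbit_of n X x'"
      using yz unfolding topspace_unordered_configuration_space by blast
    then obtain p where "pathin ?F p" "p 0 = x" "p 1 = x'"
      using path_connected_space_configurations[of n] unfolding path_connected_space_def by blast
    then show ?thesis using pathin_continuous_map[OF _ continuous_map_orbit_of] x by metis
  qed
  then have "path_connected_space ?U" unfolding path_connected_space_def by blast
  then obtain \<Psi>0 where \<Psi>0: "path_rep G ?U \<Psi>0" "\<And>p. p \<in> loops ?U b \<Longrightarrow> \<Psi>0 p = \<phi> (loop_class ?U b p)"
    by (rule path_rep_of_hom[OF G hom _ b]) (rule that)
  interpret U: path_rep G ?U \<Psi>0 by (rule \<Psi>0(1))
  let ?\<Psi>1 = "\<lambda>p. \<Psi>0 (\<lambda>t. orbit_of n X (p t))"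
  interpret F: path_rep G ?F ?\<Psi>1 by (rule U.pullback[OF continuous_map_orbit_of])
  interpret F: surface_rep w X q G n ?\<Psi>1
  proof
    fix s p assume s: "s permutes {..<n}" and p: "pathin ?F p"
    show "\<Psi>0 (\<lambda>t. orbit_of n X (p t \<circ> s)) = ?\<Psi>1 p"
      by (rule U.rep_eq[symmetric, OF pathin_continuous_map[OF p continuous_map_orbit_of]])
        (use orbit_of_permute[OF pathin_top[OF p] s] in simp)
  qed
  obtain \<gamma> where \<gamma>: "\<gamma> \<in> topspace ?F \<rightarrow> carrier G"
    "\<And>y s. y \<in> topspace ?F \<Longrightarrow> s permutes {..<n} \<Longrightarrow> \<gamma> (y \<circ> s) = \<gamma> y"
    "gauged_surface_rep w X q G n (\<lambda>p. \<gamma> (p 0) \<otimes>\<^bsub>G\<^esub> ?\<Psi>1 p \<otimes>\<^bsub>G\<^esub> inv\<^bsub>G\<^esub> (\<gamma> (p 1)))"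
    by (rule F.surface_gauge) (rule that)
  obtain x0 where x0: "x0 \<in> topspace ?F" "b = orbit_of n X x0"
    using b unfolding topspace_unordered_configuration_space by blast
  obtain p0 where p0: "pathin ?F p0" "p0 0 = x0" "p0 1 \<in> J n ` topspace ?E"
    using disc_access[OF openin_topspace x0(1)] .
  obtain e where e: "e \<in> topspace ?E" "p0 1 = J n e" using p0(3) by blast
  have x1: "J n e \<in> topspace ?F" using J_configuration'[OF e(1)] .
  define c where "c = \<gamma> (J n e)"
  have c: "c \<in> carrier G" using \<gamma>(1) x1 by (auto simp: c_def)
  define g where "g = ?\<Psi>1 p0"
  have g: "g \<in> carrier G" using F.closed[OF p0(1)] by (simp add: g_def)
  show thesis
  proof (rule that[OF \<gamma>(3)])
    fix h assume h: "h \<in> carrier G"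
    \<comment> \<open>The value is prepared to undo both changes: conjugation by \<open>c\<close>
      compensates the gauge, the further conjugation by \<open>g\<close> the detour along
      \<open>p0\<close>.\<close>
    let ?h' = "inv\<^bsub>G\<^esub> c \<otimes>\<^bsub>G\<^esub> h \<otimes>\<^bsub>G\<^esub> c"
    have h': "?h' \<in> carrier G" using h c by simp
    have "g \<otimes>\<^bsub>G\<^esub> ?h' \<otimes>\<^bsub>G\<^esub> inv\<^bsub>G\<^esub> g \<in> \<phi> ` loop_class ?U b ` loops ?U b"
      using onto g h' unfolding carrier_fundamental_group by simp
    then obtain l where l: "l \<in> loops ?U b" "\<Psi>0 l = g \<otimes>\<^bsub>G\<^esub> ?h' \<otimes>\<^bsub>G\<^esub> inv\<^bsub>G\<^esub> g" using \<Psi>0(2) by auto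
    have l': "pathin ?U l" "l 0 = orbit_of n X x0" "l 1 = b" using l(1) x0(2) by (auto simp: loops_def)
    obtain r where r: "pathin ?F r" "r 0 = x0" "\<And>t. t \<in> {0..1} \<Longrightarrow> orbit_of n X (r t) = l t"
      by (rule path_lift[OF Hausdorff_X l'(1) x0(1) l'(2)]) (rule that)
    have r1: "r 1 \<in> topspace ?F" using pathin_top[OF r(1), of 1] by simp
    have "orbit_of n X x0 = orbit_of n X (r 1)" using r(3)[of 1] l'(3) x0(2) by simp
    then obtain s where s: "s permutes {..<n}" "r 1 = x0 \<circ> s" using orbit_of_eq_iff[OF x0(1) r1] by blast
    have \<Psi>r: "?\<Psi>1 r = \<Psi>0 l" by (rule U.rep_eq[symmetric, OF l'(1)]) (simp add: r(3))
    let ?p0' = "\<lambda>t. p0 (1 - t)" and ?p0s = "\<lambda>t. p0 t \<circ> s"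
    have p0': "pathin ?F ?p0'" by (rule pathin_reverse[OF p0(1)])
    have p0s: "pathin ?F ?p0s" by (rule pathin_continuous_map[OF p0(1) continuous_map_permute[OF s(1)]])
    have 1: "pathin ?F (loop_join ?p0' r)" by (rule pathin_loop_join[OF p0' r(1)]) (simp add: p0 r)
    have 2: "pathin ?F (loop_join (loop_join ?p0' r) ?p0s)" by (rule pathin_loop_join[OF 1 p0s]) (simp add: p0 s)
    have "?\<Psi>1 (loop_join (loop_join ?p0' r) ?p0s) = ?\<Psi>1 (loop_join ?p0' r) \<otimes>\<^bsub>G\<^esub> ?\<Psi>1 ?p0s"
      by (rule F.join[OF 1 p0s]) (simp add: p0 s)
    also have "?\<Psi>1 (loop_join ?p0' r) = ?\<Psi>1 ?p0' \<otimes>\<^bsub>G\<^esub> ?\<Psi>1 r"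
      by (rule F.join[OF p0' r(1)]) (simp add: p0 r)
    also have "?\<Psi>1 ?p0' = inv\<^bsub>G\<^esub> g" unfolding g_def by (rule F.rep_reverse[OF p0(1)])
    also have "?\<Psi>1 ?p0s = g" unfolding g_def by (rule F.rep_permute[OF s(1) p0(1)])
    also have "inv\<^bsub>G\<^esub> g \<otimes>\<^bsub>G\<^esub> ?\<Psi>1 r \<otimes>\<^bsub>G\<^esub> g = ?h'"
    proof -
      have "inv\<^bsub>G\<^esub> g \<otimes>\<^bsub>G\<^esub> (g \<otimes>\<^bsub>G\<^esub> y \<otimes>\<^bsub>G\<^esub> inv\<^bsub>G\<^esub> g) \<otimes>\<^bsub>G\<^esub> g = y" if "y \<in> carrier G" for y
      proof -
        have "inv\<^bsub>G\<^esub> g \<otimes>\<^bsub>G\<^esub> (g \<otimes>\<^bsub>G\<^esub> y \<otimes>\<^bsub>G\<^esub> inv\<^bsub>G\<^esub> g) = y \<otimes>\<^bsub>G\<^esub> inv\<^bsub>G\<^esub> g"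
          using that g by (simp add: m_assoc[symmetric])
        then show ?thesis using that g by (simp add: m_assoc)
      qed
      then show ?thesis unfolding \<Psi>r l(2) using h' by blast
    qed
    finally have val: "?\<Psi>1 (loop_join (loop_join ?p0' r) ?p0s) = ?h'" .
    have ends: "loop_join (loop_join ?p0' r) ?p0s 0 = J n e" "loop_join (loop_join ?p0' r) ?p0s 1 = J n (e \<circ> s)"
      using e(2) J_permute[OF s(1), of e] by simp_all
    have "\<gamma> (J n (e \<circ> s)) = c" unfolding J_permute[OF s(1)] c_def by (rule \<gamma>(2)[OF x1 s(1)])
    moreover have "c \<otimes>\<^bsub>G\<^esub> ?h' \<otimes>\<^bsub>G\<^esub> inv\<^bsub>G\<^esub> c = h"
    proof -
      have "c \<otimes>\<^bsub>G\<^esub> ?h' = h \<otimes>\<^bsub>G\<^esub> c" using c h by (simp add: m_assoc[symmetric])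
      then show ?thesis using c h by (simp add: m_assoc)
    qed
    ultimately have "\<gamma> (loop_join (loop_join ?p0' r) ?p0s 0) \<otimes>\<^bsub>G\<^esub> ?\<Psi>1 (loop_join (loop_join ?p0' r) ?p0s) \<otimes>\<^bsub>G\<^esub>
        inv\<^bsub>G\<^esub> (\<gamma> (loop_join (loop_join ?p0' r) ?p0s 1)) = h"
      unfolding ends val c_def by simp
    moreover have "J n (e \<circ> s) \<in> J n ` topspace ?E" using configuration_permute[OF e(1) s(1)] by blast
    ultimately show "\<exists>p. pathin ?F p \<and> p 0 \<in> J n ` topspace ?E \<and> p 1 \<in> J n ` topspace ?E \<and>
        \<gamma> (p 0) \<otimes>\<^bsub>G\<^esub> ?\<Psi>1 p \<otimes>\<^bsub>G\<^esub> inv\<^bsub>G\<^esub> (\<gamma> (p 1)) = h"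
      using 2 e(1) ends by (intro exI[of _ "loop_join (loop_join ?p0' r) ?p0s"] conjI) auto
  qed
qed

theorem no_epi_to_sym_group:
  assumes m: "3 \<le> m" "m < n" "5 \<le> n" and b: "b \<in> topspace (unordered_configuration_space n X)"
  shows "\<phi> \<notin> epi (braid_group n X b) (sym_group m)"
proof
  assume \<phi>: "\<phi> \<in> epi (braid_group n X b) (sym_group m)"
  obtain \<Psi> where \<Psi>: "gauged_surface_rep w X q (sym_group m) n \<Psi>"
    "\<And>h. h \<in> carrier (sym_group m) \<Longrightarrow> \<exists>p. pathin (configuration_space n X) p \<and> p 0 \<in> J n ` topspace (disc_configurations n) \<and>
      p 1 \<in> J n ` topspace (disc_configurations n) \<and> \<Psi> p = h"
    by (rule gauged_rep_of_epi[OF sym_group_is_group \<phi> b]) (rule that)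
  interpret gauged_surface_rep w X q "sym_group m" n \<Psi> by (rule \<Psi>(1))
  have "braid_permutations (n - 1) {1..m} D.gen"
    unfolding braid_permutations_def
  proof (intro conjI allI impI)
    show "D.gen i permutes {1..m}" if "i < n - 1" for i using D.gen_closed[of i] that by (simp add: sym_group_carrier)
    show "D.gen i \<circ> D.gen (Suc i) \<circ> D.gen i = D.gen (Suc i) \<circ> D.gen i \<circ> D.gen (Suc i)" if "Suc i < n - 1" for i
      using D.gen_braid[of i] that by (simp add: sym_group_mult)
    show "D.gen i \<circ> D.gen j = D.gen j \<circ> D.gen i" if "Suc i < j" "j < n - 1" for i j
      using D.gen_far[of i j] that by (simp add: sym_group_mult)
  qed
  \<comment> \<open>The \<open>n - 1\<close> generators act on \<open>m \<le> n - 1\<close> points,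
    and \<open>n \<ge> 5\<close> makes them at least four.\<close>
  then have gens: "D.gen k = D.gen 0" if "Suc k < n" for k
    by (rule artin_permutations[of "{1..m}" "n - 1", rotated 3]) (use m that in auto)
  have "carrier (sym_group m) = {\<one>\<^bsub>sym_group m\<^esub>}"
    by (rule equal_generators_trivial[OF _ gens \<Psi>(2) sym_group_center[OF m(1)]]) (use m in auto)
  moreover have "Transposition.transpose 1 2 \<in> carrier (sym_group m)"
    unfolding sym_group_carrier using m by (intro permutes_swap_id) auto
  ultimately have "Transposition.transpose 1 2 = (id :: nat \<Rightarrow> nat)" by (simp add: sym_group_one)
  then have "Transposition.transpose 1 2 1 = id (1 :: nat)" by (rule fun_cong)
  then show False by simp
qed

section \<open>Construction of the epimorphisms\<close>

lemma epi_of_permutation_hom: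
  assumes b: "b \<in> topspace (unordered_configuration_space n X)"
    and closed: "\<And>s. s permutes {..<n} \<Longrightarrow> f s \<in> carrier G"
    and mult: "\<And>s t. s permutes {..<n} \<Longrightarrow> t permutes {..<n} \<Longrightarrow> f (s \<circ> t) = f s \<otimes>\<^bsub>G\<^esub> f t"
    and onto: "\<And>h. h \<in> carrier G \<Longrightarrow> \<exists>s. s permutes {..<n} \<and> f s = h"
  shows "\<exists>\<phi>. \<phi> \<in> epi (braid_group n X b) G"
proof -
  obtain \<mu> where \<mu>: "\<And>A. A \<in> carrier (braid_group n X b) \<Longrightarrow> \<mu> A permutes {..<n}"
    "\<And>A B. A \<in> carrier (braid_group n X b) \<Longrightarrow> B \<in> carrier (braid_group n X b) \<Longrightarrow>
       \<mu> (A \<otimes>\<^bsub>braid_group n X b\<^esub> B) = \<mu> A \<circ> \<mu> B"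
    "\<And>s. s permutes {..<n} \<Longrightarrow> \<exists>A\<in>carrier (braid_group n X b). \<mu> A = s"
    by (rule monodromy[OF Hausdorff_X path_connected_space_configurations b]) (rule that)
  have "(\<lambda>A. f (\<mu> A)) \<in> hom (braid_group n X b) G"
    by (rule homI) (use \<mu> closed mult in simp_all)
  moreover have "(\<lambda>A. f (\<mu> A)) ` carrier (braid_group n X b) = carrier G"
  proof
    show "(\<lambda>A. f (\<mu> A)) ` carrier (braid_group n X b) \<subseteq> carrier G" using closed \<mu>(1) by blast
    show "carrier G \<subseteq> (\<lambda>A. f (\<mu> A)) ` carrier (braid_group n X b)"
    proof
      fix h assume "h \<in> carrier G"
      then obtain s where s: "s permutes {..<n}" "f s = h" using onto by blast
      then show "h \<in> (\<lambda>A. f (\<mu> A)) ` carrier (braid_group n X b)" using \<mu>(3)[OF s(1)] by force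
    qed
  qed
  ultimately show ?thesis by (auto simp: epi_def)
qed

lemma epi_to_sym_group_2:
  assumes n: "2 \<le> n" and b: "b \<in> topspace (unordered_configuration_space n X)"
  shows "\<exists>\<phi>. \<phi> \<in> epi (braid_group n X b) (sym_group 2)"
proof (rule epi_of_permutation_hom[OF b])
  let ?t = "Transposition.transpose 1 2 :: nat \<Rightarrow> nat"
  let ?f = "\<lambda>s. if evenperm s then id else ?t"
  have two: "p \<in> carrier (sym_group 2) \<longleftrightarrow> p = id \<or> p = ?t" for p
  proof -
    have "{1..2} = {1, 2 :: nat}" by auto
    then show ?thesis by (simp add: sym_group_carrier permutes_doubleton_iff)
  qed
  show "?f s \<in> carrier (sym_group 2)" for s unfolding two by simp
  show "?f (s \<circ> t) = ?f s \<otimes>\<^bsub>sym_group 2\<^esub> ?f t" if "s permutes {..<n}" "t permutes {..<n}" for s t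
  proof -
    have "permutation s" "permutation t" using that by (auto simp: permutation_permutes)
    then show ?thesis by (simp add: evenperm_comp sym_group_mult)
  qed
  fix h :: "nat \<Rightarrow> nat" assume "h \<in> carrier (sym_group 2)"
  then consider "h = id" | "h = ?t" unfolding two by blast
  then show "\<exists>s. s permutes {..<n} \<and> ?f s = h"
  proof cases
    case 1
    then show ?thesis by (intro exI[of _ id]) (simp add: permutes_id)
  next
    case 2
    have "Transposition.transpose 0 1 permutes {..<n}" using n by (intro permutes_swap_id) auto
    then show ?thesis using 2 by (intro exI[of _ "Transposition.transpose 0 1"]) (simp add: evenperm_swap)
  qed
qed

end

text \<open>For distinct \<open>a, b < 4\<close> this is the bitwise exclusive or, which labels the splitting of
  \<open>{0, 1, 2, 3}\<close> into the pair \<open>{a, b}\<close> and its complement.\<close>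

definition splitting :: "nat \<Rightarrow> nat \<Rightarrow> nat" where
  "splitting a b = (if a = 0 then b else if b = 0 then a else 6 - a - b)"

text \<open>The homomorphism from permutations of four points to those of three whose kernel is the
  Klein four-group, named after the resolvent cubic. The label \<open>k\<close> stands for the
  splitting that pairs 0 with \<open>k\<close>.\<close>

definition resolvent :: "(nat \<Rightarrow> nat) \<Rightarrow> nat \<Rightarrow> nat" where
  "resolvent s k = (if k \<in> {1..3} then splitting (s k) (s 0) else k)"

text \<open>The sum 6 is that of 0, 1, 2, 3. The pair that contains 0 has the partner of 0 as its
  label, and subtracting the other two numbers from 6 gives the same value.\<close>

lemma splitting_complement:
  assumes d: "distinct [a, b, c, d]" and sum: "a + b + c + d = 6" and z: "0 \<in> {a, b, c, d}"
  shows "splitting a b = splitting c d"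
proof -
  consider "a = 0" | "b = 0" | "c = 0" | "d = 0" using z by auto
  then show ?thesis
    by cases (use d sum in \<open>simp_all add: splitting_def\<close>)
qed

lemma splitting_commute: "splitting a b = splitting b a"
  by (simp add: splitting_def add.commute)

lemma splitting_range: "a < 4 \<Longrightarrow> b < 4 \<Longrightarrow> a \<noteq> b \<Longrightarrow> splitting a b \<in> {1..3}"
  unfolding splitting_def atLeastAtMost_iff by presburger

lemma permutation_4:
  assumes s: "s permutes {..<4}"
  shows "distinct [s 0, s 1, s 2, s (3 :: nat)]" "s 0 + s 1 + s 2 + s 3 = 6" "0 \<in> {s 0, s 1, s 2, s 3}"
proof -
  show "distinct [s 0, s 1, s 2, s 3]" by (simp add: inj_eq[OF permutes_inj[OF s]])
  have "sum (\<lambda>x. x) {..<4::nat} = sum ((\<lambda>x. x) \<circ> s) {..<4}" by (rule sum.permute[OF s])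
  then show "s 0 + s 1 + s 2 + s 3 = 6" by (simp add: eval_nat_numeral)
  have "0 \<in> s ` {..<4}" using permutes_image[OF s] by simp
  then obtain k where k: "k < 4" "s k = 0" by auto
  then consider "k = 0" | "k = 1" | "k = 2" | "k = 3" by linarith
  then show "0 \<in> {s 0, s 1, s 2, s 3}" by cases (use k in simp_all)
qed

text \<open>The pair of \<open>a\<close> and \<open>b\<close> and the pair of 0 and
  \<open>splitting a b\<close> are equal or complementary, and \<open>s\<close> takes complementary
  pairs to complementary pairs.\<close>

lemma splitting_permute:
  assumes s: "s permutes {..<4}" and ab: "a < 4" "b < 4" "a \<noteq> b"
  shows "splitting (s a) (s b) = splitting (s (splitting a b)) (s 0)"
proof -
  consider "a = 0" | "b = 0" | "a \<in> {1, 2, 3}" "b \<in> {1, 2, 3}" using ab by fastforce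
  then show ?thesis
  proof cases
    case 1
    then show ?thesis by (simp add: splitting_def[of 0] splitting_commute)
  next
    case 2
    then show ?thesis by (simp add: splitting_def[of a])
  next
    case 3
    then consider "a = 1" "b = 2" | "a = 1" "b = 3" | "a = 2" "b = 1" | "a = 2" "b = 3" | "a = 3" "b = 1" | "a = 3" "b = 2"
      using ab(3) by blast
    then show ?thesis
      by cases (simp_all add: splitting_def[of "Suc 0"] splitting_def[of 2] splitting_def[of 3],
          (rule splitting_complement; use permutation_4[OF s] in \<open>simp add: ac_simps disj_commute\<close>; blast)+)
  qed
qed

lemma resolvent_comp:
  assumes s: "s permutes {..<4}" and t: "t permutes {..<4}"
  shows "resolvent (s \<circ> t) = resolvent s \<circ> resolvent t"
proof
  fix k
  show "resolvent (s \<circ> t) k = (resolvent s \<circ> resolvent t) k"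
  proof (cases "k \<in> {1..3}")
    case True
    have tk: "t k < 4" "t 0 < 4" "t k \<noteq> t 0" 
      using True permutes_in_image[OF t] by (auto simp: inj_eq[OF permutes_inj[OF t]])
    then have "splitting (t k) (t 0) \<in> {1..3}" by (rule splitting_range)
    then show ?thesis using True splitting_permute[OF s tk] by (simp add: resolvent_def)
  qed (auto simp: resolvent_def)
qed

text \<open>By multiplicativity the resolvent of the inverse permutation is a two-sided
  inverse.\<close>

lemma resolvent_permutes:
  assumes s: "s permutes {..<4}"
  shows "resolvent s permutes {1..3}"
proof -
  have id: "resolvent id = id" by (auto simp: resolvent_def splitting_def)
  have "resolvent s \<circ> resolvent (inv' s) = id" "resolvent (inv' s) \<circ> resolvent s = id"
    unfolding resolvent_comp[OF s permutes_inv[OF s], symmetric] resolvent_comp[OF permutes_inv[OF s] s, symmetric]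
      permutes_inv_o[OF s] by (rule id)+
  then have "bij (resolvent s)" by (metis o_bij)
  then show ?thesis by (auto simp: permutes_def bij_iff resolvent_def)
qed

text \<open>Permutations of 1, 2, 3 fix the point 0, and on them the resolvent is the identity; this
  provides the preimages.\<close>

lemma (in polygon_space) epi_4_to_sym_group_3:
  assumes b: "b \<in> topspace (unordered_configuration_space 4 X)"
  shows "\<exists>\<phi>. \<phi> \<in> epi (braid_group 4 X b) (sym_group 3)"
proof (rule epi_of_permutation_hom[OF b])
  show "resolvent s \<in> carrier (sym_group 3)" if "s permutes {..<4}" for s
    using resolvent_permutes[OF that] by (simp add: sym_group_carrier)
  show "resolvent (s \<circ> t) = resolvent s \<otimes>\<^bsub>sym_group 3\<^esub> resolvent t" if "s permutes {..<4}" "t permutes {..<4}" for s t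
    using resolvent_comp[OF that] by (simp add: sym_group_mult)
  fix h assume "h \<in> carrier (sym_group 3)"
  then have h: "h permutes {1..3}" by (simp add: sym_group_carrier)
  have "h permutes {..<4}" by (rule permutes_subset[OF h]) auto
  moreover have "resolvent h = h"
  proof
    fix k
    have "h 0 = 0" using permutes_not_in[OF h, of 0] by simp
    moreover have "h k = k" if "k \<notin> {1..3}" by (rule permutes_not_in[OF h that])
    ultimately show "resolvent h k = h k" by (auto simp: resolvent_def splitting_def)
  qed
  ultimately show "\<exists>s. s permutes {..<4} \<and> resolvent s = h" by blast
qed

section \<open>From the two families of surfaces to gluing words\<close>

lemma polygon_space_of_homeomorphic:
  assumes X: "X homeomorphic_space polygon_surface w" and len: "2 \<le> length w"
  obtains q where "polygon_space w X q"
proof -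
  obtain f where f: "homeomorphic_map (polygon_surface w) X f"
    using X homeomorphic_space_sym unfolding homeomorphic_space by blast
  have eq: "equiv (topspace (top_of_set (cball 0 1))) (polygon_gluing w)" by (simp add: equiv_polygon_gluing)
  let ?c = "\<lambda>z. polygon_gluing w `` {z}"
  have c: "quotient_map (top_of_set (cball 0 1)) (polygon_surface w) ?c"
    unfolding polygon_surface_def by (rule quotient_map_quotient_topology[OF eq])
  have "polygon_space w X (f \<circ> ?c)"
  proof
    show "quotient_map (top_of_set (cball 0 1)) X (f \<circ> ?c)"
      by (rule quotient_map_compose[OF c f[unfolded homeomorphic_map_def, THEN conjunct1]])
    fix z z' :: complex assume z: "z \<in> cball 0 1" "z' \<in> cball 0 1"
    have "?c z \<in> topspace (polygon_surface w)" "?c z' \<in> topspace (polygon_surface w)"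
      using z quotient_imp_surjective_map[OF c] by auto
    then have "f (?c z) = f (?c z') \<longleftrightarrow> ?c z = ?c z'"
      by (rule inj_on_eq_iff[OF homeomorphic_imp_injective_map[OF f]])
    also have "\<dots> \<longleftrightarrow> (z, z') \<in> polygon_gluing w"
      by (rule eq_equiv_class_iff[OF equiv_polygon_gluing z])
    finally show "(f \<circ> ?c) z = (f \<circ> ?c) z' \<longleftrightarrow> (z, z') \<in> polygon_gluing w" by simp
  qed (rule len)
  then show thesis by (rule that)
qed

text \<open>The bound is attained by the words of the sphere and of the projective plane.\<close>

lemma length_surface_words: "2 \<le> length (orientable_word g)" "2 \<le> length (nonorientable_word (g + 1))"
proof -
  show "2 \<le> length (orientable_word g)" by (cases g) (simp_all add: orientable_word_def)
  show "2 \<le> length (nonorientable_word (g + 1))" by (simp add: nonorientable_word_def)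
qed

theorem theorem1p4:
  fixes X :: "'a topology" and n m g :: nat and b :: "(nat \<Rightarrow> 'a) set"
  assumes "m \<ge> 2" and "n > m"
    and "X homeomorphic_space orientable_surface g \<or>
         X homeomorphic_space nonorientable_surface (g + 1)"
    and "b \<in> topspace (unordered_configuration_space n X)"
  shows "(\<exists>\<phi>. \<phi> \<in> epi (braid_group n X b) (sym_group m)) \<longleftrightarrow> m = 2 \<or> (n, m) = (4, 3)"
proof -
  obtain w where w: "X homeomorphic_space polygon_surface w" "2 \<le> length w"
    using assms(3) length_surface_words unfolding orientable_surface_def nonorientable_surface_def by blast
  obtain q where "polygon_space w X q" by (rule polygon_space_of_homeomorphic[OF w])
  then interpret polygon_space w X q .
  show ?thesis
  proof
    assume "\<exists>\<phi>. \<phi> \<in> epi (braid_group n X b) (sym_group m)"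
    \<comment> \<open>With \<open>n > m \<ge> 3\<close> and \<open>n \<le> 4\<close> only
      \<open>(4, 3)\<close> remains.\<close>
    then have "\<not> (3 \<le> m \<and> 5 \<le> n)" using no_epi_to_sym_group assms(2,4) by blast
    then show "m = 2 \<or> (n, m) = (4, 3)" using assms(1,2) by auto
  next
    assume "m = 2 \<or> (n, m) = (4, 3)"
    then show "\<exists>\<phi>. \<phi> \<in> epi (braid_group n X b) (sym_group m)"
      using epi_to_sym_group_2 epi_4_to_sym_group_3 assms(2,4) by auto
  qed
qed

end
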